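(* Let $\gamma$ be a functorial satisfying (F1), (F2) and (F3). If a finite group $G=AB$ is the mutually permutable product of its subgroups $A$ and $B$, then $h_\gamma(G)\le\max\{h_\gamma(A^{\mathfrak{N}^*}),h_\gamma(B^{\mathfrak{N}^*})\}+2$. Moreover, if $\gamma$ also satisfies (F5), then $\max\{h_\gamma(A^{\mathfrak{N}^*}),h_\gamma(B^{\mathfrak{N}^*})\}\le h_\gamma(G)$.
   Context: All groups are finite. A functorial is a function $\theta$ assigning to each group $G$ a characteristic subgroup $\theta(G)$ such that $f(\theta(G))=\theta(f(G))$ for every isomorphism $f$. Conditions (for every group $G$): (F1) $f(\gamma(G))\subseteq\gamma(f(G))$ for every epimorphism $f:G\to G^*$; (F2) $\gamma(N)\subseteq\gamma(G)$ for every $N\trianglelefteq G$; (F3) $C_G(\gamma(G))\subseteq\gamma(G)$; (F5) $\gamma(G)\cap N\subseteq\gamma(N)$ for every $N\trianglelefteq G$. The $\gamma$-series is $\gamma_{(0)}(G)=1$ and $\gamma_{(i+1)}(G)$ the full preimage of $\gamma(G/\gamma_{(i)}(G))$; $h_\gamma(G)$ is the least $h$ with $\gamma_{(h)}(G)=G$. $\mathfrak{N}^*$ is the formation of quasinilpotent groups and $H^{\mathfrak{N}^*}$ is the smallest normal subgroup of $H$ with quasinilpotent quotient. $G=AB$ is a mutually permutable product if $A$ permutes with every subgroup of $B$ and $B$ permutes with every subgroup of $A$. *)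

theory Defs
  imports "HOL-Algebra.Algebra"
begin

text \<open>A functorial is represented on the universe type nat (every finite group has an
isomorphic copy there); it is transported to groups of arbitrary type by isomorphism.\<close>

definition functorial :: "(nat monoid \<Rightarrow> nat set) \<Rightarrow> bool" where
  "functorial \<gamma> \<longleftrightarrow>
     (\<forall>G::nat monoid. group G \<and> finite (carrier G) \<longrightarrow>
        subgroup (\<gamma> G) G \<and>
        (\<forall>f. f \<in> Group.iso G G \<longrightarrow> f ` \<gamma> G = \<gamma> G)) \<and>
     (\<forall>(G::nat monoid) (H::nat monoid) f. group G \<and> finite (carrier G) \<and> group H \<and>
        f \<in> Group.iso G H \<longrightarrow> f ` \<gamma> G = \<gamma> H)"

definition gext :: "(nat monoid \<Rightarrow> nat set) \<Rightarrow> ('a, 'b) monoid_scheme \<Rightarrow> 'a set" where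
  "gext \<gamma> G = (SOME S. \<exists>(H::nat monoid) f. group H \<and> f \<in> Group.iso G H \<and>
                        S = {x \<in> carrier G. f x \<in> \<gamma> H})"

definition F1 :: "(nat monoid \<Rightarrow> nat set) \<Rightarrow> bool" where
  "F1 \<gamma> \<longleftrightarrow> (\<forall>(G::nat monoid) (G'::nat monoid) f. group G \<and> finite (carrier G) \<and> group G' \<and>
      f \<in> hom G G' \<and> f ` carrier G = carrier G' \<longrightarrow> f ` \<gamma> G \<subseteq> \<gamma> G')"

definition F2 :: "(nat monoid \<Rightarrow> nat set) \<Rightarrow> bool" where
  "F2 \<gamma> \<longleftrightarrow> (\<forall>(G::nat monoid) N. group G \<and> finite (carrier G) \<and> N \<lhd> G \<longrightarrow>
      \<gamma> (G\<lparr>carrier := N\<rparr>) \<subseteq> \<gamma> G)"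

definition F3 :: "(nat monoid \<Rightarrow> nat set) \<Rightarrow> bool" where
  "F3 \<gamma> \<longleftrightarrow> (\<forall>G::nat monoid. group G \<and> finite (carrier G) \<longrightarrow>
      {g \<in> carrier G. \<forall>x \<in> \<gamma> G. g \<otimes>\<^bsub>G\<^esub> x = x \<otimes>\<^bsub>G\<^esub> g} \<subseteq> \<gamma> G)"

definition F5 :: "(nat monoid \<Rightarrow> nat set) \<Rightarrow> bool" where
  "F5 \<gamma> \<longleftrightarrow> (\<forall>(G::nat monoid) N. group G \<and> finite (carrier G) \<and> N \<lhd> G \<longrightarrow>
      \<gamma> G \<inter> N \<subseteq> \<gamma> (G\<lparr>carrier := N\<rparr>))"

fun gser :: "(nat monoid \<Rightarrow> nat set) \<Rightarrow> ('a, 'b) monoid_scheme \<Rightarrow> nat \<Rightarrow> 'a set" where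
  "gser \<gamma> G 0 = {\<one>\<^bsub>G\<^esub>}"
| "gser \<gamma> G (Suc i) = \<Union> (gext \<gamma> (G Mod (gser \<gamma> G i)))"

definition hgam :: "(nat monoid \<Rightarrow> nat set) \<Rightarrow> ('a, 'b) monoid_scheme \<Rightarrow> nat" where
  "hgam \<gamma> G = (LEAST h. gser \<gamma> G h = carrier G)"

text \<open>Chief factors and quasinilpotent groups (Huppert--Blackburn X.13): every element of G
induces an inner automorphism on every chief factor H/K.\<close>
definition chief_factor :: "('a, 'b) monoid_scheme \<Rightarrow> 'a set \<Rightarrow> 'a set \<Rightarrow> bool" where
  "chief_factor G H K \<longleftrightarrow> K \<lhd> G \<and> H \<lhd> G \<and> K \<subset> H \<and>
     (\<forall>N. N \<lhd> G \<and> K \<subseteq> N \<and> N \<subseteq> H \<longrightarrow> N = K \<or> N = H)"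

definition quasinilpotent :: "('a, 'b) monoid_scheme \<Rightarrow> bool" where
  "quasinilpotent G \<longleftrightarrow> group G \<and>
     (\<forall>H K. chief_factor G H K \<longrightarrow>
        (\<forall>g \<in> carrier G. \<exists>h \<in> H. \<forall>x \<in> H.
           (g \<otimes>\<^bsub>G\<^esub> x \<otimes>\<^bsub>G\<^esub> inv\<^bsub>G\<^esub> g) \<otimes>\<^bsub>G\<^esub>
             inv\<^bsub>G\<^esub> (h \<otimes>\<^bsub>G\<^esub> x \<otimes>\<^bsub>G\<^esub> inv\<^bsub>G\<^esub> h) \<in> K))"

definition qn_residual :: "('a, 'b) monoid_scheme \<Rightarrow> 'a set" where
  "qn_residual H = \<Inter> {N. N \<lhd> H \<and> quasinilpotent (H Mod N)}"

definition mutually_permutable :: "('a, 'b) monoid_scheme \<Rightarrow> 'a set \<Rightarrow> 'a set \<Rightarrow> bool" where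
  "mutually_permutable G A B \<longleftrightarrow>
     (\<forall>U. subgroup U G \<and> U \<subseteq> B \<longrightarrow> A <#>\<^bsub>G\<^esub> U = U <#>\<^bsub>G\<^esub> A) \<and>
     (\<forall>U. subgroup U G \<and> U \<subseteq> A \<longrightarrow> B <#>\<^bsub>G\<^esub> U = U <#>\<^bsub>G\<^esub> B)"

end

theory Submission
  imports Defs "HOL-Combinatorics.Perm" "HOL-Number_Theory.Residues"
begin

text \<open>
Let \<open>R\<close> be the quasinilpotent residual of \<open>A\<close>. For \<open>b\<close> in \<open>B\<close> and \<open>q\<close> prime, a counting argument
modulo the core of \<open>A<b^q>\<close> in \<open>A<b>\<close> shows that this core contains \<open>A'\<close>; hence \<open>A'\<close> is subnormal in
\<open>A<b>\<close>, and in \<open>G\<close> by Wielandt's criterion. As \<open>R\<close> is normal in \<open>A\<close> and contained in \<open>A'\<close>, it is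
subnormal in \<open>G\<close>. So (F1) and (F2) show that the \<open>i\<close>-th term of the series of \<open>R\<close> lies in that of
\<open>G\<close>, and by (F5) it is the intersection of the latter with \<open>R\<close>; this gives the second inequality.

For the first let \<open>n\<close> be the maximum on the right. The \<open>n\<close>-th term of the series of \<open>G\<close> contains
both residuals, so the quotient \<open>Q\<close> by it is a mutually permutable product of quasinilpotent groups.
The commutators of such a product induce inner automorphisms on its chief factors: an abelian
minimal normal subgroup is treated through its intersections with the factors, using that a
product of two abelian groups is metabelian (Ito); a nonabelian one is the product of its
intersections with the derived subgroups of the factors. Elements inducing inner automorphisms
on all chief factors lie in \<open>\<gamma> Q\<close> by (F2) and (F3). Hence \<open>Q / \<gamma> Q\<close> is abelian, and one more
step reaches \<open>G\<close>.
\<close>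

text \<open>The factor \<open>A\<close> itself need not be subnormal: in the symmetric group of
  degree 3, a product of subgroups of orders 3 and 2, the second is not. What survives is
  \<open>der A\<close>, and this is enough because abelian groups are quasinilpotent, so that the
  residual lies inside it. With \<gamma> the generalized Fitting subgroup, the same example has
  trivial residuals and height 2: the summand 2 is sharp, and of a product of quasinilpotent groups
  only the commutators can be expected to act like inner elements. To absorb such an element into
  \<gamma>(G), take a chain of chief factors from 1 up to \<gamma>(G). Dividing by an element of
  \<gamma>(G) makes it centralize every factor. In the stabilizer S of the chain, (F3) puts the
  elements centralizing \<gamma>(S) into \<gamma>(S). Ascending from them along a central series of
  S, each further element generates a cyclic subnormal subgroup of S, which (F2) and (F3) put into
  \<gamma>(S) as well. Since \<gamma> lives on groups over \<open>nat\<close> and each quotient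
  changes the type, quotients are replaced by congruences or by images in permutation
  groups.\<close>

hide_const (open) Divisibility.prime

section \<open>Groups as subsets of a type\<close>

text \<open>Finite groups are treated as finite subsets, closed under the operations, of a type of class
\<open>mgroup\<close>; this removes all membership conditions from the group laws.\<close>

class mgroup = monoid_mult + inverse +
  assumes inverse_mult_self [simp]: "inverse x * x = 1"

lemma inverse_mult_cancel [simp]: "inverse x * (x * y) = (y::'a::mgroup)"
  by (simp add: mult.assoc [symmetric])

lemma mult_inverse_self [simp]: "x * inverse x = (1::'a::mgroup)"
  by (metis inverse_mult_cancel inverse_mult_self mult.right_neutral)

lemma mult_inverse_cancel [simp]: "x * (inverse x * y) = (y::'a::mgroup)"
  by (simp add: mult.assoc [symmetric])

lemma mgroup_left_cancel [simp]: "x * y = x * z \<longleftrightarrow> y = (z::'a::mgroup)"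
  by (metis inverse_mult_cancel)

lemma mgroup_right_cancel [simp]: "y * x = z * x \<longleftrightarrow> y = (z::'a::mgroup)"
  by (metis mult.assoc mult_inverse_self mult.right_neutral)

lemma mgroup_inverse_inverse [simp]: "inverse (inverse x) = (x::'a::mgroup)"
  by (metis inverse_mult_self mgroup_right_cancel mult_inverse_self)

lemma mgroup_inverse_one [simp]: "inverse 1 = (1::'a::mgroup)"
  by (metis inverse_mult_self mult.right_neutral)

lemma mgroup_inverse_mult: "inverse (x * y) = inverse y * inverse (x::'a::mgroup)"
proof -
  have "(x * y) * inverse (x * y) = (x * y) * (inverse y * inverse x)"
    by (simp only: mult_inverse_self) (simp add: mult.assoc)
  then show ?thesis by (simp only: mgroup_left_cancel)
qed

lemma mgroup_inverse_eq: "x * y = 1 \<longleftrightarrow> inverse x = (y::'a::mgroup)"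
  by (metis inverse_mult_cancel mult.right_neutral mult_inverse_self)

lemma mgroup_inverse_inject [simp]: "inverse x = inverse y \<longleftrightarrow> x = (y::'a::mgroup)"
  by (metis mgroup_inverse_inverse)

lemma mgroup_inverse_power: "inverse (x ^ n) = inverse (x::'a::mgroup) ^ n"
  by (induction n) (simp_all add: mgroup_inverse_mult power_commutes)

lemmas mgroup_simps = mult.assoc mgroup_inverse_mult

lemma mgroup_commute_iff: "x * y * inverse x = y \<longleftrightarrow> x * y = y * (x::'a::mgroup)"
  by (metis mult.assoc mult_inverse_self mult.right_neutral inverse_mult_self)

lemma mgroup_conj_power: "g * x ^ n * inverse g = (g * x * inverse (g::'a::mgroup)) ^ n"
proof (induction n)
  case (Suc n)
  have "g * x ^ Suc n * inverse g = (g * x * inverse g) * (g * x ^ n * inverse g)"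
    by (simp add: mult.assoc)
  with Suc show ?case by simp
qed simp

lemma conj_eq_swap: "g * x * inverse g = y \<longleftrightarrow> x = inverse g * y * (g::'a::mgroup)"
  by (metis inverse_mult_cancel mgroup_inverse_inverse mult.assoc mult_inverse_self mult.right_neutral)

section \<open>Subgroups, centralizers and commutators inside one type\<close>

definition sg :: "'a::mgroup set \<Rightarrow> bool" where
  "sg H \<longleftrightarrow> 1 \<in> H \<and> (\<forall>x\<in>H. \<forall>y\<in>H. x * y \<in> H) \<and> (\<forall>x\<in>H. inverse x \<in> H)"

definition nsg :: "'a::mgroup set \<Rightarrow> 'a set \<Rightarrow> bool" where
  "nsg N G \<longleftrightarrow> sg N \<and> N \<subseteq> G \<and> (\<forall>g\<in>G. \<forall>n\<in>N. g * n * inverse g \<in> N)"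

definition setmul :: "'a::mgroup set \<Rightarrow> 'a set \<Rightarrow> 'a set" (infixl "\<bullet>" 70) where
  "A \<bullet> B = {a * b |a b. a \<in> A \<and> b \<in> B}"

text \<open>Natural exponents only: in a finite group the inverse of \<open>x ^ i\<close> is again a
  natural power of \<open>x\<close>, so this is the cyclic subgroup (\<open>cyc_sg\<close>).\<close>

definition cyc :: "'a::mgroup \<Rightarrow> 'a set" where
  "cyc x = range (\<lambda>n::nat. x ^ n)"

definition cent :: "'a::mgroup set \<Rightarrow> 'a set \<Rightarrow> 'a set" where
  "cent G S = {g \<in> G. \<forall>s\<in>S. g * s = s * g}"

definition gen :: "'a::mgroup set \<Rightarrow> 'a set" where
  "gen S = \<Inter>{H. sg H \<and> S \<subseteq> H}"

text \<open>This convention suits conjugation from the left: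
  \<open>g * x * inverse g = cmt g x * x\<close>.\<close>

definition cmt :: "'a::mgroup \<Rightarrow> 'a \<Rightarrow> 'a" where
  "cmt x y = x * y * inverse x * inverse y"

definition der :: "'a::mgroup set \<Rightarrow> 'a set" where
  "der G = gen {cmt x y |x y. x \<in> G \<and> y \<in> G}"

lemma sg_one [simp]: "sg H \<Longrightarrow> 1 \<in> H"
  and sg_mult [simp]: "sg H \<Longrightarrow> x \<in> H \<Longrightarrow> y \<in> H \<Longrightarrow> x * y \<in> H"
  and sg_inverse [simp]: "sg H \<Longrightarrow> x \<in> H \<Longrightarrow> inverse x \<in> H"
  by (auto simp: sg_def)

lemma sg_power [simp]: "sg H \<Longrightarrow> x \<in> H \<Longrightarrow> x ^ n \<in> H"
  by (induction n) auto

lemma sg_left_iff: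
  assumes "sg H" "x \<in> H"
  shows "x * y \<in> H \<longleftrightarrow> y \<in> H"
proof
  assume "x * y \<in> H"
  then have "inverse x * (x * y) \<in> H" by (rule sg_mult[OF assms(1) sg_inverse[OF assms]])
  then show "y \<in> H" by simp
qed (use assms in simp)

lemma sg_right_iff:
  assumes "sg H" "y \<in> H"
  shows "x * y \<in> H \<longleftrightarrow> x \<in> H"
proof
  assume "x * y \<in> H"
  then have "(x * y) * inverse y \<in> H" by (rule sg_mult[OF assms(1) _ sg_inverse[OF assms]])
  then show "x \<in> H" by (simp add: mult.assoc)
qed (use assms in simp)

lemma sg_inverse_iff: "sg H \<Longrightarrow> inverse x \<in> H \<longleftrightarrow> x \<in> H"
  by (metis mgroup_inverse_inverse sg_inverse)

lemma sg_conj: "sg H \<Longrightarrow> g \<in> H \<Longrightarrow> g * x * inverse g \<in> H \<longleftrightarrow> x \<in> H"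
  by (simp add: sg_left_iff sg_right_iff)

lemma sg_Int: "sg H \<Longrightarrow> sg K \<Longrightarrow> sg (H \<inter> K)"
  unfolding sg_def by auto

lemma sg_Inter: "(\<And>H. H \<in> \<H> \<Longrightarrow> sg H) \<Longrightarrow> sg (\<Inter>\<H>)"
  unfolding sg_def by auto

lemma sg_trivial [simp]: "sg {1}"
  unfolding sg_def by simp

lemma sg_coprime_power:
  assumes "sg H" "x ^ i \<in> H" "x ^ j \<in> H" "coprime i j"
  shows "x \<in> H"
\<comment> \<open>\<open>bezout_nat\<close> wants a nonzero first argument; for \<open>i = 0\<close>
  coprimality forces \<open>j = 1\<close>.\<close>
proof (cases "i = 0")
  case True
  then show ?thesis using assms by simp
next
  case False
  then obtain u v where "i * u = j * v + 1"
    using bezout_nat[of i j] assms(4) by (auto simp: coprime_iff_gcd_eq_1)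
  then have "(x ^ i) ^ u = (x ^ j) ^ v * x"
    by (simp add: power_mult[symmetric] power_commutes)
  then show ?thesis
    using assms(1-3) by (metis sg_left_iff sg_power)
qed

lemma nsgI: "sg N \<Longrightarrow> N \<subseteq> G \<Longrightarrow> (\<And>g n. g \<in> G \<Longrightarrow> n \<in> N \<Longrightarrow> g * n * inverse g \<in> N) \<Longrightarrow> nsg N G"
  by (auto simp: nsg_def)

lemma nsg_sg: "nsg N G \<Longrightarrow> sg N"
  and nsg_subset: "nsg N G \<Longrightarrow> N \<subseteq> G"
  and nsg_conj: "nsg N G \<Longrightarrow> g \<in> G \<Longrightarrow> n \<in> N \<Longrightarrow> g * n * inverse g \<in> N"
  by (auto simp: nsg_def)

lemma nsg_conj': "nsg N G \<Longrightarrow> sg G \<Longrightarrow> g \<in> G \<Longrightarrow> n \<in> N \<Longrightarrow> inverse g * n * g \<in> N"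
  by (metis mgroup_inverse_inverse nsg_conj sg_inverse)

lemma nsg_self: "sg G \<Longrightarrow> nsg G G"
  by (simp add: nsg_def)

lemma nsg_trivial: "sg G \<Longrightarrow> nsg {1} G"
  by (simp add: nsg_def)

lemma nsg_Int: "nsg N G \<Longrightarrow> nsg M G \<Longrightarrow> nsg (N \<inter> M) G"
  by (auto simp: nsg_def sg_Int)

lemma nsg_Int_sg: "nsg N G \<Longrightarrow> sg H \<Longrightarrow> H \<subseteq> G \<Longrightarrow> nsg (N \<inter> H) H"
  by (rule nsgI) (auto simp: nsg_sg sg_Int nsg_conj subset_iff)

lemma nsg_mono: "nsg N G \<Longrightarrow> N \<subseteq> H \<Longrightarrow> H \<subseteq> G \<Longrightarrow> nsg N H"
  by (auto simp: nsg_def)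

lemma setmulI [intro]: "a \<in> A \<Longrightarrow> b \<in> B \<Longrightarrow> a * b \<in> A \<bullet> B"
  by (auto simp: setmul_def)

lemma setmulE [elim]:
  assumes "x \<in> A \<bullet> B" obtains a b where "x = a * b" "a \<in> A" "b \<in> B"
  using assms by (auto simp: setmul_def)

lemma sg_setmul_left: "sg B \<Longrightarrow> A \<subseteq> A \<bullet> B"
  by (metis mult.right_neutral setmulI sg_one subsetI)

lemma sg_setmul_right: "sg A \<Longrightarrow> B \<subseteq> A \<bullet> B"
  by (metis mult.left_neutral setmulI sg_one subsetI)

lemma setmul_subset: "sg G \<Longrightarrow> A \<subseteq> G \<Longrightarrow> B \<subseteq> G \<Longrightarrow> A \<bullet> B \<subseteq> G"
  by (auto simp: subset_iff)

lemma setmul_mono: "A \<subseteq> A' \<Longrightarrow> B \<subseteq> B' \<Longrightarrow> A \<bullet> B \<subseteq> A' \<bullet> B'"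
  by (auto simp: setmul_def)

lemma setmul_inverse: "sg A \<Longrightarrow> sg B \<Longrightarrow> x \<in> A \<bullet> B \<Longrightarrow> inverse x \<in> B \<bullet> A"
  by (elim setmulE) (simp add: mgroup_inverse_mult setmulI)

lemma sg_setmul:
  assumes "sg A" "sg B" "A \<bullet> B = B \<bullet> A"
  shows "sg (A \<bullet> B)"
  unfolding sg_def
proof (intro conjI ballI)
  show "1 \<in> A \<bullet> B"
    using assms by (metis mult.left_neutral setmulI sg_one)
  fix x assume x: "x \<in> A \<bullet> B"
  then show "inverse x \<in> A \<bullet> B"
    using assms setmul_inverse by blast
  fix y assume "y \<in> A \<bullet> B"
  then obtain a b c d where *: "x = a * b" "y = c * d" "a \<in> A" "c \<in> A" "b \<in> B" "d \<in> B"
    using x by blast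
  then obtain c' b' where "b * c = c' * b'" "c' \<in> A" "b' \<in> B"
    using assms(3) by (metis setmulE setmulI)
  then have "x * y = (a * c') * (b' * d)"
    using * by (metis mult.assoc)
  then show "x * y \<in> A \<bullet> B"
    using * \<open>c' \<in> A\<close> \<open>b' \<in> B\<close> assms by (metis setmulI sg_mult)
qed

lemma setmul_permute:
  assumes "sg A" "sg B" "B \<bullet> A \<subseteq> A \<bullet> B"
  shows "A \<bullet> B = B \<bullet> A"
proof
  show "A \<bullet> B \<subseteq> B \<bullet> A"
  proof
    fix x assume "x \<in> A \<bullet> B"
    then have "inverse x \<in> A \<bullet> B"
      using setmul_inverse assms by blast
    then show "x \<in> B \<bullet> A"
      using setmul_inverse[OF assms(1,2)] by (metis mgroup_inverse_inverse)
  qed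
qed (fact assms)

lemma nsg_setmul_permute:
  assumes "nsg N G" "sg H" "H \<subseteq> G" "sg G"
  shows "N \<bullet> H = H \<bullet> N"
proof (rule setmul_permute)
  show "H \<bullet> N \<subseteq> N \<bullet> H"
  proof
    fix x assume "x \<in> H \<bullet> N"
    then obtain h n where "x = h * n" "h \<in> H" "n \<in> N" by blast
    then have "x = (h * n * inverse h) * h" "h * n * inverse h \<in> N"
      using assms by (auto simp: mult.assoc intro: nsg_conj[unfolded mult.assoc])
    then show "x \<in> N \<bullet> H" using \<open>h \<in> H\<close> by (metis setmulI)
  qed
qed (use assms nsg_sg in auto)

lemma sg_setmul_nsg: "nsg N G \<Longrightarrow> sg H \<Longrightarrow> H \<subseteq> G \<Longrightarrow> sg G \<Longrightarrow> sg (N \<bullet> H)"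
  using nsg_setmul_permute sg_setmul nsg_sg by metis

lemma nsg_setmul:
  assumes "nsg N G" "nsg M G" "sg G"
  shows "nsg (N \<bullet> M) G"
proof (rule nsgI)
  show "sg (N \<bullet> M)" "N \<bullet> M \<subseteq> G"
    using assms by (simp_all add: nsg_sg nsg_subset sg_setmul_nsg setmul_subset)
  fix g x assume "g \<in> G" "x \<in> N \<bullet> M"
  then obtain n m where "x = n * m" "n \<in> N" "m \<in> M" by blast
  moreover have "g * (n * m) * inverse g = (g * n * inverse g) * (g * m * inverse g)"
    by (simp add: mult.assoc)
  ultimately show "g * x * inverse g \<in> N \<bullet> M"
    using assms \<open>g \<in> G\<close> by (metis nsg_conj setmulI)
qed

lemma cent_sg: "sg G \<Longrightarrow> sg (cent G S)"
proof -
  assume G: "sg G"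
  have "inverse g * s = s * inverse g" if "g * s = s * g" for g s :: 'a
    using that by (metis inverse_mult_cancel mult.assoc mult_inverse_self mult.right_neutral)
  moreover have "x * y * s = s * (x * y)" if "x * s = s * x" "y * s = s * y" for x y s :: 'a
    using that by (metis mult.assoc)
  ultimately show ?thesis
    using G unfolding sg_def cent_def by auto
qed

lemma cent_nsg:
  assumes "nsg N G" "sg G"
  shows "nsg (cent G N) G"
proof (rule nsgI)
  show "sg (cent G N)" "cent G N \<subseteq> G"
    using assms(2) cent_sg by (auto simp: cent_def)
  fix g c assume g: "g \<in> G" and c: "c \<in> cent G N"
  have "g * c * inverse g * n = n * (g * c * inverse g)" if n: "n \<in> N" for n
  proof -
    have "inverse g * n * g \<in> N" using assms g n nsg_conj' by blast
    then have "c * (inverse g * n * g) = (inverse g * n * g) * c" using c by (auto simp: cent_def)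
    then have "g * (c * (inverse g * n * g)) * inverse g = g * ((inverse g * n * g) * c) * inverse g"
      by simp
    then show ?thesis by (simp add: mult.assoc)
  qed
  then show "g * c * inverse g \<in> cent G N"
    using g c assms by (auto simp: cent_def)
qed

lemma gen_sg: "sg (gen S)"
  unfolding gen_def by (rule sg_Inter) auto

lemma gen_superset: "S \<subseteq> gen S"
  by (auto simp: gen_def)

lemma gen_least: "sg H \<Longrightarrow> S \<subseteq> H \<Longrightarrow> gen S \<subseteq> H"
  by (auto simp: gen_def)

lemma sg_vimage_conj: "sg H \<Longrightarrow> sg {x. g * x * inverse g \<in> H}"
  unfolding sg_def
proof (intro conjI ballI; clarsimp)
  assume H: "1 \<in> H" "\<forall>x\<in>H. \<forall>y\<in>H. x * y \<in> H" "\<forall>x\<in>H. inverse x \<in> H"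
  fix x assume x: "g * x * inverse g \<in> H"
  show "g * inverse x * inverse g \<in> H"
  proof -
    have "g * inverse x * inverse g = inverse (g * x * inverse g)" by (simp add: mgroup_simps)
    then show ?thesis using H x by simp
  qed
  fix y assume "g * y * inverse g \<in> H"
  then have "(g * x * inverse g) * (g * y * inverse g) \<in> H" using x H by blast
  then show "g * (x * y) * inverse g \<in> H" by (simp add: mult.assoc)
qed

text \<open>Generators suffice, because the elements that \<open>g\<close> conjugates into a given
  subgroup form a subgroup (\<open>sg_vimage_conj\<close>).\<close>

lemma gen_conj:
  assumes "\<And>s. s \<in> S \<Longrightarrow> g * s * inverse g \<in> gen S" "x \<in> gen S"
  shows "g * x * inverse g \<in> gen S"
  using gen_least[OF sg_vimage_conj[OF gen_sg], of S g S] assms by auto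

lemma gen_nsg:
  assumes "sg G" "S \<subseteq> G" "\<And>g s. g \<in> G \<Longrightarrow> s \<in> S \<Longrightarrow> g * s * inverse g \<in> gen S"
  shows "nsg (gen S) G"
proof (rule nsgI[OF gen_sg])
  show "gen S \<subseteq> G" using assms(1,2) by (rule gen_least)
  show "g * n * inverse g \<in> gen S" if "g \<in> G" "n \<in> gen S" for g n
    by (rule gen_conj[OF assms(3)[OF that(1)] that(2)])
qed

lemma cmt_in_der: "x \<in> G \<Longrightarrow> y \<in> G \<Longrightarrow> cmt x y \<in> der G"
  unfolding der_def using gen_superset by fastforce

lemma der_least: "sg H \<Longrightarrow> (\<And>x y. x \<in> G \<Longrightarrow> y \<in> G \<Longrightarrow> cmt x y \<in> H) \<Longrightarrow> der G \<subseteq> H"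
  unfolding der_def by (rule gen_least) auto

lemma der_sg: "sg (der G)"
  by (simp add: der_def gen_sg)

lemma der_subset: "sg G \<Longrightarrow> der G \<subseteq> G"
  by (rule der_least) (auto simp: cmt_def)

lemma conj_cmt: "g * cmt x y * inverse g = cmt (g * x * inverse g) (g * y * inverse g)"
  by (simp add: cmt_def mgroup_simps)

lemma der_conj:
  assumes "\<And>x. x \<in> G \<Longrightarrow> g * x * inverse g \<in> G" "x \<in> der G"
  shows "g * x * inverse g \<in> der G"
proof -
  have "g * s * inverse g \<in> der G" if "s \<in> {cmt x y |x y. x \<in> G \<and> y \<in> G}" for s
  proof -
    from that obtain x y where "s = cmt x y" "x \<in> G" "y \<in> G" by blast
    then show ?thesis using assms(1) by (simp add: conj_cmt cmt_in_der)
  qed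
  then show ?thesis using gen_conj assms(2) unfolding der_def by blast
qed

lemma der_nsg:
  assumes "nsg N G" "sg G"
  shows "nsg (der N) G"
proof (rule nsgI[OF der_sg])
  show "der N \<subseteq> G" using der_subset[OF nsg_sg[OF assms(1)]] nsg_subset[OF assms(1)] by simp
  show "g * n * inverse g \<in> der N" if "g \<in> G" "n \<in> der N" for g n
    using that nsg_conj[OF assms(1)] by (intro der_conj)
qed

lemma conj_eq_cmt: "g * x * inverse g = cmt g x * x"
  by (simp add: cmt_def mult.assoc)

lemma cmt_eq_1: "cmt x y = 1 \<longleftrightarrow> x * y = y * x"
  by (metis cmt_def conj_eq_cmt mgroup_commute_iff mult.left_neutral mult_inverse_self)

lemma nsg_over_der:
  assumes "sg G" "sg S" "der G \<subseteq> S" "S \<subseteq> G"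
  shows "nsg S G"
proof (rule nsgI)
  fix g n assume "g \<in> G" "n \<in> S"
  then have "cmt g n \<in> S" using cmt_in_der assms by blast
  then show "g * n * inverse g \<in> S" using conj_eq_cmt[of g n] assms \<open>n \<in> S\<close> by simp
qed (use assms in auto)

lemma inverse_cmt: "inverse (cmt x y) = cmt y x"
  by (simp add: cmt_def mgroup_simps)

lemma finite_order:
  assumes "sg G" "finite G" "x \<in> G"
  obtains n where "n > 0" "x ^ n = 1"
proof -
  have "range (\<lambda>n::nat. x ^ n) \<subseteq> G" using assms by auto
  then have "\<not> inj (\<lambda>n::nat. x ^ n)"
    using assms(2) finite_subset infinite_UNIV_nat finite_imageD by blast
  then obtain i j :: nat where "x ^ i = x ^ j" "i \<noteq> j" by (auto simp: inj_def)
  then obtain i j :: nat where ij: "x ^ i = x ^ j" "i < j"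
    by (metis linorder_neqE_nat)
  then have "x ^ i * x ^ (j - i) = x ^ i * 1"
    by (metis le_add_diff_inverse less_imp_le_nat mult.right_neutral power_add)
  then have "x ^ (j - i) = 1" by (simp only: mgroup_left_cancel)
  then show ?thesis using that[of "j - i"] ij by simp
qed

lemma cyc_sg:
  assumes "sg G" "finite G" "x \<in> G"
  shows "sg (cyc x)"
proof -
  obtain n where n: "n > 0" "x ^ n = 1" using finite_order assms by blast
  have "inverse (x ^ i) \<in> cyc x" for i
  proof -
    have "x ^ i * x ^ ((n - 1) * i) = (x ^ n) ^ i"
      using n(1) by (simp add: power_add[symmetric] power_mult[symmetric] algebra_simps)
    then have "inverse (x ^ i) = x ^ ((n - 1) * i)"
      using n(2) by (simp add: mgroup_inverse_eq)
    then show ?thesis by (simp add: cyc_def)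
  qed
  moreover have "1 \<in> cyc x" "x ^ i * x ^ j \<in> cyc x" for i j
    by (auto simp: cyc_def power_add[symmetric] intro: range_eqI[of _ _ 0])
  ultimately show ?thesis unfolding sg_def by (auto simp: cyc_def)
qed

lemma cyc_self: "x \<in> cyc x"
  unfolding cyc_def by (rule range_eqI[of _ _ 1]) simp

lemma cycI: "x ^ n \<in> cyc x"
  by (auto simp: cyc_def)

lemma cyc_subset: "sg G \<Longrightarrow> x \<in> G \<Longrightarrow> cyc x \<subseteq> G"
  by (auto simp: cyc_def)

text \<open>The pairs with product \<open>a * b\<close> are exactly
  \<open>(a * d, inverse d * b)\<close> with \<open>d\<close> in \<open>A \<inter> B\<close>. The
  product set is counted whether or not it is a subgroup.\<close>

lemma card_setmul:
  assumes "sg A" "sg B" "finite A" "finite B"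
  shows "card (A \<bullet> B) * card (A \<inter> B) = card A * card B"
proof -
  let ?f = "\<lambda>(a, b). a * b"
  have img: "A \<bullet> B = ?f ` (A \<times> B)" by (auto simp: setmul_def)
  have "card (A \<times> B) = (\<Sum>y\<in>?f ` (A \<times> B). card {x \<in> A \<times> B. ?f x = y})"
    using assms by (simp only: card_eq_sum) (rule sum.image_gen, auto)
  also have "\<dots> = (\<Sum>y\<in>A \<bullet> B. card (A \<inter> B))"
  proof (rule sum.cong)
    fix y assume "y \<in> A \<bullet> B"
    then obtain a b where y: "y = a * b" "a \<in> A" "b \<in> B" by blast
    have "bij_betw (\<lambda>d. (a * d, inverse d * b)) (A \<inter> B) {x \<in> A \<times> B. ?f x = y}"
      unfolding bij_betw_def
    proof
      show "inj_on (\<lambda>d. (a * d, inverse d * b)) (A \<inter> B)" by (auto simp: inj_on_def)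
      show "(\<lambda>d. (a * d, inverse d * b)) ` (A \<inter> B) = {x \<in> A \<times> B. ?f x = y}"
      proof (intro subset_antisym subsetI)
        fix p assume "p \<in> {x \<in> A \<times> B. ?f x = y}"
        then obtain c e where p: "p = (c, e)" "c \<in> A" "e \<in> B" "c * e = a * b" using y by auto
        then have eq: "inverse a * c = b * inverse e"
          by (metis inverse_mult_cancel mult.assoc mult_inverse_self mult.right_neutral)
        then have "inverse a * c \<in> A \<inter> B" using p y assms
          by (metis Int_iff sg_inverse sg_mult)
        moreover have "p = (a * (inverse a * c), inverse (inverse a * c) * b)"
          using p eq mult_inverse_cancel[of a c] mult_inverse_cancel[of b e]
          by (simp add: mgroup_inverse_mult mult.assoc)
        ultimately show "p \<in> (\<lambda>d. (a * d, inverse d * b)) ` (A \<inter> B)" by blast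
      qed (use y assms in \<open>auto simp: mult.assoc\<close>)
    qed
    then show "card {x \<in> A \<times> B. ?f x = y} = card (A \<inter> B)"
      by (simp add: bij_betw_same_card)
  qed (simp add: img)
  finally show ?thesis by (simp add: card_cartesian_product)
qed

section \<open>Link to HOL-Algebra and Lagrange's theorem\<close>

definition mgrp :: "'a::mgroup set \<Rightarrow> 'a monoid" where
  "mgrp G = \<lparr>carrier = G, monoid.mult = (*), one = 1\<rparr>"

lemma mgrp_simps [simp]:
  "carrier (mgrp G) = G" "monoid.mult (mgrp G) = (*)" "one (mgrp G) = 1"
  unfolding mgrp_def by simp_all

lemma mgrp_group: "sg G \<Longrightarrow> group (mgrp G)"
  by (rule groupI) (auto simp: mult.assoc intro!: exI bexI inverse_mult_self sg_inverse)

lemma mgrp_inv: "sg G \<Longrightarrow> x \<in> G \<Longrightarrow> inv\<^bsub>mgrp G\<^esub> x = inverse x"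
  by (rule group.inv_equality[OF mgrp_group]) auto

lemma mgrp_subgroup: "sg G \<Longrightarrow> subgroup H (mgrp G) \<longleftrightarrow> sg H \<and> H \<subseteq> G"
proof
  assume "sg G" and H: "subgroup H (mgrp G)"
  then have "H \<subseteq> G" "\<forall>x\<in>H. inverse x \<in> H"
    using subgroup.subset subgroup.m_inv_closed[OF H] mgrp_inv by fastforce+
  then show "sg H \<and> H \<subseteq> G"
    using subgroup.one_closed[OF H] subgroup.m_closed[OF H] unfolding sg_def by auto
next
  assume "sg G" "sg H \<and> H \<subseteq> G"
  then show "subgroup H (mgrp G)"
    by (intro group.subgroupI[OF mgrp_group]) (use sg_one in \<open>force simp: mgrp_inv\<close>)+
qed

lemma mgrp_normal: "sg G \<Longrightarrow> N \<lhd> mgrp G \<longleftrightarrow> nsg N G"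
  using group.normal_inv_iff[OF mgrp_group, of G N]
  by (auto simp: mgrp_subgroup nsg_def mgrp_inv)

lemma card_dvd:
  assumes "sg G" "finite G" "sg H" "H \<subseteq> G"
  shows "card H dvd card G"
proof -
  interpret group "mgrp G" using assms by (simp add: mgrp_group)
  have "card (rcosets\<^bsub>mgrp G\<^esub> H) * card H = card G"
    using lagrange_finite[of H] assms by (simp add: mgrp_subgroup Coset.order_def)
  then show ?thesis by (metis dvd_triv_right)
qed

lemma prime_order_cyc:
  assumes "sg G" "prime (card G)" "x \<in> G" "x \<noteq> 1"
  shows "G = cyc x"
proof -
  have fin: "finite G" using assms(2) by (metis card.infinite not_prime_0)
  have C: "sg (cyc x)" "cyc x \<subseteq> G" using assms fin by (simp_all add: cyc_sg cyc_subset)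
  have "card (cyc x) \<noteq> 1"
    using assms(4) C(1) cyc_self sg_one by (metis card_1_singletonE singletonD)
  then have "card (cyc x) = card G"
    using card_dvd[OF assms(1) fin C] assms(2) by (metis prime_nat_iff)
  then show ?thesis using card_subset_eq[OF fin C(2)] by simp
qed

text \<open>For normal \<open>C\<close> this is equality in the quotient group, expressed without
  leaving the type.\<close>

definition eqm :: "'a::mgroup set \<Rightarrow> 'a \<Rightarrow> 'a \<Rightarrow> bool" where
  "eqm C x y \<longleftrightarrow> x * inverse y \<in> C"

lemma eqm_refl: "sg C \<Longrightarrow> eqm C x x"
  by (simp add: eqm_def)

lemma eqm_sym: "sg C \<Longrightarrow> eqm C x y \<Longrightarrow> eqm C y x"
  unfolding eqm_def by (drule (1) sg_inverse) (simp add: mgroup_simps)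

lemma eqm_trans: "sg C \<Longrightarrow> eqm C x y \<Longrightarrow> eqm C y z \<Longrightarrow> eqm C x z"
  unfolding eqm_def by (drule (2) sg_mult) (simp add: mgroup_simps)

lemma eqm_mult:
  assumes "nsg C H" "x \<in> H" "eqm C x y" "eqm C u v"
  shows "eqm C (x * u) (y * v)"
proof -
  have "x * (u * inverse v) * inverse x \<in> C"
    using assms nsg_conj unfolding eqm_def by blast
  then have "(x * (u * inverse v) * inverse x) * (x * inverse y) \<in> C"
    by (rule sg_mult[OF nsg_sg[OF assms(1)]]) (use assms in \<open>simp add: eqm_def\<close>)
  then show ?thesis by (simp add: eqm_def mgroup_simps)
qed

lemma eqm_power:
  assumes "nsg C H" "sg H" "x \<in> H" "eqm C x y"
  shows "eqm C (x ^ n) (y ^ n)"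
proof (induction n)
  case 0
  then show ?case using assms nsg_sg eqm_refl by fastforce
next
  case (Suc n)
  then show ?case using assms eqm_mult[of C H x y] by simp
qed

lemma eqm_conj:
  assumes "nsg C H" "g \<in> H" "eqm C x y"
  shows "eqm C (g * x * inverse g) (g * y * inverse g)"
proof -
  have "g * (x * inverse y) * inverse g \<in> C" using assms nsg_conj unfolding eqm_def by blast
  then show ?thesis by (simp add: eqm_def mgroup_simps)
qed

lemma eqm_mem: "sg K \<Longrightarrow> C \<subseteq> K \<Longrightarrow> eqm C x y \<Longrightarrow> x \<in> K \<longleftrightarrow> y \<in> K"
  unfolding eqm_def by (metis (no_types) subsetD sg_inverse_iff sg_left_iff sg_right_iff)

lemma cmt_mem_iff: "cmt x y \<in> C \<longleftrightarrow> eqm C (x * y) (y * x)"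
  by (simp add: eqm_def cmt_def mgroup_simps)

lemma cmt_mem_iff': "cmt x y \<in> C \<longleftrightarrow> eqm C (x * y * inverse x) y"
  by (simp add: eqm_def cmt_def mgroup_simps)

text \<open>The set is the preimage of the centralizer of the image of \<open>Z\<close> in
  \<open>H / C\<close>. It serves to extend a commutator condition from generators to a whole
  subgroup.\<close>

lemma cmt_centralizer_sg:
  assumes "nsg C H" "sg H" "Z \<subseteq> H"
  shows "sg {x \<in> H. \<forall>z\<in>Z. cmt x z \<in> C}"
proof -
  have C: "sg C" using assms nsg_sg by blast
  have "cmt (x * y) z \<in> C" if "x \<in> H" "y \<in> H" "z \<in> H" "cmt x z \<in> C" "cmt y z \<in> C" for x y z
  proof -
    have "cmt (x * y) z = (x * cmt y z * inverse x) * cmt x z"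
      by (simp add: cmt_def mgroup_simps)
    then show ?thesis using that assms C nsg_conj by (metis sg_mult)
  qed
  moreover have "cmt (inverse x) z \<in> C" if "x \<in> H" "z \<in> H" "cmt x z \<in> C" for x z
  proof -
    have "cmt (inverse x) z = inverse x * inverse (cmt x z) * x"
      by (simp add: cmt_def mgroup_simps)
    then show ?thesis using that assms C nsg_conj' by (metis sg_inverse)
  qed
  moreover have "cmt 1 z \<in> C" for z
    using C by (simp add: cmt_def)
  ultimately show ?thesis
    using assms unfolding sg_def subset_iff by auto
qed

lemma cmt_nsg_left:
  assumes "nsg C H" "c \<in> C" "h \<in> H"
  shows "cmt c h \<in> C" "cmt h c \<in> C"
proof -
  have C: "sg C" using assms nsg_sg by blast
  have "h * c * inverse h \<in> C" using assms nsg_conj by blast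
  then show "cmt h c \<in> C" using C assms(2) by (simp add: cmt_def)
  then show "cmt c h \<in> C" using C inverse_cmt sg_inverse by metis
qed

lemma cyc_mod_prime:
  assumes C: "sg C" and q: "prime q" "b ^ q \<in> C" "b \<notin> C"
  shows "b ^ i \<in> C \<longleftrightarrow> q dvd i"
proof
  assume "b ^ i \<in> C"
  then show "q dvd i"
    using sg_coprime_power[OF C, of b q i] q prime_imp_coprime[of q i] by blast
next
  assume "q dvd i"
  then show "b ^ i \<in> C" using C q(2) by (auto simp: power_mult)
qed

text \<open>The first positive power of \<open>b\<close> to fall into \<open>C\<close> is the
  \<open>q\<close>-th, so \<open>c * b ^ i\<close> with \<open>i < q\<close> is a unique normal
  form.\<close>

lemma card_prime_extension:
  assumes C: "sg C" and q: "prime q" "b ^ q \<in> C" "b \<notin> C"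
  shows "card (C \<bullet> cyc b) = q * card C"
proof -
  have "q > 0" using q prime_gt_0_nat by blast
  have *: "i = j" if "c * b ^ i = c' * b ^ j" "i \<le> j" "c \<in> C" "c' \<in> C" "i < q" "j < q" for c c' i j
  proof -
    have "c * b ^ i = (c' * b ^ (j - i)) * b ^ i"
      using that by (simp add: mult.assoc power_add[symmetric])
    then have "c = c' * b ^ (j - i)" by (simp only: mgroup_right_cancel)
    then have "b ^ (j - i) \<in> C" using that C sg_left_iff by blast
    then have "q dvd j - i" using cyc_mod_prime[OF assms] by blast
    then show ?thesis using that by (auto dest: dvd_imp_le)
  qed
  have "inj_on (\<lambda>(c, i). c * b ^ i) (C \<times> {..<q})"
  proof (rule inj_onI)
    fix p p'
    assume h: "p \<in> C \<times> {..<q}" "p' \<in> C \<times> {..<q}" "(\<lambda>(c, i). c * b ^ i) p = (\<lambda>(c, i). c * b ^ i) p'"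
    then have "snd p = snd p'"
      using *[of "fst p" "snd p" "fst p'" "snd p'"] *[of "fst p'" "snd p'" "fst p" "snd p"]
      by (cases "snd p \<le> snd p'") (auto simp: split_beta)
    then show "p = p'" using h by (auto simp: split_beta intro: prod_eqI)
  qed
  moreover have "(\<lambda>(c, i). c * b ^ i) ` (C \<times> {..<q}) = C \<bullet> cyc b"
  proof (intro subset_antisym subsetI)
    fix x assume "x \<in> C \<bullet> cyc b"
    then obtain c n where x: "x = c * b ^ n" "c \<in> C" by (auto simp: cyc_def)
    have "b ^ n = (b ^ q) ^ (n div q) * b ^ (n mod q)"
      by (simp add: power_mult[symmetric] power_add[symmetric])
    then have "x = (\<lambda>(c, i). c * b ^ i) (c * (b ^ q) ^ (n div q), n mod q)"
      using x by (simp add: mult.assoc)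
    moreover have "(c * (b ^ q) ^ (n div q), n mod q) \<in> C \<times> {..<q}"
      using x C q(2) \<open>q > 0\<close> by simp
    ultimately show "x \<in> (\<lambda>(c, i). c * b ^ i) ` (C \<times> {..<q})" by blast
  qed (auto simp: cyc_def)
  ultimately show ?thesis
    by (metis card_cartesian_product card_image card_lessThan mult.commute)
qed

text \<open>Modulo the core \<open>C\<close>, an abelian subgroup \<open>V\<close> that permutes with \<open>b\<close> of prime order
meets its conjugate trivially, so \<open>V\<close> has order less than that of \<open>b\<close>; then there is no room
for a second conjugate of \<open>cyc b\<close>.\<close>

lemma abelian_normalizes_prime_cyc:
  assumes H: "sg H" "finite H" and C: "nsg C H" and V: "sg V" "C \<subseteq> V" "V \<subseteq> H"
    and b: "b \<in> H" "b \<notin> V" and q: "prime q" "b ^ q \<in> C"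
    and comm: "\<And>x y. x \<in> V \<Longrightarrow> y \<in> V \<Longrightarrow> cmt x y \<in> C"
    and P: "sg (V \<bullet> cyc b)"
    and core: "\<And>x. x \<in> V \<Longrightarrow> (\<And>i. inverse b ^ i * x * b ^ i \<in> V) \<Longrightarrow> x \<in> C"
    and v: "v \<in> V"
  shows "v * b * inverse v \<in> C \<bullet> cyc b"
proof (rule ccontr)
  let ?W = "C \<bullet> cyc b" and ?P = "V \<bullet> cyc b"
  assume contra: "v * b * inverse v \<notin> ?W"
  have sC: "sg C" using C nsg_sg by blast
  have bC: "b \<notin> C" using b V by blast
  have cb: "sg (cyc b)" "cyc b \<subseteq> H" using H b by (simp_all add: cyc_sg cyc_subset)
  have sW: "sg ?W" using sg_setmul_nsg[OF C] cb H by blast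
  have PH: "?P \<subseteq> H" using setmul_subset H V cb by blast
  have WP: "?W \<subseteq> ?P" using setmul_mono V by blast
  have finP: "finite ?P" using PH H finite_subset by blast
  have fin: "finite V" "finite C" "finite ?W"
    using H V finP WP by (meson finite_subset)+
  have bW: "b \<in> ?W" using sC sg_setmul_right cyc_self by blast
  have CW: "C \<subseteq> ?W" using cb sg_setmul_left by blast
  have VP: "V \<subseteq> ?P" using cb sg_setmul_left by blast
  have cardW: "card ?W = q * card C" using card_prime_extension sC q bC by blast
  have cardP: "card ?P = q * card V" using card_prime_extension V q b by blast
  have bV: "b ^ i \<in> V \<longleftrightarrow> q dvd i" for i
    using cyc_mod_prime[OF V(1) q(1) _ b(2)] q V by blast
  \<comment> \<open>\<open>V'\<close> is the conjugate of \<open>V\<close> by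
    \<open>inverse b\<close>. Either it equals \<open>V\<close>, and the core condition applies to
    all of \<open>V\<close>, or a comparison of orders leads to a contradiction.\<close>
  define V' where "V' = {x. b * x * inverse b \<in> V}"
  have sV': "sg V'" unfolding V'_def using V sg_vimage_conj by blast
  have V'img: "V' = (\<lambda>x. inverse b * x * b) ` V"
  proof (intro subset_antisym subsetI)
    fix x assume "x \<in> V'"
    then have "b * x * inverse b \<in> V" "x = inverse b * (b * x * inverse b) * b"
      by (simp_all add: V'_def mult.assoc)
    then show "x \<in> (\<lambda>x. inverse b * x * b) ` V" by blast
  qed (auto simp: V'_def mult.assoc)
  have "inj_on (\<lambda>x. inverse b * x * b) V" by (auto simp: inj_on_def)
  then have cardV': "card V' = card V" unfolding V'img by (rule card_image)
  have finV': "finite V'" using V'img fin by simp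
  have V'P: "V' \<subseteq> ?P"
    unfolding V'img using VP subsetD[OF WP bW] by (auto intro!: sg_mult[OF P] sg_inverse[OF P])
  have CV': "C \<subseteq> V'"
    using nsg_conj[OF C b(1)] V by (auto simp: V'_def)
  show False
  proof (cases "V' = V")
    case True
    have "inverse b ^ i * x * b ^ i \<in> V" if "x \<in> V" for x i
    proof (induction i)
      case (Suc i)
      then have "inverse b * (inverse b ^ i * x * b ^ i) * b \<in> V" using True V'img by blast
      moreover have "inverse b ^ Suc i * x * b ^ Suc i = inverse b * (inverse b ^ i * x * b ^ i) * b"
        by (simp add: mult.assoc power_commutes)
      ultimately show ?case by simp
    qed (use that in simp)
    then have "v \<in> C" using core v by blast
    then have "v * b * inverse v \<in> ?W"
      using CW bW sW by (metis sg_inverse sg_mult subsetD)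
    then show False using contra by blast
  next
    case False
    then have "\<not> V' \<subseteq> V" using cardV' fin card_subset_eq by blast
    then obtain u where u: "u \<in> V'" "u \<notin> V" by blast
    let ?Z = "V \<inter> V'"
    have ZH: "?Z \<subseteq> H" using V by blast
    \<comment> \<open>Modulo \<open>C\<close>, \<open>?T\<close> is the centralizer of
      \<open>V \<inter> V'\<close>. It contains \<open>V\<close> and \<open>V'\<close>, hence some
      \<open>b ^ i\<close> with \<open>i\<close> prime to \<open>q\<close>, hence \<open>b\<close>;
      so the intersection is invariant under \<open>b\<close> and lies in the core.\<close>
    let ?T = "{x \<in> H. \<forall>z\<in>?Z. cmt x z \<in> C}"
    have sT: "sg ?T" using cmt_centralizer_sg[OF C H(1) ZH] .
    have VT: "V \<subseteq> ?T" using comm V by blast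
    have "cmt x z \<in> C" if "x \<in> V'" "z \<in> V'" for x z
    proof -
      have "b * cmt x z * inverse b \<in> C"
        using that comm by (simp add: V'_def conj_cmt)
      then have "inverse b * (b * cmt x z * inverse b) * b \<in> C"
        using nsg_conj'[OF C H(1) b(1)] by blast
      then show ?thesis by (simp add: mult.assoc)
    qed
    then have V'T: "V' \<subseteq> ?T" using V'P PH by blast
    obtain v' i where vi: "u = v' * b ^ i" "v' \<in> V" using u V'P unfolding cyc_def by blast
    then have "\<not> q dvd i" using u(2) bV V(1) by auto
    then have "coprime q i" using q prime_imp_coprime by blast
    moreover have "b ^ i \<in> ?T"
    proof -
      have "v' * b ^ i \<in> ?T" using vi(1) subsetD[OF V'T u(1)] by (simp only:)
      then show ?thesis using sg_left_iff[OF sT subsetD[OF VT vi(2)]] by (simp only:)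
    qed
    moreover have "b ^ q \<in> ?T" using subsetD[OF VT subsetD[OF V(2) q(2)]] .
    ultimately have bT: "b \<in> ?T" using sg_coprime_power[OF sT, of b q i] by (simp only:)
    have Zconj: "inverse b * z * b \<in> ?Z" if "z \<in> ?Z" for z
    proof -
      have "inverse b \<in> ?T" using bT sT by (rule sg_inverse[rotated])
      then have "cmt (inverse b) z \<in> C" using that by blast
      then have "cmt (inverse b) z * z \<in> ?Z"
        using that V CV' sV' by (metis Int_iff sg_mult subsetD)
      then show ?thesis by (simp add: cmt_def mult.assoc)
    qed
    have "z \<in> C" if z: "z \<in> ?Z" for z
    proof (rule core)
      show "z \<in> V" using z by blast
      have "inverse b ^ i * z * b ^ i \<in> ?Z" for i
      proof (induction i)
        case (Suc i)
        then have "inverse b * (inverse b ^ i * z * b ^ i) * b \<in> ?Z" using Zconj by blast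
        moreover have "inverse b ^ Suc i * z * b ^ Suc i = inverse b * (inverse b ^ i * z * b ^ i) * b"
          by (simp add: mult.assoc power_commutes)
        ultimately show ?case by simp
      qed (use z in simp)
      then show "inverse b ^ i * z * b ^ i \<in> V" for i by blast
    qed
    then have Z: "V \<inter> V' = C" using V CV' by blast
    have VV': "card (V \<bullet> V') * card C = card V * card V"
      using card_setmul[OF V(1) sV'] fin finV' Z cardV' by simp
    \<comment> \<open>Otherwise \<open>b = x * (inverse b * y * b)\<close> with \<open>x\<close> and
      \<open>y\<close> in \<open>V\<close>, and cancelling gives \<open>b = y * x\<close> in
      \<open>V\<close>. So \<open>V \<bullet> V'\<close> misses a point of \<open>?P\<close>, which
      forces \<open>card V < q * card C\<close>.\<close>
    have "b \<notin> V \<bullet> V'"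
    proof
      assume "b \<in> V \<bullet> V'"
      then obtain x y where xy: "b = x * (inverse b * y * b)" "x \<in> V" "y \<in> V"
        unfolding V'img by blast
      then have "1 * b = (x * (inverse b * y)) * b" by (simp add: mult.assoc)
      then have "1 = x * (inverse b * y)" by (simp only: mgroup_right_cancel)
      then have "inverse x = inverse b * y" by (metis mgroup_inverse_eq)
      then have "b = y * x"
        by (metis mgroup_inverse_inverse mgroup_inverse_mult mult_inverse_cancel mult_inverse_self mult.assoc mult.right_neutral)
      then show False using xy V(1) b(2) by simp
    qed
    moreover have "V \<bullet> V' \<subseteq> ?P" using VP V'P P setmul_subset by blast
    moreover have "b \<in> ?P" using bW WP by blast
    ultimately have "card (V \<bullet> V') < card ?P"
      using finP by (metis psubsetI psubset_card_mono)
    moreover have "card C > 0" using sC fin by (metis card_gt_0_iff empty_iff sg_one)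
    ultimately have "card V * card V < q * card V * card C"
      using VV' cardP by (metis mult_less_mono1)
    then have VqC: "card V < q * card C" by (simp add: mult.commute mult.left_commute)
    \<comment> \<open>The conjugate of \<open>?W\<close> by \<open>v\<close>. Being different from
      \<open>?W\<close> it meets it in \<open>C\<close>, as \<open>q\<close> is prime; so their
      product has \<open>q * q * card C\<close> elements, too many for \<open>?P\<close>.\<close>
    define W' where "W' = {x. inverse v * x * inverse (inverse v) \<in> ?W}"
    have sW': "sg W'" unfolding W'_def using sW sg_vimage_conj by blast
    have W'img: "W' = (\<lambda>x. v * x * inverse v) ` ?W"
    proof (intro subset_antisym subsetI)
      fix x assume "x \<in> W'"
      then have "inverse v * x * v \<in> ?W" "x = v * (inverse v * x * v) * inverse v"
        by (simp_all add: W'_def mult.assoc)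
      then show "x \<in> (\<lambda>x. v * x * inverse v) ` ?W" by blast
    qed (auto simp: W'_def mult.assoc)
    have "inj_on (\<lambda>x. v * x * inverse v) ?W" by (auto simp: inj_on_def)
    then have cardW': "card W' = card ?W" unfolding W'img by (rule card_image)
    have finW': "finite W'" using W'img fin by simp
    have W'P: "W' \<subseteq> ?P" unfolding W'img using subsetD[OF VP v] WP by (auto intro!: sg_mult[OF P] sg_inverse[OF P])
    have CW': "C \<subseteq> W'"
      using nsg_conj'[OF C H(1), of v] v V CW by (auto simp: W'_def)
    have vbW': "v * b * inverse v \<in> W'" unfolding W'img using bW by blast
    have WW: "?W \<inter> W' = C"
    proof (rule ccontr)
      assume "?W \<inter> W' \<noteq> C"
      then obtain x where x: "x \<in> ?W" "x \<in> W'" "x \<notin> C" using CW CW' by blast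
      then obtain c i where ci: "x = c * b ^ i" "c \<in> C" by (auto simp: cyc_def)
      then have "\<not> q dvd i" using x(3) cyc_mod_prime[OF sC q bC] sC by auto
      then have "coprime q i" using q prime_imp_coprime by blast
      moreover have "b ^ i \<in> W'" using x ci CW' sW' sg_left_iff by blast
      moreover have "b ^ q \<in> W'" using q CW' by blast
      ultimately have "b \<in> W'" using sg_coprime_power[OF sW'] by blast
      then have "?W \<subseteq> W'"
        using CW' sW' setmul_subset cyc_subset by blast
      then have "?W = W'" using cardW' finW' card_subset_eq by metis
      then show False using contra vbW' by blast
    qed
    have "card (?W \<bullet> W') * card C = card ?W * card ?W"
      using card_setmul[OF sW sW'] fin finW' WW cardW' by simp
    then have "card (?W \<bullet> W') = q * (q * card C)"
      using cardW \<open>card C > 0\<close> by simp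
    moreover have "card (?W \<bullet> W') \<le> card ?P"
      using finP setmul_subset[OF P WP W'P] card_mono by blast
    ultimately have "q * (q * card C) \<le> q * card V" using cardP by simp
    then show False using VqC q prime_gt_0_nat by fastforce
  qed
qed

section \<open>Subnormal subgroups\<close>

abbreviation sn :: "'a::mgroup set \<Rightarrow> 'a set \<Rightarrow> bool" where
  "sn \<equiv> nsg\<^sup>*\<^sup>*"

lemma sn_subset: "sn S G \<Longrightarrow> S \<subseteq> G"
  by (induction rule: rtranclp_induct) (auto dest: nsg_subset)

lemma sn_sg: "sn S G \<Longrightarrow> sg G \<Longrightarrow> sg S"
  by (erule converse_rtranclpE) (auto dest: nsg_sg)

lemma sn_Int:
  assumes "sn S G" "sg K" "K \<subseteq> G" "sg G"
  shows "sn (S \<inter> K) K"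
  using assms(1,3,4)
proof (induction rule: converse_rtranclp_induct)
  case base
  then show ?case by (simp add: Int_absorb1)
next
  case (step S S')
  have "nsg (S \<inter> K) (S' \<inter> K)"
    using step(1) sg_Int[OF nsg_sg[OF step(1)] assms(2)] by (auto simp: nsg_def subset_iff assms(2))
  with step show ?case by auto
qed

lemma sn_restrict: "sn S G \<Longrightarrow> sg K \<Longrightarrow> S \<subseteq> K \<Longrightarrow> K \<subseteq> G \<Longrightarrow> sg G \<Longrightarrow> sn S K"
  using sn_Int[of S G K] by (simp add: Int_absorb2)

lemma sn_proper_normal: "sn S G \<Longrightarrow> S \<noteq> G \<Longrightarrow> \<exists>M. sn S M \<and> nsg M G \<and> M \<noteq> G"
proof (induction rule: rtranclp_induct)
  case (step y z)
  then show ?case by (cases "y = z") auto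
qed simp

text \<open>Multiplying a subnormal chain by the normal subgroup \<open>N\<close> keeps each link
  normal.\<close>

lemma sn_nsg_setmul:
  assumes "nsg N Y" "sn U Y" "sg Y"
  shows "sn (N \<bullet> U) Y"
  using assms(2)
proof (induction rule: converse_rtranclp_induct)
  case base
  have "N \<bullet> Y = Y"
    using assms setmul_subset nsg_subset sg_setmul_right nsg_sg by (metis order_refl subset_antisym)
  then show ?case by simp
next
  case (step U U')
  have sN: "sg N" using assms nsg_sg by blast
  have U'Y: "U' \<subseteq> Y" "U \<subseteq> Y" "U \<subseteq> U'" using step sn_subset nsg_subset by blast+
  have sU: "sg U'" "sg U" using step sn_sg assms(3) nsg_sg by blast+
  have NU: "sg (N \<bullet> U)" using sg_setmul_nsg[OF assms(1) sU(2) U'Y(2) assms(3)] .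
  have "nsg (N \<bullet> U) (N \<bullet> U')"
  proof (rule nsgI[OF NU])
    show "N \<bullet> U \<subseteq> N \<bullet> U'" using U'Y setmul_mono by blast
    fix g x assume "g \<in> N \<bullet> U'" "x \<in> N \<bullet> U"
    then obtain n u' m u where *: "g = n * u'" "x = m * u" "n \<in> N" "m \<in> N" "u' \<in> U'" "u \<in> U" by blast
    have 1: "u' * m * inverse u' \<in> N" using * nsg_conj[OF assms(1)] U'Y by blast
    have 2: "u' * u * inverse u' \<in> U" using * nsg_conj[OF step(1)] by blast
    have "N \<subseteq> N \<bullet> U" "U \<subseteq> N \<bullet> U"
      using sg_setmul_left[OF sU(2)] sg_setmul_right[OF sN] by auto
    then have "n \<in> N \<bullet> U" "u' * m * inverse u' \<in> N \<bullet> U" "u' * u * inverse u' \<in> N \<bullet> U"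
      using 1 2 *(3) by auto
    then have "n * (u' * m * inverse u') * (u' * u * inverse u') * inverse n \<in> N \<bullet> U"
      by (meson NU sg_inverse sg_mult)
    then show "g * x * inverse g \<in> N \<bullet> U" using * by (simp add: mgroup_simps)
  qed
  then show ?case using step(3) by (meson converse_rtranclp_into_rtranclp)
qed

text \<open>Descent from \<open>Q\<close> to \<open>S\<close> through \<open>U\<close>-invariant
  \<open>Y\<close> in which \<open>S\<close> is subnormal and for which \<open>Y \<bullet> U\<close>
  is subnormal in \<open>Q\<close>. The normal closure \<open>Y1\<close> of \<open>S\<close> in
  \<open>Y\<close> is again \<open>U\<close>-invariant and is normal in
  \<open>Y \<bullet> U\<close>, so \<open>Y1 \<bullet> U\<close> is subnormal too.\<close>

lemma sn_join:
  assumes Q: "sg Q" "finite Q" and S: "sn S Q" and U: "sn U Q"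
    and inv: "\<And>u s. u \<in> U \<Longrightarrow> s \<in> S \<Longrightarrow> u * s * inverse u \<in> S"
  shows "sn (S \<bullet> U) Q"
proof -
  have sS: "sg S" "sg U" "S \<subseteq> Q" "U \<subseteq> Q" using sn_sg sn_subset Q S U by blast+
  have "sn (S \<bullet> U) Q" if "sg Y" "Y \<subseteq> Q" "sn S Y" "\<And>u y. u \<in> U \<Longrightarrow> y \<in> Y \<Longrightarrow> u * y * inverse u \<in> Y"
    "sn (Y \<bullet> U) Q" "sg (Y \<bullet> U)" for Y
    using that
  proof (induction "card Y" arbitrary: Y rule: less_induct)
    case less
    show ?case
    proof (cases "S = Y")
      case True
      then show ?thesis using less by simp
    next
      case False
      then obtain M where M: "sn S M" "nsg M Y" "M \<noteq> Y" using sn_proper_normal[OF less(4) False] by auto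
      have finY: "finite Y" using less Q finite_subset by blast
      let ?R = "{y * s * inverse y | y s. y \<in> Y \<and> s \<in> S}"
      \<comment> \<open>The normal closure of \<open>S\<close> in \<open>Y\<close>. It is smaller
        than \<open>Y\<close> because it stays inside the proper normal subgroup
        \<open>M\<close>.\<close>
      define Y1 where "Y1 = gen ?R"
      have RY1: "?R \<subseteq> Y1" unfolding Y1_def by (rule gen_superset)
      have SY1: "S \<subseteq> Y1"
      proof
        fix s assume "s \<in> S"
        then have "1 * s * inverse 1 \<in> ?R" using sg_one[OF less(2)] by blast
        then have "1 * s * inverse 1 \<in> Y1" by (rule subsetD[OF RY1])
        then show "s \<in> Y1" by simp
      qed
      have "?R \<subseteq> M" using nsg_conj[OF M(2)] sn_subset[OF M(1)] by auto
      then have Y1M: "Y1 \<subseteq> M" unfolding Y1_def by (rule gen_least[OF nsg_sg[OF M(2)]])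
      have Y1Y: "Y1 \<subseteq> Y" using Y1M nsg_subset[OF M(2)] by (rule subset_trans)
      have sY1: "sg Y1" unfolding Y1_def by (rule gen_sg)
      have YY1: "g * x * inverse g \<in> Y1" if "g \<in> Y" "x \<in> Y1" for g x
        unfolding Y1_def
      proof (rule gen_conj[OF _ that(2)[unfolded Y1_def]])
        fix r assume "r \<in> ?R"
        then obtain y s where r: "r = y * s * inverse y" "y \<in> Y" "s \<in> S" by blast
        then have "g * r * inverse g = (g * y) * s * inverse (g * y)" by (simp add: mgroup_simps)
        moreover have "g * y \<in> Y" using r that less(2) by simp
        ultimately have "g * r * inverse g \<in> ?R" using r(3) by (intro CollectI exI conjI)
        then show "g * r * inverse g \<in> gen ?R" by (rule subsetD[OF gen_superset])
      qed
      have UY1: "u * x * inverse u \<in> Y1" if "u \<in> U" "x \<in> Y1" for u x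
        unfolding Y1_def
      proof (rule gen_conj[OF _ that(2)[unfolded Y1_def]])
        fix r assume "r \<in> ?R"
        then obtain y s where r: "r = y * s * inverse y" "y \<in> Y" "s \<in> S" by blast
        then have "u * r * inverse u = (u * y * inverse u) * (u * s * inverse u) * inverse (u * y * inverse u)"
          by (simp add: mgroup_simps)
        moreover have "u * y * inverse u \<in> Y" "u * s * inverse u \<in> S"
          using less(5)[OF that(1) r(2)] inv[OF that(1) r(3)] by auto
        ultimately have "u * r * inverse u \<in> ?R" by (intro CollectI exI conjI)
        then show "u * r * inverse u \<in> gen ?R" by (rule subsetD[OF gen_superset])
      qed
      have Y1YU: "nsg Y1 (Y \<bullet> U)"
      proof (rule nsgI[OF sY1])
        show "Y1 \<subseteq> Y \<bullet> U" using Y1Y sg_setmul_left sS by blast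
        fix g x assume "g \<in> Y \<bullet> U" "x \<in> Y1"
        then obtain y u where "g = y * u" "y \<in> Y" "u \<in> U" by blast
        then have "g * x * inverse g = y * (u * x * inverse u) * inverse y" by (simp add: mgroup_simps)
        then show "g * x * inverse g \<in> Y1"
          using YY1 UY1 \<open>x \<in> Y1\<close> \<open>y \<in> Y\<close> \<open>u \<in> U\<close> by simp
      qed
      have YUX: "Y \<bullet> U \<subseteq> Q" using less(6) sn_subset by blast
      have UYU: "U \<subseteq> Y \<bullet> U" using less(2) sg_setmul_right by blast
      have "sn U (Y \<bullet> U)" using sn_restrict[OF U less(7) UYU YUX Q(1)] .
      then have "sn (Y1 \<bullet> U) (Y \<bullet> U)" using sn_nsg_setmul Y1YU less(7) by blast
      then have 1: "sn (Y1 \<bullet> U) Q" using less(6) by (rule rtranclp_trans)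
      have 2: "sg (Y1 \<bullet> U)" using sn_sg[OF 1 Q(1)] .
      have "Y1 \<subset> Y" using Y1Y Y1M M nsg_subset by blast
      then have "card Y1 < card Y" using finY psubset_card_mono by blast
      then show ?thesis
        using less(1)[of Y1] sY1 Y1Y less(3) sn_restrict[OF less(4) sY1 SY1 Y1Y less(2)] UY1 1 2
        by blast
    qed
  qed
  moreover have "Q \<bullet> U = Q"
    using Q sS setmul_subset sg_setmul_left by (metis order_refl subset_antisym)
  ultimately show ?thesis
    using Q S sS by (metis order_refl rtranclp.rtrancl_refl sg_inverse sg_mult subsetD)
qed

section \<open>Conjugates, maximal subgroups and Wielandt's criterion\<close>

definition cj :: "'a::mgroup \<Rightarrow> 'a set \<Rightarrow> 'a set" where
  "cj g S = (\<lambda>x. g * x * inverse g) ` S"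

lemma mem_cj: "x \<in> cj g S \<longleftrightarrow> inverse g * x * g \<in> S"
proof
  assume "inverse g * x * g \<in> S"
  then have "g * (inverse g * x * g) * inverse g \<in> cj g S" unfolding cj_def by blast
  then show "x \<in> cj g S" by (simp add: mult.assoc)
qed (auto simp: cj_def mult.assoc)

lemma cj_cj: "cj g (cj h S) = cj (g * h) S"
  by (auto simp: mem_cj mgroup_simps)

lemma cj_one [simp]: "cj 1 S = S"
  by (auto simp: mem_cj)

lemma cj_mono: "S \<subseteq> T \<Longrightarrow> cj g S \<subseteq> cj g T"
  by (auto simp: cj_def)

lemma cj_sg: "sg S \<Longrightarrow> sg (cj g S)"
  using sg_vimage_conj[of S "inverse g"] by (simp add: mem_cj[symmetric])

lemma cj_nsg:
  assumes "nsg N G"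
  shows "nsg (cj g N) (cj g G)"
proof (rule nsgI)
  show "sg (cj g N)" "cj g N \<subseteq> cj g G" using assms by (auto simp: cj_sg nsg_sg cj_mono nsg_subset)
  fix h n assume "h \<in> cj g G" "n \<in> cj g N"
  then obtain h' n' where "h = g * h' * inverse g" "n = g * n' * inverse g" "h' \<in> G" "n' \<in> N"
    by (auto simp: cj_def)
  then have "h * n * inverse h = g * (h' * n' * inverse h') * inverse g" "h' * n' * inverse h' \<in> N"
    using assms nsg_conj by (auto simp: mgroup_simps)
  then show "h * n * inverse h \<in> cj g N" unfolding cj_def by blast
qed

lemma cj_sn: "sn S G \<Longrightarrow> sn (cj g S) (cj g G)"
proof (induction rule: rtranclp_induct)
  case (step y z)
  then show ?case using cj_nsg by (meson rtranclp.rtrancl_into_rtrancl)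
qed simp

lemma cj_sg_self:
  assumes "sg G" "g \<in> G"
  shows "cj g G = G"
proof -
  have "inverse g * x * g \<in> G \<longleftrightarrow> x \<in> G" for x
    using sg_conj[OF assms(1) sg_inverse[OF assms], of x] by simp
  then show ?thesis unfolding set_eq_iff mem_cj by simp
qed

lemma card_cj: "card (cj g S) = card S"
  unfolding cj_def by (rule card_image) (auto simp: inj_on_def)

lemma ex_maximal:
  assumes "finite G" "P N" "N \<subset> G"
  shows "\<exists>M. N \<subseteq> M \<and> M \<subset> G \<and> P M \<and> (\<forall>L. P L \<and> M \<subseteq> L \<and> L \<subset> G \<longrightarrow> L = M)"
proof -
  let ?A = "{M. N \<subseteq> M \<and> M \<subset> G \<and> P M}"
  have "?A \<subseteq> Pow G" by auto
  then have fin: "finite ?A" using assms(1) finite_subset finite_Pow_iff by metis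
  have "N \<in> ?A" using assms by simp
  from finite_has_maximal2[OF fin this]
  obtain M where M: "M \<in> ?A" "\<And>L. L \<in> ?A \<Longrightarrow> M \<subseteq> L \<Longrightarrow> M = L" by auto
  have "L = M" if "P L" "M \<subseteq> L" "L \<subset> G" for L
    using M(2)[of L] M(1) that by auto
  then show ?thesis using M(1) by (intro exI[of _ M]) auto
qed

definition maxsg :: "'a::mgroup set \<Rightarrow> 'a set \<Rightarrow> bool" where
  "maxsg M G \<longleftrightarrow> sg M \<and> M \<subset> G \<and> (\<forall>L. sg L \<and> M \<subseteq> L \<and> L \<subset> G \<longrightarrow> L = M)"

lemma ex_maxsg:
  assumes "finite G" "sg N" "N \<subset> G"
  shows "\<exists>M. N \<subseteq> M \<and> maxsg M G"
  using ex_maximal[of G sg N, OF assms] unfolding maxsg_def by metis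

text \<open>Take the first link of the chain at which normality of \<open>S\<close> is lost.\<close>

lemma sn_not_nsg:
  assumes "sn S K" "\<not> nsg S K" "sg S"
  shows "\<exists>H1 H2. nsg S H1 \<and> nsg H1 H2 \<and> \<not> nsg S H2 \<and> sn H2 K"
proof -
  have "nsg S K \<or> (\<exists>H1 H2. nsg S H1 \<and> nsg H1 H2 \<and> \<not> nsg S H2 \<and> sn H2 K)"
    using assms(1)
  proof (induction rule: rtranclp_induct)
    case base
    then show ?case using nsg_self assms by blast
  next
    case (step H H')
    then show ?case
      by (meson rtranclp.rtrancl_into_rtrancl rtranclp.rtrancl_refl)
  qed
  then show ?thesis using assms by blast
qed

lemma sg_normalizer: "sg G \<Longrightarrow> sg {g \<in> G. cj g S = S}"
  unfolding sg_def
proof (intro conjI ballI)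
  assume G: "1 \<in> G \<and> (\<forall>x\<in>G. \<forall>y\<in>G. x * y \<in> G) \<and> (\<forall>x\<in>G. inverse x \<in> G)"
  let ?N = "{g \<in> G. cj g S = S}"
  show "1 \<in> ?N" using G by simp
  show "x * y \<in> ?N" if "x \<in> ?N" "y \<in> ?N" for x y
    using that G by (auto simp: cj_cj[symmetric])
  show "inverse x \<in> ?N" if "x \<in> ?N" for x
    using that G cj_cj[of "inverse x" x S] by auto
qed

text \<open>Wielandt's zipper lemma. Every maximal \<open>K\<close> above \<open>S\<close> is
  compared with one \<open>M0\<close> above the normalizer of \<open>S\<close>. If \<open>S\<close>
  is not normal in \<open>K\<close>, then \<open>K\<close> contains a different conjugate of
  \<open>S\<close> that normalizes \<open>S\<close>. Their product \<open>?T\<close> lies in both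
  \<open>K\<close> and \<open>M0\<close>, inherits the hypotheses and is larger than
  \<open>S\<close>, so induction applies.\<close>

lemma wielandt_zipper:
  assumes G: "sg G" "finite G"
    and "sg S" "S \<subseteq> G" "\<not> sn S G"
    and "\<And>H. sg H \<Longrightarrow> S \<subseteq> H \<Longrightarrow> H \<subset> G \<Longrightarrow> sn S H"
    and "maxsg M G" "S \<subseteq> M" "maxsg K G" "S \<subseteq> K"
  shows "M = K"
  using assms(3-)
proof (induction "card G - card S" arbitrary: S M K rule: less_induct)
  case less
  let ?N = "{g \<in> G. cj g S = S}"
  have sN: "sg ?N" by (rule sg_normalizer[OF G(1)])
  have normN: "L \<subseteq> ?N" if "nsg S L" "L \<subseteq> G" "sg L" for L
  proof -
    have "cj g S \<subseteq> S" if "g \<in> L" for g using that \<open>nsg S L\<close> by (auto simp: cj_def nsg_conj)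
    moreover have "finite S" using finite_subset[OF less(3) G(2)] .
    ultimately have "cj g S = S" if "g \<in> L" for g using that card_cj card_subset_eq by metis
    then show ?thesis using \<open>L \<subseteq> G\<close> by auto
  qed
  have "\<not> nsg S G" using less(4) by blast
  then have "?N \<noteq> G" using less(2,3) by (auto simp: nsg_def cj_def)
  then obtain M0 where M0: "?N \<subseteq> M0" "maxsg M0 G" using ex_maxsg[OF G(2) sN] by blast
  have "K = M0" if K: "maxsg K G" "S \<subseteq> K" for K
  proof (cases "nsg S K")
    case True
    have "sg K" "K \<subset> G" using K unfolding maxsg_def by auto
    then have "K \<subseteq> M0" using normN[OF True] M0(1) by blast
    then show ?thesis using K M0(2) unfolding maxsg_def by metis
  next
    case False
    have KG: "sg K" "K \<subset> G" using K unfolding maxsg_def by auto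
    then have "sn S K" using less(5) K by blast
    then obtain H1 H2 where H: "nsg S H1" "nsg H1 H2" "\<not> nsg S H2" "sn H2 K"
      using sn_not_nsg False less(2) by blast
    have HK: "H2 \<subseteq> K" "H1 \<subseteq> H2" "S \<subseteq> H1" using H sn_subset nsg_subset by blast+
    have sH: "sg H1" "sg H2" using H nsg_sg sn_sg KG by blast+
    obtain x s where x: "x \<in> H2" "s \<in> S" "x * s * inverse x \<notin> S"
      using H(3) less(2) HK by (auto simp: nsg_def)
    let ?U = "cj x S"
    have UH1: "?U \<subseteq> H1" using nsg_conj[OF H(2) x(1)] HK(3) unfolding cj_def by auto
    have sU: "sg ?U" using cj_sg[OF less(2)] .
    let ?T = "S \<bullet> ?U"
    have sT: "sg ?T" using sg_setmul_nsg[OF H(1) sU UH1 sH(1)] .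
    have TH1: "?T \<subseteq> H1" using setmul_subset[OF sH(1) HK(3) UH1] .
    have ST: "S \<subseteq> ?T" using sg_setmul_left sU by blast
    have "x * s * inverse x \<in> ?U" using x(2) unfolding cj_def by blast
    moreover have "?U \<subseteq> ?T" using sg_setmul_right less(2) by blast
    ultimately have "S \<noteq> ?T" using x by blast
    have nST: "nsg S ?T" using nsg_mono[OF H(1) ST TH1] .
    have TG: "?T \<subseteq> G" using TH1 HK KG by blast
    have TM0: "?T \<subseteq> M0" using normN[OF nST TG sT] M0 by blast
    have "card ?T > card S" using ST \<open>S \<noteq> ?T\<close> finite_subset[OF TG G(2)] psubset_card_mono by blast
    moreover have "card ?T \<le> card G" using TG G card_mono by blast
    ultimately have 1: "card G - card ?T < card G - card S" by linarith
    have 2: "\<not> sn ?T G" using less(4) nST by (meson converse_rtranclp_into_rtranclp)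
    \<comment> \<open>\<open>S\<close> is subnormal in the conjugate of \<open>L\<close> by
      \<open>inverse x\<close>, so \<open>?U\<close> is subnormal in \<open>L\<close>; as
      \<open>?U\<close> normalizes \<open>S\<close>, \<open>sn_join\<close> gives their
      product.\<close>
    have 3: "sn ?T L" if L: "sg L" "?T \<subseteq> L" "L \<subset> G" for L
    proof (rule sn_join)
      show "sg L" "finite L" using L G finite_subset by blast+
      show "sn S L" using less(5) L ST by blast
      have xG: "x \<in> G" using x HK KG by blast
      let ?L' = "cj (inverse x) L"
      have "?L' \<subseteq> G" using cj_mono[of L G] cj_sg_self[of G "inverse x"] L xG G by fastforce
      moreover have "card ?L' < card G" using L G card_cj psubset_card_mono by metis
      ultimately have "?L' \<subset> G" by blast
      moreover have "S \<subseteq> ?L'"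
        using cj_mono[of ?U L "inverse x"] L \<open>?U \<subseteq> ?T\<close> by (simp add: cj_cj)
      ultimately have "sn S ?L'" using less(5) cj_sg L by blast
      then have "sn ?U (cj x ?L')" by (rule cj_sn)
      then show "sn ?U L" by (simp add: cj_cj)
      show "u * s * inverse u \<in> S" if "u \<in> ?U" "s \<in> S" for u s
        using that nsg_conj[OF H(1)] UH1 by blast
    qed
    show ?thesis
      using less(1)[OF 1 sT TG 2 3, of K M0] K M0 TM0 TH1 HK by blast
  qed
  then show ?case using less(6-9) by blast
qed

text \<open>In a minimal counterexample \<open>S\<close> is subnormal in all proper subgroups above
  it, so by the zipper lemma it lies in a single maximal subgroup \<open>M\<close>. No
  \<open>gen (S \<union> cj g S)\<close> is the whole group, hence all conjugates of
  \<open>S\<close> lie in \<open>M\<close>, and they generate a proper normal subgroup in which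
  \<open>S\<close> is subnormal.\<close>

theorem wielandt_subnormal:
  assumes "sg G" "finite G" "sg S" "S \<subseteq> G"
    and "\<And>g. g \<in> G \<Longrightarrow> sn S (gen (S \<union> cj g S))"
  shows "sn S G"
  using assms
proof (induction "card G" arbitrary: G rule: less_induct)
  case less
  show ?case
  proof (rule ccontr)
    assume not: "\<not> sn S G"
    have proper: "sn S H" if "sg H" "S \<subseteq> H" "H \<subset> G" for H
    proof (rule less(1))
      show "card H < card G" using psubset_card_mono[OF less(3) that(3)] .
      show "finite H" using finite_subset[OF psubset_imp_subset[OF that(3)] less(3)] .
      show "sn S (gen (S \<union> cj g S))" if "g \<in> H" for g
        using less(6) that \<open>H \<subset> G\<close> by auto
    qed (use that less(4) in auto)
    have "S \<noteq> G" using not by blast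
    then obtain M where M: "S \<subseteq> M" "maxsg M G" using ex_maxsg[OF less(3,4)] less(5) by blast
    have sub: "cj g S \<subseteq> M" if "g \<in> G" for g
    proof -
      let ?J = "gen (S \<union> cj g S)"
      have "cj g S \<subseteq> G" using cj_mono cj_sg_self less(2,5) that by blast
      then have "?J \<subseteq> G" using gen_least less(2,5) by blast
      moreover have "?J \<noteq> G" using not less(6) that by force
      ultimately obtain K where K: "?J \<subseteq> K" "maxsg K G" using ex_maxsg[OF less(3) gen_sg] by blast
      have "S \<union> cj g S \<subseteq> K" using K gen_superset by blast
      then have "K = M" using wielandt_zipper[OF less(2,3,4,5) not proper K(2) _ M(2,1)] by blast
      then show ?thesis using \<open>S \<union> cj g S \<subseteq> K\<close> by blast
    qed
    let ?R = "\<Union>g\<in>G. cj g S"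
    let ?L = "gen ?R"
    have RG: "?R \<subseteq> G" using sub M unfolding maxsg_def by blast
    have nL: "nsg ?L G"
    proof (rule gen_nsg[OF less(2) RG])
      fix g s assume "g \<in> G" "s \<in> ?R"
      then obtain h where h: "h \<in> G" "s \<in> cj h S" by blast
      then have "g * s * inverse g \<in> cj (g * h) S" by (simp add: mem_cj mgroup_simps)
      moreover have "g * h \<in> G" using h \<open>g \<in> G\<close> less(2) by simp
      ultimately have "g * s * inverse g \<in> ?R" by (rule UN_I[rotated])
      then show "g * s * inverse g \<in> ?L" by (rule subsetD[OF gen_superset])
    qed
    have sM: "sg M" "M \<subset> G" using M unfolding maxsg_def by auto
    have "?R \<subseteq> M" using sub by auto
    then have "?L \<subseteq> M" by (rule gen_least[OF sM(1)])
    then have LG: "?L \<subset> G" using sM by auto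
    have "S \<subseteq> ?R" using sg_one[OF less(2)] cj_one[of S] by auto
    then have "S \<subseteq> ?L" using gen_superset[of ?R] by (rule subset_trans)
    then have "sn S ?L" using proper LG gen_sg by auto
    then show False using not nL by (meson rtranclp.rtrancl_into_rtrancl)
  qed
qed

section \<open>Mutually permutable products\<close>

definition mutperm :: "'a::mgroup set \<Rightarrow> 'a set \<Rightarrow> bool" where
  "mutperm A B \<longleftrightarrow> (\<forall>U. sg U \<and> U \<subseteq> B \<longrightarrow> A \<bullet> U = U \<bullet> A) \<and> (\<forall>U. sg U \<and> U \<subseteq> A \<longrightarrow> B \<bullet> U = U \<bullet> B)"

lemma mutperm_sym: "mutperm A B \<Longrightarrow> mutperm B A"
  by (auto simp: mutperm_def)

lemma mutperm_sg: "mutperm A B \<Longrightarrow> sg A \<Longrightarrow> sg U \<Longrightarrow> U \<subseteq> B \<Longrightarrow> sg (A \<bullet> U)"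
  using sg_setmul[of A U] by (simp add: mutperm_def)

lemma setmul_assoc: "A \<bullet> B \<bullet> C = A \<bullet> (B \<bullet> C)"
proof (intro subset_antisym subsetI)
  fix x assume "x \<in> A \<bullet> B \<bullet> C"
  then obtain a b c where "x = a * b * c" "a \<in> A" "b \<in> B" "c \<in> C" by blast
  then have "x = a * (b * c)" "b * c \<in> B \<bullet> C" by (auto simp: mult.assoc)
  then show "x \<in> A \<bullet> (B \<bullet> C)" using \<open>a \<in> A\<close> by blast
next
  fix x assume "x \<in> A \<bullet> (B \<bullet> C)"
  then obtain a b c where "x = a * (b * c)" "a \<in> A" "b \<in> B" "c \<in> C" by blast
  then have "x = (a * b) * c" "a * b \<in> A \<bullet> B" by (auto simp: mult.assoc)
  then show "x \<in> A \<bullet> B \<bullet> C" using \<open>c \<in> C\<close> by blast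
qed

lemma setmul_commute_of_sg:
  assumes "sg A" "sg B" "sg (A \<bullet> B)"
  shows "A \<bullet> B = B \<bullet> A"
proof (rule setmul_permute[OF assms(1,2)])
  show "B \<bullet> A \<subseteq> A \<bullet> B"
    by (rule setmul_subset[OF assms(3) sg_setmul_right[OF assms(1)] sg_setmul_left[OF assms(2)]])
qed

lemma cj_setmul: "cj g (A \<bullet> B) = cj g A \<bullet> cj g B"
proof (intro subset_antisym subsetI)
  fix x assume "x \<in> cj g (A \<bullet> B)"
  then obtain a b where "x = g * (a * b) * inverse g" "a \<in> A" "b \<in> B" by (auto simp: cj_def)
  moreover have "g * (a * b) * inverse g = (g * a * inverse g) * (g * b * inverse g)" for a b
    by (simp add: mult.assoc)
  ultimately show "x \<in> cj g A \<bullet> cj g B" unfolding cj_def by auto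
next
  fix x assume "x \<in> cj g A \<bullet> cj g B"
  then obtain a b where "x = (g * a * inverse g) * (g * b * inverse g)" "a \<in> A" "b \<in> B"
    by (auto simp: cj_def)
  then have "x = g * (a * b) * inverse g" "a * b \<in> A \<bullet> B" by (auto simp: mult.assoc)
  then show "x \<in> cj g (A \<bullet> B)" unfolding cj_def by auto
qed

text \<open>Dedekind's law:
  \<open>B \<inter> (A \<bullet> U) = (A \<inter> B) \<bullet> U\<close>.\<close>

lemma mutperm_Int_permute:
  assumes "mutperm A B" "sg A" "sg B" "sg U" "U \<subseteq> B"
  shows "sg ((A \<inter> B) \<bullet> U)"
proof -
  have "B \<inter> (A \<bullet> U) = (A \<inter> B) \<bullet> U"
  proof (intro subset_antisym subsetI)
    fix x assume "x \<in> B \<inter> (A \<bullet> U)"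
    then obtain a u where x: "x = a * u" "a \<in> A" "u \<in> U" "a * u \<in> B" by blast
    then have "a \<in> B" using sg_right_iff[OF assms(3), of u a] assms(5) by auto
    then show "x \<in> (A \<inter> B) \<bullet> U" using x by auto
  next
    fix x assume "x \<in> (A \<inter> B) \<bullet> U"
    then obtain a u where "x = a * u" "a \<in> A" "a \<in> B" "u \<in> U" by blast
    then show "x \<in> B \<inter> (A \<bullet> U)" using assms(5) sg_mult[OF assms(3)] by auto
  qed
  then show ?thesis using sg_Int[OF assms(3) mutperm_sg[OF assms(1,2,4,5)]] by simp
qed

lemma cj_Int_permute:
  assumes "mutperm A B" "sg A" "sg B" "sg U" "U \<subseteq> B" "g \<in> B"
  shows "sg (cj g (A \<inter> B) \<bullet> U)"
proof -
  have "cj (inverse g) U \<subseteq> B"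
    using cj_mono[OF assms(5), of "inverse g"] cj_sg_self[OF assms(3)] assms(3,6) by simp
  then have "sg ((A \<inter> B) \<bullet> cj (inverse g) U)"
    using mutperm_Int_permute assms cj_sg by blast
  then have "sg (cj g ((A \<inter> B) \<bullet> cj (inverse g) U))" by (rule cj_sg)
  then show ?thesis by (simp add: cj_setmul cj_cj)
qed

lemma conj_power_commute: "inverse b ^ i * b ^ j * b ^ i = (b ^ j :: 'a::mgroup)"
proof -
  have "inverse b ^ i * b ^ j * b ^ i = inverse (b ^ i) * (b ^ i * b ^ j)"
    by (simp add: mgroup_inverse_power mult.assoc power_add[symmetric] add.commute)
  then show ?thesis by simp
qed

lemma cyc_power_subset: "cyc (b ^ q) \<subseteq> cyc b"
  by (auto simp: cyc_def power_mult[symmetric])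

text \<open>The core of \<open>A \<bullet> cyc (b ^ q)\<close> in \<open>A \<bullet> cyc b\<close> contains \<open>A \<inter> B\<close>, which is
why \<open>cyc a\<close> and \<open>cyc b\<close> permute modulo the core.\<close>

lemma der_subset_core:
  assumes G: "sg G" "finite G" and A: "sg A" "A \<subseteq> G" and B: "sg B" "B \<subseteq> G"
    and mut: "mutperm A B" and b: "b \<in> B" and q: "prime q" and bH': "b \<notin> A \<bullet> cyc (b ^ q)"
  shows "\<exists>C. nsg C (A \<bullet> cyc b) \<and> C \<subseteq> A \<bullet> cyc (b ^ q) \<and> der A \<subseteq> C"
proof -
  define H H' where "H = A \<bullet> cyc b" and "H' = A \<bullet> cyc (b ^ q)"
  have bG: "b \<in> G" "b ^ q \<in> G" "b ^ q \<in> B" using b B G by auto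
  have cb: "sg (cyc b)" "cyc b \<subseteq> B" "sg (cyc (b ^ q))" "cyc (b ^ q) \<subseteq> B"
    using bG G B b by (simp_all add: cyc_sg cyc_subset)
  have sH: "sg H" "sg H'" unfolding H_def H'_def using mutperm_sg[OF mut A(1)] cb by simp_all
  have HH: "H' \<subseteq> H" unfolding H_def H'_def by (rule setmul_mono[OF order_refl cyc_power_subset])
  have HG: "H \<subseteq> G" unfolding H_def using setmul_subset[OF G(1) A(2)] cb B by auto
  have finH: "finite H" using finite_subset[OF HG G(2)] .
  have AH': "A \<subseteq> H'" unfolding H'_def by (rule sg_setmul_left[OF cb(3)])
  have AH: "A \<subseteq> H" using AH' HH by simp
  have cbH: "cyc b \<subseteq> H" unfolding H_def by (rule sg_setmul_right[OF A(1)])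
  have bH: "b \<in> H" using cbH cyc_self by auto
  have cqH': "cyc (b ^ q) \<subseteq> H'" unfolding H'_def by (rule sg_setmul_right[OF A(1)])
  have bqH': "b ^ q \<in> H'" using cqH' cyc_self by auto
  have bnH': "b \<notin> H'" using bH' H'_def by simp
  have Hform: "\<exists>a\<in>A. \<exists>j. h = a * inverse b ^ j" if h: "h \<in> H" for h
  proof -
    obtain a c where ac: "h = a * c" "a \<in> A" "c \<in> cyc b" using h H_def by auto
    then have "inverse c \<in> cyc b" using cb by simp
    then obtain j where "inverse c = b ^ j" by (auto simp: cyc_def)
    then have "c = inverse b ^ j" by (metis mgroup_inverse_inverse mgroup_inverse_power)
    then show ?thesis using ac by auto
  qed
  \<comment> \<open>The core of \<open>H'\<close> in \<open>H\<close>. By \<open>Hform\<close>, and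
    because \<open>A\<close> lies in \<open>H'\<close>, only conjugation by powers of
    \<open>b\<close> has to be tested (\<open>coreI\<close>).\<close>
  define C where "C = {x. \<forall>h\<in>H. h * x * inverse h \<in> H'}"
  have coreI: "x \<in> C" if "\<And>i. inverse b ^ i * x * b ^ i \<in> H'" for x
    unfolding C_def
  proof (intro CollectI ballI)
    fix h assume "h \<in> H"
    then obtain a j where h: "h = a * inverse b ^ j" "a \<in> A" using Hform by blast
    have "a * (inverse b ^ j * x * b ^ j) * inverse a \<in> H'"
      using sg_conj[OF sH(2)] that AH' h(2) by blast
    then show "h * x * inverse h \<in> H'"
      using h by (simp add: mgroup_simps mgroup_inverse_power)
  qed
  have sC: "sg C"
  proof -
    have "C = \<Inter>((\<lambda>h. {x. h * x * inverse h \<in> H'}) ` H)" by (auto simp: C_def)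
    then show ?thesis using sg_vimage_conj[OF sH(2)] by (auto intro: sg_Inter)
  qed
  have CH': "C \<subseteq> H'"
  proof
    fix x assume "x \<in> C"
    then have "1 * x * inverse 1 \<in> H'" using sg_one[OF sH(1)] unfolding C_def by blast
    then show "x \<in> H'" by simp
  qed
  have nC: "nsg C H"
  proof (rule nsgI[OF sC])
    show "C \<subseteq> H" using CH' HH by simp
    fix g x assume gx: "g \<in> H" "x \<in> C"
    have "h * (g * x * inverse g) * inverse h \<in> H'" if "h \<in> H" for h
    proof -
      have "h * g \<in> H" using that gx sH by simp
      then have "(h * g) * x * inverse (h * g) \<in> H'" using gx unfolding C_def by blast
      then show ?thesis by (simp add: mgroup_simps)
    qed
    then show "g * x * inverse g \<in> C" by (simp add: C_def)
  qed
  have bqC: "b ^ q \<in> C" by (rule coreI) (simp add: conj_power_commute bqH')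
  have DC: "A \<inter> B \<subseteq> C"
  proof
    define D D' where "D = A \<inter> B" and "D' = cj (inverse b) D"
    define E where "E = cyc (b ^ q)"
    have sD: "sg D" "sg D'" "sg E" unfolding D_def D'_def E_def using sg_Int A B cj_sg cb by blast+
    have D'B: "D' \<subseteq> B"
      unfolding D'_def using cj_mono[of D B "inverse b"] cj_sg_self[OF B(1)] b B D_def by simp
    have DD': "sg (D \<bullet> D')" unfolding D_def
      by (rule mutperm_Int_permute[OF mut A(1) B(1) sD(2) D'B])
    have DE: "sg (D \<bullet> E)" unfolding D_def E_def
      by (rule mutperm_Int_permute[OF mut A(1) B(1) cb(3,4)])
    have D'E: "sg (D' \<bullet> E)" unfolding D'_def D_def E_def
      by (rule cj_Int_permute[OF mut A(1) B(1) cb(3,4)]) (use b B in simp)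
    \<comment> \<open>A subgroup that contains \<open>b ^ q\<close> but not \<open>b\<close>. If
      \<open>inverse b * d * b = a * b ^ i\<close>, then \<open>a\<close> is in \<open>D\<close> and
      \<open>b ^ i\<close> in \<open>F\<close>, so \<open>q\<close> divides \<open>i\<close>:
      conjugation by \<open>b\<close> moves \<open>D\<close> into
      \<open>D \<bullet> E\<close>.\<close>
    define F where "F = D \<bullet> D' \<bullet> E"
    have "F = E \<bullet> (D \<bullet> D')"
      unfolding F_def
      using setmul_commute_of_sg[OF sD(1,3) DE] setmul_commute_of_sg[OF sD(2,3) D'E]
      by (metis setmul_assoc)
    then have sF: "sg F" unfolding F_def using sg_setmul[OF DD' sD(3)] by simp
    have DF: "D \<subseteq> F" "D' \<subseteq> F" "E \<subseteq> F"
      unfolding F_def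
      using sg_setmul_left[OF sD(3), of "D \<bullet> D'"] sg_setmul_left[OF sD(2), of D]
        sg_setmul_right[OF sD(1), of D'] sg_setmul_right[OF DD', of E] by auto
    have bF: "b \<notin> F"
    proof
      assume "b \<in> F"
      then obtain d y e where dye: "b = d * y * e" "d \<in> D" "y \<in> D'" "e \<in> E"
        unfolding F_def by blast
      moreover obtain d' where "y = inverse b * d' * b" "d' \<in> D"
        using dye(3) unfolding D'_def cj_def by auto
      moreover obtain k where "e = (b ^ q) ^ k" using dye(4) unfolding E_def cyc_def by auto
      ultimately have *: "b = d * (inverse b * d' * b) * (b ^ q) ^ k" "d \<in> D" "d' \<in> D"
        by auto
      have "b * (b ^ q) ^ k = (b ^ q) ^ k * b" by (simp add: power_mult[symmetric] power_commutes)
      then have "1 * b = (d * (inverse b * (d' * (b ^ q) ^ k))) * b"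
        using *(1) by (simp add: mult.assoc)
      then have "1 = d * (inverse b * (d' * (b ^ q) ^ k))" by (simp only: mgroup_right_cancel)
      then have "inverse d = inverse b * (d' * (b ^ q) ^ k)" by (metis mgroup_inverse_eq)
      then have "b * inverse d = d' * (b ^ q) ^ k" by (metis mult_inverse_cancel)
      then have "b = d' * (b ^ q) ^ k * d" by (metis inverse_mult_self mult.assoc mult.right_neutral)
      moreover have "d' \<in> H'" "d \<in> H'" using * AH' by (auto simp: D_def)
      ultimately have "b \<in> H'" using sH(2) bqH' by (metis sg_mult sg_power)
      then show False using bnH' by simp
    qed
    have bqF: "b ^ q \<in> F" using DF(3) cyc_self[of "b ^ q"] by (auto simp: E_def)
    have step: "inverse b * d * b \<in> D \<bullet> E" if d: "d \<in> D" for d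
    proof -
      let ?y = "inverse b * d * b"
      have yD': "?y \<in> D'" using d by (auto simp: D'_def cj_def)
      have "d \<in> H" using d AH by (auto simp: D_def)
      then have "?y \<in> H" using bH sH(1) by simp
      then obtain a i where ai: "?y = a * b ^ i" "a \<in> A" by (auto simp: H_def cyc_def)
      have "a * b ^ i \<in> B" using yD' D'B ai(1) by auto
      then have "a \<in> B" using sg_right_iff[OF B(1), of "b ^ i" a] b B by simp
      then have aD: "a \<in> D" using ai by (simp add: D_def)
      have "a * b ^ i \<in> F" using yD' DF(2) ai(1) by auto
      then have "b ^ i \<in> F" using sg_left_iff[OF sF] aD DF(1) by blast
      then have "q dvd i" using cyc_mod_prime[OF sF q bqF bF] by simp
      then have "b ^ i \<in> E" by (auto simp: E_def power_mult cyc_def)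
      then show ?thesis using ai(1) aD by auto
    qed
    have step': "inverse b * x * b \<in> D \<bullet> E" if x: "x \<in> D \<bullet> E" for x
    proof -
      obtain d k where dk: "x = d * (b ^ q) ^ k" "d \<in> D" using x by (auto simp: E_def cyc_def)
      have "(b ^ q) ^ k * b = b * (b ^ q) ^ k" by (simp add: power_mult[symmetric] power_commutes)
      then have "inverse b * x * b = (inverse b * d * b) * (b ^ q) ^ k"
        using dk by (simp add: mult.assoc)
      moreover have "(b ^ q) ^ k \<in> D \<bullet> E" using sg_setmul_right[OF sD(1), of E] by (auto simp: E_def cyc_def)
      ultimately show ?thesis using step[OF dk(2)] DE by simp
    qed
    fix d assume "d \<in> A \<inter> B"
    then have d: "d \<in> D \<bullet> E" using sg_setmul_left[OF sD(3), of D] by (auto simp: D_def)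
    have DEH': "D \<bullet> E \<subseteq> H'" unfolding H'_def E_def D_def by (rule setmul_mono) auto
    show "d \<in> C"
    proof (rule coreI)
      fix i
      have "inverse b ^ i * d * b ^ i \<in> D \<bullet> E"
      proof (induction i)
        case (Suc i)
        then have "inverse b * (inverse b ^ i * d * b ^ i) * b \<in> D \<bullet> E" by (rule step')
        then show ?case by (simp add: mult.assoc power_commutes)
      qed (use d in simp)
      then show "inverse b ^ i * d * b ^ i \<in> H'" using DEH' by auto
    qed
  qed
  have norm: "a * b * inverse a \<in> C \<bullet> cyc b" if a: "a \<in> A" for a
  proof -
    \<comment> \<open>Taking one \<open>cyc a\<close> at a time makes \<open>V\<close> abelian
      modulo \<open>C\<close>, as \<open>abelian_normalizes_prime_cyc\<close> demands, although
      \<open>A\<close> may be nonabelian.\<close>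
    define V where "V = C \<bullet> cyc a"
    have ca: "sg (cyc a)" "cyc a \<subseteq> A" using a A G by (auto simp: cyc_sg cyc_subset)
    have caH: "cyc a \<subseteq> H" using ca AH by simp
    have sV: "sg V" unfolding V_def by (rule sg_setmul_nsg[OF nC ca(1) caH sH(1)])
    have CV: "C \<subseteq> V" unfolding V_def by (rule sg_setmul_left[OF ca(1)])
    have VH': "V \<subseteq> H'" unfolding V_def by (rule setmul_subset[OF sH(2) CH']) (use ca AH' in simp)
    have VH: "V \<subseteq> H" using VH' HH by simp
    have aV: "a \<in> V" unfolding V_def using sg_setmul_right[OF sC] cyc_self by blast
    have comm: "cmt x y \<in> C" if xy: "x \<in> V" "y \<in> V" for x y
    proof -
      let ?T1 = "{x \<in> H. \<forall>z\<in>cyc a. cmt x z \<in> C}"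
      let ?T2 = "{x \<in> H. \<forall>z\<in>V. cmt x z \<in> C}"
      have T1: "sg ?T1" by (rule cmt_centralizer_sg[OF nC sH(1) caH])
      have T2: "sg ?T2" by (rule cmt_centralizer_sg[OF nC sH(1) VH])
      have C1: "C \<subseteq> ?T1" using cmt_nsg_left(1)[OF nC] caH CV VH by blast
      have C2: "C \<subseteq> ?T2" using cmt_nsg_left(1)[OF nC] CV VH by blast
      have "cmt (a ^ i) (a ^ j) \<in> C" for i j
        using cmt_eq_1[of "a ^ i" "a ^ j"] sC by (simp add: power_add[symmetric] add.commute)
      then have "cyc a \<subseteq> ?T1" using caH by (auto simp: cyc_def)
      then have VT1: "V \<subseteq> ?T1" unfolding V_def by (rule setmul_subset[OF T1 C1])
      have "cmt c z \<in> C" if "c \<in> cyc a" "z \<in> V" for c z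
      proof -
        have "cmt z c \<in> C" using VT1 that by blast
        then show ?thesis using sg_inverse[OF sC] inverse_cmt by metis
      qed
      then have "cyc a \<subseteq> ?T2" using caH by blast
      then have "V \<subseteq> ?T2" using C2 setmul_subset[OF T2] V_def by blast
      then show ?thesis using xy by blast
    qed
    have sP: "sg (V \<bullet> cyc b)"
    proof -
      \<comment> \<open>\<open>B \<bullet> cyc a\<close> is a subgroup by mutual permutability. For
        an element of \<open>E\<close> the part from \<open>B\<close> splits as \<open>y * z\<close>
        with \<open>y\<close> in \<open>A \<inter> B\<close>, which \<open>C\<close> absorbs; so
        \<open>C \<bullet> E\<close> is exactly \<open>V \<bullet> cyc b\<close>.\<close>
      define E where "E = (B \<bullet> cyc a) \<inter> H"
      have sBa: "sg (B \<bullet> cyc a)" by (rule mutperm_sg[OF mutperm_sym[OF mut] B(1) ca])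
      have sE: "sg E" unfolding E_def by (rule sg_Int[OF sBa sH(1)])
      have "cyc a \<bullet> cyc b \<subseteq> E"
      proof (rule setmul_subset[OF sE])
        show "cyc a \<subseteq> E" using sg_setmul_right[OF B(1), of "cyc a"] caH E_def by simp
        show "cyc b \<subseteq> E" using sg_setmul_left[OF ca(1), of B] cb(2) cbH E_def by auto
      qed
      then have 1: "V \<bullet> cyc b \<subseteq> C \<bullet> E"
        unfolding V_def setmul_assoc by (rule setmul_mono[OF order_refl])
      have 2: "C \<bullet> E \<subseteq> V \<bullet> cyc b"
      proof
        fix x assume "x \<in> C \<bullet> E"
        then obtain c e where ce: "x = c * e" "c \<in> C" "e \<in> E" by blast
        have "B \<bullet> cyc a = cyc a \<bullet> B" using mut ca unfolding mutperm_def by blast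
        then obtain \<alpha> \<beta> where ab: "e = \<alpha> * \<beta>" "\<alpha> \<in> cyc a" "\<beta> \<in> B"
          using ce E_def by blast
        have "\<alpha> * \<beta> \<in> H" using ce ab E_def by blast
        then have "\<beta> \<in> H" using sg_left_iff[OF sH(1)] ab caH by blast
        then obtain y z where yz: "\<beta> = y * z" "y \<in> A" "z \<in> cyc b" unfolding H_def by blast
        have "y * z \<in> B" using yz ab by simp
        then have "y \<in> B" using sg_right_iff[OF B(1)] yz cb by blast
        then have "y \<in> C" using yz DC by blast
        then have "\<alpha> * y * inverse \<alpha> \<in> C" using nsg_conj[OF nC] ab caH by blast
        then have "c * (\<alpha> * y * inverse \<alpha>) * \<alpha> \<in> V"
          unfolding V_def using ce ab sC by (intro setmulI) simp_all
        then have "c * (\<alpha> * y * inverse \<alpha>) * \<alpha> * z \<in> V \<bullet> cyc b" using yz by blast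
        then show "x \<in> V \<bullet> cyc b" using ce ab yz by (simp add: mult.assoc)
      qed
      have "sg (C \<bullet> E)" by (rule sg_setmul_nsg[OF nC sE _ sH(1)]) (simp add: E_def)
      then show ?thesis using 1 2 by (metis subset_antisym)
    qed
    show ?thesis
    proof (rule abelian_normalizes_prime_cyc[OF sH(1) finH nC sV CV VH bH _ q bqC comm sP _ aV])
      show "b \<notin> V" using VH' bnH' by blast
      show "x \<in> C" if "\<And>i. inverse b ^ i * x * b ^ i \<in> V" for x
        using coreI that VH' by blast
    qed
  qed
  \<comment> \<open>Modulo \<open>C\<close>, elements of \<open>A\<close> act on
    \<open>cyc b\<close> by power maps, and these commute. A commutator therefore centralizes
    \<open>b\<close> modulo \<open>C\<close> and passes the core test.\<close>
  have "cmt x y \<in> C" if xy: "x \<in> A" "y \<in> A" for x y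
  proof -
    \<comment> \<open>Inverses, so that \<open>inverse ?r * ?p\<close> below is
      \<open>cmt x y\<close>.\<close>
    let ?a = "inverse x" and ?b = "inverse y"
    have aA: "?a \<in> A" "?b \<in> A" using xy A by simp_all
    have aH: "?a \<in> H" "?b \<in> H" using aA AH by auto
    obtain c k where "?a * b * inverse ?a = c * b ^ k" "c \<in> C"
      using norm[OF aA(1)] by (auto simp: cyc_def)
    then have k: "eqm C (?a * b * inverse ?a) (b ^ k)" by (simp add: eqm_def mult.assoc)
    obtain c' l where "?b * b * inverse ?b = c' * b ^ l" "c' \<in> C"
      using norm[OF aA(2)] by (auto simp: cyc_def)
    then have l: "eqm C (?b * b * inverse ?b) (b ^ l)" by (simp add: eqm_def mult.assoc)
    let ?p = "?a * ?b" and ?r = "?b * ?a"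
    have two: "eqm C ((g * h) * b * inverse (g * h)) (b ^ (i * j))"
      if "g \<in> H" "h \<in> H" "eqm C (g * b * inverse g) (b ^ i)" "eqm C (h * b * inverse h) (b ^ j)" for g h i j
    proof -
      have "eqm C (g * (h * b * inverse h) * inverse g) (g * b ^ j * inverse g)"
        using eqm_conj[OF nC that(1,4)] .
      moreover have "eqm C (g * b ^ j * inverse g) ((b ^ i) ^ j)"
        unfolding mgroup_conj_power
        by (rule eqm_power[OF nC sH(1) _ that(3)]) (use that bH sH in simp)
      ultimately have "eqm C (g * (h * b * inverse h) * inverse g) ((b ^ i) ^ j)"
        using eqm_trans[OF sC] by blast
      then show ?thesis by (simp add: mgroup_simps power_mult)
    qed
    have "eqm C (?p * b * inverse ?p) (?r * b * inverse ?r)"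
      using two[OF aH k l] two[OF aH(2,1) l k] eqm_sym[OF sC] eqm_trans[OF sC]
      by (metis mult.commute)
    moreover have rH: "inverse ?r \<in> H" using aH sH by simp
    ultimately have "eqm C (inverse ?r * (?p * b * inverse ?p) * inverse (inverse ?r))
        (inverse ?r * (?r * b * inverse ?r) * inverse (inverse ?r))"
      using eqm_conj[OF nC] by blast
    moreover define w where "w = cmt x y"
    ultimately have "eqm C (w * b * inverse w) b" by (simp add: cmt_def mgroup_simps)
    then have wb: "cmt w b \<in> C" by (simp add: cmt_mem_iff')
    have wH': "w \<in> H'" using xy A AH' by (auto simp: w_def cmt_def)
    have "w \<in> C"
    proof (rule coreI)
      fix i
      let ?T = "{z \<in> H. \<forall>s\<in>{w}. cmt z s \<in> C}"
      have T: "sg ?T" by (rule cmt_centralizer_sg[OF nC sH(1)]) (use wH' HH in blast)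
      have "cmt b w \<in> C" using sg_inverse[OF sC wb] by (simp add: inverse_cmt)
      then have "b \<in> ?T" using bH by simp
      then have "inverse b ^ i \<in> ?T" by (intro sg_power[OF T] sg_inverse[OF T])
      then have "cmt (inverse b ^ i) w * w \<in> H'" using CH' sg_mult[OF sH(2) _ wH'] by blast
      then show "inverse b ^ i * w * b ^ i \<in> H'"
        by (simp add: cmt_def mult.assoc mgroup_inverse_power)
    qed
    then show ?thesis by (simp add: w_def)
  qed
  then have "der A \<subseteq> C" by (rule der_least[OF sC])
  then show ?thesis using nC CH' H_def H'_def by blast
qed

text \<open>Induction on an exponent \<open>n\<close> of \<open>b\<close>. For a prime
  \<open>q\<close> dividing \<open>n\<close> the claim holds for \<open>b ^ q\<close>; the subgroup
  from \<open>der_subset_core\<close>, normal in \<open>A \<bullet> cyc b\<close> and contained in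
  \<open>A \<bullet> cyc (b ^ q)\<close>, carries it over to \<open>b\<close>.\<close>

lemma sn_der_cyc:
  assumes "sg G" "finite G" "sg A" "A \<subseteq> G" "sg B" "B \<subseteq> G" "mutperm A B"
    and "b \<in> B" "n > 0" "b ^ n = 1"
  shows "sn (der A) (A \<bullet> cyc b)"
  using assms(8-)
proof (induction n arbitrary: b rule: less_induct)
  case (less n)
  show ?case
  proof (cases "n = 1")
    case True
    then have "b = 1" using less by simp
    then have "A \<bullet> cyc b = A" by (auto simp: setmul_def cyc_def)
    then show ?thesis using der_nsg[OF nsg_self assms(3)] assms(3) by auto
  next
    case False
    then obtain q where q: "prime q" "q dvd n" using prime_factor_nat by blast
    then obtain m where m: "n = q * m" by (elim dvdE)
    have q1: "q > 1" using q prime_gt_1_nat by blast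
    have "m > 0" "m < n" using m less(3) q1 by (auto intro: Nat.gr0I)
    moreover have "(b ^ q) ^ m = 1" using less(4) m by (simp add: power_mult)
    moreover have "b ^ q \<in> B" using assms(5) less(2) by simp
    ultimately have IH: "sn (der A) (A \<bullet> cyc (b ^ q))" using less(1) by blast
    have cb: "sg (cyc (b ^ q))" "cyc (b ^ q) \<subseteq> B"
      using assms(1,2,5,6) \<open>b ^ q \<in> B\<close> by (auto simp: cyc_sg cyc_subset)
    have sH': "sg (A \<bullet> cyc (b ^ q))" by (rule mutperm_sg[OF assms(7,3) cb])
    show ?thesis
    proof (cases "b \<in> A \<bullet> cyc (b ^ q)")
      case True
      then have "cyc b \<subseteq> A \<bullet> cyc (b ^ q)" by (rule cyc_subset[OF sH'])
      then have "A \<bullet> cyc b \<subseteq> A \<bullet> cyc (b ^ q)"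
        by (rule setmul_subset[OF sH' sg_setmul_left[OF cb(1)]])
      moreover have "A \<bullet> cyc (b ^ q) \<subseteq> A \<bullet> cyc b"
        by (rule setmul_mono[OF order_refl cyc_power_subset])
      ultimately show ?thesis using IH by simp
    next
      case False
      obtain C where C: "nsg C (A \<bullet> cyc b)" "C \<subseteq> A \<bullet> cyc (b ^ q)" "der A \<subseteq> C"
        using der_subset_core[OF assms(1-7) less(2) q(1) False] by blast
      have "sn (der A) C" by (rule sn_restrict[OF IH nsg_sg[OF C(1)] C(3,2) sH'])
      then show ?thesis using C(1) by (rule rtranclp.rtrancl_into_rtrancl)
    qed
  qed
qed

lemma cj_nsg_self:
  assumes "nsg N G" "sg G" "g \<in> G"
  shows "cj g N = N"
proof (intro subset_antisym subsetI)
  show "x \<in> N" if "x \<in> cj g N" for x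
    using that nsg_conj[OF assms(1,3)] by (auto simp: cj_def)
  show "x \<in> cj g N" if "x \<in> N" for x
    using nsg_conj'[OF assms that] by (simp add: mem_cj)
qed

text \<open>Write \<open>g = b * a\<close>. As \<open>a\<close> normalizes \<open>der A\<close>,
  both \<open>der A\<close> and its conjugate by \<open>g\<close> lie in
  \<open>A \<bullet> cyc b\<close>, where \<open>sn_der_cyc\<close> gives the local condition of
  Wielandt's criterion.\<close>

theorem der_factor_subnormal:
  assumes "sg G" "finite G" "sg A" "sg B" "G = A \<bullet> B" "mutperm A B"
  shows "sn (der A) G"
proof -
  have AG: "A \<subseteq> G" "B \<subseteq> G" using assms(5) sg_setmul_left[OF assms(4), of A] sg_setmul_right[OF assms(3), of B] by auto
  have GBA: "G = B \<bullet> A" using assms setmul_commute_of_sg by metis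
  have dA: "der A \<subseteq> A" "nsg (der A) A"
    using der_subset[OF assms(3)] der_nsg[OF nsg_self[OF assms(3)] assms(3)] by auto
  show ?thesis
  proof (rule wielandt_subnormal[OF assms(1,2) der_sg])
    show "der A \<subseteq> G" using dA AG by simp
    fix g assume "g \<in> G"
    then obtain b a where ba: "g = b * a" "b \<in> B" "a \<in> A" using GBA by auto
    have "cj g (der A) = cj b (der A)"
      using ba cj_nsg_self[OF dA(2) assms(3)] by (simp add: cj_cj[symmetric])
    obtain n where n: "n > 0" "b ^ n = 1" using finite_order[OF assms(1,2)] ba AG by blast
    have cb: "sg (cyc b)" "cyc b \<subseteq> B" using ba assms AG by (auto simp: cyc_sg cyc_subset)
    let ?H = "A \<bullet> cyc b"
    have sH: "sg ?H" by (rule mutperm_sg[OF assms(6,3) cb])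
    have sub: "der A \<subseteq> ?H" using sg_setmul_left[OF cb(1), of A] dA by simp
    have "b \<in> ?H" using sg_setmul_right[OF assms(3), of "cyc b"] cyc_self[of b] by auto
    then have "cj g (der A) \<subseteq> ?H"
      using \<open>cj g (der A) = cj b (der A)\<close> cj_mono[OF sub, of b] cj_sg_self[OF sH] by simp
    then have "gen (der A \<union> cj g (der A)) \<subseteq> ?H" using gen_least[OF sH] sub by simp
    moreover have "der A \<subseteq> gen (der A \<union> cj g (der A))"
      using gen_superset[of "der A \<union> cj g (der A)"] by auto
    ultimately show "sn (der A) (gen (der A \<union> cj g (der A)))"
      using sn_restrict[OF sn_der_cyc[OF assms(1-3) AG(1) assms(4) AG(2) assms(6) ba(2) n] gen_sg _ _ sH]
      by simp
  qed
qed

section \<open>Minimal normal subgroups and their traces in the factors\<close>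

definition minn :: "'a::mgroup set \<Rightarrow> 'a set \<Rightarrow> bool" where
  "minn N G \<longleftrightarrow> nsg N G \<and> N \<noteq> {1} \<and> (\<forall>M. nsg M G \<and> M \<subseteq> N \<longrightarrow> M = {1} \<or> M = N)"

lemma minn_nsg: "minn N G \<Longrightarrow> nsg N G"
  and minn_nontrivial: "minn N G \<Longrightarrow> N \<noteq> {1}"
  and minn_cases: "minn N G \<Longrightarrow> nsg M G \<Longrightarrow> M \<subseteq> N \<Longrightarrow> M = {1} \<or> M = N"
  by (auto simp: minn_def)

lemma ex_minn:
  assumes "finite G" "nsg K G" "K \<noteq> {1}"
  obtains N where "minn N G" "N \<subseteq> K"
proof -
  let ?A = "{N. nsg N G \<and> N \<noteq> {1} \<and> N \<subseteq> K}"
  have "?A \<subseteq> Pow G" using nsg_subset by auto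
  then have fin: "finite ?A" using assms(1) finite_subset finite_Pow_iff by metis
  have "K \<in> ?A" using assms by simp
  from finite_has_minimal2[OF fin this]
  obtain N where N: "N \<in> ?A" "\<And>L. L \<in> ?A \<Longrightarrow> L \<subseteq> N \<Longrightarrow> N = L" by auto
  have "minn N G"
    unfolding minn_def
  proof (intro conjI allI impI)
    fix M assume "nsg M G \<and> M \<subseteq> N"
    then show "M = {1} \<or> M = N" using N(2)[of M] N(1) by auto
  qed (use N in auto)
  then show ?thesis using that N by auto
qed

lemma sg_nontrivial: "sg H \<Longrightarrow> H \<noteq> {1} \<Longrightarrow> \<exists>x\<in>H. x \<noteq> 1"
  using sg_one by blast

lemma cj_minn:
  assumes "minn L M"
  shows "minn (cj g L) (cj g M)"
  unfolding minn_def
proof (intro conjI allI impI)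
  show "nsg (cj g L) (cj g M)" using cj_nsg minn_nsg assms by blast
  have one: "cj h {1} = {1::'a}" for h by (auto simp: cj_def)
  show "cj g L \<noteq> {1}"
  proof
    assume "cj g L = {1}"
    then have "cj (inverse g) (cj g L) = {1}" by (simp add: one)
    then show False using minn_nontrivial[OF assms] by (simp add: cj_cj)
  qed
  fix K assume K: "nsg K (cj g M) \<and> K \<subseteq> cj g L"
  have "nsg (cj (inverse g) K) (cj (inverse g) (cj g M))" using cj_nsg K by blast
  moreover have "cj (inverse g) K \<subseteq> cj (inverse g) (cj g L)" using cj_mono K by blast
  ultimately have "cj (inverse g) K = {1} \<or> cj (inverse g) K = L"
    using minn_cases[OF assms] by (simp add: cj_cj)
  then have "cj g (cj (inverse g) K) = cj g {1} \<or> cj g (cj (inverse g) K) = cj g L" by auto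
  then show "K = {1} \<or> K = cj g L" by (simp add: cj_cj one)
qed

text \<open>Conjugation by \<open>G\<close> permutes the minimal normal subgroups of
  \<open>M\<close> inside \<open>N\<close>, so what they generate is normal in \<open>G\<close>;
  minimality of \<open>N\<close> does the rest.\<close>

lemma minn_generated:
  assumes G: "sg G" "finite G" and M: "nsg M G" and N: "minn N G" "N \<subseteq> M"
  shows "N = gen (\<Union>{L. minn L M \<and> L \<subseteq> N})"
proof -
  let ?R = "\<Union>{L. minn L M \<and> L \<subseteq> N}"
  have sN: "sg N" "N \<subseteq> G" "nsg N G" using N minn_nsg nsg_sg nsg_subset by blast+
  have sM: "sg M" "finite M" using M nsg_sg nsg_subset G finite_subset by metis+
  have RN: "?R \<subseteq> N" by auto
  have "nsg (gen ?R) G"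
  proof (rule gen_nsg[OF G(1)])
    show "?R \<subseteq> G" using RN sN by simp
    fix g s assume g: "g \<in> G" and "s \<in> ?R"
    then obtain L where L: "minn L M" "L \<subseteq> N" "s \<in> L" by auto
    have "minn (cj g L) M"
      using cj_minn[OF L(1), of g] cj_nsg_self[OF M G(1) g] by simp
    moreover have "cj g L \<subseteq> N"
      using cj_mono[OF L(2), of g] cj_nsg_self[OF sN(3) G(1) g] by simp
    moreover have "g * s * inverse g \<in> cj g L" using L(3) by (auto simp: cj_def)
    ultimately have "g * s * inverse g \<in> ?R" by auto
    then show "g * s * inverse g \<in> gen ?R" by (rule subsetD[OF gen_superset])
  qed
  moreover have "gen ?R \<subseteq> N" by (rule gen_least[OF sN(1) RN])
  moreover have "gen ?R \<noteq> {1}"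
  proof -
    have "nsg N M" by (rule nsg_mono[OF sN(3) N(2) nsg_subset[OF M]])
    then obtain L where L: "minn L M" "L \<subseteq> N" using ex_minn[OF sM(2)] minn_nontrivial[OF N(1)] by metis
    then have "L \<subseteq> ?R" by auto
    then have "L \<subseteq> gen ?R" using gen_superset by (rule subset_trans)
    moreover obtain x where "x \<in> L" "x \<noteq> 1"
      using sg_nontrivial[of L] minn_nontrivial[OF L(1)] nsg_sg[OF minn_nsg[OF L(1)]] by blast
    ultimately show ?thesis by auto
  qed
  ultimately show ?thesis using minn_cases[OF N(1)] by metis
qed

lemma nsg_disjoint_commute:
  assumes "nsg N G" "nsg M G" "N \<inter> M = {1}" "n \<in> N" "m \<in> M"
  shows "n * m = m * n"
proof -
  have nm: "n \<in> G" "m \<in> G" "sg N" "sg M" using assms nsg_subset nsg_sg by blast+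
  have "n * (m * inverse n * inverse m) \<in> N"
    using nsg_conj[OF assms(1) nm(2), of "inverse n"] assms(4) nm by (simp add: mult.assoc)
  moreover have "(n * m * inverse n) * inverse m \<in> M"
    using nsg_conj[OF assms(2) nm(1) assms(5)] assms(5) nm by simp
  ultimately have "cmt n m \<in> N \<inter> M" by (simp add: cmt_def mult.assoc)
  then have "cmt n m = 1" using assms(3) by simp
  then show ?thesis by (simp add: cmt_eq_1)
qed

text \<open>A minimal normal subgroup is controlled by the minimal normal subgroups, inside it, of any
subnormal subgroup: with \<open>Z\<close> the normalizer of \<open>S\<close> this gives Wielandt's theorem that
minimal normal subgroups normalize subnormal ones.\<close>

lemma minn_subset_via_subnormal:
  assumes G: "sg G" "finite G" and S: "sn S G" and N: "minn N G" and Z: "sg Z" "cent G S \<subseteq> Z"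
    and base: "\<And>L. minn L S \<Longrightarrow> L \<subseteq> N \<Longrightarrow> L \<subseteq> Z"
  shows "N \<subseteq> Z"
proof -
  have sS: "sg S" using sn_sg S G by blast
  \<comment> \<open>Induction up the subnormal chain. A minimal normal \<open>L\<close> of the next
    term inside \<open>N\<close> either meets \<open>Y\<close> trivially, and then centralizes
    \<open>S\<close>, or lies in \<open>Y\<close> and is generated by minimal normal subgroups of
    \<open>Y\<close>.\<close>
  have "S \<subseteq> Y \<and> sg Y \<and> (Y \<subseteq> G \<longrightarrow> (\<forall>L. minn L Y \<and> L \<subseteq> N \<longrightarrow> L \<subseteq> Z))" if "sn S Y" "sg G" "Y \<subseteq> G" "sg Y" for Y
    using that
  proof (induction rule: rtranclp_induct)
    case base
    then show ?case using assms(7) sS by auto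
  next
    case (step Y Y')
    have Y: "Y \<subseteq> Y'" "sg Y" using step(2) nsg_subset nsg_sg by auto
    then have IH: "S \<subseteq> Y" "\<And>L. minn L Y \<Longrightarrow> L \<subseteq> N \<Longrightarrow> L \<subseteq> Z" using step by auto
    have "L \<subseteq> Z" if L: "minn L Y'" "L \<subseteq> N" for L
    proof -
      have nL: "nsg L Y'" using L minn_nsg by blast
      have "L \<inter> Y = {1} \<or> L \<inter> Y = L"
        using minn_cases[OF L(1) nsg_Int[OF nL step(2)]] by auto
      then show ?thesis
      proof
        assume dis: "L \<inter> Y = {1}"
        have "L \<subseteq> cent G S"
        proof
          fix x assume x: "x \<in> L"
          then have "x \<in> G" using nsg_subset[OF nL] step(5) by auto
          moreover have "x * s = s * x" if "s \<in> S" for s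
            using nsg_disjoint_commute[OF nL step(2) dis x] that IH(1) by auto
          ultimately show "x \<in> cent G S" by (simp add: cent_def)
        qed
        then show ?thesis using Z by simp
      next
        assume "L \<inter> Y = L"
        then have LY: "L \<subseteq> Y" by auto
        have fin: "finite Y'" using step(5) G finite_subset by auto
        have "L = gen (\<Union>{K. minn K Y \<and> K \<subseteq> L})"
          by (rule minn_generated[OF step(6) fin step(2) L(1) LY])
        moreover have "\<Union>{K. minn K Y \<and> K \<subseteq> L} \<subseteq> Z" using IH(2) L(2) by blast
        ultimately show ?thesis using gen_least[OF Z(1)] by metis
      qed
    qed
    then show ?case using IH(1) Y(1) step(6) by auto
  qed
  then show ?thesis using S G N by blast
qed

lemma nsg_of_factors:
  assumes "sg N" "N \<subseteq> A \<bullet> B" "\<And>a n. a \<in> A \<Longrightarrow> n \<in> N \<Longrightarrow> a * n * inverse a \<in> N"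
    and "\<And>b n. b \<in> B \<Longrightarrow> n \<in> N \<Longrightarrow> b * n * inverse b \<in> N"
  shows "nsg N (A \<bullet> B)"
proof (rule nsgI[OF assms(1,2)])
  fix g n assume "g \<in> A \<bullet> B" "n \<in> N"
  then obtain a b where "g = a * b" "a \<in> A" "b \<in> B" by blast
  then show "g * n * inverse g \<in> N"
    using assms(3)[of a "b * n * inverse b"] assms(4)[of b n] \<open>n \<in> N\<close> by (simp add: mgroup_simps)
qed

locale mutperm_product =
  fixes G A B :: "'a::mgroup set"
  assumes G: "sg G" "finite G" and A: "sg A" and B: "sg B" and GAB: "G = A \<bullet> B" and mut: "mutperm A B"
begin

lemma swap: "mutperm_product G B A"
  using G A B GAB mut setmul_commute_of_sg[OF A B] by unfold_locales (auto intro: mutperm_sym)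

lemma AG: "A \<subseteq> G" and BG: "B \<subseteq> G"
  using GAB sg_setmul_left[OF B, of A] sg_setmul_right[OF A, of B] by auto

text \<open>The product equals \<open>N \<inter> (A \<bullet> (N \<inter> B))\<close>. Here
  \<open>A \<bullet> (N \<inter> B)\<close> is a subgroup containing \<open>A\<close>, so
  \<open>A\<close> normalizes the intersection; by symmetry so does \<open>B\<close>.\<close>

lemma Int_product_normal:
  assumes N: "nsg N G"
  shows "nsg ((N \<inter> A) \<bullet> (N \<inter> B)) G"
proof -
  have sN: "sg N" using N nsg_sg by blast
  have NA: "sg (N \<inter> A)" "sg (N \<inter> B)" using sg_Int sN A B by auto
  let ?L = "(N \<inter> A) \<bullet> (N \<inter> B)"
  have eq: "(N \<inter> A') \<bullet> (N \<inter> B') = N \<inter> (A' \<bullet> (N \<inter> B'))" for A' B'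
  proof (intro subset_antisym subsetI)
    fix x assume "x \<in> (N \<inter> A') \<bullet> (N \<inter> B')"
    then show "x \<in> N \<inter> (A' \<bullet> (N \<inter> B'))" using sN by auto
  next
    fix x assume "x \<in> N \<inter> (A' \<bullet> (N \<inter> B'))"
    then obtain a b where "x = a * b" "a \<in> A'" "b \<in> N" "b \<in> B'" "a * b \<in> N" by auto
    then show "x \<in> (N \<inter> A') \<bullet> (N \<inter> B')" using sg_right_iff[OF sN, of b a] by auto
  qed
  have sAB: "sg (A \<bullet> (N \<inter> B))" "sg (B \<bullet> (N \<inter> A))"
    using mutperm_sg[OF mut A NA(2)] mutperm_sg[OF mutperm_sym[OF mut] B NA(1)] by auto
  have sL: "sg ?L" using eq[of A B] sg_Int[OF sN sAB(1)] by simp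
  have LL: "?L = (N \<inter> B) \<bullet> (N \<inter> A)" by (rule setmul_commute_of_sg[OF NA sL])
  have LB: "?L = N \<inter> (B \<bullet> (N \<inter> A))" unfolding LL by (rule eq)
  show ?thesis
    unfolding GAB
  proof (rule nsg_of_factors[OF sL])
    show "?L \<subseteq> A \<bullet> B" by (rule setmul_mono) auto
    show "a * n * inverse a \<in> ?L" if "a \<in> A" "n \<in> ?L" for a n
    proof -
      have "a \<in> A \<bullet> (N \<inter> B)" using sg_setmul_left[OF NA(2), of A] that by auto
      then show ?thesis
        using that(2) AG that(1) nsg_conj[OF N] sAB(1) unfolding eq by auto
    qed
    show "b * n * inverse b \<in> ?L" if "b \<in> B" "n \<in> ?L" for b n
    proof -
      have "b \<in> B \<bullet> (N \<inter> A)" using sg_setmul_left[OF NA(1), of B] that by auto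
      then show ?thesis
        using that(2) BG that(1) nsg_conj[OF N] sAB(2) unfolding LB by auto
    qed
  qed
qed

end

text \<open>An element \<open>\<beta> * x ^ i\<close> of \<open>N\<close> is congruent to
  \<open>\<beta> * b ^ i\<close>, which then lies in the trivial group \<open>N \<inter> B\<close>;
  so \<open>\<beta>\<close> is the inverse of \<open>b ^ i\<close>.\<close>

lemma Int_mul_cyc:
  assumes G: "sg G" "nsg N G" and B: "sg B" "N \<inter> B = {1}" and b: "b \<in> B" and BG: "B \<subseteq> G"
    and x: "x \<in> G" "eqm N x b"
  shows "N \<inter> (B \<bullet> cyc x) = range (\<lambda>i::nat. inverse b ^ i * x ^ i)"
proof (intro subset_antisym subsetI)
  have N: "sg N" using G nsg_sg by blast
  have pw: "eqm N (x ^ i) (b ^ i)" for i by (rule eqm_power[OF G(2,1) x])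
  fix y assume y: "y \<in> N \<inter> (B \<bullet> cyc x)"
  then obtain \<beta> i where bi: "y = \<beta> * x ^ i" "\<beta> \<in> B" by (auto simp: cyc_def)
  have "eqm N (\<beta> * x ^ i) (\<beta> * b ^ i)"
    by (rule eqm_mult[OF G(2) _ eqm_refl[OF N] pw]) (use bi BG in auto)
  then have "\<beta> * b ^ i \<in> N" using eqm_mem[OF N order_refl] y bi by auto
  moreover have "\<beta> * b ^ i \<in> B" using bi b B by simp
  ultimately have "\<beta> * b ^ i = 1" using B(2) by auto
  then have "\<beta> = inverse b ^ i" by (metis mgroup_inverse_eq mgroup_inverse_inverse mgroup_inverse_power)
  then show "y \<in> range (\<lambda>i. inverse b ^ i * x ^ i)" using bi by simp
next
  have N: "sg N" using G nsg_sg by blast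
  fix y assume "y \<in> range (\<lambda>i::nat. inverse b ^ i * x ^ i)"
  then obtain i where y: "y = inverse (b ^ i) * x ^ i" by (auto simp: mgroup_inverse_power)
  have "x ^ i * inverse (b ^ i) \<in> N" using eqm_power[OF G(2,1) x, of i] by (simp add: eqm_def)
  moreover have "b ^ i \<in> G" using b BG G by auto
  ultimately have "inverse (b ^ i) * (x ^ i * inverse (b ^ i)) * b ^ i \<in> N"
    using nsg_conj'[OF G(2,1)] by blast
  then have "y \<in> N" using y by (simp add: mult.assoc)
  moreover have "y \<in> B \<bullet> cyc x" using y b B(1) by (auto simp: cyc_def)
  ultimately show "y \<in> N \<inter> (B \<bullet> cyc x)" by simp
qed

text \<open>With \<open>m\<close> the least positive exponent for which \<open>a ^ m\<close> is in
  \<open>B\<close>, let \<open>p\<close> be a prime divisor of \<open>m\<close> and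
  \<open>m = p * j\<close>.\<close>

lemma ex_prime_power_into:
  assumes G: "sg G" "finite G" and B: "sg B" and a: "a \<in> G" "a \<notin> B"
  obtains j p where "prime p" "a ^ j \<notin> B" "(a ^ j) ^ p \<in> B"
proof -
  obtain n where n: "n > 0" "a ^ n = 1" using finite_order G a by blast
  let ?P = "\<lambda>m. m > 0 \<and> a ^ m \<in> B"
  define m where "m = (LEAST m. ?P m)"
  have "?P n" using n B by simp
  then have m: "?P m" unfolding m_def by (rule LeastI)
  have least: "\<not> ?P k" if "k < m" for k using not_less_Least that unfolding m_def by blast
  have "m \<noteq> 1" using m a by auto
  then obtain p where p: "prime p" "p dvd m" using prime_factor_nat by blast
  then obtain j where j: "m = p * j" by (elim dvdE)
  have "j > 0" "j < m" using j m p prime_gt_1_nat[OF p(1)] by (auto intro: Nat.gr0I)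
  then have "a ^ j \<notin> B" using least by blast
  moreover have "(a ^ j) ^ p \<in> B" using m j by (simp add: power_mult[symmetric] mult.commute)
  ultimately show ?thesis using that p by blast
qed

context mutperm_product
begin

text \<open>Writing \<open>x \<in> A\<close> as \<open>b\<close> modulo \<open>N\<close>, both \<open>N \<inter> (B \<bullet> cyc x)\<close> and
\<open>N \<inter> (A \<bullet> cyc b)\<close> consist of the quotients of corresponding powers of \<open>x\<close> and \<open>b\<close>; hence they
agree and are normal.\<close>

lemma minn_disjoint_factors:
  assumes N: "minn N G" and NA: "N \<inter> A = {1}" and NB: "N \<inter> B = {1}"
  obtains x b p where "x \<in> A" "b \<in> B" "prime p" "card N = p" "inverse b * x \<in> N" "inverse b * x \<noteq> 1"
    "x ^ p = b ^ p"
proof -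
  have nN: "nsg N G" and sN: "sg N" using N minn_nsg nsg_sg by blast+
  obtain n0 where n0: "n0 \<in> N" "n0 \<noteq> 1" using sg_nontrivial[OF sN] minn_nontrivial[OF N] by blast
  then obtain a \<beta> where ab: "n0 = a * \<beta>" "a \<in> A" "\<beta> \<in> B" using nsg_subset[OF nN] GAB by blast
  have aB: "a \<notin> B" using ab B n0 NB by (metis IntI empty_iff insert_iff sg_mult)
  have aG: "a \<in> G" using ab AG by auto
  obtain j p where p: "prime p" "a ^ j \<notin> B" "(a ^ j) ^ p \<in> B"
    using ex_prime_power_into[OF G B aG aB] by blast
  \<comment> \<open>\<open>inverse \<beta>\<close> is congruent to \<open>a\<close> modulo
    \<open>N\<close>. The common exponent \<open>j\<close> is chosen so that the first positive
    power of \<open>x\<close> in \<open>B\<close> is the \<open>p\<close>-th.\<close>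
  define x b where "x = a ^ j" and "b = inverse \<beta> ^ j"
  have xA: "x \<in> A" and bB: "b \<in> B" using ab A B by (auto simp: x_def b_def)
  have xG: "x \<in> G" "b \<in> G" using xA bB AG BG by auto
  have "eqm N a (inverse \<beta>)" using n0 ab by (simp add: eqm_def)
  then have xb: "eqm N x b" unfolding x_def b_def by (rule eqm_power[OF nN G(1) aG])
  have bx: "eqm N b x" using eqm_sym[OF sN xb] .
  have xB: "x ^ i \<in> B \<longleftrightarrow> p dvd i" for i
    using cyc_mod_prime[OF B p(1)] p x_def by blast
  define N1 where "N1 = N \<inter> (B \<bullet> cyc x)"
  define N2 where "N2 = N \<inter> (A \<bullet> cyc b)"
  have N1: "N1 = range (\<lambda>i::nat. inverse b ^ i * x ^ i)"
    unfolding N1_def by (rule Int_mul_cyc[OF G(1) nN B NB bB BG xG(1) xb])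
  have N2: "N2 = range (\<lambda>i::nat. inverse x ^ i * b ^ i)"
    unfolding N2_def by (rule Int_mul_cyc[OF G(1) nN A NA xA AG xG(2) bx])
  have cx: "sg (cyc x)" "cyc x \<subseteq> A" "sg (cyc b)" "cyc b \<subseteq> B"
    using xA bB xG G A B by (auto simp: cyc_sg cyc_subset)
  have sBx: "sg (B \<bullet> cyc x)" "sg (A \<bullet> cyc b)"
    using mutperm_sg[OF mut A cx(3,4)] mutperm_sg[OF mutperm_sym[OF mut] B cx(1,2)] by auto
  have sN1: "sg N1" "sg N2" unfolding N1_def N2_def using sg_Int sN sBx by auto
  have inv12: "inverse (inverse b ^ i * x ^ i) = inverse x ^ i * b ^ i" for i
    by (simp add: mgroup_simps mgroup_inverse_power)
  have "N1 = N2"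
  proof (intro subset_antisym subsetI)
    fix y assume "y \<in> N1"
    then have "inverse y \<in> N1" using sN1 by simp
    then show "y \<in> N2" unfolding N1 N2 using inv12 by (metis (no_types, lifting) image_iff mgroup_inverse_inverse rangeI)
  next
    fix y assume "y \<in> N2"
    then have "inverse y \<in> N2" using sN1 by simp
    then show "y \<in> N1" unfolding N1 N2 using inv12 by (metis (no_types, lifting) image_iff mgroup_inverse_inverse rangeI)
  qed
  have "nsg N1 (A \<bullet> B)"
  proof (rule nsg_of_factors[OF sN1(1)])
    show "N1 \<subseteq> A \<bullet> B" using nsg_subset[OF nN] GAB N1_def by auto
    show "a * n * inverse a \<in> N1" if "a \<in> A" "n \<in> N1" for a n
    proof -
      have "a \<in> A \<bullet> cyc b" using sg_setmul_left[OF cx(3), of A] that by auto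
      then show ?thesis
        using that(2) AG that(1) nsg_conj[OF nN] sBx(2) unfolding \<open>N1 = N2\<close> N2_def by auto
    qed
    show "\<beta> * n * inverse \<beta> \<in> N1" if "\<beta> \<in> B" "n \<in> N1" for \<beta> n
    proof -
      have "\<beta> \<in> B \<bullet> cyc x" using sg_setmul_left[OF cx(1), of B] that by auto
      then show ?thesis
        using that(2) BG that(1) nsg_conj[OF nN] sBx(1) unfolding N1_def by auto
    qed
  qed
  then have nN1: "nsg N1 G" using GAB by simp
  have n1: "inverse b * x \<in> N1" unfolding N1 by (rule range_eqI[of _ _ 1]) simp
  have n1': "inverse b * x \<noteq> 1"
  proof
    assume "inverse b * x = 1"
    then have "x = b" by (metis mgroup_inverse_eq mgroup_inverse_inverse)
    then show False using bB p(2) x_def by simp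
  qed
  have "N1 = N" using minn_cases[OF N nN1] n1 n1' N1_def by auto
  have xbp: "x ^ p = b ^ p"
  proof -
    have "inverse b ^ p * x ^ p \<in> N" using N1 \<open>N1 = N\<close> by auto
    moreover have "inverse b ^ p * x ^ p \<in> B" using bB B p(3) x_def by simp
    ultimately have "inverse b ^ p * x ^ p = 1" using NB by auto
    then show ?thesis by (metis mgroup_inverse_eq mgroup_inverse_inverse mgroup_inverse_power)
  qed
  have p0: "p > 0" using p prime_gt_0_nat by blast
  \<comment> \<open>Since \<open>x ^ p = b ^ p\<close>, exponents count only modulo
    \<open>p\<close>; distinct residues give distinct elements because \<open>x ^ i\<close> is in
    \<open>B\<close> only when \<open>p\<close> divides \<open>i\<close>.\<close>
  have "bij_betw (\<lambda>i. inverse b ^ i * x ^ i) {..<p} N1"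
    unfolding bij_betw_def
  proof
    have *: "i = j" if "inverse b ^ i * x ^ i = inverse b ^ j * x ^ j" "i \<le> j" "j < p" for i j
    proof -
      have "inverse b ^ i * x ^ i = (inverse b ^ j * x ^ (j - i)) * x ^ i"
        using that by (simp add: mult.assoc power_add[symmetric])
      then have "inverse b ^ j * x ^ (j - i) = inverse b ^ i" by (simp only: mgroup_right_cancel)
      then have "inverse b ^ j * x ^ (j - i) \<in> B" using bB B by simp
      then have "x ^ (j - i) \<in> B" using sg_left_iff[OF B, of "inverse b ^ j"] bB B by simp
      then have "p dvd j - i" using xB by simp
      then show ?thesis using that by (auto dest: dvd_imp_le)
    qed
    show "inj_on (\<lambda>i. inverse b ^ i * x ^ i) {..<p}"
      by (rule inj_onI) (metis * lessThan_iff nat_le_linear)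
    show "(\<lambda>i. inverse b ^ i * x ^ i) ` {..<p} = N1"
    proof (intro subset_antisym subsetI)
      fix y assume "y \<in> N1"
      then obtain i where y: "y = inverse b ^ i * x ^ i" unfolding N1 by blast
      have i: "i = i mod p + p * (i div p)" by simp
      have "x ^ (p * (i div p)) = b ^ (p * (i div p))" using xbp by (simp add: power_mult)
      then have "y = inverse b ^ (i mod p) * x ^ (i mod p)"
      proof -
        assume eq: "x ^ (p * (i div p)) = b ^ (p * (i div p))"
        have xi: "x ^ i = x ^ (p * (i div p)) * x ^ (i mod p)"
          by (metis i power_add add.commute)
        have "inverse b ^ i = inverse b ^ (i mod p) * inverse b ^ (p * (i div p))"
          by (metis i power_add)
        then have bi: "inverse b ^ i = inverse b ^ (i mod p) * inverse (b ^ (p * (i div p)))"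
          by (simp only: mgroup_inverse_power)
        show ?thesis unfolding y xi bi eq by (simp only: mult.assoc inverse_mult_cancel)
      qed
      then show "y \<in> (\<lambda>i. inverse b ^ i * x ^ i) ` {..<p}" using p0 by auto
    qed (auto simp: N1)
  qed
  then have "card N1 = p" using bij_betw_same_card by fastforce
  then show ?thesis using that[OF xA bB p(1)] n1 n1' xbp \<open>N1 = N\<close> by simp
qed

end

section \<open>Commutators in products and Ito's theorem\<close>

lemma gen_commute:
  assumes "\<And>x y. x \<in> S \<Longrightarrow> y \<in> T \<Longrightarrow> x * y = y * x" "x \<in> gen S" "y \<in> gen T"
  shows "x * y = y * x"
proof -
  have sgc: "sg {x::'a. \<forall>y\<in>T. x * y = y * x}" for T
    using cent_sg[of "UNIV::'a set" T] unfolding cent_def by (simp add: sg_def)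
  have "gen S \<subseteq> {x. \<forall>y\<in>T. x * y = y * x}" by (rule gen_least[OF sgc]) (use assms(1) in blast)
  then have "T \<subseteq> {y. \<forall>x\<in>gen S. y * x = x * y}" by fastforce
  then have "gen T \<subseteq> {y. \<forall>x\<in>gen S. y * x = x * y}" by (rule gen_least[OF sgc])
  then show ?thesis using assms(2,3) by fastforce
qed

lemma setmul_closed_cent:
  assumes "G = A \<bullet> B" "A \<subseteq> T" "B \<subseteq> T" "sg T"
  shows "G \<subseteq> T"
  using assms setmul_subset by blast

text \<open>The elements whose commutators with a fixed set lie in \<open>C\<close> form a subgroup,
  so containing \<open>A\<close> and \<open>B\<close> it is all of \<open>G\<close>. This is applied
  with the fixed sets \<open>A\<close>, \<open>B\<close> and finally \<open>G\<close>.\<close>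

lemma cmt_of_factors:
  assumes G: "sg G" and A: "sg A" and B: "sg B" and GAB: "G = A \<bullet> B" and C: "nsg C G"
    and AA: "\<And>x y. x \<in> A \<Longrightarrow> y \<in> A \<Longrightarrow> cmt x y \<in> C"
    and BB: "\<And>x y. x \<in> B \<Longrightarrow> y \<in> B \<Longrightarrow> cmt x y \<in> C"
    and AB: "\<And>x y. x \<in> A \<Longrightarrow> y \<in> B \<Longrightarrow> cmt x y \<in> C"
    and xy: "x \<in> G" "y \<in> G"
  shows "cmt x y \<in> C"
proof -
  have AG: "A \<subseteq> G" "B \<subseteq> G" using GAB sg_setmul_left[OF B, of A] sg_setmul_right[OF A, of B] by auto
  have flip: "cmt y x \<in> C" if "cmt x y \<in> C" for x y
    using sg_inverse[OF nsg_sg[OF C] that] by (simp add: inverse_cmt)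
  have T: "sg {x \<in> G. \<forall>z\<in>Z. cmt x z \<in> C}" if "Z \<subseteq> G" for Z
    by (rule cmt_centralizer_sg[OF C G that])
  have "A \<subseteq> {x \<in> G. \<forall>z\<in>A. cmt x z \<in> C}" using AG AA by auto
  moreover have "B \<subseteq> {x \<in> G. \<forall>z\<in>A. cmt x z \<in> C}" using AG AB flip by auto
  ultimately have "G \<subseteq> {x \<in> G. \<forall>z\<in>A. cmt x z \<in> C}"
    by (rule setmul_closed_cent[OF GAB _ _ T[OF AG(1)]])
  then have 1: "cmt a x \<in> C" if "x \<in> G" "a \<in> A" for x a
    using that flip by auto
  have "A \<subseteq> {x \<in> G. \<forall>z\<in>B. cmt x z \<in> C}" using AG AB by auto
  moreover have "B \<subseteq> {x \<in> G. \<forall>z\<in>B. cmt x z \<in> C}" using AG BB by auto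
  ultimately have "G \<subseteq> {x \<in> G. \<forall>z\<in>B. cmt x z \<in> C}"
    by (rule setmul_closed_cent[OF GAB _ _ T[OF AG(2)]])
  then have 2: "cmt b x \<in> C" if "x \<in> G" "b \<in> B" for x b
    using that flip by auto
  have "A \<subseteq> {x \<in> G. \<forall>z\<in>G. cmt x z \<in> C}" using AG 1 by auto
  moreover have "B \<subseteq> {x \<in> G. \<forall>z\<in>G. cmt x z \<in> C}" using AG 2 by auto
  ultimately have "G \<subseteq> {x \<in> G. \<forall>z\<in>G. cmt x z \<in> C}"
    by (rule setmul_closed_cent[OF GAB _ _ T[OF order_refl]])
  then show ?thesis using xy by auto
qed

lemma commute_cmt_of_conj_eq:
  assumes "inverse y * (inverse x * c * x) * y = inverse x * (inverse y * c * y) * (x::'a::mgroup)"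
  shows "c * cmt x y = cmt x y * c"
proof -
  have "x * y * (inverse y * (inverse x * c * x) * y) * inverse x * inverse y
      = x * y * (inverse x * (inverse y * c * y) * x) * inverse x * inverse y"
    by (simp only: assms)
  then show ?thesis by (simp add: mult.assoc cmt_def)
qed

text \<open>Conjugation by an element of \<open>A\<close> sends \<open>cmt a b\<close> to
  \<open>cmt a b'\<close> with \<open>b'\<close> independent of \<open>a\<close>, and symmetrically
  for \<open>B\<close>. Hence conjugations by elements of \<open>A\<close> and of \<open>B\<close>
  commute on these commutators, so \<open>cmt \<alpha> \<beta>\<close> centralizes all of them; they
  generate a normal subgroup containing \<open>der G\<close>.\<close>

theorem ito:
  assumes G: "sg G" and A: "sg A" and B: "sg B" and GAB: "G = A \<bullet> B"
    and abA: "\<And>x y. x \<in> A \<Longrightarrow> y \<in> A \<Longrightarrow> x * y = y * x"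
    and abB: "\<And>x y. x \<in> B \<Longrightarrow> y \<in> B \<Longrightarrow> x * y = y * x"
    and "u \<in> der G" "v \<in> der G"
  shows "u * v = v * u"
proof -
  have AG: "A \<subseteq> G" "B \<subseteq> G" using GAB sg_setmul_left[OF B, of A] sg_setmul_right[OF A, of B] by auto
  have GBA: "G = B \<bullet> A" using setmul_commute_of_sg[OF A B] G GAB by simp
  have cA: "\<exists>b'\<in>B. \<forall>a\<in>A. \<alpha> * cmt a b * inverse \<alpha> = cmt a b'" if "\<alpha> \<in> A" "b \<in> B" for \<alpha> b
  proof -
    have "\<alpha> * b * inverse \<alpha> \<in> B \<bullet> A" unfolding GBA[symmetric] using sg_conj[OF G, of \<alpha> b] that AG by auto
    then obtain b2 a2 where *: "\<alpha> * b * inverse \<alpha> = b2 * a2" "b2 \<in> B" "a2 \<in> A" by blast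
    have "\<alpha> * cmt a b * inverse \<alpha> = cmt a b2" if a: "a \<in> A" for a
    proof -
      have "\<alpha> * a * inverse \<alpha> = a" using abA[OF \<open>\<alpha> \<in> A\<close> a] by (simp add: mult.assoc mgroup_commute_iff[unfolded mult.assoc])
      then have "\<alpha> * cmt a b * inverse \<alpha> = cmt a (b2 * a2)" using * by (simp add: conj_cmt)
      also have "\<dots> = a * b2 * (a2 * inverse a) * inverse a2 * inverse b2"
        by (simp add: cmt_def mgroup_simps)
      also have "a2 * inverse a = inverse a * a2" using abA * a A by simp
      finally show ?thesis by (simp add: cmt_def mult.assoc)
    qed
    then show ?thesis using * by blast
  qed
  have cB: "\<exists>a'\<in>A. \<forall>b\<in>B. \<beta> * cmt a b * inverse \<beta> = cmt a' b" if "\<beta> \<in> B" "a \<in> A" for \<beta> a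
  proof -
    have "\<beta> * a * inverse \<beta> \<in> A \<bullet> B" unfolding GAB[symmetric] using sg_conj[OF G, of \<beta> a] that AG by auto
    then obtain a3 b3 where *: "\<beta> * a * inverse \<beta> = a3 * b3" "b3 \<in> B" "a3 \<in> A" by blast
    have "\<beta> * cmt a b * inverse \<beta> = cmt a3 b" if b: "b \<in> B" for b
    proof -
      have "\<beta> * b * inverse \<beta> = b" using abB[OF \<open>\<beta> \<in> B\<close> b] by (simp add: mult.assoc mgroup_commute_iff[unfolded mult.assoc])
      then have "\<beta> * cmt a b * inverse \<beta> = cmt (a3 * b3) b" using * by (simp add: conj_cmt)
      also have "\<dots> = a3 * (b3 * b) * inverse b3 * inverse a3 * inverse b"
        by (simp add: cmt_def mgroup_simps)
      also have "b3 * b = b * b3" using abB * b by simp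
      finally show ?thesis by (simp add: cmt_def mult.assoc)
    qed
    then show ?thesis using * by blast
  qed
  let ?S = "{cmt a b |a b. a \<in> A \<and> b \<in> B}"
  have comm: "cmt a b * cmt \<alpha> \<beta> = cmt \<alpha> \<beta> * cmt a b"
    if h: "a \<in> A" "b \<in> B" "\<alpha> \<in> A" "\<beta> \<in> B" for a b \<alpha> \<beta>
  proof -
    have inv: "inverse \<alpha> \<in> A" "inverse \<beta> \<in> B" using h A B by auto
    let ?\<alpha> = "inverse \<alpha>" and ?\<beta> = "inverse \<beta>"
    obtain b' where b': "b' \<in> B" "\<forall>a\<in>A. ?\<alpha> * cmt a b * inverse ?\<alpha> = cmt a b'"
      using cA[OF inv(1) h(2)] by blast
    obtain a' where a': "a' \<in> A" "\<forall>b\<in>B. ?\<beta> * cmt a b * inverse ?\<beta> = cmt a' b"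
      using cB[OF inv(2) h(1)] by blast
    have "?\<alpha> * cmt a b * \<alpha> = cmt a b'" "?\<beta> * cmt a b' * \<beta> = cmt a' b'"
      "?\<beta> * cmt a b * \<beta> = cmt a' b" "?\<alpha> * cmt a' b * \<alpha> = cmt a' b'"
      using bspec[OF b'(2) h(1)] bspec[OF b'(2) a'(1)] bspec[OF a'(2) h(2)] bspec[OF a'(2) b'(1)]
      by (simp_all only: mgroup_inverse_inverse)
    then have "?\<beta> * (?\<alpha> * cmt a b * \<alpha>) * \<beta> = ?\<alpha> * (?\<beta> * cmt a b * \<beta>) * \<alpha>"
      by (simp only:)
    then show ?thesis by (rule commute_cmt_of_conj_eq)
  qed
  have nS: "nsg (gen ?S) G"
    unfolding GAB
  proof (rule nsg_of_factors[OF gen_sg])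
    show "gen ?S \<subseteq> A \<bullet> B" unfolding GAB[symmetric]
    proof (rule gen_least[OF G])
      show "?S \<subseteq> G"
      proof
        fix s assume "s \<in> ?S"
        then obtain a b where "s = cmt a b" "a \<in> G" "b \<in> G" using AG by blast
        then show "s \<in> G" using G by (simp add: cmt_def)
      qed
    qed
    show "\<alpha> * n * inverse \<alpha> \<in> gen ?S" if "\<alpha> \<in> A" "n \<in> gen ?S" for \<alpha> n
    proof (rule gen_conj[OF _ that(2)])
      fix s assume "s \<in> ?S"
      then obtain a b where "s = cmt a b" "a \<in> A" "b \<in> B" by blast
      then have "\<alpha> * s * inverse \<alpha> \<in> ?S" using cA[OF that(1)] by blast
      then show "\<alpha> * s * inverse \<alpha> \<in> gen ?S" by (rule subsetD[OF gen_superset])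
    qed
    show "\<beta> * n * inverse \<beta> \<in> gen ?S" if "\<beta> \<in> B" "n \<in> gen ?S" for \<beta> n
    proof (rule gen_conj[OF _ that(2)])
      fix s assume "s \<in> ?S"
      then obtain a b where "s = cmt a b" "a \<in> A" "b \<in> B" by blast
      then have "\<beta> * s * inverse \<beta> \<in> ?S" using cB[OF that(1)] by blast
      then show "\<beta> * s * inverse \<beta> \<in> gen ?S" by (rule subsetD[OF gen_superset])
    qed
  qed
  have S: "cmt a b \<in> gen ?S" if "a \<in> A" "b \<in> B" for a b
    by (rule subsetD[OF gen_superset]) (use that in blast)
  have one: "cmt x y \<in> gen ?S" if "x * y = y * x" for x y
  proof -
    have "cmt x y = 1" using that by (simp only: cmt_eq_1)
    then show ?thesis using sg_one[OF gen_sg] by (simp only:)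
  qed
  have "cmt x y \<in> gen ?S" if "x \<in> G" "y \<in> G" for x y
    by (rule cmt_of_factors[OF G A B GAB nS]) (use that S one abA abB in auto)
  then have "der G \<subseteq> gen ?S" by (intro der_least[OF gen_sg]) auto
  then have uv: "u \<in> gen ?S" "v \<in> gen ?S" using assms(7,8) by auto
  show ?thesis
  proof (rule gen_commute[OF _ uv])
    fix x y assume "x \<in> ?S" "y \<in> ?S"
    then obtain a b \<alpha> \<beta> where "x = cmt a b" "y = cmt \<alpha> \<beta>" "a \<in> A" "b \<in> B" "\<alpha> \<in> A" "\<beta> \<in> B"
      by blast
    then show "x * y = y * x" by (simp add: comm)
  qed
qed

lemma conj_power_iterate:
  assumes "\<alpha> * n * inverse \<alpha> = n ^ k"
  shows "\<alpha> ^ j * n * inverse (\<alpha> ^ j) = (n::'a::mgroup) ^ (k ^ j)"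
proof (induction j)
  case (Suc j)
  have "\<alpha> ^ Suc j * n * inverse (\<alpha> ^ Suc j) = \<alpha> ^ j * (\<alpha> * n * inverse \<alpha>) * inverse (\<alpha> ^ j)"
    by (simp only: power_Suc2 mgroup_inverse_mult mult.assoc)
  also have "\<dots> = (\<alpha> ^ j * n * inverse (\<alpha> ^ j)) ^ k"
    unfolding assms by (rule mgroup_conj_power)
  also have "\<dots> = n ^ (k ^ Suc j)" unfolding Suc by (simp add: power_mult[symmetric] mult.commute)
  finally show ?case .
qed simp

lemma power_cong_order:
  assumes "n ^ p = (1::'a::mgroup)" "[i = j] (mod p)"
  shows "n ^ i = n ^ j"
proof -
  have "n ^ i = n ^ (i mod p)" for i
  proof -
    have "n ^ i = n ^ (p * (i div p) + i mod p)" by simp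
    then show ?thesis unfolding power_add power_mult assms(1) by simp
  qed
  then show ?thesis using assms(2) by (metis cong_def)
qed

text \<open>Used for exponents of power automorphisms: raising an automorphism of a group of order
  \<open>p\<close> to a power of \<open>p\<close> leaves it unchanged.\<close>

lemma fermat_iterate:
  assumes "prime (p::nat)" "\<not> p dvd k"
  shows "[k ^ (p ^ m) = k] (mod p)"
proof (induction m)
  case (Suc m)
  have "[k ^ p = k] (mod p)"
  proof -
    have "[k ^ (p - 1) * k = 1 * k] (mod p)"
      using fermat_theorem[OF assms] by (rule cong_mult) simp
    moreover have "k ^ (p - 1) * k = k ^ p"
      using prime_gt_0_nat[OF assms(1)] by (metis Suc_pred' power_Suc2 diff_Suc_1 Suc_diff_1)
    ultimately show ?thesis by simp
  qed
  then have "[(k ^ p) ^ (p ^ m) = k ^ (p ^ m)] (mod p)" by (rule cong_pow)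
  then show ?case using Suc by (metis cong_trans power_Suc power_mult)
qed simp

text \<open>Permutations of finite support, over any type, are the targets of all embeddings
  below.\<close>

instance Perm.perm :: (type) mgroup
  by standard (transfer, simp add: bij_is_inj)

lemmas mgroup_conj_eqI = mgroup_commute_iff[THEN iffD2]

section \<open>Homomorphisms and quotients\<close>

definition ghom :: "('a::mgroup \<Rightarrow> 'b::mgroup) \<Rightarrow> 'a set \<Rightarrow> bool" where
  "ghom \<phi> G \<longleftrightarrow> (\<forall>x\<in>G. \<forall>y\<in>G. \<phi> (x * y) = \<phi> x * \<phi> y)"

lemma ghom_mult: "ghom \<phi> G \<Longrightarrow> x \<in> G \<Longrightarrow> y \<in> G \<Longrightarrow> \<phi> (x * y) = \<phi> x * \<phi> y"
  by (simp add: ghom_def)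

lemma ghom_one: "ghom \<phi> G \<Longrightarrow> sg G \<Longrightarrow> \<phi> 1 = 1"
  using ghom_mult[of \<phi> G 1 1] mgroup_left_cancel[of "\<phi> 1" "\<phi> 1" 1] by simp

lemma ghom_inverse:
  assumes "ghom \<phi> G" "sg G" "x \<in> G"
  shows "\<phi> (inverse x) = inverse (\<phi> x)"
proof -
  have "\<phi> x * \<phi> (inverse x) = 1"
    using ghom_mult[OF assms(1,3), of "inverse x"] ghom_one[OF assms(1,2)] assms by simp
  then show ?thesis unfolding mgroup_inverse_eq by simp
qed

lemma ghom_subset: "ghom \<phi> G \<Longrightarrow> H \<subseteq> G \<Longrightarrow> ghom \<phi> H"
  by (auto simp: ghom_def)

lemma ghom_conj:
  assumes "ghom \<phi> G" "sg G" "g \<in> G" "x \<in> G"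
  shows "\<phi> (g * x * inverse g) = \<phi> g * \<phi> x * inverse (\<phi> g)"
  using assms by (simp add: ghom_mult ghom_inverse)

lemma ghom_cmt:
  assumes "ghom \<phi> G" "sg G" "x \<in> G" "y \<in> G"
  shows "\<phi> (cmt x y) = cmt (\<phi> x) (\<phi> y)"
  using assms by (simp add: cmt_def ghom_mult ghom_inverse)

lemma ghom_image_sg:
  assumes "ghom \<phi> G" "sg G" "sg H" "H \<subseteq> G"
  shows "sg (\<phi> ` H)"
  unfolding sg_def
proof (intro conjI ballI)
  have h: "ghom \<phi> H" using ghom_subset assms by blast
  show "1 \<in> \<phi> ` H" using ghom_one[OF h assms(3)] assms(3) by (metis image_eqI sg_one)
  show "x * y \<in> \<phi> ` H" if xy: "x \<in> \<phi> ` H" "y \<in> \<phi> ` H" for x y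
  proof -
    obtain u v where uv: "x = \<phi> u" "y = \<phi> v" "u \<in> H" "v \<in> H" using xy by blast
    then have "x * y = \<phi> (u * v)" using ghom_mult[OF h] by simp
    then show ?thesis using uv assms(3) by simp
  qed
  show "inverse x \<in> \<phi> ` H" if x: "x \<in> \<phi> ` H" for x
  proof -
    obtain u where u: "x = \<phi> u" "u \<in> H" using x by blast
    then have "inverse x = \<phi> (inverse u)" using ghom_inverse[OF h assms(3)] by simp
    then show ?thesis using u assms(3) by simp
  qed
qed

lemma ghom_image_setmul:
  assumes "ghom \<phi> G" "A \<subseteq> G" "B \<subseteq> G"
  shows "\<phi> ` (A \<bullet> B) = \<phi> ` A \<bullet> \<phi> ` B"
proof (intro subset_antisym subsetI)
  fix y assume "y \<in> \<phi> ` (A \<bullet> B)"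
  then obtain a b where "y = \<phi> (a * b)" "a \<in> A" "b \<in> B" by blast
  moreover from this have "\<phi> (a * b) = \<phi> a * \<phi> b" using ghom_mult[OF assms(1), of a b] assms by auto
  ultimately show "y \<in> \<phi> ` A \<bullet> \<phi> ` B" by auto
next
  fix y assume "y \<in> \<phi> ` A \<bullet> \<phi> ` B"
  then obtain a b where ab: "y = \<phi> a * \<phi> b" "a \<in> A" "b \<in> B" by blast
  then have "y = \<phi> (a * b)" using ghom_mult[OF assms(1), of a b] subsetD[OF assms(2)] subsetD[OF assms(3)] by simp
  then show "y \<in> \<phi> ` (A \<bullet> B)" using ab by blast
qed

lemma ghom_vimage_sg:
  assumes "ghom \<phi> G" "sg G" "sg U"
  shows "sg {x \<in> G. \<phi> x \<in> U}"
  unfolding sg_def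
  using assms ghom_one[OF assms(1,2)] ghom_inverse[OF assms(1,2)] ghom_mult[OF assms(1)] by auto

lemma ghom_vimage_nsg:
  assumes "ghom \<phi> G" "sg G" "nsg U (\<phi> ` G)"
  shows "nsg {x \<in> G. \<phi> x \<in> U} G"
proof (rule nsgI)
  show "sg {x \<in> G. \<phi> x \<in> U}" by (rule ghom_vimage_sg[OF assms(1,2) nsg_sg[OF assms(3)]])
  fix g n assume "g \<in> G" "n \<in> {x \<in> G. \<phi> x \<in> U}"
  then show "g * n * inverse g \<in> {x \<in> G. \<phi> x \<in> U}"
    using nsg_conj[OF assms(3)] assms(2) ghom_conj[OF assms(1,2)] by auto
qed auto

lemma ghom_image_nsg:
  assumes "ghom \<phi> G" "sg G" "nsg N G"
  shows "nsg (\<phi> ` N) (\<phi> ` G)"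
proof (rule nsgI)
  have N: "N \<subseteq> G" "sg N" using assms nsg_subset nsg_sg by auto
  show "sg (\<phi> ` N)" by (rule ghom_image_sg[OF assms(1,2) N(2,1)])
  show "\<phi> ` N \<subseteq> \<phi> ` G" using N by auto
  fix g n assume "g \<in> \<phi> ` G" "n \<in> \<phi> ` N"
  then obtain h m where hm: "g = \<phi> h" "n = \<phi> m" "h \<in> G" "m \<in> N" by auto
  then have "g * n * inverse g = \<phi> (h * m * inverse h)"
    using ghom_conj[OF assms(1,2)] N by auto
  then show "g * n * inverse g \<in> \<phi> ` N" using nsg_conj[OF assms(3) hm(3,4)] by simp
qed

text \<open>A subgroup of the image of a factor is the image of its preimage in that factor, where
  permutability is known.\<close>

lemma ghom_image_mutperm:
  assumes "ghom \<phi> G" "sg G" "sg A" "sg B" "A \<subseteq> G" "B \<subseteq> G" "mutperm A B"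
  shows "mutperm (\<phi> ` A) (\<phi> ` B)"
proof -
  have *: "\<phi> ` A \<bullet> U = U \<bullet> \<phi> ` A"
    if "sg A" "sg B" "A \<subseteq> G" "B \<subseteq> G" "mutperm A B" "sg U" "U \<subseteq> \<phi> ` B" for A B U
  proof -
    let ?V = "{x \<in> B. \<phi> x \<in> U}"
    have h: "ghom \<phi> B" using ghom_subset assms(1) that by blast
    have V: "sg ?V" "?V \<subseteq> B" using ghom_vimage_sg[OF h that(2,6)] by auto
    have U: "\<phi> ` ?V = U" using that(7) by auto
    have VG: "?V \<subseteq> G" using that(4) by auto
    have "A \<bullet> ?V = ?V \<bullet> A" using that(5) V unfolding mutperm_def by blast
    then have "\<phi> ` (A \<bullet> ?V) = \<phi> ` (?V \<bullet> A)" by simp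
    then show ?thesis
      unfolding ghom_image_setmul[OF assms(1) that(3) VG] ghom_image_setmul[OF assms(1) VG that(3)] U .
  qed
  show ?thesis
    unfolding mutperm_def
    using *[OF assms(3-7)] *[OF assms(4,3,6,5) mutperm_sym[OF assms(7)]] by blast
qed

text \<open>Cayley's theorem makes every finite group a subgroup of a type of class \<^class>\<open>mgroup\<close>.\<close>

lemma finite_group_embeds:
  fixes Q :: "('q, 'm) monoid_scheme"
  assumes "group Q" "finite (carrier Q)"
  obtains \<phi> :: "'q \<Rightarrow> 'q perm" where "\<phi> \<in> hom Q (mgrp UNIV)" "inj_on \<phi> (carrier Q)"
proof -
  interpret group Q by fact
  define f where "f g x = (if x \<in> carrier Q then g \<otimes>\<^bsub>Q\<^esub> x else x)" for g x
  define \<phi> where "\<phi> g = Perm (f g)" for g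
  have ff: "f g (f h x) = f (g \<otimes>\<^bsub>Q\<^esub> h) x" if "g \<in> carrier Q" "h \<in> carrier Q" for g h x
    using that by (simp add: f_def m_assoc)
  have f1: "f \<one>\<^bsub>Q\<^esub> x = x" for x by (simp add: f_def)
  have bij: "bij (f g)" if "g \<in> carrier Q" for g
  proof (rule o_bij)
    show "f (inv\<^bsub>Q\<^esub> g) \<circ> f g = id" using that by (intro ext) (simp add: ff f1)
    show "f g \<circ> f (inv\<^bsub>Q\<^esub> g) = id" using that by (intro ext) (simp add: ff f1)
  qed
  have "finite {x. f g x \<noteq> x}" for g
    by (rule finite_subset[OF _ assms(2)]) (auto simp: f_def)
  then have app: "apply (\<phi> g) = f g" if "g \<in> carrier Q" for g
    unfolding \<phi>_def using bij[OF that] by (subst Perm_inverse) auto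
  have "\<phi> (g \<otimes>\<^bsub>Q\<^esub> h) = \<phi> g * \<phi> h" if "g \<in> carrier Q" "h \<in> carrier Q" for g h
    using that by (intro perm_eqI) (simp add: apply_times app ff)
  moreover have "inj_on \<phi> (carrier Q)"
  proof (rule inj_onI)
    fix g h assume gh: "g \<in> carrier Q" "h \<in> carrier Q" "\<phi> g = \<phi> h"
    then have "f g \<one>\<^bsub>Q\<^esub> = f h \<one>\<^bsub>Q\<^esub>" using app by metis
    then show "g = h" using gh by (simp add: f_def)
  qed
  ultimately show ?thesis by (intro that) (auto simp: hom_def)
qed

lemma normal_rcos_iff:
  assumes "K \<lhd> G" "x \<in> carrier G" "y \<in> carrier G"
  shows "K #>\<^bsub>G\<^esub> x = K #>\<^bsub>G\<^esub> y \<longleftrightarrow> x \<otimes>\<^bsub>G\<^esub> inv\<^bsub>G\<^esub> y \<in> K"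
proof -
  interpret normal K G by fact
  have s: "subgroup K G" by (rule subgroup_axioms)
  show ?thesis
  proof
    assume "K #>\<^bsub>G\<^esub> x = K #>\<^bsub>G\<^esub> y"
    then have "x \<in> K #>\<^bsub>G\<^esub> y" using rcos_self[OF assms(2) s] by simp
    then show "x \<otimes>\<^bsub>G\<^esub> inv\<^bsub>G\<^esub> y \<in> K" using rcos_module_imp[OF is_group assms(3)] by simp
  next
    assume "x \<otimes>\<^bsub>G\<^esub> inv\<^bsub>G\<^esub> y \<in> K"
    then have "x \<in> K #>\<^bsub>G\<^esub> y" using rcos_module_rev[OF is_group assms(3,2)] by simp
    then show "K #>\<^bsub>G\<^esub> x = K #>\<^bsub>G\<^esub> y" using repr_independence[OF _ assms(3) s] by simp
  qed
qed

lemma finite_FactGroup: "finite (carrier G) \<Longrightarrow> finite (carrier (G Mod K))"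
  by (simp add: carrier_FactGroup)

lemma normal_quotient_embeds:
  fixes G :: "'a monoid"
  assumes G: "group G" "finite (carrier G)" and K: "K \<lhd> G"
  obtains \<phi> :: "'a \<Rightarrow> 'a set perm"
  where "\<phi> \<in> hom G (mgrp UNIV)" "\<And>x. x \<in> carrier G \<Longrightarrow> \<phi> x = 1 \<longleftrightarrow> x \<in> K"
proof -
  interpret normal K G by fact
  have Q: "group (G Mod K)" by (rule factorgroup_is_group)
  obtain \<psi> :: "'a set \<Rightarrow> 'a set perm" where \<psi>: "\<psi> \<in> hom (G Mod K) (mgrp UNIV)" "inj_on \<psi> (carrier (G Mod K))"
    using finite_group_embeds[OF Q finite_FactGroup[OF G(2)]] by blast
  define \<phi> where "\<phi> x = \<psi> (K #>\<^bsub>G\<^esub> x)" for x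
  have hc: "K #>\<^bsub>G\<^esub> x \<in> carrier (G Mod K)" if "x \<in> carrier G" for x
    using that by (auto simp: carrier_FactGroup)
  have hom: "\<phi> (x \<otimes>\<^bsub>G\<^esub> y) = \<phi> x * \<phi> y" if "x \<in> carrier G" "y \<in> carrier G" for x y
    using hom_mult[OF \<psi>(1) hc[OF that(1)] hc[OF that(2)]] rcos_sum[OF that] by (simp add: \<phi>_def)
  have "\<phi> \<one>\<^bsub>G\<^esub> = \<phi> \<one>\<^bsub>G\<^esub> * \<phi> \<one>\<^bsub>G\<^esub>" using hom[of "\<one>\<^bsub>G\<^esub>" "\<one>\<^bsub>G\<^esub>"] by simp
  then have one: "\<phi> \<one>\<^bsub>G\<^esub> = 1" using mgroup_left_cancel[of "\<phi> \<one>\<^bsub>G\<^esub>" "\<phi> \<one>\<^bsub>G\<^esub>" 1] by simp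
  have "\<phi> x = 1 \<longleftrightarrow> x \<in> K" if x: "x \<in> carrier G" for x
  proof -
    have "\<phi> x = 1 \<longleftrightarrow> \<phi> x = \<phi> \<one>\<^bsub>G\<^esub>" using one by simp
    also have "\<dots> \<longleftrightarrow> K #>\<^bsub>G\<^esub> x = K #>\<^bsub>G\<^esub> \<one>\<^bsub>G\<^esub>"
      unfolding \<phi>_def by (rule inj_on_eq_iff[OF \<psi>(2) hc[OF x] hc]) simp
    also have "\<dots> \<longleftrightarrow> x \<in> K" using normal_rcos_iff[OF K x, of "\<one>\<^bsub>G\<^esub>"] x by simp
    finally show ?thesis .
  qed
  moreover have "\<phi> \<in> hom G (mgrp UNIV)" using hom by (simp add: hom_def)
  ultimately show ?thesis by (rule that[rotated])
qed

text \<open>Stand-in for the quotient by \<open>C\<close>: the image of \<open>G\<close> is a copy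
  of it in a type of class \<open>mgroup\<close>, so results on \<open>mutperm_product\<close> apply
  to quotients.\<close>

lemma ex_quotient_ghom:
  fixes G C :: "'a::mgroup set"
  assumes "sg G" "finite G" "nsg C G"
  obtains \<phi> :: "'a \<Rightarrow> 'a set perm" where "ghom \<phi> G" "\<And>x. x \<in> G \<Longrightarrow> \<phi> x = 1 \<longleftrightarrow> x \<in> C"
proof -
  have "C \<lhd> mgrp G" "finite (carrier (mgrp G))" using assms by (simp_all add: mgrp_normal)
  then obtain \<phi> :: "'a \<Rightarrow> 'a set perm" where \<phi>: "\<phi> \<in> hom (mgrp G) (mgrp UNIV)"
    "\<And>x. x \<in> carrier (mgrp G) \<Longrightarrow> \<phi> x = 1 \<longleftrightarrow> x \<in> C"
    using normal_quotient_embeds[OF mgrp_group[OF assms(1)]] by metis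
  have "ghom \<phi> G" using \<phi>(1) by (simp add: ghom_def hom_def)
  then show ?thesis using that \<phi>(2) by simp
qed

lemma ghom_eq_iff:
  assumes "ghom \<phi> G" "sg G" "\<And>x. x \<in> G \<Longrightarrow> \<phi> x = 1 \<longleftrightarrow> x \<in> C" "x \<in> G" "y \<in> G"
  shows "\<phi> x = \<phi> y \<longleftrightarrow> x * inverse y \<in> C"
proof -
  have "\<phi> (x * inverse y) = \<phi> x * inverse (\<phi> y)"
    using assms by (simp add: ghom_mult ghom_inverse)
  then have "x * inverse y \<in> C \<longleftrightarrow> \<phi> x * inverse (\<phi> y) = 1"
    using assms(3)[of "x * inverse y"] assms(2,4,5) by simp
  also have "\<dots> \<longleftrightarrow> \<phi> x = \<phi> y" by (metis mgroup_inverse_eq mgroup_inverse_inject)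
  finally show ?thesis by simp
qed

section \<open>Products of two abelian groups\<close>

context mutperm_product
begin

lemma ghom_image:
  assumes "ghom \<phi> G"
  shows "mutperm_product (\<phi> ` G) (\<phi> ` A) (\<phi> ` B)"
proof
  show "sg (\<phi> ` G)" "sg (\<phi> ` A)" "sg (\<phi> ` B)" using ghom_image_sg[OF assms G(1)] G A B AG BG by auto
  show "finite (\<phi> ` G)" using G by simp
  show "\<phi> ` G = \<phi> ` A \<bullet> \<phi> ` B"
    using ghom_image_setmul[OF assms AG BG] GAB by simp
  show "mutperm (\<phi> ` A) (\<phi> ` B)" by (rule ghom_image_mutperm[OF assms G(1) A B AG BG mut])
qed

lemma central_cyc_normal:
  assumes "b \<in> G" "\<And>a. a \<in> A \<Longrightarrow> a * b = b * a" "\<And>c. c \<in> B \<Longrightarrow> c * b = b * c"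
  shows "nsg (cyc b) G"
proof -
  have sc: "sg (cyc b)" "cyc b \<subseteq> G" using assms G by (auto simp: cyc_sg cyc_subset)
  have *: "g * n * inverse g \<in> cyc b" if gn: "g * b = b * g" "n \<in> cyc b" for g n
  proof -
    obtain i where i: "n = b ^ i" using gn by (auto simp: cyc_def)
    have "g * b * inverse g = b" by (rule mgroup_conj_eqI[OF gn(1)])
    then show ?thesis unfolding i mgroup_conj_power by (simp add: cycI)
  qed
  show ?thesis unfolding GAB
    by (rule nsg_of_factors[OF sc(1) sc(2)[unfolded GAB]]) (use * assms in auto)
qed

text \<open>If \<open>\<alpha>\<close> acted nontrivially, then so would its part of order prime to \<open>p\<close> (Fermat), and
\<open>B \<bullet> cyc \<alpha>\<close> would contain \<open>K\<close>, forcing the element \<open>x\<close> of order \<open>p\<close> into \<open>cyc \<alpha>\<close>.\<close>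

lemma factor_centralizes_prime:
  assumes abA: "\<And>x y. x \<in> A \<Longrightarrow> y \<in> A \<Longrightarrow> x * y = y * x" and D: "A \<inter> B = {1}"
    and K: "nsg K G" "card K = p" "prime p" "K \<inter> B = {1}"
    and xb: "x \<in> A" "b \<in> B" "inverse b * x \<in> K" "inverse b * x \<noteq> 1" "x ^ p = b ^ p"
    and \<alpha>: "\<alpha> \<in> A"
  shows "\<alpha> * (inverse b * x) = (inverse b * x) * \<alpha>"
proof -
  define n where "n = inverse b * x"
  have sK: "sg K" using K nsg_sg by blast
  have x: "x = b * n" "b = x * inverse n" by (simp_all add: n_def mgroup_simps)
  have n: "n \<in> K" "n \<noteq> 1" using xb n_def by auto
  have Kc: "K = cyc n" using prime_order_cyc[OF sK _ n] K by simp
  have xp: "x ^ p = 1"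
  proof -
    have "x ^ p \<in> A" "b ^ p \<in> B" using xb(1,2) A B by auto
    then show ?thesis using D xb(5) by auto
  qed
  have np: "n ^ p = 1"
  proof -
    have "n [^]\<^bsub>mgrp K\<^esub> Coset.order (mgrp K) = \<one>\<^bsub>mgrp K\<^esub>"
      using group.pow_order_eq_1[OF mgrp_group[OF sK], of n] n by simp
    moreover have "n [^]\<^bsub>mgrp K\<^esub> (i::nat) = n ^ i" for i
      by (induction i) (simp_all add: group.is_monoid[OF mgrp_group[OF sK]] monoid.nat_pow_0 monoid.nat_pow_Suc power_commutes)
    ultimately show ?thesis using K(2) by (simp add: Coset.order_def)
  qed
  have "\<alpha> * n * inverse \<alpha> \<in> K" using nsg_conj[OF K(1)] \<alpha> AG n by auto
  then obtain k where k: "\<alpha> * n * inverse \<alpha> = n ^ k" unfolding Kc cyc_def by blast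
  show ?thesis
  proof (rule ccontr)
    assume not: "\<alpha> * (inverse b * x) \<noteq> (inverse b * x) * \<alpha>"
    have "n ^ k \<noteq> n"
      using k not mgroup_commute_iff[of \<alpha> n] unfolding n_def by metis
    have "\<not> p dvd k"
    proof
      assume "p dvd k"
      then have "n ^ k = 1" using np by (auto simp: power_mult)
      then have "n = inverse \<alpha> * 1 * \<alpha>" using k conj_eq_swap by metis
      then show False using n by simp
    qed
    obtain l where l: "l > 0" "\<alpha> ^ l = 1" using finite_order[OF G] \<alpha> AG by blast
    have "\<not> is_unit p" using K(3) by auto
    then obtain s where s: "l = p ^ multiplicity p l * s" "\<not> p dvd s"
      using multiplicity_decompose'[of l p] l(1) by blast
    \<comment> \<open>A power of \<open>\<alpha>\<close> whose order is prime to \<open>p\<close>;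
      by \<open>fermat_iterate\<close> it acts on \<open>n\<close> exactly as
      \<open>\<alpha>\<close> does.\<close>
    define \<beta> where "\<beta> = \<alpha> ^ (p ^ multiplicity p l)"
    have \<beta>s: "\<beta> ^ s = 1" using l(2) s(1) by (metis \<beta>_def power_mult)
    have \<beta>A: "\<beta> \<in> A" using \<alpha> A by (simp add: \<beta>_def)
    have "\<beta> * n * inverse \<beta> = n ^ (k ^ (p ^ multiplicity p l))"
      unfolding \<beta>_def by (rule conj_power_iterate[OF k])
    also have "\<dots> = n ^ k" by (rule power_cong_order[OF np fermat_iterate[OF K(3) \<open>\<not> p dvd k\<close>]])
    finally have \<beta>n: "\<beta> * n * inverse \<beta> = n ^ k" .
    have cb: "sg (cyc \<beta>)" "cyc \<beta> \<subseteq> A" using \<beta>A G A AG by (auto simp: cyc_sg cyc_subset)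
    have sP: "sg (B \<bullet> cyc \<beta>)" by (rule mutperm_sg[OF mutperm_sym[OF mut] B cb])
    have bP: "b \<in> B \<bullet> cyc \<beta>" using sg_setmul_left[OF cb(1), of B] xb by auto
    have \<beta>P: "\<beta> \<in> B \<bullet> cyc \<beta>" using sg_setmul_right[OF B, of "cyc \<beta>"] cyc_self[of \<beta>] by auto
    \<comment> \<open>\<open>\<beta>\<close> fixes \<open>x\<close> but moves \<open>n\<close>, so
      conjugating \<open>b\<close> multiplies it by a nontrivial element of \<open>K\<close>. The
      subgroup \<open>B \<bullet> cyc \<beta>\<close> then contains \<open>K\<close>, and with it
      \<open>x\<close>.\<close>
    have "\<beta> * b * inverse \<beta> = (\<beta> * x * inverse \<beta>) * inverse (\<beta> * n * inverse \<beta>)"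
      unfolding x(2) by (simp add: mgroup_simps)
    also have "\<beta> * x * inverse \<beta> = x" by (rule mgroup_conj_eqI[OF abA[OF \<beta>A xb(1)]])
    also have "x * inverse (\<beta> * n * inverse \<beta>) = b * (n * inverse (n ^ k))"
      unfolding \<beta>n by (subst x(1)) (simp add: mult.assoc)
    finally have "b * (n * inverse (n ^ k)) \<in> B \<bullet> cyc \<beta>" using sg_conj[OF sP \<beta>P, of b] bP by simp
    then have wP: "n * inverse (n ^ k) \<in> B \<bullet> cyc \<beta>" using sg_left_iff[OF sP bP] by simp
    have wK: "n * inverse (n ^ k) \<in> K" using n sK by simp
    have w1: "n * inverse (n ^ k) \<noteq> 1"
    proof
      assume "n * inverse (n ^ k) = 1"
      then have "inverse n = inverse (n ^ k)" by (simp only: mgroup_inverse_eq)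
      then show False using \<open>n ^ k \<noteq> n\<close> by simp
    qed
    have "K = cyc (n * inverse (n ^ k))" using prime_order_cyc[OF sK _ wK w1] K by simp
    then have "n \<in> B \<bullet> cyc \<beta>" using n cyc_subset[OF sP wP] by auto
    then have "x \<in> B \<bullet> cyc \<beta>" using x(1) bP sP by simp
    \<comment> \<open>\<open>c\<close> falls into \<open>A \<inter> B\<close>, so \<open>x\<close>
      is a power of \<open>\<beta>\<close> and \<open>x ^ s = 1\<close>. Together with
      \<open>x ^ p = 1\<close> this gives \<open>x = 1\<close>, which puts \<open>n\<close> into
      \<open>B\<close>.\<close>
    then obtain c j where cj: "x = c * \<beta> ^ j" "c \<in> B" by (auto simp: cyc_def)
    have "c \<in> A" using sg_right_iff[OF A, of "\<beta> ^ j" c] \<beta>A A xb cj by auto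
    then have "c = 1" using cj D by auto
    then have "x ^ s = (\<beta> ^ s) ^ j" using cj by (simp add: power_mult[symmetric] mult.commute)
    then have "x ^ s = 1" using \<beta>s by simp
    moreover have "coprime p s" using s(2) K(3) prime_imp_coprime by blast
    ultimately have "x \<in> {1}" using sg_coprime_power[of "{1}" x p s] xp by simp
    then have "n \<in> B" using xb B by (simp add: n_def)
    then show False using K(4) n by auto
  qed
qed

text \<open>If \<open>der G\<close> is nontrivial, it is abelian by Ito's theorem. A minimal normal
  \<open>K\<close> inside it meets \<open>A\<close> and \<open>B\<close> trivially, so it has prime
  order and a generator \<open>inverse b * x\<close>. \<open>A\<close> centralizes this generator
  and \<open>x\<close>, hence \<open>b\<close>, and \<open>cyc b\<close> becomes a normal subgroup
  inside \<open>B\<close>.\<close>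

theorem abelian_product_trivial:
  assumes abA: "\<And>x y. x \<in> A \<Longrightarrow> y \<in> A \<Longrightarrow> x * y = y * x"
    and abB: "\<And>x y. x \<in> B \<Longrightarrow> y \<in> B \<Longrightarrow> x * y = y * x"
    and noA: "\<And>M. nsg M G \<Longrightarrow> M \<subseteq> A \<Longrightarrow> M = {1}"
    and noB: "\<And>M. nsg M G \<Longrightarrow> M \<subseteq> B \<Longrightarrow> M = {1}"
  shows "G = {1}"
proof (cases "der G = {1}")
  case True
  have "nsg A G" "nsg B G" using nsg_over_der[OF G(1)] A B AG BG True by auto
  then have "A = {1}" "B = {1}" using noA noB by auto
  then show ?thesis using GAB by (auto simp: setmul_def)
next
  case False
  have "nsg (der G) G" by (rule der_nsg[OF nsg_self[OF G(1)] G(1)])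
  then obtain K where K: "minn K G" "K \<subseteq> der G" using ex_minn[OF G(2) _ False] by blast
  have nK: "nsg K G" using K minn_nsg by blast
  have KA: "K \<inter> A' = {1}"
    if mp: "mutperm_product G A' B'" and ab: "\<And>x y. x \<in> A' \<Longrightarrow> y \<in> A' \<Longrightarrow> x * y = y * x"
      "\<And>x y. x \<in> B' \<Longrightarrow> y \<in> B' \<Longrightarrow> x * y = y * x"
      and no: "\<And>M. nsg M G \<Longrightarrow> M \<subseteq> A' \<Longrightarrow> M = {1}" "\<And>M. nsg M G \<Longrightarrow> M \<subseteq> B' \<Longrightarrow> M = {1}" for A' B'
  proof -
    interpret P: mutperm_product G A' B' by (rule mp)
    \<comment> \<open>The centre \<open>Z\<close> of \<open>M\<close> is normal in \<open>G\<close>.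
      The component in \<open>B'\<close> of an element of \<open>Z\<close> is central in
      \<open>G\<close>, so it generates a normal subgroup inside \<open>B'\<close> and vanishes.
      Thus \<open>Z\<close> lies in \<open>A'\<close> and is trivial; but
      \<open>K \<inter> A'\<close> is central in \<open>M\<close>.\<close>
    define M where "M = der G \<bullet> A'"
    have nder: "nsg (der G) G" by fact
    have sM: "sg M" unfolding M_def by (rule sg_setmul_nsg[OF nder P.A P.AG G(1)])
    have MG: "M \<subseteq> G" unfolding M_def by (rule setmul_subset[OF G(1) nsg_subset[OF nder] P.AG])
    have dM: "der G \<subseteq> M" unfolding M_def by (rule sg_setmul_left[OF P.A])
    have A'M: "A' \<subseteq> M" unfolding M_def by (rule sg_setmul_right[OF der_sg])
    have nM: "nsg M G" by (rule nsg_over_der[OF G(1) sM dM MG])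
    define Z where "Z = cent G M \<inter> M"
    have nZ: "nsg Z G" unfolding Z_def by (rule nsg_Int[OF cent_nsg[OF nM G(1)] nM])
    have "Z \<subseteq> A'"
    proof
      fix z assume z: "z \<in> Z"
      then obtain a b where ab': "z = a * b" "a \<in> A'" "b \<in> B'" using P.GAB nsg_subset[OF nZ] by blast
      have zc: "z * a' = a' * z" if "a' \<in> A'" for a'
        using z A'M that by (auto simp: Z_def cent_def)
      have "a' * b = b * a'" if a': "a' \<in> A'" for a'
      proof -
        have b: "b = inverse a * z" using ab' by simp
        have "a' * inverse a = inverse a * a'" using ab(1) ab' a' P.A by simp
        then have "a' * b = inverse a * (a' * z)" unfolding b by (simp add: mult.assoc[symmetric])
        then show ?thesis unfolding b zc[OF a', symmetric] by (simp add: mult.assoc)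
      qed
      then have "nsg (cyc b) G" using ab' ab(2) P.BG by (intro P.central_cyc_normal) auto
      moreover have "cyc b \<subseteq> B'" by (rule cyc_subset[OF P.B ab'(3)])
      ultimately have "cyc b = {1}" using no(2) by blast
      then have "b = 1" using cyc_self[of b] by auto
      then show "z \<in> A'" using ab' by simp
    qed
    then have Z1: "Z = {1}" using no(1)[OF nZ] by simp
    have "K \<inter> A' \<subseteq> Z"
    proof
      fix k assume k: "k \<in> K \<inter> A'"
      have "M \<subseteq> cent G {k}"
        unfolding M_def
      proof (rule setmul_subset[OF cent_sg[OF G(1)]])
        show "der G \<subseteq> cent G {k}"
          using ito[OF G(1) P.A P.B P.GAB ab] k K(2) nsg_subset[OF nder] by (auto simp: cent_def)
        show "A' \<subseteq> cent G {k}" using ab(1) k P.AG by (auto simp: cent_def)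
      qed
      then show "k \<in> Z" using k A'M MG by (auto simp: Z_def cent_def)
    qed
    then show ?thesis using Z1 sg_one[OF nsg_sg[OF nK]] sg_one[OF P.A] by auto
  qed
  have KA1: "K \<inter> A = {1}" by (rule KA[OF mutperm_product_axioms abA abB noA noB])
  have KB1: "K \<inter> B = {1}" by (rule KA[OF swap abB abA noB noA])
  obtain x b p where xb: "x \<in> A" "b \<in> B" "prime p" "card K = p" "inverse b * x \<in> K" "inverse b * x \<noteq> 1"
    "x ^ p = b ^ p" by (rule minn_disjoint_factors[OF K(1) KA1 KB1])
  \<comment> \<open>Elements common to both abelian factors are central in \<open>G\<close>.\<close>
  have D: "A \<inter> B = {1}"
  proof -
    have "d = 1" if d: "d \<in> A \<inter> B" for d
    proof -
      have "nsg (cyc d) G" using d abA abB AG by (intro central_cyc_normal) auto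
      moreover have "cyc d \<subseteq> A" using cyc_subset[OF A] d by blast
      ultimately have "cyc d = {1}" using noA by blast
      then show ?thesis using cyc_self[of d] by auto
    qed
    then show ?thesis using A B by auto
  qed
  have cA: "\<alpha> * (inverse b * x) = (inverse b * x) * \<alpha>" if "\<alpha> \<in> A" for \<alpha>
    by (rule factor_centralizes_prime[OF abA D nK xb(4,3) KB1 xb(1,2,5,6,7) that])
  define n where "n = inverse b * x"
  have cAb: "\<alpha> * b = b * \<alpha>" if a: "\<alpha> \<in> A" for \<alpha>
  proof -
    have b: "b = x * inverse n" by (simp add: n_def mgroup_simps)
    have "\<alpha> * n * inverse \<alpha> = n"
      unfolding n_def by (rule mgroup_conj_eqI[OF cA[OF a]])
    moreover have "\<alpha> * x * inverse \<alpha> = x" by (rule mgroup_conj_eqI[OF abA[OF a xb(1)]])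
    moreover have "\<alpha> * b * inverse \<alpha> = (\<alpha> * x * inverse \<alpha>) * inverse (\<alpha> * n * inverse \<alpha>)"
      unfolding b by (simp add: mgroup_simps)
    ultimately have "\<alpha> * b * inverse \<alpha> = b" using b by (simp only:)
    then show ?thesis by (simp only: mgroup_commute_iff)
  qed
  have "nsg (cyc b) G" using xb BG cAb abB by (intro central_cyc_normal) auto
  moreover have "cyc b \<subseteq> B" by (rule cyc_subset[OF B xb(2)])
  ultimately have "cyc b = {1}" using noB by blast
  then have "b = 1" using cyc_self[of b] by auto
  then have "inverse b * x \<in> K \<inter> A" using xb by auto
  then show ?thesis using KA1 xb(6) by auto
qed

end

section \<open>Products of quasinilpotent groups\<close>

definition chief :: "'a::mgroup set \<Rightarrow> 'a set \<Rightarrow> 'a set \<Rightarrow> bool" where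
  "chief G H K \<longleftrightarrow> nsg K G \<and> nsg H G \<and> K \<subset> H \<and>
     (\<forall>N. nsg N G \<and> K \<subseteq> N \<and> N \<subseteq> H \<longrightarrow> N = K \<or> N = H)"

definition inner_on :: "'a::mgroup \<Rightarrow> 'a set \<Rightarrow> 'a set \<Rightarrow> bool" where
  "inner_on g H K \<longleftrightarrow>
     (\<exists>h\<in>H. \<forall>x\<in>H. (g * x * inverse g) * inverse (h * x * inverse h) \<in> K)"

definition qn :: "'a::mgroup set \<Rightarrow> bool" where
  "qn G \<longleftrightarrow> (\<forall>H K. chief G H K \<longrightarrow> (\<forall>g\<in>G. inner_on g H K))"

lemma chief_minn: "minn N G \<Longrightarrow> sg G \<Longrightarrow> chief G N {1}"
  unfolding chief_def minn_def by (auto simp: nsg_trivial dest: nsg_sg)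

lemma ex_chief_below:
  assumes G: "sg G" "finite G" and M: "nsg M G" "M \<noteq> {1}"
  obtains K where "chief G M K"
proof -
  have fin: "finite M" using finite_subset[OF nsg_subset[OF M(1)] G(2)] .
  have "{1} \<subset> M" using M(2) sg_one[OF nsg_sg[OF M(1)]] by auto
  from ex_maximal[OF fin, of "\<lambda>K. nsg K G", OF nsg_trivial[OF G(1)] this]
  obtain K where K: "K \<subset> M" "nsg K G" "\<forall>L. nsg L G \<and> K \<subseteq> L \<and> L \<subset> M \<longrightarrow> L = K" by auto
  have "chief G M K"
    unfolding chief_def
  proof (intro conjI allI impI)
    fix L assume L: "nsg L G \<and> K \<subseteq> L \<and> L \<subseteq> M"
    show "L = K \<or> L = M"
    proof (cases "L = M")
      case False
      then have "L \<subset> M" using L by auto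
      then show ?thesis using K(3) L by auto
    qed simp
  qed (use K M(1) in auto)
  then show ?thesis by (rule that)
qed

lemma qn_abelian_chief:
  assumes "qn G" "chief G H K" "\<And>x y. x \<in> H \<Longrightarrow> y \<in> H \<Longrightarrow> x * y = y * x" "g \<in> G" "x \<in> H"
  shows "cmt g x \<in> K"
proof -
  obtain h where h: "h \<in> H" "\<forall>x\<in>H. (g * x * inverse g) * inverse (h * x * inverse h) \<in> K"
    using assms unfolding qn_def inner_on_def by blast
  have "h * x * inverse h = x" by (rule mgroup_conj_eqI[OF assms(3)[OF h(1) assms(5)]])
  then show ?thesis using bspec[OF h(2) assms(5)] by (simp only: cmt_def)
qed

text \<open>An abelian minimal normal subgroup of a quasinilpotent group is central, since its only
  inner automorphism is the identity.\<close>

lemma qn_abelian_fixed_points: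
  assumes A: "sg A" "finite A" "qn A" and L: "nsg L A" "L \<noteq> {1}"
    "\<And>x y. x \<in> L \<Longrightarrow> y \<in> L \<Longrightarrow> x * y = y * x"
  obtains z where "z \<in> L" "z \<noteq> 1" "\<And>a. a \<in> A \<Longrightarrow> a * z = z * a"
proof -
  obtain M where M: "minn M A" "M \<subseteq> L" using ex_minn[OF A(2) L(1,2)] by blast
  obtain z where z: "z \<in> M" "z \<noteq> 1"
    using sg_nontrivial[OF nsg_sg[OF minn_nsg[OF M(1)]]] minn_nontrivial[OF M(1)] by blast
  have "cmt a z \<in> {1}" if "a \<in> A" for a
    by (rule qn_abelian_chief[OF A(3) chief_minn[OF M(1) A(1)] _ that z(1)]) (use L(3) M(2) in auto)
  then have "a * z = z * a" if "a \<in> A" for a using that cmt_eq_1[of a z] by blast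
  then show ?thesis using that z M(2) by blast
qed

text \<open>An \<open>A\<close>-chief factor of \<open>L\<close> is abelian, hence central by quasinilpotency; the first one that
meets \<open>N1\<close> contains \<open>N1\<close> up to a subgroup disjoint from it.\<close>

lemma qn_abelian_minn_der_central:
  assumes A: "sg A" "finite A" "qn A" and L0: "nsg L0 A" "\<And>x y. x \<in> L0 \<Longrightarrow> y \<in> L0 \<Longrightarrow> x * y = y * x"
    and N1: "minn N1 (der A)" "N1 \<subseteq> L0" and s: "s \<in> der A" and n: "n \<in> N1"
  shows "s * n = n * s"
proof -
  have nN1: "nsg N1 (der A)" using N1 minn_nsg by blast
  \<comment> \<open>\<open>L\<close> is minimal among the normal subgroups of \<open>A\<close>
    between \<open>N1\<close> and \<open>L0\<close>. For a chief factor \<open>L / K\<close> the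
    subgroup \<open>K\<close> thus fails to contain \<open>N1\<close> and meets it trivially;
    quasinilpotency puts \<open>cmt s n\<close> into \<open>K\<close>.\<close>
  let ?S = "{L. nsg L A \<and> L \<subseteq> L0 \<and> N1 \<subseteq> L}"
  have "?S \<subseteq> Pow A" using nsg_subset by auto
  then have fin: "finite ?S" using A(2) finite_subset finite_Pow_iff by metis
  have "L0 \<in> ?S" using L0 N1 by simp
  from finite_has_minimal2[OF fin this]
  obtain L where L: "L \<in> ?S" "\<And>M. M \<in> ?S \<Longrightarrow> M \<subseteq> L \<Longrightarrow> L = M" by auto
  have N1ne: "N1 \<noteq> {1}" "sg N1" using minn_nontrivial[OF N1(1)] nsg_sg[OF nN1] by auto
  have "L \<noteq> {1}" using L(1) N1ne sg_one[OF N1ne(2)] by auto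
  then obtain K where ch: "chief A L K" using ex_chief_below[OF A(1,2)] L(1) by auto
  have K: "K \<subset> L" "nsg K A" using ch unfolding chief_def by auto
  have "N1 \<inter> K = {1} \<or> N1 \<inter> K = N1"
  proof (rule minn_cases[OF N1(1)])
    have "nsg (N1 \<inter> (K \<inter> der A)) (der A)"
      by (rule nsg_Int[OF nN1 nsg_Int_sg[OF K(2) der_sg der_subset[OF A(1)]]])
    moreover have "N1 \<inter> (K \<inter> der A) = N1 \<inter> K" using nsg_subset[OF nN1] by auto
    ultimately show "nsg (N1 \<inter> K) (der A)" by simp
  qed auto
  moreover have "N1 \<inter> K \<noteq> N1"
  proof
    assume "N1 \<inter> K = N1"
    then have "K \<in> ?S" using K L(1) by auto
    then show False using L(2) K(1) by auto
  qed
  ultimately have N1K: "N1 \<inter> K = {1}" by simp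
  have sA: "s \<in> A" using s der_subset[OF A(1)] by auto
  have "cmt s n \<in> K"
    by (rule qn_abelian_chief[OF A(3) ch _ sA]) (use L0(2) L(1) n in auto)
  moreover have "cmt s n \<in> N1" by (rule cmt_nsg_left(2)[OF nN1 n s])
  ultimately have "cmt s n = 1" using N1K by auto
  then show ?thesis by (simp only: cmt_eq_1)
qed

lemma cmt_centralizes:
  assumes G: "sg G" "nsg N G" and gh: "g \<in> G" "h \<in> G"
    and eq: "\<And>u. u \<in> N \<Longrightarrow> g * (h * u * inverse h) * inverse g = h * (g * u * inverse g) * inverse h"
  shows "cmt g h \<in> cent G N"
  unfolding cent_def
proof (intro CollectI conjI ballI)
  show "cmt g h \<in> G" using gh G by (simp add: cmt_def)
  fix v assume v: "v \<in> N"
  define u where "u = inverse (h * g) * v * (h * g)"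
  have "u \<in> N" unfolding u_def by (rule nsg_conj'[OF G(2,1)]) (use gh G v in auto)
  from eq[OF this] have "cmt g h * v * inverse (cmt g h) = v"
    by (simp add: u_def cmt_def mgroup_simps)
  then show "cmt g h * v = v * cmt g h" by (simp only: mgroup_commute_iff)
qed

text \<open>Automorphisms of a cyclic group are power maps, and these commute.\<close>

lemma cyc_normal_conj_commute:
  assumes "nsg (cyc n) G" "sg G" "g \<in> G" "h \<in> G" "u \<in> cyc n"
  shows "g * (h * u * inverse h) * inverse g = h * (g * u * inverse g) * inverse h"
proof -
  have n: "n \<in> cyc n" by (rule cyc_self)
  obtain k where k: "g * n * inverse g = n ^ k" using nsg_conj[OF assms(1,3) n] by (auto simp: cyc_def)
  obtain l where l: "h * n * inverse h = n ^ l" using nsg_conj[OF assms(1,4) n] by (auto simp: cyc_def)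
  obtain i where i: "u = n ^ i" using assms(5) by (auto simp: cyc_def)
  show ?thesis
    unfolding i mgroup_conj_power k l power_mult[symmetric] by (simp add: mult.commute mult.left_commute)
qed

section \<open>Abelian minimal normal subgroups\<close>

context mutperm_product
begin

lemma finA: "finite A" "finite B"
  using G AG BG finite_subset by auto

text \<open>\<open>der A\<close> is subnormal, so it suffices to treat the minimal normal subgroups
  of \<open>der A\<close> inside \<open>N\<close>; these are central in \<open>der A\<close> because
  \<open>A\<close> is quasinilpotent.\<close>

lemma minn_abelian_cmt_der:
  assumes qA: "qn A" and N: "minn N G" and ab: "\<And>x y. x \<in> N \<Longrightarrow> y \<in> N \<Longrightarrow> x * y = y * x"
    and xy: "x \<in> A" "y \<in> A"
  shows "cmt x y \<in> cent G N"
proof -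
  have nN: "nsg N G" using N minn_nsg by blast
  have sd: "sn (der A) G" by (rule der_factor_subnormal[OF G A B GAB mut])
  have nX: "nsg (N \<inter> A) A" by (rule nsg_Int_sg[OF nN A AG])
  have dG: "der A \<subseteq> G" using der_subset[OF A] AG by auto
  have "N \<subseteq> cent G (der A)"
  proof (rule minn_subset_via_subnormal[OF G sd N cent_sg[OF G(1)] order_refl])
    fix L assume L: "minn L (der A)" "L \<subseteq> N"
    have LA: "L \<subseteq> der A" using nsg_subset[OF minn_nsg[OF L(1)]] .
    then have LX: "L \<subseteq> N \<inter> A" using L(2) der_subset[OF A] by auto
    show "L \<subseteq> cent G (der A)"
    proof
      fix n assume n: "n \<in> L"
      have "s * n = n * s" if "s \<in> der A" for s
        by (rule qn_abelian_minn_der_central[OF A finA(1) qA nX _ L(1) LX that n]) (use ab in auto)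
      then show "n \<in> cent G (der A)" using n LA dG by (auto simp: cent_def)
    qed
  qed
  then have "der A \<subseteq> cent G N" using dG by (auto simp: cent_def subset_iff)
  then show ?thesis using cmt_in_der[OF xy] by auto
qed

text \<open>\<open>N\<close> lies in \<open>A\<close>, and \<open>B\<close> normalizes every
  \<open>cyc n\<close> with \<open>n\<close> in \<open>N\<close> because
  \<open>N \<inter> (B \<bullet> cyc n) = cyc n\<close>. So the fixed points of \<open>A\<close> in
  \<open>N\<close> form a normal subgroup of \<open>G\<close>; by quasinilpotency it is nontrivial,
  hence equal to \<open>N\<close>.\<close>

lemma minn_abelian_inside_factor:
  assumes qA: "qn A" and N: "minn N G" and ab: "\<And>x y. x \<in> N \<Longrightarrow> y \<in> N \<Longrightarrow> x * y = y * x"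
    and NA: "N \<inter> A \<noteq> {1}" and NB: "N \<inter> B = {1}" and x: "x \<in> A"
  shows "x \<in> cent G N"
proof -
  have nN: "nsg N G" and sN: "sg N" using N minn_nsg nsg_sg by blast+
  have "(N \<inter> A) \<bullet> (N \<inter> B) = N \<inter> A" unfolding NB by (auto simp: setmul_def)
  then have "nsg (N \<inter> A) G" using Int_product_normal[OF nN] by simp
  then have "N \<inter> A = N" using minn_cases[OF N] NA by blast
  then have NsA: "N \<subseteq> A" by auto
  have bc: "b * n * inverse b \<in> cyc n" if b: "b \<in> B" and n: "n \<in> N" for b n
  proof -
    have cn: "sg (cyc n)" "cyc n \<subseteq> A" using cyc_sg[OF G, of n] cyc_subset[OF A, of n] n NsA AG by auto
    have sP: "sg (B \<bullet> cyc n)" by (rule mutperm_sg[OF mutperm_sym[OF mut] B cn])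
    have "b \<in> B \<bullet> cyc n" "n \<in> B \<bullet> cyc n"
      using sg_setmul_left[OF cn(1), of B] sg_setmul_right[OF B, of "cyc n"] cyc_self[of n] b by auto
    then have "b * n * inverse b \<in> B \<bullet> cyc n" using sg_conj[OF sP] by blast
    then obtain \<beta> c where c: "b * n * inverse b = \<beta> * c" "\<beta> \<in> B" "c \<in> cyc n" by blast
    have "b * n * inverse b \<in> N" using nsg_conj[OF nN _ n] b BG by auto
    moreover have "c \<in> N" using c(3) cyc_subset[OF sN n] by auto
    ultimately have "\<beta> \<in> N" using sg_right_iff[OF sN] c(1) by metis
    then have "\<beta> = 1" using c NB by auto
    then show ?thesis using c by simp
  qed
  define W where "W = N \<inter> cent G A"
  have sW: "sg W" unfolding W_def by (rule sg_Int[OF sN cent_sg[OF G(1)]])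
  have "nsg W (A \<bullet> B)"
  proof (rule nsg_of_factors[OF sW])
    show "W \<subseteq> A \<bullet> B" using nsg_subset[OF nN] GAB by (auto simp: W_def)
    show "a * n * inverse a \<in> W" if "a \<in> A" "n \<in> W" for a n
    proof -
      have "a * n = n * a" using that by (auto simp: W_def cent_def)
      then have "a * n * inverse a = n" by (rule mgroup_conj_eqI)
      then show ?thesis using that by simp
    qed
    show "b * n * inverse b \<in> W" if "b \<in> B" "n \<in> W" for b n
    proof -
      have "n \<in> N" using that by (simp add: W_def)
      then have "b * n * inverse b \<in> cyc n" by (rule bc[OF that(1)])
      then show ?thesis using cyc_subset[OF sW that(2)] by auto
    qed
  qed
  then have nW: "nsg W G" using GAB by simp
  have nNA: "nsg N A" by (rule nsg_mono[OF nN NsA AG])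
  obtain z where z: "z \<in> N" "z \<noteq> 1" "\<And>a. a \<in> A \<Longrightarrow> a * z = z * a"
    using qn_abelian_fixed_points[OF A finA(1) qA nNA minn_nontrivial[OF N] ab] by blast
  have "z \<in> W" using z nsg_subset[OF nN] by (auto simp: W_def cent_def)
  then have "W = N" using minn_cases[OF N nW] z(2) by (auto simp: W_def)
  then have "N \<subseteq> cent G A" by (auto simp: W_def)
  then show ?thesis using x AG by (auto simp: cent_def subset_iff)
qed

text \<open>When both factors have nontrivial fixed points on \<open>N\<close>, no nontrivial normal subgroup of
\<open>G / cent G N\<close> lies in the image of a factor.\<close>

lemma minn_abelian_both_fixed:
  assumes N: "minn N G"
    and A': "\<And>x y. x \<in> A \<Longrightarrow> y \<in> A \<Longrightarrow> cmt x y \<in> cent G N"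
    and B': "\<And>x y. x \<in> B \<Longrightarrow> y \<in> B \<Longrightarrow> cmt x y \<in> cent G N"
    and zA: "z \<in> N" "z \<noteq> 1" "\<And>a. a \<in> A \<Longrightarrow> a * z = z * a"
    and wB: "w \<in> N" "w \<noteq> 1" "\<And>b. b \<in> B \<Longrightarrow> b * w = w * b"
  shows "G = cent G N"
proof -
  have nN: "nsg N G" and sN: "sg N" using N minn_nsg nsg_sg by blast+
  have nC: "nsg (cent G N) G" by (rule cent_nsg[OF nN G(1)])
  obtain \<phi> :: "'a \<Rightarrow> 'a set perm" where \<phi>: "ghom \<phi> G" "\<And>x. x \<in> G \<Longrightarrow> \<phi> x = 1 \<longleftrightarrow> x \<in> cent G N"
    using ex_quotient_ghom[OF G nC] by blast
  interpret Q: mutperm_product "\<phi> ` G" "\<phi> ` A" "\<phi> ` B" by (rule ghom_image[OF \<phi>(1)])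
  have comm: "u * v = v * u"
    if F: "F \<subseteq> G" "\<And>x y. x \<in> F \<Longrightarrow> y \<in> F \<Longrightarrow> cmt x y \<in> cent G N" and uv: "u \<in> \<phi> ` F" "v \<in> \<phi> ` F" for F u v
  proof -
    obtain x y where "u = \<phi> x" "v = \<phi> y" "x \<in> F" "y \<in> F" using uv by blast
    moreover from this have "\<phi> (cmt x y) = 1" using F \<phi>(2) nsg_subset[OF nC] by blast
    ultimately have "cmt u v = 1" using ghom_cmt[OF \<phi>(1) G(1), of x y] F(1) by auto
    then show ?thesis by (simp only: cmt_eq_1)
  qed
  \<comment> \<open>The preimage \<open>?K\<close> still fixes \<open>t\<close>, because
    \<open>cent G N\<close> does. So \<open>N \<inter> cent G ?K\<close> is a nontrivial normal
    subgroup, equals \<open>N\<close>, and \<open>?K\<close> acts trivially on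
    \<open>N\<close>.\<close>
  have no: "M = {1}"
    if F: "F \<subseteq> G" "t \<in> N" "t \<noteq> 1" "\<And>f. f \<in> F \<Longrightarrow> f * t = t * f" and M: "nsg M (\<phi> ` G)" "M \<subseteq> \<phi> ` F" for F t M
  proof -
    let ?K = "{x \<in> G. \<phi> x \<in> M}"
    have nK: "nsg ?K G" by (rule ghom_vimage_nsg[OF \<phi>(1) G(1) M(1)])
    have tK: "g * t = t * g" if g: "g \<in> ?K" for g
    proof -
      obtain f where f: "f \<in> F" "\<phi> g = \<phi> f" using g M(2) by blast
      then have "g * inverse f \<in> cent G N" using ghom_eq_iff[OF \<phi>(1) G(1) \<phi>(2)] g F(1) by auto
      then have "g * inverse f * t = t * (g * inverse f)" using F(2) by (auto simp: cent_def)
      moreover have "f * t = t * f" using F(4) f by blast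
      moreover have "g = g * inverse f * f" by (simp add: mult.assoc)
      ultimately show ?thesis by (metis mult.assoc)
    qed
    have "t \<in> N \<inter> cent G ?K" using F(2) tK nsg_subset[OF nN] by (auto simp: cent_def)
    then have "N \<inter> cent G ?K = N"
      using minn_cases[OF N nsg_Int[OF nN cent_nsg[OF nK G(1)]]] F(3) by auto
    then have NK: "N \<subseteq> cent G ?K" by auto
    have "?K \<subseteq> cent G N"
    proof
      fix x assume x: "x \<in> ?K"
      have "s * x = x * s" if "s \<in> N" for s using subsetD[OF NK that] x by (auto simp: cent_def)
      then show "x \<in> cent G N" using x by (simp add: cent_def)
    qed
    then have "m = 1" if "m \<in> M" for m
      using that nsg_subset[OF M(1)] \<phi>(2) by blast
    then show ?thesis using sg_one[OF nsg_sg[OF M(1)]] by blast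
  qed
  have "\<phi> ` G = {1}"
    by (rule Q.abelian_product_trivial[OF comm[OF AG A'] comm[OF BG B'] no[OF AG zA] no[OF BG wB]])
  then show ?thesis using \<phi>(2) nsg_subset[OF nC] by blast
qed

text \<open>Only mixed commutators remain after \<open>minn_abelian_cmt_der\<close>. If
  \<open>N\<close> meets neither factor it has prime order, so its automorphisms commute; if it
  meets just one, that factor centralizes it; if it meets both, \<open>G\<close> does.\<close>

lemma cmt_centralizes_minn_abelian:
  assumes qA: "qn A" and qB: "qn B" and N: "minn N G"
    and ab: "\<And>x y. x \<in> N \<Longrightarrow> y \<in> N \<Longrightarrow> x * y = y * x"
    and xy: "x \<in> G" "y \<in> G"
  shows "cmt x y \<in> cent G N"
proof -
  interpret S: mutperm_product G B A by (rule swap)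
  have nN: "nsg N G" and sN: "sg N" using N minn_nsg nsg_sg by blast+
  have nC: "nsg (cent G N) G" by (rule cent_nsg[OF nN G(1)])
  have dA: "cmt x y \<in> cent G N" if "x \<in> A" "y \<in> A" for x y
    by (rule minn_abelian_cmt_der[OF qA N ab that])
  have dB: "cmt x y \<in> cent G N" if "x \<in> B" "y \<in> B" for x y
    by (rule S.minn_abelian_cmt_der[OF qB N ab that])
  consider "N \<inter> A = {1}" "N \<inter> B = {1}" | "N \<inter> A \<noteq> {1}" "N \<inter> B = {1}"
    | "N \<inter> A = {1}" "N \<inter> B \<noteq> {1}" | "N \<inter> A \<noteq> {1}" "N \<inter> B \<noteq> {1}" by blast
  then have "cmt a b \<in> cent G N" if "a \<in> A" "b \<in> B" for a b
  proof cases
    case 1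
    obtain u v p where "prime p" "card N = p" "inverse v * u \<in> N" "inverse v * u \<noteq> 1"
      by (rule minn_disjoint_factors[OF N 1])
    then have Nc: "N = cyc (inverse v * u)" using prime_order_cyc[OF sN] by blast
    show ?thesis
    proof (rule cmt_centralizes[OF G(1) nN])
      show "a \<in> G" "b \<in> G" using that AG BG by auto
      then show "a * (b * u * inverse b) * inverse a = b * (a * u * inverse a) * inverse b" if "u \<in> N" for u
        using that nN G(1) unfolding Nc by (intro cyc_normal_conj_commute)
    qed
  next
    case 2
    have "a \<in> cent G N" by (rule minn_abelian_inside_factor[OF qA N ab 2 that(1)])
    then show ?thesis using cmt_nsg_left(1)[OF nC] that BG by auto
  next
    case 3
    have "b \<in> cent G N" by (rule S.minn_abelian_inside_factor[OF qB N ab 3(2,1) that(2)])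
    then show ?thesis using cmt_nsg_left(2)[OF nC] that AG by auto
  next
    case 4
    obtain z where z: "z \<in> N \<inter> A" "z \<noteq> 1" "\<And>a. a \<in> A \<Longrightarrow> a * z = z * a"
      using qn_abelian_fixed_points[OF A finA(1) qA nsg_Int_sg[OF nN A AG] 4(1)] ab by blast
    obtain w where w: "w \<in> N \<inter> B" "w \<noteq> 1" "\<And>b. b \<in> B \<Longrightarrow> b * w = w * b"
      using qn_abelian_fixed_points[OF B finA(2) qB nsg_Int_sg[OF nN B BG] 4(2)] ab by blast
    have "G = cent G N"
      using minn_abelian_both_fixed[OF N dA dB _ z(2,3) _ w(2,3)] z(1) w(1) by blast
    then have "a \<in> cent G N" using that AG by auto
    then show ?thesis using cmt_nsg_left(1)[OF nC] that BG by auto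
  qed
  then show ?thesis using cmt_of_factors[OF G(1) A B GAB nC dA dB _ xy] by blast
qed

end

section \<open>Nonabelian minimal normal subgroups\<close>

lemma qn_centerless_decomposition:
  assumes "sg A" "finite A" "qn A" "nsg L A" "cent L L = {1}" "a \<in> A"
  shows "\<exists>x\<in>L. \<exists>c\<in>cent A L. a = x * c"
  using assms(4-)
\<comment> \<open>Split off a minimal normal \<open>M\<close> of \<open>A\<close> inside
  \<open>L\<close>: some \<open>m\<close> in \<open>M\<close> acts on \<open>M\<close> as
  \<open>a\<close> does, so \<open>inverse m * a\<close> centralizes \<open>M\<close>. The rest
  \<open>L \<inter> cent A M\<close> again has trivial centre, and it is smaller, since otherwise
  \<open>M\<close> would be central in \<open>L\<close>.\<close>
proof (induction "card L" arbitrary: L a rule: less_induct)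
  case less
  show ?case
  proof (cases "L = {1}")
    case True
    then have "a \<in> cent A L" using less(4) by (auto simp: cent_def)
    then have "1 \<in> L \<and> a \<in> cent A L \<and> a = 1 * a" using True by simp
    then show ?thesis by blast
  next
    case False
    have sL: "sg L" "L \<subseteq> A" using nsg_sg[OF less(2)] nsg_subset[OF less(2)] by auto
    obtain M where M: "minn M A" "M \<subseteq> L" using ex_minn[OF assms(2) less(2) False] by blast
    have nM: "nsg M A" "sg M" using minn_nsg[OF M(1)] nsg_sg[OF minn_nsg[OF M(1)]] by auto
    have dec: "\<exists>m\<in>M. \<exists>c\<in>cent A M. g = m * c" if g: "g \<in> A" for g
    proof -
      obtain m where m: "m \<in> M" "\<forall>x\<in>M. (g * x * inverse g) * inverse (m * x * inverse m) \<in> {1}"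
        using assms(3) chief_minn[OF M(1) assms(1)] g unfolding qn_def inner_on_def by blast
      have mA: "m \<in> A" using m nsg_subset[OF nM(1)] by auto
      have "inverse m * g \<in> cent A M"
        unfolding cent_def
      proof (intro CollectI conjI ballI)
        show "inverse m * g \<in> A" using mA g assms(1) by simp
        fix x assume x: "x \<in> M"
        have "(g * x * inverse g) * inverse (m * x * inverse m) = 1" using bspec[OF m(2) x] by simp
        then have "inverse (g * x * inverse g) = inverse (m * x * inverse m)" by (simp only: mgroup_inverse_eq)
        then have "g * x * inverse g = m * x * inverse m" by (simp only: mgroup_inverse_inject)
        then have "inverse m * (g * x * inverse g) * m = x" by (simp add: mult.assoc)
        then have "(inverse m * g) * x * inverse (inverse m * g) = x" by (simp add: mgroup_simps)
        then show "inverse m * g * x = x * (inverse m * g)" by (simp only: mgroup_commute_iff)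
      qed
      moreover have "g = m * (inverse m * g)" by simp
      ultimately show ?thesis using m(1) by blast
    qed
    define L2 where "L2 = L \<inter> cent A M"
    have nL2: "nsg L2 A" unfolding L2_def by (rule nsg_Int[OF less(2) cent_nsg[OF nM(1) assms(1)]])
    have Ldec: "\<exists>m\<in>M. \<exists>c\<in>L2. x = m * c" if x: "x \<in> L" for x
    proof -
      obtain m c where mc: "m \<in> M" "c \<in> cent A M" "x = m * c" using dec x sL by blast
      then have "c \<in> L" using sg_left_iff[OF sL(1), of m c] M(2) x by auto
      then show ?thesis using mc L2_def by blast
    qed
    have "cent L2 L2 \<subseteq> cent L L"
    proof
      fix z assume z: "z \<in> cent L2 L2"
      have "z * x = x * z" if x: "x \<in> L" for x
      proof -
        obtain m c where mc: "m \<in> M" "c \<in> L2" "x = m * c" using Ldec x by blast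
        have "z * m = m * z" using z mc by (auto simp: cent_def L2_def)
        moreover have "z * c = c * z" using z mc by (auto simp: cent_def)
        ultimately show ?thesis using mc(3) by (metis mult.assoc)
      qed
      then show "z \<in> cent L L" using z by (auto simp: cent_def L2_def)
    qed
    moreover have "1 \<in> cent L2 L2" using sg_one[OF cent_sg[OF nsg_sg[OF nL2]]] .
    ultimately have cL2: "cent L2 L2 = {1}" using less(3) by auto
    have "L2 \<noteq> L"
    proof
      assume eq: "L2 = L"
      have LM: "L \<subseteq> cent A M" using eq by (auto simp: L2_def)
      have "M \<subseteq> cent L L"
      proof
        fix z assume z: "z \<in> M"
        have "z * s = s * z" if "s \<in> L" for s using subsetD[OF LM that] z by (simp add: cent_def)
        then show "z \<in> cent L L" using z M(2) by (auto simp: cent_def)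
      qed
      then show False using less(3) minn_nontrivial[OF M(1)] sg_one[OF nM(2)] by auto
    qed
    then have "L2 \<subset> L" by (auto simp: L2_def)
    then have "card L2 < card L" using finite_subset[OF sL(2) assms(2)] psubset_card_mono by blast
    then have IH: "\<exists>x\<in>L2. \<exists>c\<in>cent A L2. g = x * c" if "g \<in> A" for g
      using less(1) nL2 cL2 that by blast
    obtain m c where mc: "m \<in> M" "c \<in> cent A M" "a = m * c" using dec less(4) by blast
    have "c \<in> A" using mc by (simp add: cent_def)
    then obtain x d where xd: "x \<in> L2" "d \<in> cent A L2" "c = x * d" using IH by blast
    have xcM: "x \<in> cent A M" using xd by (simp add: L2_def)
    have "d \<in> cent A M" using sg_left_iff[OF cent_sg[OF assms(1)] xcM] mc(2) xd(3) by metis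
    have "d \<in> cent A L"
      unfolding cent_def
    proof (intro CollectI conjI ballI)
      show "d \<in> A" using xd by (simp add: cent_def)
      fix y assume "y \<in> L"
      then obtain m' c' where y: "m' \<in> M" "c' \<in> L2" "y = m' * c'" using Ldec by blast
      have "d * m' = m' * d" using \<open>d \<in> cent A M\<close> y by (auto simp: cent_def)
      moreover have "d * c' = c' * d" using xd y by (auto simp: cent_def)
      ultimately show "d * y = y * d" using y(3) by (metis mult.assoc)
    qed
    moreover have "m * x \<in> L" using mc M xd sL by (auto simp: L2_def)
    moreover have "a = (m * x) * d" using mc xd by (simp add: mult.assoc)
    ultimately show ?thesis by blast
  qed
qed

lemma minn_normalizes_subnormal:
  assumes G: "sg G" "finite G" and S: "sn S G" and N: "minn N G" and ns: "n \<in> N" "s \<in> S"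
  shows "n * s * inverse n \<in> S"
proof -
  have sS: "sg S" "S \<subseteq> G" using sn_sg sn_subset S G by blast+
  let ?Z = "{g \<in> G. cj g S = S}"
  have "N \<subseteq> ?Z"
  proof (rule minn_subset_via_subnormal[OF G S N sg_normalizer[OF G(1)]])
    show "cent G S \<subseteq> ?Z"
    proof
      fix g assume g: "g \<in> cent G S"
      have "g * s * inverse g = s" if "s \<in> S" for s
        using that g by (intro mgroup_conj_eqI) (auto simp: cent_def)
      then have "cj g S = S" by (simp add: cj_def)
      then show "g \<in> ?Z" using g by (simp add: cent_def)
    qed
    fix L assume "minn L S"
    then have "L \<subseteq> S" using minn_nsg nsg_subset by blast
    then show "L \<subseteq> ?Z" using cj_sg_self[OF sS(1)] sS(2) by auto
  qed
  then have "cj n S = S" using ns by auto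
  then show ?thesis using ns by (auto simp: cj_def)
qed

locale minn_nonabelian =
  fixes G N :: "'a::mgroup set"
  assumes G: "sg G" "finite G" and N: "minn N G" and nonab: "\<exists>x\<in>N. \<exists>y\<in>N. x * y \<noteq> y * x"
begin

lemma nN: "nsg N G" and sN: "sg N" and NG: "N \<subseteq> G" and finN: "finite N"
  using N G minn_nsg nsg_sg nsg_subset finite_subset by metis+

lemma socle: "N = gen (\<Union>{L. minn L N \<and> L \<subseteq> N})"
  by (rule minn_generated[OF G nN N order_refl])

lemma cent_self: "cent N N = {1}"
proof -
  have eq: "cent N N = N \<inter> cent G N" using NG by (auto simp: cent_def)
  have "nsg (cent N N) G" unfolding eq by (rule nsg_Int[OF nN cent_nsg[OF nN G(1)]])
  then have "cent N N = {1} \<or> cent N N = N" using minn_cases[OF N] by (auto simp: cent_def)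
  then show ?thesis using nonab by (auto simp: cent_def set_eq_iff)
qed

text \<open>Distinct minimal normal subgroups of \<open>N\<close> commute elementwise and all of
  them generate \<open>N\<close>, so an abelian one would lie in the trivial centre of
  \<open>N\<close>.\<close>

lemma minn_inside_nonabelian:
  assumes L: "minn L N"
  shows "\<exists>x\<in>L. \<exists>y\<in>L. x * y \<noteq> y * x"
proof (rule ccontr)
  assume ab: "\<not> ?thesis"
  have nL: "nsg L N" using L minn_nsg by blast
  have "x * y = y * x" if x: "x \<in> L" and y: "y \<in> N" for x y
  proof -
    have y': "y \<in> gen (\<Union>{L. minn L N \<and> L \<subseteq> N})" using y socle by simp
    have x': "x \<in> gen L" using x gen_superset by auto
    show ?thesis
    proof (rule gen_commute[OF _ x' y'])
      fix u v assume u: "u \<in> L" and "v \<in> \<Union>{L. minn L N \<and> L \<subseteq> N}"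
      then obtain M where M: "minn M N" "v \<in> M" by auto
      have nM: "nsg M N" using M minn_nsg by blast
      have "L \<inter> M = {1} \<or> L \<inter> M = L" using minn_cases[OF L nsg_Int[OF nL nM]] by auto
      moreover have "L \<inter> M = {1} \<or> L \<inter> M = M" using minn_cases[OF M(1) nsg_Int[OF nL nM]] by auto
      ultimately have "L \<inter> M = {1} \<or> L = M" by auto
      then show "u * v = v * u"
        using nsg_disjoint_commute[OF nL nM _ u M(2)] ab u M(2) by auto
    qed
  qed
  then have "L \<subseteq> cent N N" using nsg_subset[OF nL] by (auto simp: cent_def)
  then show False using cent_self minn_nontrivial[OF L] sg_one[OF nsg_sg[OF nL]] by auto
qed

text \<open>The centre of \<open>L\<close> is normal in \<open>N\<close>, and a minimal normal
  subgroup of \<open>N\<close> inside it would be abelian.\<close>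

lemma cent_normal_self:
  assumes L: "nsg L N"
  shows "cent L L = {1}"
proof (rule ccontr)
  assume "cent L L \<noteq> {1}"
  have eq: "cent L L = L \<inter> cent N L" using nsg_subset[OF L] by (auto simp: cent_def)
  have "nsg (cent L L) N" unfolding eq by (rule nsg_Int[OF L cent_nsg[OF L sN]])
  then obtain M where M: "minn M N" "M \<subseteq> cent L L" using ex_minn[OF finN _ \<open>cent L L \<noteq> {1}\<close>] by blast
  then have "x * y = y * x" if "x \<in> M" "y \<in> M" for x y
    using that by (auto simp: cent_def subset_iff)
  then show False using minn_inside_nonabelian[OF M(1)] by blast
qed

text \<open>Each minimal normal subgroup of \<open>N\<close> lies in \<open>L\<close> or meets it
  trivially and then centralizes it; together they generate \<open>N\<close>.\<close>

lemma normal_complement: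
  assumes L: "nsg L N"
  shows "N = L \<bullet> cent N L"
proof -
  have nC: "nsg (cent N L) N" by (rule cent_nsg[OF L sN])
  have nLC: "nsg (L \<bullet> cent N L) N" by (rule nsg_setmul[OF L nC sN])
  have "M \<subseteq> L \<bullet> cent N L" if M: "minn M N" for M
  proof -
    have nM: "nsg M N" using M minn_nsg by blast
    have "M \<inter> L = {1} \<or> M \<inter> L = M" using minn_cases[OF M nsg_Int[OF nM L]] by auto
    then show ?thesis
    proof
      assume dis: "M \<inter> L = {1}"
      have "M \<subseteq> cent N L"
        using nsg_disjoint_commute[OF nM L dis] nsg_subset[OF nM] by (auto simp: cent_def)
      then show ?thesis using sg_setmul_right[OF nsg_sg[OF L]] by auto
    next
      assume "M \<inter> L = M"
      then show ?thesis using sg_setmul_left[OF nsg_sg[OF nC], of L] by auto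
    qed
  qed
  then have "\<Union>{M. minn M N \<and> M \<subseteq> N} \<subseteq> L \<bullet> cent N L" by auto
  then have "gen (\<Union>{M. minn M N \<and> M \<subseteq> N}) \<subseteq> L \<bullet> cent N L" by (rule gen_least[OF nsg_sg[OF nLC]])
  then show ?thesis using socle nsg_subset[OF nLC] by auto
qed

lemma perfect: "der N = N"
proof -
  have "nsg (der N) G" by (rule der_nsg[OF nN G(1)])
  moreover have "der N \<noteq> {1}"
  proof
    assume "der N = {1}"
    then have "cmt x y = 1" if "x \<in> N" "y \<in> N" for x y using cmt_in_der[OF that] by simp
    then show False using nonab by (metis cmt_eq_1)
  qed
  ultimately show ?thesis using minn_cases[OF N] der_subset[OF sN] by blast
qed

text \<open>If \<open>u\<close> centralizes \<open>L\<close>, all commutators of \<open>u\<close>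
  with \<open>N\<close> lie in \<open>M\<close>. Dividing \<open>u\<close> by its component in
  \<open>M\<close> leaves an element of \<open>cent N M\<close> whose commutators lie in the trivial
  centre of \<open>M\<close>; it is central in \<open>N\<close> and thus trivial.\<close>

lemma cent_subset_of_cover:
  assumes X: "nsg L N" and Y: "nsg M N" and cover: "N = L \<bullet> M"
  shows "cent N L \<subseteq> M"
proof
  fix u assume u: "u \<in> cent N L"
  then have uN: "u \<in> N" by (simp add: cent_def)
  have uM: "cmt u n \<in> M" if n: "n \<in> N" for n
  proof -
    obtain x y where xy: "n = x * y" "x \<in> L" "y \<in> M" using n cover by blast
    have "u * x = x * u" using u xy by (simp add: cent_def)
    then have "cmt u n = (x * u) * y * inverse u * inverse y * inverse x"
      unfolding cmt_def xy(1) by (metis mgroup_inverse_mult mult.assoc)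
    then have "cmt u n = x * cmt u y * inverse x" by (simp add: cmt_def mult.assoc)
    moreover have "cmt u y \<in> M" by (rule cmt_nsg_left(2)[OF Y xy(3) uN])
    ultimately show ?thesis using nsg_conj[OF Y, of x] xy nsg_subset[OF X] by auto
  qed
  obtain y z where yz: "u = y * z" "y \<in> M" "z \<in> cent N M" using uN normal_complement[OF Y] by blast
  have zN: "z \<in> N" using yz by (simp add: cent_def)
  let ?T = "{t \<in> N. \<forall>n\<in>N. cmt t n \<in> M}"
  have T: "sg ?T" by (rule cmt_centralizer_sg[OF Y sN order_refl])
  have yT: "y \<in> ?T" using yz(2) cmt_nsg_left(1)[OF Y yz(2)] nsg_subset[OF Y] by auto
  have "y * z \<in> ?T" using uM uN yz(1) by auto
  then have zT: "z \<in> ?T" using sg_left_iff[OF T yT] by blast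
  have nC: "nsg (cent N M) N" by (rule cent_nsg[OF Y sN])
  have "z * n = n * z" if n: "n \<in> N" for n
  proof -
    have "cmt z n \<in> M" using zT n by blast
    moreover have "cmt z n \<in> cent N M" by (rule cmt_nsg_left(1)[OF nC yz(3) n])
    ultimately have "cmt z n \<in> cent M M" by (simp add: cent_def)
    then have "cmt z n = 1" using cent_normal_self[OF Y] by simp
    then show ?thesis by (simp only: cmt_eq_1)
  qed
  then have "z \<in> cent N N" using zN by (simp add: cent_def)
  then have "z = 1" using cent_self by simp
  then show "u \<in> M" using yz by simp
qed

lemma conj_cent:
  assumes g: "g \<in> G" "\<And>x. x \<in> L \<Longrightarrow> g * x = x * g" and L: "L \<subseteq> N" and u: "u \<in> cent N L"
  shows "g * u * inverse g \<in> cent N L"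
  unfolding cent_def
proof (intro CollectI conjI ballI)
  show "g * u * inverse g \<in> N" using nsg_conj[OF nN g(1)] u by (simp add: cent_def)
  fix x assume x: "x \<in> L"
  have "g * x * inverse g = x" using g(2)[OF x] by (rule mgroup_conj_eqI)
  then have "g * u * inverse g * x = g * (u * x) * inverse g"
    by (metis inverse_mult_cancel mult.assoc)
  also have "u * x = x * u" using u x by (simp add: cent_def)
  also have "g * (x * u) * inverse g = (g * x * inverse g) * (g * u * inverse g)" by (simp add: mult.assoc)
  finally show "g * u * inverse g * x = x * (g * u * inverse g)"
    using \<open>g * x * inverse g = x\<close> by simp
qed

text \<open>\<open>c\<close> moves only \<open>cent N L \<subseteq> M\<close>, and \<open>d\<close> only \<open>cent N M \<subseteq> L\<close>: disjoint supports.\<close>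

lemma cmt_centralizes_of_cover:
  assumes L: "nsg L N" and M: "nsg M N" and cover: "N = L \<bullet> M" "N = M \<bullet> L"
    and c: "c \<in> G" "\<And>x. x \<in> L \<Longrightarrow> c * x = x * c" and d: "d \<in> G" "\<And>y. y \<in> M \<Longrightarrow> d * y = y * d"
  shows "cmt c d \<in> cent G N"
proof (rule cmt_centralizes[OF G(1) nN c(1) d(1)])
  fix u assume u: "u \<in> N"
  have CL: "cent N L \<subseteq> M" by (rule cent_subset_of_cover[OF L M cover(1)])
  have CM: "cent N M \<subseteq> L" by (rule cent_subset_of_cover[OF M L cover(2)])
  have fc: "c * x * inverse c = x" if "x \<in> L" for x using c(2)[OF that] by (rule mgroup_conj_eqI)
  have fd: "d * y * inverse d = y" if "y \<in> M" for y using d(2)[OF that] by (rule mgroup_conj_eqI)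
  have sLM: "sg L" "sg M" using L M nsg_sg by auto
  \<comment> \<open>Split \<open>u = y * z\<close> with \<open>y\<close> in \<open>M\<close> and
    \<open>z\<close> in \<open>cent N M\<close>, which lies in \<open>L\<close>. On
    \<open>z\<close>, conjugation by \<open>c\<close> is the identity and \<open>d\<close> stays
    inside \<open>L\<close>; on \<open>y\<close>, conjugation by \<open>d\<close> is the identity
    and \<open>c\<close> stays inside \<open>M\<close>.\<close>
  have P1: "c * (d * z * inverse d) * inverse c = d * (c * z * inverse c) * inverse d" if z: "z \<in> cent N M" for z
  proof -
    have "d * z * inverse d \<in> cent N M" using conj_cent[OF d nsg_subset[OF M] z] .
    then have "d * z * inverse d \<in> L" "z \<in> L" using CM z by auto
    then show ?thesis by (simp only: fc)
  qed
  have P2: "c * (d * y * inverse d) * inverse c = d * (c * y * inverse c) * inverse d" if y: "y \<in> M" for y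
  proof -
    obtain x v where xv: "y = x * v" "x \<in> L" "v \<in> cent N L"
      using y nsg_subset[OF M] normal_complement[OF L] by blast
    have vM: "v \<in> M" using xv CL by auto
    have xM: "x \<in> M" using sg_right_iff[OF sLM(2) vM, of x] xv(1) y by simp
    have "c * v * inverse c \<in> M" using conj_cent[OF c nsg_subset[OF L] xv(3)] CL by auto
    then have "(c * x * inverse c) * (c * v * inverse c) \<in> M" using fc[OF xv(2)] xM sLM by simp
    then have "c * y * inverse c \<in> M" using xv(1) by (simp add: mult.assoc)
    then show ?thesis by (simp only: fd[OF y] fd)
  qed
  obtain y z where yz: "u = y * z" "y \<in> M" "z \<in> cent N M" using u normal_complement[OF M] by blast
  have m: "g * (h * u * inverse h) * inverse g
      = (g * (h * y * inverse h) * inverse g) * (g * (h * z * inverse h) * inverse g)" for g h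
    unfolding yz(1) by (simp add: mult.assoc)
  show "c * (d * u * inverse d) * inverse c = d * (c * u * inverse c) * inverse d"
    unfolding m[of c d] m[of d c] P1[OF yz(3)] P2[OF yz(2)] ..
qed

end

lemma cmt_eqm:
  assumes W: "nsg W G" "sg G" and in_G: "a \<in> G" "a' \<in> G" "c \<in> G" "c' \<in> G"
    and eq: "eqm W a c" "eqm W a' c'" and cc: "cmt c c' \<in> W"
  shows "cmt a a' \<in> W"
proof -
  have sW: "sg W" using W nsg_sg by blast
  have "eqm W (a * a') (c * c')" by (rule eqm_mult[OF W(1) in_G(1) eq])
  moreover have "eqm W (c * c') (c' * c)" using cc by (simp add: cmt_mem_iff)
  moreover have "eqm W (a' * a) (c' * c)" by (rule eqm_mult[OF W(1) in_G(2) eq(2,1)])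
  ultimately show ?thesis
    unfolding cmt_mem_iff using eqm_trans[OF sW] eqm_sym[OF sW] by metis
qed

context mutperm_product
begin

text \<open>\<open>N\<close> normalizes the subnormal \<open>der A\<close>, so \<open>L\<close> is
  normal in \<open>N\<close> with trivial centre, and \<open>qn_centerless_decomposition\<close>
  corrects \<open>a\<close> by an element of \<open>L\<close>. A commutator \<open>w\<close> of
  elements of \<open>cent A L\<close> centralizes \<open>L\<close>. For \<open>u\<close> in
  \<open>cent N L\<close>, \<open>cmt w u\<close> lies in \<open>L\<close> and centralizes
  \<open>L\<close>, so it is trivial; hence \<open>w\<close> centralizes
  \<open>N = L \<bullet> cent N L\<close>.\<close>

lemma nonabelian_trace_decomposition:
  assumes qA: "qn A" and N: "minn_nonabelian G N"
  defines "L \<equiv> N \<inter> der A"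
  shows "nsg L N" "a \<in> A \<Longrightarrow> \<exists>c\<in>cent A L. eqm (N \<bullet> cent G N) a c"
    "c \<in> cent A L \<Longrightarrow> c' \<in> cent A L \<Longrightarrow> cmt c c' \<in> cent G N"
proof -
  interpret N: minn_nonabelian G N by fact
  have sd: "sn (der A) G" by (rule der_factor_subnormal[OF G A B GAB mut])
  have dA: "der A \<subseteq> A" by (rule der_subset[OF A])
  have norm: "n * s * inverse n \<in> der A" if "n \<in> N" "s \<in> der A" for n s
    by (rule minn_normalizes_subnormal[OF G sd N.N that])
  have sL: "sg L" unfolding L_def by (rule sg_Int[OF N.sN der_sg])
  show nL: "nsg L N"
    by (rule nsgI[OF sL]) (use norm N.sN in \<open>auto simp: L_def\<close>)
  have "nsg (N \<inter> A \<inter> der A) A"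
    by (rule nsg_Int[OF nsg_Int_sg[OF N.nN A AG] der_nsg[OF nsg_self[OF A] A]])
  moreover have "N \<inter> A \<inter> der A = L" using dA by (auto simp: L_def)
  ultimately have nLA: "nsg L A" by simp
  have cL: "cent L L = {1}" by (rule N.cent_normal_self[OF nL])
  have nC: "nsg (cent G N) G" by (rule cent_nsg[OF N.nN G(1)])
  show "\<exists>c\<in>cent A L. eqm (N \<bullet> cent G N) a c" if a: "a \<in> A"
  proof -
    obtain x c where xc: "x \<in> L" "c \<in> cent A L" "a = x * c"
      using qn_centerless_decomposition[OF A finA(1) qA nLA cL a] by blast
    have "x \<in> N \<bullet> cent G N" using sg_setmul_left[OF nsg_sg[OF nC], of N] xc by (auto simp: L_def)
    then have "eqm (N \<bullet> cent G N) a c" using xc by (simp add: eqm_def mult.assoc)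
    then show ?thesis using xc by blast
  qed
  show "cmt c c' \<in> cent G N" if cc: "c \<in> cent A L" "c' \<in> cent A L"
  proof -
    define w where "w = cmt c c'"
    have wA: "w \<in> cent A L" using cc cent_sg[OF A, of L] by (simp add: w_def cmt_def)
    have wd: "w \<in> der A" unfolding w_def by (rule cmt_in_der) (use cc in \<open>auto simp: cent_def\<close>)
    have wG: "w \<in> G" using wd dA AG by auto
    have wL: "w * x = x * w" if "x \<in> L" for x using wA that by (simp add: cent_def)
    have wC: "w * u = u * w" if u: "u \<in> cent N L" for u
    proof -
      have uN: "u \<in> N" using u by (simp add: cent_def)
      have "u * inverse w * inverse u \<in> der A" using norm[OF uN] wd sg_inverse[OF der_sg] by blast
      then have "w * (u * inverse w * inverse u) \<in> der A" using wd by (rule sg_mult[OF der_sg, rotated])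
      then have 1: "cmt w u \<in> der A" by (simp add: cmt_def mult.assoc)
      have 2: "cmt w u \<in> N" by (rule cmt_nsg_left(2)[OF N.nN uN wG])
      have "w * u * inverse w \<in> cent N L" by (rule N.conj_cent[OF wG wL nsg_subset[OF nL] u])
      then have "cmt w u \<in> cent N L"
        unfolding cmt_def by (rule sg_mult[OF cent_sg[OF N.sN] _ sg_inverse[OF cent_sg[OF N.sN] u]])
      then have "cmt w u \<in> cent L L" using 1 2 by (simp add: cent_def L_def)
      then have "cmt w u = 1" using cL by simp
      then show ?thesis by (simp only: cmt_eq_1)
    qed
    have "w * n = n * w" if n: "n \<in> N" for n
    proof -
      have "n \<in> L \<bullet> cent N L" using n N.normal_complement[OF nL] by (simp only:)
      then obtain x u where xu: "n = x * u" "x \<in> L" "u \<in> cent N L" by blast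
      then show ?thesis using wL[OF xu(2)] wC[OF xu(3)] by (metis mult.assoc)
    qed
    then show ?thesis using wG unfolding w_def cent_def by blast
  qed
qed

text \<open>\<open>N\<close> is the product of its intersections with \<open>A\<close> and
  \<open>B\<close>, since otherwise both are trivial and \<open>N\<close> has prime order. Modulo
  \<open>(N \<inter> der A) \<bullet> (N \<inter> der B)\<close> these become abelian, so the
  quotient is metabelian by Ito's theorem; but \<open>N\<close> is perfect.\<close>

lemma nonabelian_trace_cover:
  assumes N: "minn_nonabelian G N" and nL: "nsg (N \<inter> der A) N" and nM: "nsg (N \<inter> der B) N"
  shows "N = (N \<inter> der A) \<bullet> (N \<inter> der B)"
proof -
  interpret N: minn_nonabelian G N by fact
  define M where "M = (N \<inter> der A) \<bullet> (N \<inter> der B)"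
  have nMM: "nsg M N" unfolding M_def by (rule nsg_setmul[OF nL nM N.sN])
  have "(N \<inter> A) \<bullet> (N \<inter> B) = {1} \<or> (N \<inter> A) \<bullet> (N \<inter> B) = N"
    by (rule minn_cases[OF N.N Int_product_normal[OF N.nN]])
       (rule setmul_subset[OF N.sN]; auto)
  moreover have "(N \<inter> A) \<bullet> (N \<inter> B) \<noteq> {1}"
  proof
    assume triv: "(N \<inter> A) \<bullet> (N \<inter> B) = {1}"
    have "N \<inter> A \<subseteq> (N \<inter> A) \<bullet> (N \<inter> B)" by (rule sg_setmul_left[OF sg_Int[OF N.sN B]])
    then have NA: "N \<inter> A = {1}" using triv N.sN A by auto
    have "N \<inter> B \<subseteq> (N \<inter> A) \<bullet> (N \<inter> B)" by (rule sg_setmul_right[OF sg_Int[OF N.sN A]])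
    then have NB: "N \<inter> B = {1}" using triv N.sN B by auto
    obtain u v p where uv: "prime p" "card N = p" "inverse v * u \<in> N" "inverse v * u \<noteq> 1"
      by (rule minn_disjoint_factors[OF N.N NA NB])
    have Nc: "N = cyc (inverse v * u)" using prime_order_cyc[OF N.sN _ uv(3,4)] uv(1,2) by blast
    have "x * y = y * x" if "x \<in> N" "y \<in> N" for x y
      using that unfolding Nc by (auto simp: cyc_def power_add[symmetric] add.commute)
    then show False using N.nonab by blast
  qed
  ultimately have NAB: "N = (N \<inter> A) \<bullet> (N \<inter> B)" by simp
  obtain \<phi> :: "'a \<Rightarrow> 'a set perm" where \<phi>: "ghom \<phi> N" "\<And>x. x \<in> N \<Longrightarrow> \<phi> x = 1 \<longleftrightarrow> x \<in> M"
    using ex_quotient_ghom[OF N.sN N.finN nMM] by blast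
  have ab: "u * v = v * u"
    if F: "sg F" "N \<inter> der F \<subseteq> M" and uv: "u \<in> \<phi> ` (N \<inter> F)" "v \<in> \<phi> ` (N \<inter> F)" for F u v
  proof -
    obtain x y where xy: "u = \<phi> x" "v = \<phi> y" "x \<in> N \<inter> F" "y \<in> N \<inter> F" using uv by blast
    have "cmt x y \<in> N \<inter> der F" using xy cmt_in_der[of x F y] N.sN by (simp add: cmt_def)
    then have "\<phi> (cmt x y) = 1" using \<phi>(2) F(2) by blast
    then have "cmt u v = 1" using ghom_cmt[OF \<phi>(1) N.sN, of x y] xy by auto
    then show ?thesis by (simp only: cmt_eq_1)
  qed
  have M: "N \<inter> der A \<subseteq> M" "N \<inter> der B \<subseteq> M"
    unfolding M_def using sg_setmul_left[OF nsg_sg[OF nM]] sg_setmul_right[OF nsg_sg[OF nL]] by auto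
  have s: "sg (\<phi> ` N)" "sg (\<phi> ` (N \<inter> A))" "sg (\<phi> ` (N \<inter> B))"
    using ghom_image_sg[OF \<phi>(1) N.sN] N.sN sg_Int[OF N.sN A] sg_Int[OF N.sN B] by auto
  have prod: "\<phi> ` N = \<phi> ` (N \<inter> A) \<bullet> \<phi> ` (N \<inter> B)"
    using ghom_image_setmul[OF \<phi>(1), of "N \<inter> A" "N \<inter> B"] NAB by simp
  have comm: "u * v = v * u" if "u \<in> der (\<phi> ` N)" "v \<in> der (\<phi> ` N)" for u v
    by (rule ito[OF s prod ab[OF A M(1)] ab[OF B M(2)] that])
  have "der N \<subseteq> {x \<in> N. \<phi> x \<in> der (\<phi> ` N)}"
  proof (rule der_least[OF ghom_vimage_sg[OF \<phi>(1) N.sN der_sg]])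
    fix x y assume xy: "x \<in> N" "y \<in> N"
    then have "\<phi> (cmt x y) \<in> der (\<phi> ` N)"
      using cmt_in_der[of "\<phi> x" "\<phi> ` N" "\<phi> y"] ghom_cmt[OF \<phi>(1) N.sN xy] by simp
    then show "cmt x y \<in> {x \<in> N. \<phi> x \<in> der (\<phi> ` N)}" using xy N.sN by (simp add: cmt_def)
  qed
  then have "\<phi> x \<in> der (\<phi> ` N)" if "x \<in> N" for x using that N.perfect by auto
  then have "\<phi> x * \<phi> y = \<phi> y * \<phi> x" if "x \<in> N" "y \<in> N" for x y
    using comm that by simp
  then have "cmt (\<phi> x) (\<phi> y) = 1" if "x \<in> N" "y \<in> N" for x y
    using that by (simp only: cmt_eq_1)
  then have "\<phi> (cmt x y) = 1" if "x \<in> N" "y \<in> N" for x y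
    using that ghom_cmt[OF \<phi>(1) N.sN] by simp
  then have "cmt x y \<in> M" if "x \<in> N" "y \<in> N" for x y
    using that \<phi>(2) N.sN by (simp add: cmt_def)
  then have "der N \<subseteq> M" by (rule der_least[OF nsg_sg[OF nMM]])
  then show ?thesis using N.perfect nsg_subset[OF nMM] M_def by auto
qed

text \<open>Modulo \<open>N \<bullet> cent G N\<close>, elements of \<open>A\<close> and
  \<open>B\<close> may be replaced by elements centralizing \<open>L\<close> and \<open>M\<close>.
  Their commutators centralize \<open>N\<close>: within a factor by
  \<open>nonabelian_trace_decomposition\<close>, across the factors by
  \<open>cmt_centralizes_of_cover\<close>.\<close>

lemma cmt_inner_minn_nonabelian:
  assumes qA: "qn A" and qB: "qn B" and N: "minn_nonabelian G N" and xy: "x \<in> G" "y \<in> G"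
  shows "cmt x y \<in> N \<bullet> cent G N"
proof -
  interpret S: mutperm_product G B A by (rule swap)
  interpret N: minn_nonabelian G N by fact
  define L M where "L = N \<inter> der A" and "M = N \<inter> der B"
  define W where "W = N \<bullet> cent G N"
  have nC: "nsg (cent G N) G" by (rule cent_nsg[OF N.nN G(1)])
  have nW: "nsg W G" unfolding W_def by (rule nsg_setmul[OF N.nN nC G(1)])
  have CW: "cent G N \<subseteq> W" unfolding W_def by (rule sg_setmul_right[OF N.sN])
  note decA = nonabelian_trace_decomposition[OF qA N, folded L_def W_def]
  note decB = S.nonabelian_trace_decomposition[OF qB N, folded M_def W_def]
  have cover: "N = L \<bullet> M"
    unfolding L_def M_def using nonabelian_trace_cover[OF N] decA(1) decB(1) L_def M_def by simp
  have cover': "N = M \<bullet> L"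
    unfolding L_def M_def using S.nonabelian_trace_cover[OF N] decA(1) decB(1) L_def M_def by simp
  have inG: "c \<in> G" if "c \<in> cent A L \<or> c \<in> cent B M" for c
    using that AG BG by (auto simp: cent_def)
  have "cmt a b \<in> W"
    if ab: "a \<in> G" "b \<in> G" "eqm W a c" "eqm W b d" "c \<in> G" "d \<in> G" "cmt c d \<in> cent G N" for a b c d
    by (rule cmt_eqm[OF nW G(1) ab(1,2,5,6,3,4)]) (use ab(7) CW in auto)
  note step = this
  show ?thesis
    unfolding W_def[symmetric]
  proof (rule cmt_of_factors[OF G(1) A B GAB nW _ _ _ xy])
    fix a a' assume a: "a \<in> A" "a' \<in> A"
    obtain c c' where c: "c \<in> cent A L" "c' \<in> cent A L" "eqm W a c" "eqm W a' c'"
      using decA(2) a by metis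
    show "cmt a a' \<in> W"
      by (rule step[OF _ _ c(3,4) _ _ decA(3)[OF c(1,2)]]) (use a AG inG c in auto)
  next
    fix a a' assume a: "a \<in> B" "a' \<in> B"
    obtain c c' where c: "c \<in> cent B M" "c' \<in> cent B M" "eqm W a c" "eqm W a' c'"
      using decB(2) a by metis
    show "cmt a a' \<in> W"
      by (rule step[OF _ _ c(3,4) _ _ decB(3)[OF c(1,2)]]) (use a BG inG c in auto)
  next
    fix a b assume a: "a \<in> A" "b \<in> B"
    obtain c where c: "c \<in> cent A L" "eqm W a c" using decA(2) a by metis
    obtain d where d: "d \<in> cent B M" "eqm W b d" using decB(2) a by metis
    have cG: "c \<in> G" and dG: "d \<in> G" using inG c d by auto
    have cd: "cmt c d \<in> cent G N"
      by (rule N.cmt_centralizes_of_cover[OF decA(1) decB(1) cover cover' cG _ dG])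
         (use c d in \<open>auto simp: cent_def\<close>)
    show "cmt a b \<in> W"
      by (rule step[OF _ _ c(2) d(2) cG dG cd]) (use a AG BG in auto)
  qed
qed

lemma cmt_inner_minn:
  assumes qA: "qn A" and qB: "qn B" and N: "minn N G" and xy: "x \<in> G" "y \<in> G"
  shows "cmt x y \<in> N \<bullet> cent G N"
proof (cases "\<exists>x\<in>N. \<exists>y\<in>N. x * y \<noteq> y * x")
  case True
  then have "minn_nonabelian G N" using G N by unfold_locales auto
  then show ?thesis by (rule cmt_inner_minn_nonabelian[OF qA qB _ xy])
next
  case False
  then have "cmt x y \<in> cent G N"
    by (intro cmt_centralizes_minn_abelian[OF qA qB N _ xy]) blast
  moreover have "cent G N \<subseteq> N \<bullet> cent G N" by (rule sg_setmul_right[OF nsg_sg[OF minn_nsg[OF N]]])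
  ultimately show ?thesis by auto
qed

end

section \<open>From minimal normal subgroups to chief factors\<close>

lemma chief_vimage:
  assumes \<phi>: "ghom \<phi> A" and A: "sg A" and ch: "chief (\<phi> ` A) H K"
  shows "chief A {x \<in> A. \<phi> x \<in> H} {x \<in> A. \<phi> x \<in> K}"
proof -
  have HK: "nsg K (\<phi> ` A)" "nsg H (\<phi> ` A)" "K \<subset> H" using ch unfolding chief_def by auto
  let ?H = "{x \<in> A. \<phi> x \<in> H}" and ?K = "{x \<in> A. \<phi> x \<in> K}"
  have im: "\<phi> ` {x \<in> A. \<phi> x \<in> M} = M" if "M \<subseteq> \<phi> ` A" for M using that by auto
  have "M = ?K \<or> M = ?H" if M: "nsg M A" "?K \<subseteq> M" "M \<subseteq> ?H" for M
  proof -
    have "nsg (\<phi> ` M) (\<phi> ` A)" by (rule ghom_image_nsg[OF \<phi> A M(1)])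
    moreover have "K \<subseteq> \<phi> ` M" using im[OF nsg_subset[OF HK(1)]] image_mono[OF M(2), of \<phi>] by simp
    moreover have "\<phi> ` M \<subseteq> H" using M(3) by auto
    ultimately have *: "\<phi> ` M = K \<or> \<phi> ` M = H" using ch unfolding chief_def by blast
    have "M = {x \<in> A. \<phi> x \<in> \<phi> ` M}"
    proof (intro subset_antisym subsetI)
      show "x \<in> {x \<in> A. \<phi> x \<in> \<phi> ` M}" if "x \<in> M" for x using that nsg_subset[OF M(1)] by auto
      fix x assume "x \<in> {x \<in> A. \<phi> x \<in> \<phi> ` M}"
      then obtain m where m: "x \<in> A" "m \<in> M" "\<phi> x = \<phi> m" by auto
      have mA: "m \<in> A" using m nsg_subset[OF M(1)] by auto
      have "\<phi> (x * inverse m) = 1" using ghom_mult[OF \<phi>] ghom_inverse[OF \<phi> A] m mA A by simp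
      then have "x * inverse m \<in> ?K" using m mA A sg_one[OF nsg_sg[OF HK(1)]] by simp
      then have "x * inverse m \<in> M" using M(2) by auto
      then show "x \<in> M" using sg_right_iff[OF nsg_sg[OF M(1)], of "inverse m" x] m nsg_sg[OF M(1)] by simp
    qed
    then show ?thesis using * by auto
  qed
  moreover have "?K \<subset> ?H"
  proof
    show "?K \<subseteq> ?H" using HK(3) by auto
    show "?K \<noteq> ?H"
    proof
      assume "?K = ?H"
      then have "\<phi> ` ?K = \<phi> ` ?H" by (rule arg_cong)
      then show False
        unfolding im[OF nsg_subset[OF HK(1)]] im[OF nsg_subset[OF HK(2)]] using HK(3) by simp
    qed
  qed
  ultimately show ?thesis
    unfolding chief_def
    by (intro conjI allI impI ghom_vimage_nsg[OF \<phi> A HK(1)] ghom_vimage_nsg[OF \<phi> A HK(2)]) auto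
qed

lemma inner_on_image:
  assumes \<phi>: "ghom \<phi> A" and A: "sg A" and g: "g \<in> A" and H: "H \<subseteq> \<phi> ` A"
    and inn: "inner_on g {x \<in> A. \<phi> x \<in> H} {x \<in> A. \<phi> x \<in> K}"
  shows "inner_on (\<phi> g) H K"
proof -
  obtain h where h0: "h \<in> {x \<in> A. \<phi> x \<in> H}"
    "\<forall>x\<in>{x \<in> A. \<phi> x \<in> H}. (g * x * inverse g) * inverse (h * x * inverse h) \<in> {x \<in> A. \<phi> x \<in> K}"
    using inn unfolding inner_on_def by (elim bexE)
  have h: "h \<in> A" "\<phi> h \<in> H" using h0(1) by auto
  have h': "\<phi> ((g * x * inverse g) * inverse (h * x * inverse h)) \<in> K" if "x \<in> A" "\<phi> x \<in> H" for x
  proof -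
    have "x \<in> {x \<in> A. \<phi> x \<in> H}" using that by simp
    from bspec[OF h0(2) this] show ?thesis unfolding mem_Collect_eq by (rule conjunct2)
  qed
  have "(\<phi> g * y * inverse (\<phi> g)) * inverse (\<phi> h * y * inverse (\<phi> h)) \<in> K" if y: "y \<in> H" for y
  proof -
    obtain x where x: "x \<in> A" "y = \<phi> x" using H y by auto
    have "\<phi> ((g * x * inverse g) * inverse (h * x * inverse h))
        = \<phi> (g * x * inverse g) * inverse (\<phi> (h * x * inverse h))"
      using x(1) g h(1) A by (simp add: ghom_mult[OF \<phi>] ghom_inverse[OF \<phi> A])
    then show ?thesis
      using h'[OF x(1)] x y by (simp add: ghom_conj[OF \<phi> A g x(1)] ghom_conj[OF \<phi> A h(1) x(1)])
  qed
  then show ?thesis unfolding inner_on_def using h(2) by blast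
qed

lemma qn_image:
  assumes "ghom \<phi> A" "sg A" "qn A"
  shows "qn (\<phi> ` A)"
  unfolding qn_def
proof (intro allI impI ballI)
  fix H K g assume ch: "chief (\<phi> ` A) H K" and "g \<in> \<phi> ` A"
  then obtain a where a: "g = \<phi> a" "a \<in> A" by auto
  have "inner_on a {x \<in> A. \<phi> x \<in> H} {x \<in> A. \<phi> x \<in> K}"
    using chief_vimage[OF assms(1,2) ch] assms(3) a unfolding qn_def by blast
  moreover have "nsg H (\<phi> ` A)" using ch unfolding chief_def by auto
  then have "H \<subseteq> \<phi> ` A" by (rule nsg_subset)
  ultimately show "inner_on g H K" unfolding a(1) by (intro inner_on_image[OF assms(1,2) a(2)])
qed

text \<open>Images of quasinilpotent groups are quasinilpotent, so dividing by \<open>K\<close>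
  makes \<open>H\<close> a minimal normal subgroup of a product of the same kind. By
  \<open>cmt_inner_minn\<close> the commutator acts on it as an element of \<open>H\<close>
  does.\<close>

theorem (in mutperm_product) cmt_inner_on_chief:
  assumes qA: "qn A" and qB: "qn B" and ch: "chief G H K" and xy: "x \<in> G" "y \<in> G"
  shows "inner_on (cmt x y) H K"
proof -
  have HK: "nsg K G" "nsg H G" "K \<subset> H" using ch unfolding chief_def by auto
  obtain \<phi> :: "'a \<Rightarrow> 'a set perm" where \<phi>: "ghom \<phi> G" "\<And>x. x \<in> G \<Longrightarrow> \<phi> x = 1 \<longleftrightarrow> x \<in> K"
    using ex_quotient_ghom[OF G HK(1)] by blast
  interpret Q: mutperm_product "\<phi> ` G" "\<phi> ` A" "\<phi> ` B" by (rule ghom_image[OF \<phi>(1)])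
  have qAB: "qn (\<phi> ` A)" "qn (\<phi> ` B)"
    using qn_image[OF ghom_subset[OF \<phi>(1) AG] A qA] qn_image[OF ghom_subset[OF \<phi>(1) BG] B qB] by auto
  have HG: "H \<subseteq> G" using HK nsg_subset by blast
  have "minn (\<phi> ` H) (\<phi> ` G)"
    unfolding minn_def
  proof (intro conjI allI impI)
    show "nsg (\<phi> ` H) (\<phi> ` G)" by (rule ghom_image_nsg[OF \<phi>(1) G(1) HK(2)])
    show "\<phi> ` H \<noteq> {1}"
    proof -
      obtain h where h: "h \<in> H" "h \<notin> K" using HK(3) by auto
      then have "\<phi> h \<noteq> 1" using \<phi>(2) HG by auto
      then show ?thesis using h(1) by auto
    qed
    fix M assume M: "nsg M (\<phi> ` G) \<and> M \<subseteq> \<phi> ` H"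
    let ?M = "{x \<in> G. \<phi> x \<in> M}"
    have "nsg ?M G" by (rule ghom_vimage_nsg[OF \<phi>(1) G(1)]) (use M in auto)
    moreover have "K \<subseteq> ?M"
    proof
      fix x assume x: "x \<in> K"
      then have "x \<in> G" using nsg_subset[OF HK(1)] by auto
      then have "\<phi> x = 1" using \<phi>(2) x by blast
      then show "x \<in> ?M" using \<open>x \<in> G\<close> M nsg_sg sg_one by auto
    qed
    moreover have "?M \<subseteq> H"
    proof
      fix x assume x: "x \<in> ?M"
      then obtain h where h: "h \<in> H" "\<phi> x = \<phi> h" using M by blast
      then have "x * inverse h \<in> K" using ghom_eq_iff[OF \<phi>(1) G(1) \<phi>(2)] x HG by auto
      then have "x * inverse h \<in> H" using HK(3) by auto
      then show "x \<in> H" using sg_right_iff[OF nsg_sg[OF HK(2)], of "inverse h" x] h nsg_sg[OF HK(2)] by simp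
    qed
    ultimately have "?M = K \<or> ?M = H" using ch unfolding chief_def by blast
    moreover have "M \<subseteq> \<phi> ` G" using M nsg_subset by auto
    then have "\<phi> ` ?M = M" by auto
    moreover have "\<phi> x = 1" if "x \<in> K" for x
      using \<phi>(2)[of x] that nsg_subset[OF HK(1)] by auto
    then have "\<phi> ` K = {1}" using sg_one[OF nsg_sg[OF HK(1)]] by auto
    ultimately show "M = {1} \<or> M = \<phi> ` H" by metis
  qed
  then have "cmt (\<phi> x) (\<phi> y) \<in> \<phi> ` H \<bullet> cent (\<phi> ` G) (\<phi> ` H)"
    by (rule Q.cmt_inner_minn[OF qAB]) (use xy in auto)
  then obtain h c where hc: "cmt (\<phi> x) (\<phi> y) = \<phi> h * c" "h \<in> H" "c \<in> cent (\<phi> ` G) (\<phi> ` H)" by blast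
  have w: "\<phi> (cmt x y) = \<phi> h * c" "cmt x y \<in> G"
    using hc(1) ghom_cmt[OF \<phi>(1) G(1) xy] xy G by (simp_all add: cmt_def)
  have "(cmt x y * u * inverse (cmt x y)) * inverse (h * u * inverse h) \<in> K" if u: "u \<in> H" for u
  proof -
    have uG: "u \<in> G" "h \<in> G" using u hc HG by auto
    have "c * \<phi> u * inverse c = \<phi> u"
      using hc(3) u by (intro mgroup_conj_eqI) (simp add: cent_def)
    then have "\<phi> (cmt x y * u * inverse (cmt x y)) = \<phi> (h * u * inverse h)"
      unfolding ghom_conj[OF \<phi>(1) G(1) w(2) uG(1)] ghom_conj[OF \<phi>(1) G(1) uG(2,1)] w(1)
      by (metis mgroup_inverse_mult mult.assoc)
    then show ?thesis
      using ghom_eq_iff[OF \<phi>(1) G(1) \<phi>(2), of "cmt x y * u * inverse (cmt x y)" "h * u * inverse h"] uG w(2) G(1)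
      by simp
  qed
  then show ?thesis unfolding inner_on_def by (intro bexI[OF _ hc(2)] ballI)
qed

section \<open>Elements inducing inner automorphisms on chief factors\<close>

lemma ex_chief_chain:
  assumes "sg G" "finite G" "nsg M G"
  shows "\<exists>k Ms. Ms 0 = {1} \<and> Ms k = M \<and> (\<forall>i<k. chief G (Ms (Suc i)) (Ms i))"
  using assms(3)
proof (induction "card M" arbitrary: M rule: less_induct)
  case less
  show ?case
  proof (cases "M = {1}")
    case True
    then show ?thesis by (intro exI[of _ 0] exI[of _ "\<lambda>_. {1}"]) auto
  next
    case False
    have finM: "finite M" using finite_subset[OF nsg_subset[OF less(2)] assms(2)] .
    obtain K where ch: "chief G M K" using ex_chief_below[OF assms(1,2) less(2) False] .
    have K: "K \<subset> M" "nsg K G" using ch unfolding chief_def by auto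
    have "card K < card M" using psubset_card_mono[OF finM K(1)] .
    from less(1)[OF this K(2)] obtain k Ms
      where Ms: "Ms 0 = {1}" "Ms k = K" "\<forall>i<k. chief G (Ms (Suc i)) (Ms i)" by auto
    have "chief G ((Ms(Suc k := M)) (Suc i)) ((Ms(Suc k := M)) i)" if "i < Suc k" for i
      using that Ms ch by (cases "i = k") auto
    then show ?thesis using Ms by (intro exI[of _ "Suc k"] exI[of _ "Ms(Suc k := M)"]) auto
  qed
qed

lemma stabilizer_nsg:
  assumes "sg G" "nsg H G" "nsg K G"
  shows "nsg {t \<in> G. \<forall>x\<in>H. cmt t x \<in> K} G"
proof (rule nsgI[OF cmt_centralizer_sg[OF assms(3,1) nsg_subset[OF assms(2)]]])
  fix g t assume g: "g \<in> G" and t: "t \<in> {t \<in> G. \<forall>x\<in>H. cmt t x \<in> K}"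
  have "cmt (g * t * inverse g) x \<in> K" if x: "x \<in> H" for x
  proof -
    have "inverse g * x * g \<in> H" by (rule nsg_conj'[OF assms(2,1) g x])
    then have "g * cmt t (inverse g * x * g) * inverse g \<in> K" using nsg_conj[OF assms(3) g] t by auto
    then show ?thesis by (simp add: cmt_def mgroup_simps)
  qed
  then show "g * t * inverse g \<in> {t \<in> G. \<forall>x\<in>H. cmt t x \<in> K}" using g t assms(1) by simp
qed auto

section \<open>Stabilizers of normal chains\<close>

locale normal_chain =
  fixes G :: "'a::mgroup set" and Ms :: "nat \<Rightarrow> 'a set" and k :: nat
  assumes G: "sg G" "finite G" and bottom: "Ms 0 = {1}"
    and normal: "\<And>i. i \<le> k \<Longrightarrow> nsg (Ms i) G" and step_subset: "\<And>i. i < k \<Longrightarrow> Ms i \<subseteq> Ms (Suc i)"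
begin

text \<open>Trivial action on the lowest \<open>j\<close> factors only, so that
  \<open>inner_stab_decomposition\<close> can climb the chain factor by factor.\<close>

definition stab :: "nat \<Rightarrow> 'a set" where
  "stab j = {t \<in> G. \<forall>i<j. \<forall>x\<in>Ms (Suc i). cmt t x \<in> Ms i}"

lemma stab_Suc: "stab (Suc j) = stab j \<inter> {t \<in> G. \<forall>x\<in>Ms (Suc j). cmt t x \<in> Ms j}"
  by (auto simp: stab_def less_Suc_eq)

lemma stab_nsg: "j \<le> k \<Longrightarrow> nsg (stab j) G"
proof (induction j)
  case 0
  have "stab 0 = G" by (simp add: stab_def)
  then show ?case using nsg_self[OF G(1)] by simp
next
  case (Suc j)
  then show ?case
    unfolding stab_Suc using stabilizer_nsg[OF G(1) normal normal, of "Suc j" j] by (intro nsg_Int) auto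
qed

lemma stab_cmt:
  assumes "s \<in> stab k" "i \<le> k" "x \<in> Ms i"
  shows "cmt s x \<in> Ms (i - 1)"
\<comment> \<open>Natural subtraction: for \<open>i = 0\<close> both terms are the trivial
  group.\<close>
proof (cases i)
  case 0
  then have "cmt s x = 1" using assms(3) bottom by (simp add: cmt_def)
  then show ?thesis using 0 bottom by simp
next
  case (Suc j)
  then show ?thesis using assms by (auto simp: stab_def)
qed

text \<open>Climbing from \<open>?K\<close> to \<open>?H\<close>: either \<open>?H\<close> meets
  \<open>?K \<bullet> stab j\<close> only in \<open>?K\<close>, and then commutators of
  \<open>inverse m * g\<close> with \<open>?H\<close> already fall into \<open>?K\<close>; or
  \<open>?H\<close> lies inside it, and the action of \<open>g\<close> on the factor is induced by
  an element of \<open>stab j\<close>, which leaves the lower factors alone.\<close>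

lemma inner_stab_decomposition:
  assumes chief: "\<And>i. i < k \<Longrightarrow> chief G (Ms (Suc i)) (Ms i)"
    and inner: "\<And>i. i < k \<Longrightarrow> inner_on g (Ms (Suc i)) (Ms i)" and g: "g \<in> G"
  shows "j \<le> k \<Longrightarrow> \<exists>m\<in>Ms j. inverse m * g \<in> stab j"
proof (induction j)
  case 0
  then show ?case using bottom g by (simp add: stab_def)
next
  case (Suc j)
  then obtain m where m: "m \<in> Ms j" "inverse m * g \<in> stab j" by auto
  let ?H = "Ms (Suc j)" and ?K = "Ms j" and ?C = "{t \<in> G. \<forall>x\<in>Ms (Suc j). cmt t x \<in> Ms j}"
  have nH: "nsg ?H G" and nK: "nsg ?K G" using normal Suc(2) by auto
  have sH: "sg ?H" and sK: "sg ?K" using nH nK nsg_sg by auto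
  have KH: "?K \<subseteq> ?H" using step_subset Suc(2) by simp
  have HG: "?H \<subseteq> G" using nsg_subset[OF nH] .
  have nS: "nsg (stab j) G" using stab_nsg Suc(2) by simp
  have nC: "nsg ?C G" by (rule stabilizer_nsg[OF G(1) nH nK])
  have KC: "?K \<subseteq> ?C" using cmt_nsg_left(1)[OF nK] HG KH by auto
  have mG: "m \<in> G" using m KH HG by auto
  let ?L = "?H \<inter> (?K \<bullet> stab j)"
  have nL: "nsg ?L G" by (rule nsg_Int[OF nH nsg_setmul[OF nK nS G(1)]])
  have "?K \<subseteq> ?L" using KH sg_setmul_left[OF nsg_sg[OF nS], of ?K] by auto
  then have "?L = ?K \<or> ?L = ?H"
    using chief[of j] Suc(2) nL unfolding chief_def by auto
  then show ?case
  proof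
    assume L: "?L = ?K"
    let ?e = "inverse m * g"
    have eG: "?e \<in> G" using mG g G by simp
    have "cmt ?e x \<in> ?K" if x: "x \<in> ?H" for x
    proof -
      have "cmt ?e x \<in> ?H" by (rule cmt_nsg_left(2)[OF nH x eG])
      moreover have "cmt ?e x \<in> stab j" by (rule cmt_nsg_left(1)[OF nS m(2)]) (use x HG in auto)
      then have "cmt ?e x \<in> ?K \<bullet> stab j" using sg_setmul_right[OF sK, of "stab j"] by auto
      ultimately show ?thesis using L by blast
    qed
    then have "?e \<in> stab (Suc j)" using m(2) eG by (simp add: stab_Suc)
    then show ?thesis using m(1) KH by auto
  next
    assume L: "?L = ?H"
    obtain h where h: "h \<in> ?H" "\<forall>x\<in>?H. (g * x * inverse g) * inverse (h * x * inverse h) \<in> ?K"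
      using inner[of j] Suc(2) unfolding inner_on_def by auto
    have hG: "h \<in> G" using h HG by auto
    have "inverse h * g \<in> ?C"
    proof (intro CollectI conjI ballI)
      show "inverse h * g \<in> G" using hG g G by simp
      fix x assume x: "x \<in> ?H"
      have "inverse h * ((g * x * inverse g) * inverse (h * x * inverse h)) * h \<in> ?K"
        using nsg_conj'[OF nK G(1) hG] bspec[OF h(2) x] by simp
      then show "cmt (inverse h * g) x \<in> ?K" by (simp add: cmt_def mgroup_simps)
    qed
    \<comment> \<open>The new divisor is \<open>m * t\<close>. It agrees with \<open>h\<close>
      modulo \<open>?K\<close>, so it acts on the factor as \<open>g\<close> does, and
      \<open>t\<close> is in \<open>stab j\<close>.\<close>
    moreover obtain \<kappa> t where kt: "h = \<kappa> * t" "\<kappa> \<in> ?K" "t \<in> stab j" using h(1) L by blast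
    have tG: "t \<in> G" using kt(3) by (simp add: stab_def)
    have "inverse t * (inverse m * \<kappa>) * t \<in> ?K" using nsg_conj'[OF nK G(1) tG] kt m sK by simp
    then have "inverse t * (inverse m * \<kappa>) * t \<in> ?C" using KC by auto
    ultimately have "(inverse t * (inverse m * \<kappa>) * t) * (inverse h * g) \<in> ?C"
      using sg_mult[OF nsg_sg[OF nC]] by blast
    then have 1: "inverse (m * t) * g \<in> ?C" using kt(1) by (simp add: mgroup_simps)
    have "inverse t * (inverse m * g) \<in> stab j" using kt(3) m(2) nsg_sg[OF nS] by simp
    then have "inverse (m * t) * g \<in> stab j" by (simp add: mgroup_simps)
    then have "inverse (m * t) * g \<in> stab (Suc j)" using 1 by (simp only: stab_Suc Int_iff)
    moreover have "t \<in> ?H" using sg_left_iff[OF sH, of \<kappa> t] kt h(1) KH by auto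
    then have "m * t \<in> ?H" using m(1) KH sH by auto
    ultimately show ?thesis by blast
  qed
qed

text \<open>A descending central series of the stabilizer of the chain, as in Kaluzhnin's theorem.\<close>

definition lower :: "nat \<Rightarrow> 'a set" where
  "lower r = {s \<in> stab k. \<forall>i\<le>k. \<forall>x\<in>Ms i. cmt s x \<in> Ms (i - r)}"

lemma stab_lower: "stab k \<subseteq> lower 1"
  using stab_cmt by (auto simp: lower_def)

text \<open>With \<open>y = cmt s x\<close> and \<open>z = cmt d x\<close>, conjugating
  \<open>x\<close> by \<open>d * s\<close> and by \<open>s * d\<close> gives
  \<open>y * z * x\<close> and \<open>z * y * x\<close> up to the factors \<open>cmt d y\<close> and
  \<open>cmt s z\<close>. These and \<open>cmt y z\<close> lie \<open>r + 1\<close> steps down the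
  chain, the last because normality of the stabilizer puts \<open>y\<close> into it.\<close>

lemma cmt_lower:
  assumes d: "d \<in> lower r" and s: "s \<in> stab k"
  shows "cmt d s \<in> lower (Suc r)"
proof -
  have nS: "nsg (stab k) G" using stab_nsg by simp
  have sS: "sg (stab k)" using nsg_sg[OF nS] .
  have dS: "d \<in> stab k" using d by (simp add: lower_def)
  have dG: "d \<in> G" "s \<in> G" using dS s by (auto simp: stab_def)
  have "cmt (cmt d s) v \<in> Ms (i - Suc r)" if i: "i \<le> k" and v: "v \<in> Ms i" for i v
  proof -
    let ?P = "Ms (i - Suc r)"
    have nI: "nsg (Ms i) G" using normal i by simp
    have nP: "nsg ?P G" using normal i by simp
    have sP: "sg ?P" using nsg_sg[OF nP] .
    \<comment> \<open>\<open>v\<close> is the conjugate of \<open>x\<close> by \<open>s * d\<close>,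
      so \<open>cmt d s\<close> conjugates \<open>v\<close> to the conjugate of \<open>x\<close> by
      \<open>d * s\<close>.\<close>
    define x where "x = inverse (s * d) * v * (s * d)"
    have xI: "x \<in> Ms i" unfolding x_def by (rule nsg_conj'[OF nI G(1)]) (use dG G v in auto)
    have xG: "x \<in> G" using xI nsg_subset[OF nI] by auto
    define y z where "y = cmt s x" and "z = cmt d x"
    have y: "y \<in> Ms (i - 1)" unfolding y_def by (rule stab_cmt[OF s i xI])
    have z: "z \<in> Ms (i - r)" using d i xI by (simp add: lower_def z_def)
    have yS: "y \<in> stab k" unfolding y_def by (rule cmt_nsg_left(1)[OF nS s xG])
    have yG: "y \<in> G" using yS by (simp add: stab_def)
    have zG: "z \<in> G" using z subsetD[OF nsg_subset[OF normal[of "i - r"]]] i by simp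
    have dy: "cmt d y \<in> ?P"
    proof -
      have "i - 1 \<le> k" using i by simp
      then have "cmt d y \<in> Ms (i - 1 - r)" using d y unfolding lower_def by blast
      then show ?thesis by simp
    qed
    have "i - r - 1 = i - Suc r" by simp
    then have sz: "cmt s z \<in> ?P" and yz: "cmt y z \<in> ?P"
      using stab_cmt[OF s _ z] stab_cmt[OF yS _ z] i by simp_all
    have 1: "(d * s) * x * inverse (d * s) = cmt d y * (y * z * x)"
      unfolding z_def y_def cmt_def by (simp add: mgroup_simps)
    have 2: "(s * d) * x * inverse (s * d) = cmt s z * (z * y * x)"
      unfolding z_def y_def cmt_def by (simp add: mgroup_simps)
    have e1: "eqm ?P (cmt d y * (y * z * x)) (y * z * x)" using dy by (simp add: eqm_def mult.assoc)
    have e2: "eqm ?P (cmt s z * (z * y * x)) (z * y * x)" using sz by (simp add: eqm_def mult.assoc)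
    have "eqm ?P (y * z) (z * y)" using yz by (simp add: cmt_mem_iff)
    then have e3: "eqm ?P (y * z * x) (z * y * x)"
      using eqm_mult[OF nP _ _ eqm_refl[OF sP]] yG zG G by (metis sg_mult)
    have "eqm ?P ((d * s) * x * inverse (d * s)) ((s * d) * x * inverse (s * d))"
      unfolding 1 2 using eqm_trans[OF sP eqm_trans[OF sP e1 e3] eqm_sym[OF sP e2]] .
    then have "eqm ?P (cmt d s * v * inverse (cmt d s)) v"
      unfolding x_def by (simp add: cmt_def mgroup_simps)
    then show ?thesis by (simp add: cmt_mem_iff')
  qed
  moreover have "cmt d s \<in> stab k" using dS s sS by (simp add: cmt_def)
  ultimately show ?thesis by (simp add: lower_def)
qed

text \<open>The subgroups \<open>(E \<inter> Ms i) \<bullet> cyc d\<close> form a subnormal chain: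
  commutators of \<open>d\<close> with \<open>E \<inter> Ms (Suc i)\<close> are in
  \<open>E \<inter> Ms i\<close>.\<close>

lemma cyc_subnormal_in_extension:
  assumes E: "nsg E (stab k)" "E \<subseteq> Ms k" and d: "d \<in> stab k"
  shows "sn (cyc d) (E \<bullet> cyc d)"
proof -
  have nS: "nsg (stab k) G" using stab_nsg by simp
  have sS: "sg (stab k)" "finite (stab k)"
    using nsg_sg[OF nS] nsg_subset[OF nS] G finite_subset by auto
  have cd: "sg (cyc d)" "cyc d \<subseteq> stab k" using cyc_sg[OF sS d] cyc_subset[OF sS(1) d] .
  let ?Y = "\<lambda>i. (E \<inter> Ms i) \<bullet> cyc d"
  have nE: "nsg (E \<inter> Ms i) (stab k)" if "i \<le> k" for i
  proof -
    have "nsg (E \<inter> (Ms i \<inter> stab k)) (stab k)"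
      by (rule nsg_Int[OF E(1) nsg_Int_sg[OF normal[OF that] sS(1) nsg_subset[OF nS]]])
    moreover have "E \<inter> (Ms i \<inter> stab k) = E \<inter> Ms i" using nsg_subset[OF E(1)] by auto
    ultimately show ?thesis by simp
  qed
  have sY: "sg (?Y i)" if "i \<le> k" for i by (rule sg_setmul_nsg[OF nE[OF that] cd sS(1)])
  have "i \<le> k \<Longrightarrow> sn (cyc d) (?Y i)" for i
  proof (induction i)
    case 0
    have "E \<inter> Ms 0 = {1}" using bottom sg_one[OF nsg_sg[OF E(1)]] by auto
    then have "?Y 0 = cyc d" by (auto simp: setmul_def)
    then show ?case by simp
  next
    case (Suc i)
    have i: "i \<le> k" "Suc i \<le> k" using Suc by auto
    have EY: "E \<inter> Ms i \<subseteq> ?Y i" by (rule sg_setmul_left[OF cd(1)])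
    have cY: "cyc d \<subseteq> ?Y i" by (rule sg_setmul_right[OF nsg_sg[OF nE[OF i(1)]]])
    have dY: "d \<in> ?Y i" using cY cyc_self by auto
    have "nsg (?Y i) (?Y (Suc i))"
    proof (rule nsg_of_factors[OF sY[OF i(1)]])
      show "?Y i \<subseteq> ?Y (Suc i)" by (rule setmul_mono) (use step_subset[of i] i in auto)
      show "c * n * inverse c \<in> ?Y i" if "c \<in> cyc d" "n \<in> ?Y i" for c n
        using sg_conj[OF sY[OF i(1)]] that cY by auto
      fix e n assume e: "e \<in> E \<inter> Ms (Suc i)" and n: "n \<in> ?Y i"
      obtain e0 l where n': "n = e0 * d ^ l" "e0 \<in> E \<inter> Ms i" using n by (auto simp: cyc_def)
      have eS: "e \<in> stab k" using e nsg_subset[OF E(1)] by auto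
      have "cmt d e \<in> Ms i" using stab_cmt[OF d i(2)] e by auto
      moreover have "cmt d e \<in> E" by (rule cmt_nsg_left(2)[OF E(1) _ d]) (use e in auto)
      ultimately have "cmt d e \<in> ?Y i" using EY by auto
      then have "cmt e d \<in> ?Y i" using sg_inverse[OF sY[OF i(1)]] inverse_cmt by metis
      then have "e * d * inverse e \<in> ?Y i" unfolding conj_eq_cmt using dY sY[OF i(1)] by simp
      then have "(e * d * inverse e) ^ l \<in> ?Y i" by (rule sg_power[OF sY[OF i(1)]])
      then have 1: "e * d ^ l * inverse e \<in> ?Y i" by (simp only: mgroup_conj_power)
      have "e * e0 * inverse e \<in> E \<inter> Ms i" using nsg_conj[OF nE[OF i(1)] eS n'(2)] .
      then have 2: "e * e0 * inverse e \<in> ?Y i" using EY by auto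
      have "e * n * inverse e = (e * e0 * inverse e) * (e * d ^ l * inverse e)"
        unfolding n' by (simp add: mult.assoc)
      then show "e * n * inverse e \<in> ?Y i" using sg_mult[OF sY[OF i(1)] 2 1] by (simp only:)
    qed
    then show ?case using Suc(1)[OF i(1)] by (meson rtranclp.rtrancl_into_rtrancl)
  qed
  then have "sn (cyc d) (?Y k)" by simp
  moreover have "E \<inter> Ms k = E" using E(2) by auto
  ultimately show ?thesis by simp
qed

end

text \<open>What a functorial with (F2) and (F3) provides for groups that are subsets of one type;
  \<open>gext_internal_functorial\<close> supplies the instances.\<close>

locale internal_functorial =
  fixes \<Gamma> :: "'a::mgroup set \<Rightarrow> 'a set"
  assumes normal: "sg S \<Longrightarrow> finite S \<Longrightarrow> nsg (\<Gamma> S) S"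
    and mono_normal: "sg S \<Longrightarrow> finite S \<Longrightarrow> nsg N S \<Longrightarrow> \<Gamma> N \<subseteq> \<Gamma> S"
    and centralizer: "sg S \<Longrightarrow> finite S \<Longrightarrow> cent S (\<Gamma> S) \<subseteq> \<Gamma> S"
begin

lemma mono_subnormal: "sn N S \<Longrightarrow> sg S \<Longrightarrow> finite S \<Longrightarrow> \<Gamma> N \<subseteq> \<Gamma> S"
proof (induction rule: rtranclp_induct)
  case (step y z)
  have "sg y" "finite y" using step nsg_sg nsg_subset finite_subset by metis+
  then show ?case using step mono_normal by blast
qed simp

lemma abelian:
  assumes "sg S" "finite S" "\<And>x y. x \<in> S \<Longrightarrow> y \<in> S \<Longrightarrow> x * y = y * x"
  shows "\<Gamma> S = S"
proof -
  have "S \<subseteq> cent S (\<Gamma> S)" using assms(3) nsg_subset[OF normal[OF assms(1,2)]] by (auto simp: cent_def)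
  then show ?thesis using centralizer[OF assms(1,2)] nsg_subset[OF normal[OF assms(1,2)]] by auto
qed

text \<open>\<open>S\<close> is the stabilizer of a chain of chief factors ending at
  \<open>\<Gamma> G\<close>, which contains \<open>\<Gamma> S\<close>. The deepest
  \<open>lower\<close> term centralizes \<open>\<Gamma> S\<close> and so lies in it. If
  \<open>lower (Suc r)\<close> lies in \<open>\<Gamma> S\<close>, an element \<open>d\<close> of
  \<open>lower r\<close> is central in \<open>S\<close> modulo \<open>\<Gamma> S\<close>; then
  \<open>cyc d\<close> is subnormal in \<open>S\<close> and hence inside \<open>\<Gamma> S\<close>.
  So \<open>S\<close> lies in \<open>\<Gamma> G\<close>, and \<open>g\<close> is a product of
  elements of \<open>\<Gamma> G\<close> and \<open>S\<close>.\<close>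

theorem inner_on_chief_mem:
  assumes G: "sg G" "finite G" and g: "g \<in> G"
    and inner: "\<And>H K. chief G H K \<Longrightarrow> inner_on g H K"
  shows "g \<in> \<Gamma> G"
proof -
  obtain k Ms where Ms: "Ms 0 = {1}" "Ms k = \<Gamma> G" "\<forall>i<k. chief G (Ms (Suc i)) (Ms i)"
    using ex_chief_chain[OF G normal[OF G]] by blast
  have nMs: "nsg (Ms i) G" if "i \<le> k" for i
  proof (cases i)
    case 0
    then show ?thesis using Ms(1) nsg_trivial[OF G(1)] by simp
  next
    case (Suc j)
    then show ?thesis using Ms(3) that unfolding chief_def by auto
  qed
  interpret C: normal_chain G Ms k
    by unfold_locales (use G Ms nMs in \<open>auto simp: chief_def\<close>)
  define S where "S = C.stab k"
  have nS: "nsg S G" unfolding S_def using C.stab_nsg by simp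
  have sS: "sg S" "finite S" using nsg_sg[OF nS] nsg_subset[OF nS] G finite_subset by auto
  have nE: "nsg (\<Gamma> S) S" by (rule normal[OF sS])
  have EM: "\<Gamma> S \<subseteq> Ms k" using mono_normal[OF G nS] Ms(2) by simp
  have "C.lower r \<subseteq> \<Gamma> S" if "r \<le> Suc k" "1 \<le> r" for r
    using that
  proof (induction r rule: inc_induct)
    case base
    show ?case
    proof
      fix s assume s: "s \<in> C.lower (Suc k)"
      then have sS': "s \<in> S" by (simp add: C.lower_def S_def)
      have "s * x = x * s" if "x \<in> \<Gamma> S" for x
      proof -
        \<comment> \<open>\<open>k - Suc k\<close> is 0, and \<open>Ms 0\<close> is trivial.\<close>
        have "cmt s x \<in> Ms (k - Suc k)" using s EM that unfolding C.lower_def by blast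
        then have "cmt s x = 1" using Ms(1) by simp
        then show ?thesis by (simp only: cmt_eq_1)
      qed
      then have "s \<in> cent S (\<Gamma> S)" using sS' by (simp add: cent_def)
      then show "s \<in> \<Gamma> S" using centralizer[OF sS] by auto
    qed
  next
    case (step r)
    show ?case
    proof
      fix d assume d: "d \<in> C.lower r"
      then have dS: "d \<in> S" by (simp add: C.lower_def S_def)
      have IH: "C.lower (Suc r) \<subseteq> \<Gamma> S" using step by simp
      have cd: "sg (cyc d)" "cyc d \<subseteq> S" using cyc_sg[OF sS dS] cyc_subset[OF sS(1) dS] .
      let ?Y = "\<Gamma> S \<bullet> cyc d"
      have sY: "sg ?Y" by (rule sg_setmul_nsg[OF nE cd sS(1)])
      have YS: "?Y \<subseteq> S" by (rule setmul_subset[OF sS(1) nsg_subset[OF nE] cd(2)])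
      let ?T = "{y \<in> S. \<forall>s\<in>S. cmt y s \<in> \<Gamma> S}"
      have T: "sg ?T" by (rule cmt_centralizer_sg[OF nE sS(1) order_refl])
      have "d \<in> ?T" using dS C.cmt_lower[OF d] IH unfolding S_def by auto
      then have "cyc d \<subseteq> ?T" by (rule cyc_subset[OF T])
      moreover have "\<Gamma> S \<subseteq> ?T" using cmt_nsg_left(1)[OF nE] nsg_subset[OF nE] by auto
      ultimately have YT: "?Y \<subseteq> ?T" using setmul_subset[OF T] by blast
      have nY: "nsg ?Y S"
      proof (rule nsgI[OF sY YS])
        fix s y assume s: "s \<in> S" and y: "y \<in> ?Y"
        have "cmt y s \<in> \<Gamma> S" using YT y s by auto
        then have "cmt s y \<in> \<Gamma> S" using sg_inverse[OF nsg_sg[OF nE]] inverse_cmt by metis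
        then have "cmt s y \<in> ?Y" using sg_setmul_left[OF cd(1)] by auto
        then show "s * y * inverse s \<in> ?Y" unfolding conj_eq_cmt using y sY by simp
      qed
      have "sn (cyc d) ?Y"
        using C.cyc_subnormal_in_extension[of "\<Gamma> S" d] nE EM dS unfolding S_def by simp
      then have "sn (cyc d) S" using nY by (rule rtranclp.rtrancl_into_rtrancl)
      then have "\<Gamma> (cyc d) \<subseteq> \<Gamma> S" by (rule mono_subnormal[OF _ sS])
      moreover have "\<Gamma> (cyc d) = cyc d"
      proof (rule abelian[OF cd(1)])
        show "finite (cyc d)" using finite_subset[OF cd(2) sS(2)] .
        show "x * y = y * x" if "x \<in> cyc d" "y \<in> cyc d" for x y
          using that by (auto simp: cyc_def power_add[symmetric] add.commute)
      qed
      ultimately show "d \<in> \<Gamma> S" using cyc_self[of d] by auto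
    qed
  qed
  then have "C.lower 1 \<subseteq> \<Gamma> S" by simp
  then have SM: "S \<subseteq> \<Gamma> G" using C.stab_lower EM Ms(2) unfolding S_def by auto
  obtain m where m: "m \<in> Ms k" "inverse m * g \<in> C.stab k"
    using C.inner_stab_decomposition[of g k] Ms(3) inner g by auto
  then have "inverse m * g \<in> \<Gamma> G" using SM unfolding S_def by auto
  then have "m * (inverse m * g) \<in> \<Gamma> G"
    using sg_mult[OF nsg_sg[OF normal[OF G]]] m(1) Ms(2) by blast
  then show ?thesis by simp
qed

end

section \<open>The series of a functorial\<close>

lemma ex_nat_copy:
  fixes G :: "'a monoid"
  assumes "group G" "finite (carrier G)"
  obtains H :: "nat monoid" and f where "group H" "f \<in> iso G H" "finite (carrier H)"
proof -
  obtain e :: "'a \<Rightarrow> nat" where e: "inj_on e (carrier G)"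
    using finite_imp_inj_to_nat_seg[OF assms(2)] by blast
  have "group (image_group e G)" by (rule group.inj_imp_image_group_is_group[OF assms(1) e])
  moreover have "e \<in> iso G (image_group e G)" by (rule inj_imp_image_group_iso[OF e])
  moreover have "finite (carrier (image_group e G))" using assms(2) by (simp add: image_group_def)
  ultimately show ?thesis by (rule that)
qed

lemma iso_hom: "f \<in> iso G H \<Longrightarrow> f \<in> hom G H"
  and iso_image: "f \<in> iso G H \<Longrightarrow> f ` carrier G = carrier H"
  and iso_inj: "f \<in> iso G H \<Longrightarrow> inj_on f (carrier G)"
  by (auto simp: iso_def bij_betw_def)

text \<open>The choice inside \<open>gext\<close> is immaterial: two copies over \<open>nat\<close>
  differ by an isomorphism, and \<open>\<gamma>\<close> is compatible with isomorphisms.\<close>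

lemma gext_mem:
  fixes G :: "'a monoid" and H :: "nat monoid"
  assumes fn: "functorial \<gamma>" and G: "group G" "finite (carrier G)" and H: "group H" and f: "f \<in> iso G H"
  shows "x \<in> gext \<gamma> G \<longleftrightarrow> x \<in> carrier G \<and> f x \<in> \<gamma> H"
proof -
  let ?P = "\<lambda>S. \<exists>(H::nat monoid) f. group H \<and> f \<in> iso G H \<and> S = {x \<in> carrier G. f x \<in> \<gamma> H}"
  have "\<exists>S. ?P S" using H f by blast
  then have "?P (gext \<gamma> G)" unfolding gext_def by (rule someI_ex)
  then obtain H' :: "nat monoid" and f' where H': "group H'" "f' \<in> iso G H'"
    "gext \<gamma> G = {x \<in> carrier G. f' x \<in> \<gamma> H'}" by blast
  define h where "h = f \<circ> inv_into (carrier G) f'"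
  have h: "h \<in> iso H' H"
    unfolding h_def by (rule iso_set_trans[OF group.iso_set_sym[OF G(1) H'(2)] f])
  have fin: "finite (carrier H')" using iso_image[OF H'(2)] G(2) by (metis finite_imageI)
  have img: "h ` \<gamma> H' = \<gamma> H" and sub: "\<gamma> H' \<subseteq> carrier H'"
    using fn H'(1) fin H h unfolding functorial_def by (auto dest: subgroup.subset)
  have "f' x \<in> \<gamma> H' \<longleftrightarrow> f x \<in> \<gamma> H" if x: "x \<in> carrier G" for x
  proof -
    have hf: "h (f' x) = f x" using inv_into_f_f[OF iso_inj[OF H'(2)] x] by (simp add: h_def)
    have "f' x \<in> carrier H'" using iso_image[OF H'(2)] x by blast
    then show ?thesis
      using inj_on_image_mem_iff[OF iso_inj[OF h] _ sub, of "f' x"] unfolding img hf by simp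
  qed
  then show ?thesis unfolding H'(3) by blast
qed

lemma gext_subset: "functorial \<gamma> \<Longrightarrow> group G \<Longrightarrow> finite (carrier G) \<Longrightarrow> gext \<gamma> (G::'a monoid) \<subseteq> carrier G"
  using gext_mem ex_nat_copy by (metis subsetI)

lemma gext_iso:
  fixes G :: "'a monoid" and G' :: "'b monoid"
  assumes fn: "functorial \<gamma>" and G: "group G" "finite (carrier G)" "group G'" and k: "k \<in> iso G G'"
    and x: "x \<in> carrier G"
  shows "k x \<in> gext \<gamma> G' \<longleftrightarrow> x \<in> gext \<gamma> G"
proof -
  have fin: "finite (carrier G')" using iso_image[OF k] G(2) by (metis finite_imageI)
  obtain H :: "nat monoid" and f where H: "group H" "f \<in> iso G' H" using ex_nat_copy[OF G(3) fin] by metis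
  have "k x \<in> carrier G'" using iso_image[OF k] x by blast
  then have "k x \<in> gext \<gamma> G' \<longleftrightarrow> f (k x) \<in> \<gamma> H" using gext_mem[OF fn G(3) fin H] by simp
  moreover have "x \<in> gext \<gamma> G \<longleftrightarrow> (f \<circ> k) x \<in> \<gamma> H"
    using gext_mem[OF fn G(1,2) H(1) iso_set_trans[OF k H(2)]] x by simp
  ultimately show ?thesis by simp
qed

lemma gext_epi:
  fixes G :: "'a monoid" and G' :: "'b monoid"
  assumes fn: "functorial \<gamma>" "F1 \<gamma>" and G: "group G" "finite (carrier G)" "group G'"
    and f: "f \<in> hom G G'" "f ` carrier G = carrier G'" and x: "x \<in> gext \<gamma> G"
  shows "f x \<in> gext \<gamma> G'"
proof -
  have fin: "finite (carrier G')" using f(2) G(2) by (metis finite_imageI)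
  obtain H :: "nat monoid" and u where H: "group H" "u \<in> iso G H" "finite (carrier H)"
    using ex_nat_copy[OF G(1,2)] by metis
  obtain H' :: "nat monoid" and u' where H': "group H'" "u' \<in> iso G' H'" using ex_nat_copy[OF G(3) fin] by metis
  let ?v = "inv_into (carrier G) u"
  have v: "?v \<in> iso H G" by (rule group.iso_set_sym[OF G(1) H(2)])
  define h where "h = u' \<circ> (f \<circ> ?v)"
  have hom: "h \<in> hom H H'"
    unfolding h_def by (rule hom_compose[OF hom_compose[OF iso_hom[OF v] f(1)] iso_hom[OF H'(2)]])
  have "h ` carrier H = carrier H'"
    unfolding h_def image_comp[symmetric] iso_image[OF v] f(2) iso_image[OF H'(2)] ..
  then have "h ` \<gamma> H \<subseteq> \<gamma> H'" using fn(2) H(1,3) H'(1) hom unfolding F1_def by blast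
  moreover have ux: "x \<in> carrier G" "u x \<in> \<gamma> H" using gext_mem[OF fn(1) G(1,2) H(1,2)] x by auto
  ultimately have "h (u x) \<in> \<gamma> H'" by blast
  then have "u' (f x) \<in> \<gamma> H'" using inv_into_f_f[OF iso_inj[OF H(2)] ux(1)] by (simp add: h_def)
  moreover have "f x \<in> carrier G'" using f(2) ux(1) by blast
  ultimately show ?thesis using gext_mem[OF fn(1) G(3) fin H'] by simp
qed

text \<open>A single copy \<open>u\<close> of \<open>G\<close> serves both \<open>G\<close> and
  \<open>N\<close>, so that (F2) and (F5) over \<open>nat\<close> can be read back.\<close>

lemma gext_restrict_copy:
  fixes G :: "'a monoid"
  assumes fn: "functorial \<gamma>" and G: "group G" "finite (carrier G)" and N: "N \<lhd> G"
    and H: "group H" "u \<in> iso G (H::nat monoid)"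
  shows "u ` N \<lhd> H" "x \<in> gext \<gamma> (G\<lparr>carrier := N\<rparr>) \<longleftrightarrow> x \<in> N \<and> u x \<in> \<gamma> (H\<lparr>carrier := u ` N\<rparr>)"
proof -
  have sN: "subgroup N G" by (rule normal_imp_subgroup[OF N])
  interpret u: group_hom G H u
    by (rule group_hom.intro[OF G(1) H(1)]) (simp add: group_hom_axioms_def iso_hom[OF H(2)])
  have img: "subgroup (u ` N) H" by (rule u.subgroup_img_is_subgroup[OF sN])
  show "u ` N \<lhd> H"
    by (rule normal.surj_hom_normal_subgroup[OF N u.group_hom_axioms iso_image[OF H(2)]])
  have "restrict u N \<in> iso (G\<lparr>carrier := N\<rparr>) (H\<lparr>carrier := u ` N\<rparr>)"
    by (rule iso_restrict[OF H(2) G(1) H(1) sN])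
  moreover have "finite N" using subgroup.subset[OF sN] G(2) finite_subset by blast
  ultimately have "x \<in> gext \<gamma> (G\<lparr>carrier := N\<rparr>) \<longleftrightarrow> x \<in> N \<and> restrict u N x \<in> \<gamma> (H\<lparr>carrier := u ` N\<rparr>)"
    using gext_mem[OF fn subgroup.subgroup_is_group[OF sN G(1)] _ subgroup.subgroup_is_group[OF img H(1)]]
    by simp
  then show "x \<in> gext \<gamma> (G\<lparr>carrier := N\<rparr>) \<longleftrightarrow> x \<in> N \<and> u x \<in> \<gamma> (H\<lparr>carrier := u ` N\<rparr>)" by auto
qed

lemma gext_normal_mono:
  fixes G :: "'a monoid"
  assumes fn: "functorial \<gamma>" "F2 \<gamma>" and G: "group G" "finite (carrier G)" and N: "N \<lhd> G"
  shows "gext \<gamma> (G\<lparr>carrier := N\<rparr>) \<subseteq> gext \<gamma> G"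
proof
  obtain H :: "nat monoid" and u where H: "group H" "u \<in> iso G H" "finite (carrier H)"
    using ex_nat_copy[OF G] by metis
  note c = gext_restrict_copy[OF fn(1) G N H(1,2)]
  have "\<gamma> (H\<lparr>carrier := u ` N\<rparr>) \<subseteq> \<gamma> H" using fn(2) H c(1) unfolding F2_def by blast
  fix x assume "x \<in> gext \<gamma> (G\<lparr>carrier := N\<rparr>)"
  then have "x \<in> N" "u x \<in> \<gamma> H" using c(2) \<open>\<gamma> _ \<subseteq> \<gamma> H\<close> by auto
  moreover have "N \<subseteq> carrier G" using normal_imp_subgroup[OF N] subgroup.subset by blast
  ultimately show "x \<in> gext \<gamma> G" using gext_mem[OF fn(1) G H(1,2)] by auto
qed

lemma gext_normal_Int:
  fixes G :: "'a monoid"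
  assumes fn: "functorial \<gamma>" "F5 \<gamma>" and G: "group G" "finite (carrier G)" and N: "N \<lhd> G"
  shows "gext \<gamma> G \<inter> N \<subseteq> gext \<gamma> (G\<lparr>carrier := N\<rparr>)"
proof
  obtain H :: "nat monoid" and u where H: "group H" "u \<in> iso G H" "finite (carrier H)"
    using ex_nat_copy[OF G] by metis
  note c = gext_restrict_copy[OF fn(1) G N H(1,2)]
  have sub: "\<gamma> H \<inter> u ` N \<subseteq> \<gamma> (H\<lparr>carrier := u ` N\<rparr>)" using fn(2) H c(1) unfolding F5_def by blast
  fix x assume "x \<in> gext \<gamma> G \<inter> N"
  then have "u x \<in> \<gamma> H" "x \<in> N" using gext_mem[OF fn(1) G H(1,2)] by auto
  then show "x \<in> gext \<gamma> (G\<lparr>carrier := N\<rparr>)" using c(2) sub by auto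
qed

lemma gext_centralizer:
  fixes G :: "'a monoid"
  assumes fn: "functorial \<gamma>" "F3 \<gamma>" and G: "group G" "finite (carrier G)"
    and x: "x \<in> carrier G" "\<And>y. y \<in> gext \<gamma> G \<Longrightarrow> x \<otimes>\<^bsub>G\<^esub> y = y \<otimes>\<^bsub>G\<^esub> x"
  shows "x \<in> gext \<gamma> G"
proof -
  obtain H :: "nat monoid" and u where H: "group H" "u \<in> iso G H" "finite (carrier H)"
    using ex_nat_copy[OF G] by metis
  have sub: "\<gamma> H \<subseteq> carrier H" using fn(1) H unfolding functorial_def by (auto dest: subgroup.subset)
  have ux: "u x \<in> carrier H" using iso_image[OF H(2)] x(1) by blast
  have "u x \<otimes>\<^bsub>H\<^esub> z = z \<otimes>\<^bsub>H\<^esub> u x" if z: "z \<in> \<gamma> H" for z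
  proof -
    obtain y where y: "y \<in> carrier G" "z = u y" using sub z iso_image[OF H(2)] by blast
    then have "x \<otimes>\<^bsub>G\<^esub> y = y \<otimes>\<^bsub>G\<^esub> x" using x(2) gext_mem[OF fn(1) G H(1,2)] z by simp
    then show ?thesis using hom_mult[OF iso_hom[OF H(2)]] x(1) y by metis
  qed
  then have "u x \<in> \<gamma> H" using fn(2) H ux unfolding F3_def by blast
  then show ?thesis using gext_mem[OF fn(1) G H(1,2)] x(1) by simp
qed

text \<open>Conjugation is an automorphism, so normality is a case of
  \<open>gext_iso\<close>.\<close>

lemma gext_normal:
  fixes G :: "'a monoid"
  assumes fn: "functorial \<gamma>" and G: "group G" "finite (carrier G)"
  shows "gext \<gamma> G \<lhd> G"
proof -
  interpret group G by fact
  obtain H :: "nat monoid" and u where H: "group H" "u \<in> iso G H" "finite (carrier H)"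
    using ex_nat_copy[OF G] by metis
  note mem = gext_mem[OF fn G H(1,2)]
  interpret u: group_hom G H u
    by (rule group_hom.intro[OF G(1) H(1)]) (simp add: group_hom_axioms_def iso_hom[OF H(2)])
  have s: "subgroup (\<gamma> H) H" using fn H unfolding functorial_def by blast
  have sub: "subgroup (gext \<gamma> G) G"
  proof (rule subgroupI)
    show "gext \<gamma> G \<subseteq> carrier G" using mem by auto
    show "gext \<gamma> G \<noteq> {}" using mem[of "\<one>\<^bsub>G\<^esub>"] subgroup.one_closed[OF s] by auto
    show "inv\<^bsub>G\<^esub> a \<in> gext \<gamma> G" if "a \<in> gext \<gamma> G" for a
      using that mem subgroup.m_inv_closed[OF s] by auto
    show "a \<otimes>\<^bsub>G\<^esub> b \<in> gext \<gamma> G" if "a \<in> gext \<gamma> G" "b \<in> gext \<gamma> G" for a b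
      using that mem subgroup.m_closed[OF s] by auto
  qed
  have "g \<otimes>\<^bsub>G\<^esub> x \<otimes>\<^bsub>G\<^esub> inv\<^bsub>G\<^esub> g \<in> gext \<gamma> G" if g: "g \<in> carrier G" and x: "x \<in> gext \<gamma> G" for g x
  proof -
    let ?c = "\<lambda>x. g \<otimes>\<^bsub>G\<^esub> x \<otimes>\<^bsub>G\<^esub> inv\<^bsub>G\<^esub> g"
    have xG: "x \<in> carrier G" using mem x by auto
    have canc: "inv\<^bsub>G\<^esub> g \<otimes>\<^bsub>G\<^esub> (g \<otimes>\<^bsub>G\<^esub> a) = a" "g \<otimes>\<^bsub>G\<^esub> (inv\<^bsub>G\<^esub> g \<otimes>\<^bsub>G\<^esub> a) = a" if "a \<in> carrier G" for a
      using g that by (simp_all add: m_assoc[symmetric])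
    have "?c \<in> iso G G"
    proof (rule isoI)
      show "?c \<in> hom G G" using g by (auto simp: hom_def m_assoc canc)
      show "bij_betw ?c (carrier G) (carrier G)"
        by (rule bij_betw_byWitness[where f' = "\<lambda>x. inv\<^bsub>G\<^esub> g \<otimes>\<^bsub>G\<^esub> x \<otimes>\<^bsub>G\<^esub> g"])
           (use g in \<open>auto simp: m_assoc canc\<close>)
    qed
    then show ?thesis using gext_iso[OF fn G G(1) _ xG] x by simp
  qed
  then show ?thesis using sub by (simp add: normal_inv_iff)
qed

lemma gext_internal_functorial:
  assumes "functorial \<gamma>" "F2 \<gamma>" "F3 \<gamma>"
  shows "internal_functorial (\<lambda>S::'a::mgroup set. gext \<gamma> (mgrp S))"
proof
  fix S N :: "'a set"
  assume S: "sg S" "finite S"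
  note g = mgrp_group[OF S(1)]
  have fin: "finite (carrier (mgrp S))" using S by simp
  show n: "nsg (gext \<gamma> (mgrp S)) S" using gext_normal[OF assms(1) g fin] mgrp_normal[OF S(1)] by simp
  show "cent S (gext \<gamma> (mgrp S)) \<subseteq> gext \<gamma> (mgrp S)"
    using gext_centralizer[OF assms(1,3) g fin] by (auto simp: cent_def)
  assume N: "nsg N S"
  have "(mgrp S)\<lparr>carrier := N\<rparr> = mgrp N" by (simp add: mgrp_def)
  then show "gext \<gamma> (mgrp N) \<subseteq> gext \<gamma> (mgrp S)"
    using gext_normal_mono[OF assms(1,2) g fin] mgrp_normal[OF S(1)] N by metis
qed

section \<open>The series and its behaviour on normal subgroups\<close>

lemma gser_normal_Suc:
  fixes G :: "'a monoid"
  assumes fn: "functorial \<gamma>" and G: "group G" "finite (carrier G)" and K: "gser \<gamma> G i \<lhd> G"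
  shows "x \<in> gser \<gamma> G (Suc i) \<longleftrightarrow> x \<in> carrier G \<and> gser \<gamma> G i #>\<^bsub>G\<^esub> x \<in> gext \<gamma> (G Mod gser \<gamma> G i)"
proof -
  let ?K = "gser \<gamma> G i"
  interpret normal ?K G by fact
  have Q: "group (G Mod ?K)" by (rule factorgroup_is_group)
  have sub: "gext \<gamma> (G Mod ?K) \<subseteq> carrier (G Mod ?K)" by (rule gext_subset[OF fn Q finite_FactGroup[OF G(2)]])
  have s: "subgroup ?K G" by (rule subgroup_axioms)
  \<comment> \<open>The union of a set of cosets is its full preimage, as each element determines
    its coset.\<close>
  show ?thesis
  proof
    assume "x \<in> gser \<gamma> G (Suc i)"
    then obtain Y where Y: "Y \<in> gext \<gamma> (G Mod ?K)" "x \<in> Y" by auto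
    then obtain y where y: "y \<in> carrier G" "Y = ?K #>\<^bsub>G\<^esub> y" using sub by (auto simp: carrier_FactGroup)
    then have "x \<in> carrier G" using Y(2) r_coset_subset_G[OF subset] by blast
    moreover have "Y = ?K #>\<^bsub>G\<^esub> x" using repr_independence[OF _ y(1) s] Y(2) y(2) by simp
    ultimately show "x \<in> carrier G \<and> ?K #>\<^bsub>G\<^esub> x \<in> gext \<gamma> (G Mod ?K)" using Y(1) by simp
  next
    assume "x \<in> carrier G \<and> ?K #>\<^bsub>G\<^esub> x \<in> gext \<gamma> (G Mod ?K)"
    then show "x \<in> gser \<gamma> G (Suc i)" using rcos_self[OF _ s, of x] by auto
  qed
qed

lemma gser_normal:
  fixes G :: "'a monoid"
  assumes fn: "functorial \<gamma>" and G: "group G" "finite (carrier G)"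
  shows "gser \<gamma> G i \<lhd> G"
proof (induction i)
  case 0
  show ?case using group.one_is_normal[OF G(1)] by simp
next
  case (Suc i)
  let ?K = "gser \<gamma> G i"
  interpret normal ?K G by fact
  have Q: "group (G Mod ?K)" by (rule factorgroup_is_group)
  have n: "gext \<gamma> (G Mod ?K) \<lhd> G Mod ?K" by (rule gext_normal[OF fn Q finite_FactGroup[OF G(2)]])
  interpret E: normal "gext \<gamma> (G Mod ?K)" "G Mod ?K" by (rule n)
  note mem = gser_normal_Suc[OF fn G Suc]
  have hc: "?K #>\<^bsub>G\<^esub> x \<in> carrier (G Mod ?K)" if "x \<in> carrier G" for x
    using that by (auto simp: carrier_FactGroup)
  interpret q: group_hom G "G Mod ?K" "\<lambda>x. ?K #>\<^bsub>G\<^esub> x"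
    by (rule group_hom.intro[OF G(1) Q]) (auto simp: group_hom_axioms_def hom_def hc rcos_sum)
  have "subgroup (gser \<gamma> G (Suc i)) G"
  proof (rule subgroupI)
    show "gser \<gamma> G (Suc i) \<subseteq> carrier G" using mem by blast
    have "\<one>\<^bsub>G\<^esub> \<in> gser \<gamma> G (Suc i)" unfolding mem using subgroup.one_closed[OF E.subgroup_axioms] q.hom_one by simp
    then show "gser \<gamma> G (Suc i) \<noteq> {}" by blast
    show "inv\<^bsub>G\<^esub> a \<in> gser \<gamma> G (Suc i)" if "a \<in> gser \<gamma> G (Suc i)" for a
      using that unfolding mem using subgroup.m_inv_closed[OF E.subgroup_axioms] q.hom_inv by auto
    show "a \<otimes>\<^bsub>G\<^esub> b \<in> gser \<gamma> G (Suc i)" if "a \<in> gser \<gamma> G (Suc i)" "b \<in> gser \<gamma> G (Suc i)" for a b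
      using that unfolding mem using subgroup.m_closed[OF E.subgroup_axioms] q.hom_mult by auto
  qed
  moreover have "g \<otimes>\<^bsub>G\<^esub> x \<otimes>\<^bsub>G\<^esub> inv\<^bsub>G\<^esub> g \<in> gser \<gamma> G (Suc i)"
    if "g \<in> carrier G" "x \<in> gser \<gamma> G (Suc i)" for g x
    using that E.inv_op_closed2 unfolding mem by (auto simp: q.hom_mult q.hom_inv simp del: mult_FactGroup)
  ultimately show ?case by (simp only: normal_inv_iff) blast
qed

text \<open>By the isomorphism theorem and \<open>gext_iso\<close>, any epimorphism with kernel
  \<open>gser \<gamma> G i\<close> may replace the coset projection. This allows the series to be
  computed in permutation copies of the quotients.\<close>

lemma gser_via_hom:
  fixes G :: "'a monoid" and Q :: "'b monoid"
  assumes fn: "functorial \<gamma>" and G: "group G" "finite (carrier G)" and Q: "group Q"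
    and f: "f \<in> hom G Q" "f ` carrier G = carrier Q"
    and ker: "\<And>x. x \<in> carrier G \<Longrightarrow> f x = \<one>\<^bsub>Q\<^esub> \<longleftrightarrow> x \<in> gser \<gamma> G i" and x: "x \<in> carrier G"
  shows "x \<in> gser \<gamma> G (Suc i) \<longleftrightarrow> f x \<in> gext \<gamma> Q"
proof -
  let ?K = "gser \<gamma> G i"
  have nK: "?K \<lhd> G" by (rule gser_normal[OF fn G])
  interpret normal ?K G by fact
  interpret f: group_hom G Q f by (rule group_hom.intro[OF G(1) Q]) (simp add: group_hom_axioms_def f)
  have "kernel G Q f = ?K" using ker subset by (auto simp: kernel_def)
  then have iso: "(\<lambda>Y. the_elem (f ` Y)) \<in> iso (G Mod ?K) Q" using f.FactGroup_iso_set[OF f(2)] by simp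
  have "f ` (?K #>\<^bsub>G\<^esub> x) = {f x}"
  proof (intro subset_antisym subsetI)
    fix y assume "y \<in> f ` (?K #>\<^bsub>G\<^esub> x)"
    then obtain k where k: "k \<in> ?K" "y = f (k \<otimes>\<^bsub>G\<^esub> x)" by (auto simp: r_coset_def)
    then have "k \<in> carrier G" using subset by blast
    then show "y \<in> {f x}" using k ker x by simp
  next
    fix y assume "y \<in> {f x}"
    then show "y \<in> f ` (?K #>\<^bsub>G\<^esub> x)" using rcos_self[OF x subgroup_axioms] by simp
  qed
  then have e: "the_elem (f ` (?K #>\<^bsub>G\<^esub> x)) = f x" by simp
  have "?K #>\<^bsub>G\<^esub> x \<in> carrier (G Mod ?K)" using x by (auto simp: carrier_FactGroup)
  then have "f x \<in> gext \<gamma> Q \<longleftrightarrow> ?K #>\<^bsub>G\<^esub> x \<in> gext \<gamma> (G Mod ?K)"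
    using gext_iso[OF fn factorgroup_is_group finite_FactGroup[OF G(2)] Q iso] e by metis
  then show ?thesis unfolding gser_normal_Suc[OF fn G nK] using x by simp
qed

text \<open>By induction, the projection of \<open>N\<close> modulo \<open>gser \<gamma> G i\<close>
  factors through the quotient of \<open>N\<close> by its own term. (F1) carries \<gamma> along this
  epimorphism to the image of \<open>N\<close>, and (F2) from that normal subgroup to the whole
  quotient.\<close>

lemma gser_mono_normal:
  fixes G :: "'a monoid"
  assumes fn: "functorial \<gamma>" "F1 \<gamma>" "F2 \<gamma>" and G: "group G" "finite (carrier G)" and N: "N \<lhd> G"
  shows "gser \<gamma> (G\<lparr>carrier := N\<rparr>) i \<subseteq> gser \<gamma> G i"
proof (induction i)
  case (Suc i)
  let ?N = "G\<lparr>carrier := N\<rparr>" and ?K = "gser \<gamma> G i" and ?L = "gser \<gamma> (G\<lparr>carrier := N\<rparr>) i"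
  have sN: "subgroup N G" by (rule normal_imp_subgroup[OF N])
  have NG: "N \<subseteq> carrier G" by (rule subgroup.subset[OF sN])
  have gN: "group ?N" "finite (carrier ?N)"
    using subgroup.subgroup_is_group[OF sN G(1)] finite_subset[OF NG G(2)] by auto
  have nK: "?K \<lhd> G" by (rule gser_normal[OF fn(1) G])
  have nL: "?L \<lhd> ?N" by (rule gser_normal[OF fn(1) gN])
  interpret K: normal ?K G by fact
  let ?Q = "G Mod ?K"
  have Q: "group ?Q" "finite (carrier ?Q)" using K.factorgroup_is_group finite_FactGroup[OF G(2)] by auto
  let ?q = "\<lambda>x. ?K #>\<^bsub>G\<^esub> x"
  interpret q: group_hom G ?Q ?q
    by (rule group_hom.intro[OF G(1) Q(1)]) (auto simp: group_hom_axioms_def hom_def carrier_FactGroup K.rcos_sum)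
  have nqN: "?q ` N \<lhd> ?Q"
    by (rule normal.surj_hom_normal_subgroup[OF N q.group_hom_axioms]) (simp add: carrier_FactGroup)
  let ?QN = "?Q\<lparr>carrier := ?q ` N\<rparr>"
  have QN: "group ?QN" by (rule subgroup.subgroup_is_group[OF normal_imp_subgroup[OF nqN] Q(1)])
  have hq: "?q \<in> hom ?N ?QN"
  proof (rule homI)
    fix x y assume "x \<in> carrier ?N" "y \<in> carrier ?N"
    then have "x \<in> carrier G" "y \<in> carrier G" using NG by auto
    then show "?q (x \<otimes>\<^bsub>?N\<^esub> y) = ?q x \<otimes>\<^bsub>?QN\<^esub> ?q y" using K.rcos_sum[of x y] by simp
  qed simp
  have resp: "?q x = ?q y"
    if xy: "x \<in> carrier ?N" "y \<in> carrier ?N" "?L #>\<^bsub>?N\<^esub> x = ?L #>\<^bsub>?N\<^esub> y" for x y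
  proof -
    have "x \<otimes>\<^bsub>G\<^esub> inv\<^bsub>G\<^esub> y \<in> ?L"
      using normal_rcos_iff[OF nL xy(1,2)] xy group.m_inv_consistent[OF G(1) sN, of y] by simp
    then show ?thesis using Suc normal_rcos_iff[OF nK, of x y] xy NG by auto
  qed
  obtain g where g: "g \<in> hom (?N Mod ?L) ?QN" "\<And>x. x \<in> carrier ?N \<Longrightarrow> g (?L #>\<^bsub>?N\<^esub> x) = ?q x"
    using FactGroup_universal[OF hq nL resp] by blast
  have gs: "g ` carrier (?N Mod ?L) = carrier ?QN"
    unfolding carrier_FactGroup image_image using g(2) by simp
  show ?case
  proof
    fix x assume "x \<in> gser \<gamma> ?N (Suc i)"
    then have x: "x \<in> N" "?L #>\<^bsub>?N\<^esub> x \<in> gext \<gamma> (?N Mod ?L)"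
      unfolding gser_normal_Suc[OF fn(1) gN nL] by auto
    have "g (?L #>\<^bsub>?N\<^esub> x) \<in> gext \<gamma> ?QN"
      by (rule gext_epi[OF fn(1,2) normal.factorgroup_is_group[OF nL] finite_FactGroup[OF gN(2)] QN g(1) gs x(2)])
    then have "?q x \<in> gext \<gamma> ?Q" using g(2) x(1) gext_normal_mono[OF fn(1,3) Q nqN] by auto
    then show "x \<in> gser \<gamma> G (Suc i)" unfolding gser_normal_Suc[OF fn(1) G nK] using x(1) NG by auto
  qed
qed simp

text \<open>The induction hypothesis and \<open>gser_mono_normal\<close> identify the kernel of the
  projection on \<open>N\<close> with the term for \<open>N\<close>. So the next term can be
  computed in the image of \<open>N\<close>, where (F5) applies.\<close>

lemma gser_Int_normal:
  fixes G :: "'a monoid"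
  assumes fn: "functorial \<gamma>" "F1 \<gamma>" "F2 \<gamma>" "F5 \<gamma>" and G: "group G" "finite (carrier G)" and N: "N \<lhd> G"
  shows "gser \<gamma> G i \<inter> N \<subseteq> gser \<gamma> (G\<lparr>carrier := N\<rparr>) i"
proof (induction i)
  case (Suc i)
  let ?N = "G\<lparr>carrier := N\<rparr>" and ?K = "gser \<gamma> G i"
  have sN: "subgroup N G" by (rule normal_imp_subgroup[OF N])
  have NG: "N \<subseteq> carrier G" by (rule subgroup.subset[OF sN])
  have gN: "group ?N" "finite (carrier ?N)"
    using subgroup.subgroup_is_group[OF sN G(1)] finite_subset[OF NG G(2)] by auto
  have nK: "?K \<lhd> G" by (rule gser_normal[OF fn(1) G])
  interpret K: normal ?K G by fact
  let ?Q = "G Mod ?K"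
  have Q: "group ?Q" "finite (carrier ?Q)" using K.factorgroup_is_group finite_FactGroup[OF G(2)] by auto
  let ?q = "\<lambda>x. ?K #>\<^bsub>G\<^esub> x"
  interpret q: group_hom G ?Q ?q
    by (rule group_hom.intro[OF G(1) Q(1)]) (auto simp: group_hom_axioms_def hom_def carrier_FactGroup K.rcos_sum)
  have nqN: "?q ` N \<lhd> ?Q"
    by (rule normal.surj_hom_normal_subgroup[OF N q.group_hom_axioms]) (simp add: carrier_FactGroup)
  let ?QN = "?Q\<lparr>carrier := ?q ` N\<rparr>"
  have QN: "group ?QN" by (rule subgroup.subgroup_is_group[OF normal_imp_subgroup[OF nqN] Q(1)])
  have hq: "?q \<in> hom ?N ?QN"
  proof (rule homI)
    fix x y assume "x \<in> carrier ?N" "y \<in> carrier ?N"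
    then have "x \<in> carrier G" "y \<in> carrier G" using NG by auto
    then show "?q (x \<otimes>\<^bsub>?N\<^esub> y) = ?q x \<otimes>\<^bsub>?QN\<^esub> ?q y" using K.rcos_sum[of x y] by simp
  qed simp
  have sub: "gser \<gamma> ?N i \<subseteq> ?K" by (rule gser_mono_normal[OF fn(1-3) G N])
  have ker: "?q x = \<one>\<^bsub>?QN\<^esub> \<longleftrightarrow> x \<in> gser \<gamma> ?N i" if x: "x \<in> carrier ?N" for x
  proof -
    have "?q x = ?K \<longleftrightarrow> x \<in> ?K"
      using normal_rcos_iff[OF nK, of x "\<one>\<^bsub>G\<^esub>"] x NG K.coset_mult_one[OF K.subset] by auto
    then show ?thesis using x Suc sub by auto
  qed
  show ?case
  proof
    fix x assume x: "x \<in> gser \<gamma> G (Suc i) \<inter> N"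
    then have "x \<in> gser \<gamma> G (Suc i)" "x \<in> N" by (simp_all only: Int_iff)
    then have "?q x \<in> gext \<gamma> ?Q \<inter> ?q ` N" unfolding gser_normal_Suc[OF fn(1) G nK] by blast
    then have "?q x \<in> gext \<gamma> ?QN" using gext_normal_Int[OF fn(1,4) Q nqN] by auto
    then show "x \<in> gser \<gamma> ?N (Suc i)"
      using gser_via_hom[OF fn(1) gN QN hq _ ker] x by simp
  qed
qed (use subgroup.one_closed[OF normal_imp_subgroup[OF N]] in simp)

lemma gser_subset_Suc:
  fixes G :: "'a monoid"
  assumes fn: "functorial \<gamma>" and G: "group G" "finite (carrier G)"
  shows "gser \<gamma> G i \<subseteq> gser \<gamma> G (Suc i)"
proof
  let ?K = "gser \<gamma> G i"
  have nK: "?K \<lhd> G" by (rule gser_normal[OF fn G])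
  interpret normal ?K G by fact
  have Q: "group (G Mod ?K)" by (rule factorgroup_is_group)
  have one: "?K \<in> gext \<gamma> (G Mod ?K)"
    using subgroup.one_closed[OF normal_imp_subgroup[OF gext_normal[OF fn Q finite_FactGroup[OF G(2)]]]] by simp
  fix x assume x: "x \<in> ?K"
  then have "?K #>\<^bsub>G\<^esub> x = ?K" using coset_join2[OF _ subgroup_axioms x] subset by blast
  then show "x \<in> gser \<gamma> G (Suc i)" unfolding gser_normal_Suc[OF fn G nK] using x subset one by auto
qed

text \<open>If the series stood still, \<gamma> of a nontrivial quotient would be trivial and its
  centralizer everything, against (F3).\<close>

lemma gser_proper_Suc:
  fixes G :: "'a monoid"
  assumes fn: "functorial \<gamma>" "F3 \<gamma>" and G: "group G" "finite (carrier G)"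
    and proper: "gser \<gamma> G i \<noteq> carrier G"
  shows "gser \<gamma> G i \<subset> gser \<gamma> G (Suc i)"
proof -
  let ?K = "gser \<gamma> G i"
  have nK: "?K \<lhd> G" by (rule gser_normal[OF fn(1) G])
  interpret normal ?K G by fact
  have Q: "group (G Mod ?K)" "finite (carrier (G Mod ?K))"
    using factorgroup_is_group finite_FactGroup[OF G(2)] by auto
  interpret Q: group "G Mod ?K" by (rule Q)
  have "gser \<gamma> G (Suc i) \<noteq> ?K"
  proof
    assume eq: "gser \<gamma> G (Suc i) = ?K"
    have "Y = ?K" if Y: "Y \<in> gext \<gamma> (G Mod ?K)" for Y
    proof -
      obtain y where y: "y \<in> carrier G" "Y = ?K #>\<^bsub>G\<^esub> y"
        using Y gext_subset[OF fn(1) Q] by (auto simp: carrier_FactGroup)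
      then have "y \<in> ?K" using eq Y gser_normal_Suc[OF fn(1) G nK] by blast
      then show ?thesis using y coset_join2[OF y(1) subgroup_axioms] by simp
    qed
    then have triv: "Y = \<one>\<^bsub>G Mod ?K\<^esub>" if "Y \<in> gext \<gamma> (G Mod ?K)" for Y using that by simp
    obtain x where x: "x \<in> carrier G" "x \<notin> ?K" using proper subset by blast
    have xQ: "?K #>\<^bsub>G\<^esub> x \<in> carrier (G Mod ?K)" using x by (auto simp: carrier_FactGroup)
    have "?K #>\<^bsub>G\<^esub> x \<in> gext \<gamma> (G Mod ?K)"
    proof (rule gext_centralizer[OF fn Q xQ])
      fix Y assume "Y \<in> gext \<gamma> (G Mod ?K)"
      then have Y: "Y = \<one>\<^bsub>G Mod ?K\<^esub>" by (rule triv)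
      show "(?K #>\<^bsub>G\<^esub> x) \<otimes>\<^bsub>G Mod ?K\<^esub> Y = Y \<otimes>\<^bsub>G Mod ?K\<^esub> (?K #>\<^bsub>G\<^esub> x)"
        unfolding Y using Q.r_one[OF xQ] Q.l_one[OF xQ] by metis
    qed
    then have "x \<in> ?K" using eq x gser_normal_Suc[OF fn(1) G nK] by blast
    then show False using x by simp
  qed
  then show ?thesis using gser_subset_Suc[OF fn(1) G] by blast
qed

lemma gser_subset_carrier:
  fixes G :: "'a monoid"
  assumes "functorial \<gamma>" "group G" "finite (carrier G)"
  shows "gser \<gamma> G i \<subseteq> carrier G"
  using normal_imp_subgroup[OF gser_normal[OF assms]] subgroup.subset by blast

lemma gser_mono:
  fixes G :: "'a monoid"
  assumes "functorial \<gamma>" "group G" "finite (carrier G)" "i \<le> j"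
  shows "gser \<gamma> G i \<subseteq> gser \<gamma> G j"
  using assms(4)
proof (induction rule: dec_induct)
  case (step n)
  show ?case using step(3) gser_subset_Suc[OF assms(1-3), of n] by (rule subset_trans)
qed simp

text \<open>Strict growth in a finite group. It makes the \<open>LEAST\<close> in
  \<open>hgam\<close> refer to an index that really exists.\<close>

lemma gser_reaches_carrier:
  fixes G :: "'a monoid"
  assumes fn: "functorial \<gamma>" "F3 \<gamma>" and G: "group G" "finite (carrier G)"
  shows "\<exists>h. gser \<gamma> G h = carrier G"
proof (rule ccontr)
  assume "\<nexists>h. gser \<gamma> G h = carrier G"
  then have ne: "gser \<gamma> G h \<noteq> carrier G" for h by blast
  have "i \<le> card (gser \<gamma> G i)" for i
  proof (induction i)
    case (Suc i)
    have "card (gser \<gamma> G i) < card (gser \<gamma> G (Suc i))"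
      by (rule psubset_card_mono[OF finite_subset[OF gser_subset_carrier[OF fn(1) G] G(2)]
            gser_proper_Suc[OF fn G ne]])
    then show ?case using Suc by simp
  qed simp
  from this[of "Suc (card (carrier G))"] show False
    using card_mono[OF G(2) gser_subset_carrier[OF fn(1) G]] by (metis Suc_n_not_le_n le_trans)
qed

lemma hgam_le_iff:
  fixes G :: "'a monoid"
  assumes fn: "functorial \<gamma>" "F3 \<gamma>" and G: "group G" "finite (carrier G)"
  shows "hgam \<gamma> G \<le> h \<longleftrightarrow> gser \<gamma> G h = carrier G"
proof
  have "gser \<gamma> G (hgam \<gamma> G) = carrier G"
    unfolding hgam_def by (rule LeastI_ex[OF gser_reaches_carrier[OF fn G]])
  then show "gser \<gamma> G h = carrier G" if "hgam \<gamma> G \<le> h"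
    using gser_mono[OF fn(1) G that] gser_subset_carrier[OF fn(1) G] by blast
  show "hgam \<gamma> G \<le> h" if "gser \<gamma> G h = carrier G"
    unfolding hgam_def by (rule Least_le[of "\<lambda>h. gser \<gamma> G h = carrier G", OF that])
qed

section \<open>Quasinilpotent residuals\<close>

text \<open>\<open>qnr G N\<close> says that \<open>G / N\<close> is quasinilpotent, in terms of chief factors of \<open>G\<close> above \<open>N\<close>.\<close>

definition qnr :: "'a::mgroup set \<Rightarrow> 'a set \<Rightarrow> bool" where
  "qnr G N \<longleftrightarrow> (\<forall>H K. chief G H K \<and> N \<subseteq> K \<longrightarrow> (\<forall>g\<in>G. inner_on g H K))"

lemma chiefD:
  assumes "chief G H K"
  shows "nsg K G" "nsg H G" "K \<subseteq> H" "K \<noteq> H"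
    "\<And>N. nsg N G \<Longrightarrow> K \<subseteq> N \<Longrightarrow> N \<subseteq> H \<Longrightarrow> N = K \<or> N = H"
  using assms unfolding chief_def by auto

lemma chiefI:
  assumes "nsg K G" "nsg H G" "K \<subseteq> H" "K \<noteq> H"
    "\<And>N. nsg N G \<Longrightarrow> K \<subseteq> N \<Longrightarrow> N \<subseteq> H \<Longrightarrow> N = K \<or> N = H"
  shows "chief G H K"
  using assms unfolding chief_def by auto

text \<open>Subgroups of \<open>P\<close> above the kernel \<open>N\<close> are full preimages of
  their images, so chief factors above \<open>N\<close> correspond to chief factors of the
  image.\<close>

lemma qnr_of_image:
  assumes P: "sg P" and \<chi>: "ghom \<chi> P" and ker: "\<And>x. x \<in> P \<Longrightarrow> \<chi> x = 1 \<longleftrightarrow> x \<in> N"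
    and q: "qn (\<chi> ` P)"
  shows "qnr P N"
  unfolding qnr_def
proof (intro allI impI ballI)
  fix H K g
  assume "chief P H K \<and> N \<subseteq> K" and g: "g \<in> P"
  then have ch: "chief P H K" and NK: "N \<subseteq> K" by auto
  note c = chiefD[OF ch]
  have sub: "K \<subseteq> P" "H \<subseteq> P" "sg K" "sg H" using c(1,2) nsg_subset nsg_sg by auto
  have sat: "x \<in> L" if L: "sg L" "L \<subseteq> P" "N \<subseteq> L" and x: "x \<in> P" "\<chi> x \<in> \<chi> ` L" for x L
  proof -
    obtain y where y: "y \<in> L" "\<chi> x = \<chi> y" using x by auto
    then have "x * inverse y \<in> N" using ghom_eq_iff[OF \<chi> P ker x(1), of y] L by auto
    then have "x * inverse y \<in> L" using L by auto
    then show ?thesis using sg_right_iff[OF L(1), of "inverse y" x] y L by simp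
  qed
  have NH: "N \<subseteq> H" using NK c(3) by simp
  have "chief (\<chi> ` P) (\<chi> ` H) (\<chi> ` K)"
  proof (rule chiefI)
    show "nsg (\<chi> ` K) (\<chi> ` P)" "nsg (\<chi> ` H) (\<chi> ` P)" using ghom_image_nsg[OF \<chi> P] c by auto
    show "\<chi> ` K \<subseteq> \<chi> ` H" using c(3) by auto
    show "\<chi> ` K \<noteq> \<chi> ` H"
    proof
      assume eq: "\<chi> ` K = \<chi> ` H"
      have "h \<in> K" if "h \<in> H" for h using sat[OF sub(3,1) NK, of h] that sub eq by auto
      then show False using c(3,4) by auto
    qed
    fix M assume M: "nsg M (\<chi> ` P)" "\<chi> ` K \<subseteq> M" "M \<subseteq> \<chi> ` H"
    let ?V = "{x \<in> P. \<chi> x \<in> M}"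
    have "?V = K \<or> ?V = H"
    proof (rule c(5)[OF ghom_vimage_nsg[OF \<chi> P M(1)]])
      show "K \<subseteq> ?V" using M(2) sub by auto
      show "?V \<subseteq> H" using sat[OF sub(4,2) NH] M(3) by auto
    qed
    moreover have "\<chi> ` ?V = M" using nsg_subset[OF M(1)] by auto
    ultimately show "M = \<chi> ` K \<or> M = \<chi> ` H" by auto
  qed
  then have "inner_on (\<chi> g) (\<chi> ` H) (\<chi> ` K)" using q g unfolding qn_def by blast
  then obtain h where h: "h \<in> H"
    "\<forall>y\<in>\<chi> ` H. (\<chi> g * y * inverse (\<chi> g)) * inverse (\<chi> h * y * inverse (\<chi> h)) \<in> \<chi> ` K"
    unfolding inner_on_def by auto
  have hP: "h \<in> P" using h sub by auto
  have "(g * x * inverse g) * inverse (h * x * inverse h) \<in> K" if x: "x \<in> H" for x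
  proof (rule sat[OF sub(3,1) NK])
    have xP: "x \<in> P" using x sub by auto
    show "(g * x * inverse g) * inverse (h * x * inverse h) \<in> P" using g hP xP P by simp
    have "\<chi> ((g * x * inverse g) * inverse (h * x * inverse h))
        = (\<chi> g * \<chi> x * inverse (\<chi> g)) * inverse (\<chi> h * \<chi> x * inverse (\<chi> h))"
      using g hP xP P by (simp add: ghom_mult[OF \<chi>] ghom_inverse[OF \<chi> P])
    then show "\<chi> ((g * x * inverse g) * inverse (h * x * inverse h)) \<in> \<chi> ` K"
      using h(2) x by auto
  qed
  then show "inner_on g H K" unfolding inner_on_def by (intro bexI[OF _ h(1)] ballI)
qed

lemma qn_image_of_qnr:
  assumes P: "sg P" and \<chi>: "ghom \<chi> P" and R: "\<And>x. x \<in> R \<Longrightarrow> x \<in> P \<and> \<chi> x = 1" and q: "qnr P R"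
  shows "qn (\<chi> ` P)"
  unfolding qn_def
proof (intro allI impI ballI)
  fix H K g assume ch: "chief (\<chi> ` P) H K" and "g \<in> \<chi> ` P"
  then obtain a where a: "g = \<chi> a" "a \<in> P" by auto
  have "R \<subseteq> {x \<in> P. \<chi> x \<in> K}" using R sg_one[OF nsg_sg[OF chiefD(1)[OF ch]]] by auto
  then have "inner_on a {x \<in> P. \<chi> x \<in> H} {x \<in> P. \<chi> x \<in> K}"
    using chief_vimage[OF \<chi> P ch] q a(2) unfolding qnr_def by blast
  then show "inner_on g H K"
    unfolding a(1) by (rule inner_on_image[OF \<chi> P a(2) nsg_subset[OF chiefD(2)[OF ch]]])
qed

text \<open>\<open>L / M\<close> is isomorphic to \<open>(L \<bullet> N) / (M \<bullet> N)\<close>,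
  a chief factor above \<open>N\<close>, compatibly with the action of \<open>P\<close>. There
  \<open>g\<close> acts as some \<open>h * n\<close>, and \<open>n\<close> may be dropped because
  its commutators lie in \<open>N\<close>.\<close>

lemma inner_on_covered:
  assumes P: "sg P" and ch: "chief P L M" and N: "nsg N P" and meet: "L \<inter> (M \<bullet> N) = M"
    and q: "qnr P N" and g: "g \<in> P"
  shows "inner_on g L M"
proof -
  note c = chiefD[OF ch]
  have s: "sg L" "sg M" "sg N" "L \<subseteq> P" "M \<subseteq> P" "N \<subseteq> P"
    using nsg_sg[OF c(1)] nsg_sg[OF c(2)] nsg_sg[OF N] nsg_subset[OF c(1)] nsg_subset[OF c(2)] nsg_subset[OF N] by auto
  let ?W = "M \<bullet> N"
  have nW: "nsg ?W P" and nLN: "nsg (L \<bullet> N) P" using nsg_setmul c N P by auto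
  have sW: "sg ?W" using nsg_sg[OF nW] .
  have NW: "N \<subseteq> ?W" "M \<subseteq> ?W" using sg_setmul_right[OF s(2)] sg_setmul_left[OF s(3)] by auto
  have "chief P (L \<bullet> N) ?W"
  proof (rule chiefI[OF nW nLN])
    show "?W \<subseteq> L \<bullet> N" by (rule setmul_mono[OF c(3) order_refl])
    show "?W \<noteq> L \<bullet> N"
    proof
      assume "?W = L \<bullet> N"
      then have "L \<subseteq> ?W" using sg_setmul_left[OF s(3), of L] by simp
      then show False using meet c(4) by auto
    qed
    fix U assume U: "nsg U P" "?W \<subseteq> U" "U \<subseteq> L \<bullet> N"
    have "L \<inter> U = M \<or> L \<inter> U = L"
      by (rule c(5)[OF nsg_Int[OF c(2) U(1)]]) (use U(2) NW c(3) in auto)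
    then show "U = ?W \<or> U = L \<bullet> N"
    proof
      assume LU: "L \<inter> U = M"
      have "U \<subseteq> ?W"
      proof
        fix u assume u: "u \<in> U"
        then obtain x n where xn: "u = x * n" "x \<in> L" "n \<in> N" using U(3) by blast
        have "n \<in> U" using xn NW U(2) by auto
        then have "x \<in> U" using sg_right_iff[OF nsg_sg[OF U(1)], of n x] u xn(1) by simp
        then have "x \<in> M" using LU xn by auto
        then show "u \<in> ?W" using xn by auto
      qed
      then show ?thesis using U(2) by auto
    next
      assume "L \<inter> U = L"
      then have "L \<bullet> N \<subseteq> U" using setmul_subset[OF nsg_sg[OF U(1)], of L N] NW U(2) by auto
      then show ?thesis using U(3) by auto
    qed
  qed
  then have "inner_on g (L \<bullet> N) ?W" using q NW g unfolding qnr_def by blast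
  then obtain h2 where h2: "h2 \<in> L \<bullet> N"
    "\<forall>x\<in>L \<bullet> N. (g * x * inverse g) * inverse (h2 * x * inverse h2) \<in> ?W" unfolding inner_on_def by auto
  then obtain h n where hn: "h2 = h * n" "h \<in> L" "n \<in> N" by blast
  have hP: "h \<in> P" "n \<in> P" using hn s by auto
  have "(g * x * inverse g) * inverse (h * x * inverse h) \<in> M" if x: "x \<in> L" for x
  proof -
    have xP: "x \<in> P" using x s by auto
    have "x \<in> L \<bullet> N" using sg_setmul_left[OF s(3), of L] x by auto
    then have e1: "eqm ?W (g * x * inverse g) (h2 * x * inverse h2)" using h2(2) by (simp add: eqm_def)
    have "cmt n x \<in> N" by (rule cmt_nsg_left(1)[OF N hn(3) xP])
    then have "eqm ?W (n * x * inverse n) x" using NW by (auto simp: cmt_mem_iff'[symmetric])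
    then have "eqm ?W (h * (n * x * inverse n) * inverse h) (h * x * inverse h)" by (rule eqm_conj[OF nW hP(1)])
    then have e2: "eqm ?W (h2 * x * inverse h2) (h * x * inverse h)" using hn(1) by (simp add: mgroup_simps)
    have "(g * x * inverse g) * inverse (h * x * inverse h) \<in> ?W"
      using eqm_trans[OF sW e1 e2] by (simp add: eqm_def)
    moreover have "g * x * inverse g \<in> L" "h * x * inverse h \<in> L" using nsg_conj[OF c(2)] g hP x by auto
    then have "(g * x * inverse g) * inverse (h * x * inverse h) \<in> L" using s by simp
    ultimately show ?thesis using meet by blast
  qed
  then show ?thesis unfolding inner_on_def by (intro bexI[OF _ hn(2)] ballI)
qed

text \<open>Each element of \<open>H\<close> agrees modulo \<open>K\<close> with one of
  \<open>H \<inter> N\<close>, so \<open>H / K\<close> and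
  \<open>(H \<inter> N) / (K \<inter> N)\<close> are isomorphic with the action of
  \<open>P\<close>.\<close>

lemma chief_Int:
  assumes P: "sg P" and ch: "chief P H K" and N: "nsg N P" and cov: "H \<subseteq> K \<bullet> N"
  shows "chief P (H \<inter> N) (K \<inter> N)"
    and "g \<in> P \<Longrightarrow> inner_on g (H \<inter> N) (K \<inter> N) \<Longrightarrow> inner_on g H K"
proof -
  note c = chiefD[OF ch]
  have s: "sg H" "sg K" "sg N" "H \<subseteq> P" "K \<subseteq> P" "N \<subseteq> P"
    using nsg_sg[OF c(1)] nsg_sg[OF c(2)] nsg_sg[OF N] nsg_subset[OF c(1)] nsg_subset[OF c(2)] nsg_subset[OF N] by auto
  have dec: "\<exists>k\<in>K. \<exists>y\<in>H \<inter> N. x = k * y" if x: "x \<in> H" for x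
  proof -
    obtain k y where ky: "x = k * y" "k \<in> K" "y \<in> N" using x cov by blast
    then have "y \<in> H" using sg_left_iff[OF s(1), of k y] c(3) x by auto
    then show ?thesis using ky by blast
  qed
  show "chief P (H \<inter> N) (K \<inter> N)"
  proof (rule chiefI)
    show "nsg (K \<inter> N) P" "nsg (H \<inter> N) P" using nsg_Int c N by auto
    show "K \<inter> N \<subseteq> H \<inter> N" using c(3) by auto
    show "K \<inter> N \<noteq> H \<inter> N"
    proof
      assume eq: "K \<inter> N = H \<inter> N"
      have "x \<in> K" if x: "x \<in> H" for x
      proof -
        obtain k y where ky: "x = k * y" "k \<in> K" "y \<in> H \<inter> N" using dec[OF x] by blast
        then have "y \<in> K" unfolding eq[symmetric] by simp
        then show ?thesis using ky s(2) by simp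
      qed
      then show False using c(3,4) by auto
    qed
    fix M assume M: "nsg M P" "K \<inter> N \<subseteq> M" "M \<subseteq> H \<inter> N"
    have sM: "sg M" using nsg_sg[OF M(1)] .
    have "K \<bullet> M = K \<or> K \<bullet> M = H"
    proof (rule c(5)[OF nsg_setmul[OF c(1) M(1) P] sg_setmul_left[OF sM]])
      show "K \<bullet> M \<subseteq> H" by (rule setmul_subset[OF s(1) c(3)]) (use M(3) in auto)
    qed
    then show "M = K \<inter> N \<or> M = H \<inter> N"
    proof
      assume "K \<bullet> M = K"
      then have "M \<subseteq> K" using sg_setmul_right[OF s(2), of M] by simp
      then show ?thesis using M(2,3) by auto
    next
      assume KM: "K \<bullet> M = H"
      have "H \<inter> N \<subseteq> M"
      proof
        fix x assume x: "x \<in> H \<inter> N"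
        then obtain k m where km: "x = k * m" "k \<in> K" "m \<in> M" using KM by blast
        then have "k \<in> N" using sg_right_iff[OF s(3), of m k] x M(3) by auto
        then have "k \<in> M" using km M(2) by auto
        then show "x \<in> M" using km sM by simp
      qed
      then show ?thesis using M(3) by auto
    qed
  qed
  assume g: "g \<in> P" and "inner_on g (H \<inter> N) (K \<inter> N)"
  then obtain h where h: "h \<in> H \<inter> N"
    "\<forall>x\<in>H \<inter> N. (g * x * inverse g) * inverse (h * x * inverse h) \<in> K \<inter> N" unfolding inner_on_def by auto
  have hP: "h \<in> P" using h(1) s by auto
  have "(g * x * inverse g) * inverse (h * x * inverse h) \<in> K" if x: "x \<in> H" for x
  proof -
    obtain k y where ky: "x = k * y" "k \<in> K" "y \<in> H \<inter> N" using dec x by blast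
    have xy: "eqm K x y" using ky by (simp add: eqm_def mult.assoc)
    have e1: "eqm K (g * x * inverse g) (g * y * inverse g)" by (rule eqm_conj[OF c(1) g xy])
    have e2: "eqm K (g * y * inverse g) (h * y * inverse h)" using bspec[OF h(2) ky(3)] by (simp add: eqm_def)
    have e3: "eqm K (h * y * inverse h) (h * x * inverse h)"
      by (rule eqm_conj[OF c(1) hP eqm_sym[OF s(2) xy]])
    show ?thesis using eqm_trans[OF s(2) eqm_trans[OF s(2) e1 e2] e3] by (simp add: eqm_def)
  qed
  then show "inner_on g H K" unfolding inner_on_def using h(1) by blast
qed

text \<open>Closure of the formation under subdirect products. A chief factor \<open>H / K\<close>
  either survives multiplication by \<open>N1\<close>, or is isomorphic to a factor inside
  \<open>N1\<close>; the latter survives multiplication by \<open>N2\<close>, as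
  \<open>N1 \<inter> N2\<close> lies in \<open>K\<close>.\<close>

lemma qnr_Int:
  assumes P: "sg P" and N: "nsg N1 P" "nsg N2 P" and q: "qnr P N1" "qnr P N2"
  shows "qnr P (N1 \<inter> N2)"
  unfolding qnr_def
proof (intro allI impI ballI)
  fix H K g
  assume "chief P H K \<and> N1 \<inter> N2 \<subseteq> K" and g: "g \<in> P"
  then have ch: "chief P H K" and NK: "N1 \<inter> N2 \<subseteq> K" by auto
  note c = chiefD[OF ch]
  have s: "sg N1" "sg N2" "sg K" using N c nsg_sg by auto
  have "H \<inter> (K \<bullet> N1) = K \<or> H \<inter> (K \<bullet> N1) = H"
    by (rule c(5)[OF nsg_Int[OF c(2) nsg_setmul[OF c(1) N(1) P]]])
       (use c(3) sg_setmul_left[OF s(1), of K] in auto)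
  then show "inner_on g H K"
  proof
    assume "H \<inter> (K \<bullet> N1) = K"
    then show ?thesis by (rule inner_on_covered[OF P ch N(1) _ q(1) g])
  next
    assume "H \<inter> (K \<bullet> N1) = H"
    then have cov: "H \<subseteq> K \<bullet> N1" by auto
    let ?L = "H \<inter> N1" and ?M = "K \<inter> N1"
    have "?L \<inter> (?M \<bullet> N2) = ?M"
    proof (intro subset_antisym subsetI)
      fix x assume x: "x \<in> ?L \<inter> (?M \<bullet> N2)"
      then obtain y n where yn: "x = y * n" "y \<in> ?M" "n \<in> N2" by blast
      then have "n \<in> N1" using sg_left_iff[OF s(1), of y n] x by auto
      then have "n \<in> ?M" using NK yn by auto
      then show "x \<in> ?M" using yn s by auto
    next
      fix x assume "x \<in> ?M"
      then show "x \<in> ?L \<inter> (?M \<bullet> N2)" using c(3) sg_setmul_left[OF s(2), of ?M] by auto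
    qed
    then have "inner_on g ?L ?M"
      by (rule inner_on_covered[OF P chief_Int(1)[OF P ch N(1) cov] N(2) _ q(2) g])
    then show ?thesis by (rule chief_Int(2)[OF P ch N(1) cov g])
  qed
qed

lemma qnr_Inter:
  assumes "sg P" "finite \<F>" "\<F> \<noteq> {}" "\<And>N. N \<in> \<F> \<Longrightarrow> nsg N P \<and> qnr P N"
  shows "nsg (\<Inter>\<F>) P \<and> qnr P (\<Inter>\<F>)"
  using assms(2-)
proof (induction rule: finite_ne_induct)
  case (insert N \<F>)
  then have "nsg (\<Inter>\<F>) P" "qnr P (\<Inter>\<F>)" "nsg N P" "qnr P N" by auto
  then show ?case using nsg_Int qnr_Int[OF assms(1)] by auto
qed simp

section \<open>From library groups to the class \<open>mgroup\<close>\<close>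

lemma hom_image_sg:
  fixes \<phi> :: "'a \<Rightarrow> 'b::mgroup"
  assumes "group G" "\<phi> \<in> hom G (mgrp UNIV)" "subgroup H G"
  shows "sg (\<phi> ` H)"
proof -
  have U: "sg (UNIV :: 'b set)" by (simp add: sg_def)
  interpret group_hom G "mgrp UNIV" \<phi>
    by (rule group_hom.intro[OF assms(1) mgrp_group[OF U]]) (simp add: group_hom_axioms_def assms(2))
  show ?thesis using subgroup_img_is_subgroup[OF assms(3)] mgrp_subgroup[OF U] by blast
qed

lemma hom_mgrp:
  fixes \<phi> :: "'a \<Rightarrow> 'b::mgroup"
  assumes "group G" "\<phi> \<in> hom G (mgrp UNIV)"
  shows "x \<in> carrier G \<Longrightarrow> y \<in> carrier G \<Longrightarrow> \<phi> (x \<otimes>\<^bsub>G\<^esub> y) = \<phi> x * \<phi> y"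
    and "x \<in> carrier G \<Longrightarrow> \<phi> (inv\<^bsub>G\<^esub> x) = inverse (\<phi> x)" and "\<phi> \<one>\<^bsub>G\<^esub> = 1"
proof -
  have U: "sg (UNIV :: 'b set)" by (simp add: sg_def)
  interpret group_hom G "mgrp UNIV" \<phi>
    by (rule group_hom.intro[OF assms(1) mgrp_group[OF U]]) (simp add: group_hom_axioms_def assms(2))
  show "x \<in> carrier G \<Longrightarrow> y \<in> carrier G \<Longrightarrow> \<phi> (x \<otimes>\<^bsub>G\<^esub> y) = \<phi> x * \<phi> y" using hom_mult by simp
  show "x \<in> carrier G \<Longrightarrow> \<phi> (inv\<^bsub>G\<^esub> x) = inverse (\<phi> x)" using hom_inv mgrp_inv[OF U] by simp
  show "\<phi> \<one>\<^bsub>G\<^esub> = 1" using hom_one by simp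
qed

lemma hom_image_nsg:
  fixes \<phi> :: "'a \<Rightarrow> 'b::mgroup"
  assumes G: "group G" "\<phi> \<in> hom G (mgrp UNIV)" and N: "N \<lhd> G"
  shows "nsg (\<phi> ` N) (\<phi> ` carrier G)"
proof (rule nsgI)
  have sN: "subgroup N G" by (rule normal_imp_subgroup[OF N])
  have NG: "N \<subseteq> carrier G" by (rule subgroup.subset[OF sN])
  show "sg (\<phi> ` N)" by (rule hom_image_sg[OF G sN])
  show "\<phi> ` N \<subseteq> \<phi> ` carrier G" using NG by auto
  fix g n assume "g \<in> \<phi> ` carrier G" "n \<in> \<phi> ` N"
  then obtain h m where hm: "g = \<phi> h" "n = \<phi> m" "h \<in> carrier G" "m \<in> N" by auto
  interpret group G by fact
  have "h \<otimes>\<^bsub>G\<^esub> m \<otimes>\<^bsub>G\<^esub> inv\<^bsub>G\<^esub> h \<in> N" using N hm by (simp add: normal_inv_iff)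
  moreover have "g * n * inverse g = \<phi> (h \<otimes>\<^bsub>G\<^esub> m \<otimes>\<^bsub>G\<^esub> inv\<^bsub>G\<^esub> h)"
    using hm NG by (auto simp: hom_mgrp[OF G])
  ultimately show "g * n * inverse g \<in> \<phi> ` N" by simp
qed

lemma hom_vimage_subgroup:
  fixes \<phi> :: "'a \<Rightarrow> 'b::mgroup"
  assumes G: "group G" "\<phi> \<in> hom G (mgrp UNIV)" and U: "sg U"
  shows "subgroup {x \<in> carrier G. \<phi> x \<in> U} G"
proof -
  interpret group G by fact
  show ?thesis
  proof (rule subgroupI)
    show "{x \<in> carrier G. \<phi> x \<in> U} \<noteq> {}" using hom_mgrp(3)[OF G] sg_one[OF U] by auto
  qed (use U in \<open>auto simp: hom_mgrp[OF G]\<close>)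
qed

lemma hom_vimage_normal:
  fixes \<phi> :: "'a \<Rightarrow> 'b::mgroup"
  assumes G: "group G" "\<phi> \<in> hom G (mgrp UNIV)" and U: "nsg U (\<phi> ` carrier G)"
  shows "{x \<in> carrier G. \<phi> x \<in> U} \<lhd> G"
proof -
  interpret group G by fact
  show ?thesis
    unfolding normal_inv_iff
  proof (intro conjI ballI)
    show "subgroup {x \<in> carrier G. \<phi> x \<in> U} G" by (rule hom_vimage_subgroup[OF G nsg_sg[OF U]])
    fix g h assume "g \<in> carrier G" "h \<in> {x \<in> carrier G. \<phi> x \<in> U}"
    then show "g \<otimes>\<^bsub>G\<^esub> h \<otimes>\<^bsub>G\<^esub> inv\<^bsub>G\<^esub> g \<in> {x \<in> carrier G. \<phi> x \<in> U}"
      using nsg_conj[OF U] by (auto simp: hom_mgrp[OF G])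
  qed
qed

lemma qn_of_quasinilpotent:
  fixes \<psi> :: "'q \<Rightarrow> 'b::mgroup" and Q :: "('q, 'm) monoid_scheme"
  assumes q: "quasinilpotent Q" and \<psi>: "\<psi> \<in> hom Q (mgrp UNIV)" "inj_on \<psi> (carrier Q)"
  shows "qn (\<psi> ` carrier Q)"
  unfolding qn_def
proof (intro allI impI ballI)
  have Q: "group Q" using q unfolding quasinilpotent_def by blast
  fix H K g
  assume ch: "chief (\<psi> ` carrier Q) H K" and "g \<in> \<psi> ` carrier Q"
  then obtain a where a: "g = \<psi> a" "a \<in> carrier Q" by auto
  note c = chiefD[OF ch]
  let ?V = "\<lambda>M. {x \<in> carrier Q. \<psi> x \<in> M}"
  have im: "\<psi> ` ?V M = M" if "M \<subseteq> \<psi> ` carrier Q" for M using that by auto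
  have HP: "H \<subseteq> \<psi> ` carrier Q" "K \<subseteq> \<psi> ` carrier Q" using c(1,2) nsg_subset by auto
  have "chief_factor Q (?V H) (?V K)"
    unfolding chief_factor_def
  proof (intro conjI allI impI)
    show "?V K \<lhd> Q" "?V H \<lhd> Q" using hom_vimage_normal[OF Q \<psi>(1)] c by auto
    show "?V K \<subset> ?V H"
    proof
      show "?V K \<subseteq> ?V H" using c(3) by auto
      show "?V K \<noteq> ?V H"
      proof
        assume "?V K = ?V H"
        then have "\<psi> ` ?V K = \<psi> ` ?V H" by (rule arg_cong)
        then show False unfolding im[OF HP(1)] im[OF HP(2)] using c(4) by simp
      qed
    qed
    fix M assume M: "M \<lhd> Q \<and> ?V K \<subseteq> M \<and> M \<subseteq> ?V H"
    have MQ: "M \<subseteq> carrier Q" using M by auto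
    have "\<psi> ` M = K \<or> \<psi> ` M = H"
    proof (rule c(5))
      show "nsg (\<psi> ` M) (\<psi> ` carrier Q)" using hom_image_nsg[OF Q \<psi>(1)] M by blast
      show "K \<subseteq> \<psi> ` M" using im[OF HP(2)] image_mono[of "?V K" M \<psi>] M by simp
      show "\<psi> ` M \<subseteq> H" using M by auto
    qed
    moreover have "M = ?V (\<psi> ` M)" using inj_on_image_mem_iff[OF \<psi>(2) _ MQ] MQ by auto
    ultimately show "M = ?V K \<or> M = ?V H" by metis
  qed
  note inner = q[unfolded quasinilpotent_def, THEN conjunct2, rule_format, OF this a(2)]
  from inner obtain h where h: "h \<in> ?V H" "\<forall>x\<in>?V H. (a \<otimes>\<^bsub>Q\<^esub> x \<otimes>\<^bsub>Q\<^esub> inv\<^bsub>Q\<^esub> a) \<otimes>\<^bsub>Q\<^esub>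
      inv\<^bsub>Q\<^esub> (h \<otimes>\<^bsub>Q\<^esub> x \<otimes>\<^bsub>Q\<^esub> inv\<^bsub>Q\<^esub> h) \<in> ?V K"
    by (rule bexE)
  interpret group Q by fact
  have hQ: "h \<in> carrier Q" "\<psi> h \<in> H" using h(1) by auto
  have "(g * y * inverse g) * inverse (\<psi> h * y * inverse (\<psi> h)) \<in> K" if y: "y \<in> H" for y
  proof -
    obtain x where x: "x \<in> carrier Q" "y = \<psi> x" using y HP by auto
    have "x \<in> ?V H" using x y by simp
    from bspec[OF h(2) this]
    have "\<psi> ((a \<otimes>\<^bsub>Q\<^esub> x \<otimes>\<^bsub>Q\<^esub> inv\<^bsub>Q\<^esub> a) \<otimes>\<^bsub>Q\<^esub>
      inv\<^bsub>Q\<^esub> (h \<otimes>\<^bsub>Q\<^esub> x \<otimes>\<^bsub>Q\<^esub> inv\<^bsub>Q\<^esub> h)) \<in> K" by simp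
    moreover have "\<psi> ((a \<otimes>\<^bsub>Q\<^esub> x \<otimes>\<^bsub>Q\<^esub> inv\<^bsub>Q\<^esub> a) \<otimes>\<^bsub>Q\<^esub> inv\<^bsub>Q\<^esub> (h \<otimes>\<^bsub>Q\<^esub> x \<otimes>\<^bsub>Q\<^esub> inv\<^bsub>Q\<^esub> h))
       = (\<psi> a * \<psi> x * inverse (\<psi> a)) * inverse (\<psi> h * \<psi> x * inverse (\<psi> h))"
      using a(2) hQ(1) x(1) by (simp only: hom_mgrp[OF Q \<psi>(1)] m_closed inv_closed)
    ultimately show ?thesis using a(1) x(2) by simp
  qed
  then show "inner_on g H K" unfolding inner_on_def using hQ(2) by blast
qed

lemma comm_quasinilpotent:
  assumes "comm_group Q"
  shows "quasinilpotent Q"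
  unfolding quasinilpotent_def
proof (intro conjI allI impI ballI)
  interpret comm_group Q by fact
  show "group Q" by (rule is_group)
  fix H K g assume ch: "chief_factor Q H K" and g: "g \<in> carrier Q"
  have "K \<lhd> Q" "H \<lhd> Q" using ch unfolding chief_factor_def by auto
  then have s: "subgroup K Q" "subgroup H Q" using normal_imp_subgroup by auto
  show "\<exists>h\<in>H. \<forall>x\<in>H. g \<otimes>\<^bsub>Q\<^esub> x \<otimes>\<^bsub>Q\<^esub> inv\<^bsub>Q\<^esub> g \<otimes>\<^bsub>Q\<^esub> inv\<^bsub>Q\<^esub> (h \<otimes>\<^bsub>Q\<^esub> x \<otimes>\<^bsub>Q\<^esub> inv\<^bsub>Q\<^esub> h) \<in> K"
  proof (intro bexI ballI)
    show "\<one>\<^bsub>Q\<^esub> \<in> H" using s subgroup.one_closed by blast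
    fix x assume "x \<in> H"
    then have x: "x \<in> carrier Q" using s(2) subgroup.subset by blast
    have "g \<otimes>\<^bsub>Q\<^esub> x \<otimes>\<^bsub>Q\<^esub> inv\<^bsub>Q\<^esub> g = x" using g x by (simp add: m_comm[of g x] m_assoc)
    then have "g \<otimes>\<^bsub>Q\<^esub> x \<otimes>\<^bsub>Q\<^esub> inv\<^bsub>Q\<^esub> g \<otimes>\<^bsub>Q\<^esub> inv\<^bsub>Q\<^esub> (\<one>\<^bsub>Q\<^esub> \<otimes>\<^bsub>Q\<^esub> x \<otimes>\<^bsub>Q\<^esub> inv\<^bsub>Q\<^esub> \<one>\<^bsub>Q\<^esub>) = \<one>\<^bsub>Q\<^esub>"
      using x by simp
    then show "g \<otimes>\<^bsub>Q\<^esub> x \<otimes>\<^bsub>Q\<^esub> inv\<^bsub>Q\<^esub> g \<otimes>\<^bsub>Q\<^esub> inv\<^bsub>Q\<^esub> (\<one>\<^bsub>Q\<^esub> \<otimes>\<^bsub>Q\<^esub> x \<otimes>\<^bsub>Q\<^esub> inv\<^bsub>Q\<^esub> \<one>\<^bsub>Q\<^esub>) \<in> K"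
      using subgroup.one_closed[OF s(1)] by simp
  qed
qed

context
  fixes H :: "'a monoid" and \<phi> :: "'a \<Rightarrow> 'b::mgroup"
  assumes H: "group H" "finite (carrier H)" and \<phi>: "\<phi> \<in> hom H (mgrp UNIV)" "inj_on \<phi> (carrier H)"
begin

lemma image_sg: "sg (\<phi> ` carrier H)"
  by (rule hom_image_sg[OF H(1) \<phi>(1) group.subgroup_self[OF H(1)]])

lemma ghom_inv_into:
  fixes f :: "'a \<Rightarrow> 'c::mgroup"
  assumes "f \<in> hom H (mgrp UNIV)"
  shows "ghom (\<lambda>p. f (inv_into (carrier H) \<phi> p)) (\<phi> ` carrier H)"
  unfolding ghom_def
proof (intro ballI)
  fix p q assume "p \<in> \<phi> ` carrier H" "q \<in> \<phi> ` carrier H"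
  then obtain x y where xy: "p = \<phi> x" "q = \<phi> y" "x \<in> carrier H" "y \<in> carrier H" by auto
  interpret group H by (rule H)
  have "p * q = \<phi> (x \<otimes>\<^bsub>H\<^esub> y)" using xy hom_mgrp(1)[OF H(1) \<phi>(1)] by simp
  then show "f (inv_into (carrier H) \<phi> (p * q)) = f (inv_into (carrier H) \<phi> p) * f (inv_into (carrier H) \<phi> q)"
    using xy inv_into_f_f[OF \<phi>(2)] hom_mgrp(1)[OF H(1) assms] by simp
qed

lemma qnr_of_quasinilpotent_quotient:
  assumes N: "N \<lhd> H" and q: "quasinilpotent (H Mod N)"
  shows "qnr (\<phi> ` carrier H) (\<phi> ` N)"
proof -
  interpret normal N H by fact
  have Q: "group (H Mod N)" by (rule factorgroup_is_group)
  obtain \<psi> :: "'a set \<Rightarrow> 'a set perm" where \<psi>: "\<psi> \<in> hom (H Mod N) (mgrp UNIV)" "inj_on \<psi> (carrier (H Mod N))"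
    using finite_group_embeds[OF Q finite_FactGroup[OF H(2)]] by blast
  define f where "f x = \<psi> (N #>\<^bsub>H\<^esub> x)" for x
  have hc: "N #>\<^bsub>H\<^esub> x \<in> carrier (H Mod N)" if "x \<in> carrier H" for x
    using that by (auto simp: carrier_FactGroup)
  have f: "f \<in> hom H (mgrp UNIV)"
  proof (rule homI)
    fix x y assume xy: "x \<in> carrier H" "y \<in> carrier H"
    show "f (x \<otimes>\<^bsub>H\<^esub> y) = f x \<otimes>\<^bsub>mgrp UNIV\<^esub> f y"
      using hom_mult[OF \<psi>(1) hc[OF xy(1)] hc[OF xy(2)]] rcos_sum[OF xy] by (simp add: f_def)
  qed simp
  define \<chi> where "\<chi> p = f (inv_into (carrier H) \<phi> p)" for p
  have \<chi>: "ghom \<chi> (\<phi> ` carrier H)" unfolding \<chi>_def by (rule ghom_inv_into[OF f])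
  have \<chi>\<phi>: "\<chi> (\<phi> x) = f x" if "x \<in> carrier H" for x using inv_into_f_f[OF \<phi>(2) that] by (simp add: \<chi>_def)
  have img: "\<chi> ` (\<phi> ` carrier H) = \<psi> ` carrier (H Mod N)"
    unfolding image_image carrier_FactGroup using \<chi>\<phi> by (simp add: f_def)
  show ?thesis
  proof (rule qnr_of_image[OF image_sg \<chi>])
    show "qn (\<chi> ` \<phi> ` carrier H)" unfolding img by (rule qn_of_quasinilpotent[OF q \<psi>])
    fix p assume "p \<in> \<phi> ` carrier H"
    then obtain x where x: "p = \<phi> x" "x \<in> carrier H" by auto
    have "\<chi> p = 1 \<longleftrightarrow> f x = f \<one>\<^bsub>H\<^esub>" using x \<chi>\<phi> hom_mgrp(3)[OF H(1) f] by simp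
    also have "\<dots> \<longleftrightarrow> N #>\<^bsub>H\<^esub> x = N #>\<^bsub>H\<^esub> \<one>\<^bsub>H\<^esub>"
      unfolding f_def by (rule inj_on_eq_iff[OF \<psi>(2) hc[OF x(2)] hc]) simp
    also have "\<dots> \<longleftrightarrow> x \<in> N" using normal_rcos_iff[OF N x(2), of "\<one>\<^bsub>H\<^esub>"] x(2) by simp
    also have "\<dots> \<longleftrightarrow> p \<in> \<phi> ` N" using inj_on_image_mem_iff[OF \<phi>(2) x(2) subset] x(1) by simp
    finally show "\<chi> p = 1 \<longleftrightarrow> p \<in> \<phi> ` N" .
  qed
qed

text \<open>The quotient by the derived subgroup is abelian, hence quasinilpotent; this places the
  residual inside it.\<close>

lemma quasinilpotent_quotient_der:
  "{x \<in> carrier H. \<phi> x \<in> der (\<phi> ` carrier H)} \<lhd> H"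
  "quasinilpotent (H Mod {x \<in> carrier H. \<phi> x \<in> der (\<phi> ` carrier H)})"
proof -
  let ?D = "{x \<in> carrier H. \<phi> x \<in> der (\<phi> ` carrier H)}"
  show nD: "?D \<lhd> H" by (rule hom_vimage_normal[OF H(1) \<phi>(1) der_nsg[OF nsg_self[OF image_sg] image_sg]])
  interpret group H by (rule H)
  have key: "(x \<otimes>\<^bsub>H\<^esub> y) \<otimes>\<^bsub>H\<^esub> inv\<^bsub>H\<^esub> (y \<otimes>\<^bsub>H\<^esub> x) \<in> ?D" if xy: "x \<in> carrier H" "y \<in> carrier H" for x y
  proof -
    have "\<phi> ((x \<otimes>\<^bsub>H\<^esub> y) \<otimes>\<^bsub>H\<^esub> inv\<^bsub>H\<^esub> (y \<otimes>\<^bsub>H\<^esub> x)) = cmt (\<phi> x) (\<phi> y)"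
      using xy by (simp add: hom_mgrp[OF H(1) \<phi>(1)] cmt_def mgroup_simps)
    then show ?thesis
      using xy cmt_in_der[of "\<phi> x" "\<phi> ` carrier H" "\<phi> y"] by simp
  qed
  have "comm_group (H Mod ?D)"
  proof (rule group.group_comm_groupI[OF normal.factorgroup_is_group[OF nD]])
    fix a b assume ab: "a \<in> carrier (H Mod ?D)" "b \<in> carrier (H Mod ?D)"
    obtain x where x: "a = ?D #>\<^bsub>H\<^esub> x" "x \<in> carrier H"
      using ab(1) unfolding carrier_FactGroup by (rule imageE)
    obtain y where y: "b = ?D #>\<^bsub>H\<^esub> y" "y \<in> carrier H"
      using ab(2) unfolding carrier_FactGroup by (rule imageE)
    note xy = x(1) y(1) x(2) y(2)
    have "?D #>\<^bsub>H\<^esub> (x \<otimes>\<^bsub>H\<^esub> y) = ?D #>\<^bsub>H\<^esub> (y \<otimes>\<^bsub>H\<^esub> x)"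
      unfolding normal_rcos_iff[OF nD m_closed[OF xy(3,4)] m_closed[OF xy(4,3)]] by (rule key[OF xy(3,4)])
    then show "a \<otimes>\<^bsub>H Mod ?D\<^esub> b = b \<otimes>\<^bsub>H Mod ?D\<^esub> a"
      unfolding xy(1,2) mult_FactGroup normal.rcos_sum[OF nD xy(3,4)] normal.rcos_sum[OF nD xy(4,3)] .
  qed
  then show "quasinilpotent (H Mod ?D)" by (rule comm_quasinilpotent)
qed

text \<open>The family is finite and nonempty, so by \<open>qnr_Inter\<close> the quotient by the
  residual is itself quasinilpotent. Injectivity of \<open>\<phi>\<close> lets images commute with
  the intersection.\<close>

lemma qn_residual_image:
  shows "qn_residual H \<subseteq> carrier H" "nsg (\<phi> ` qn_residual H) (\<phi> ` carrier H)"
    "qnr (\<phi> ` carrier H) (\<phi> ` qn_residual H)" "\<phi> ` qn_residual H \<subseteq> der (\<phi> ` carrier H)"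
proof -
  let ?F = "{N. N \<lhd> H \<and> quasinilpotent (H Mod N)}"
  let ?D = "{x \<in> carrier H. \<phi> x \<in> der (\<phi> ` carrier H)}"
  have D: "?D \<in> ?F" using quasinilpotent_quotient_der by (intro CollectI conjI)
  then have RD: "qn_residual H \<subseteq> ?D" unfolding qn_residual_def by (rule Inter_lower)
  then show "qn_residual H \<subseteq> carrier H" "\<phi> ` qn_residual H \<subseteq> der (\<phi> ` carrier H)" by auto
  have sub: "N \<subseteq> carrier H" if "N \<in> ?F" for N
    using that normal_imp_subgroup subgroup.subset by blast
  have "?F \<subseteq> Pow (carrier H)" using sub by auto
  then have fin: "finite ?F" using H(2) finite_subset finite_Pow_iff by metis
  have "\<phi> ` (\<Inter>N\<in>?F. N) = (\<Inter>N\<in>?F. \<phi> ` N)"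
    by (rule image_INT[OF \<phi>(2) _ D]) (use sub in blast)
  then have img: "\<phi> ` qn_residual H = \<Inter>((`) \<phi> ` ?F)" by (simp add: qn_residual_def)
  have "nsg (\<Inter>((`) \<phi> ` ?F)) (\<phi> ` carrier H) \<and> qnr (\<phi> ` carrier H) (\<Inter>((`) \<phi> ` ?F))"
  proof (rule qnr_Inter[OF image_sg])
    show "finite ((`) \<phi> ` ?F)" using fin by (rule finite_imageI)
    show "(`) \<phi> ` ?F \<noteq> {}" using D by blast
    fix N assume "N \<in> (`) \<phi> ` ?F"
    then obtain M where "N = \<phi> ` M" "M \<lhd> H" "quasinilpotent (H Mod M)" by auto
    then show "nsg N (\<phi> ` carrier H) \<and> qnr (\<phi> ` carrier H) N"
      using hom_image_nsg[OF H(1) \<phi>(1)] qnr_of_quasinilpotent_quotient by blast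
  qed
  then show "nsg (\<phi> ` qn_residual H) (\<phi> ` carrier H)" "qnr (\<phi> ` carrier H) (\<phi> ` qn_residual H)"
    unfolding img by auto
qed

end

text \<open>The results for normal subgroups are iterated along a subnormal chain. The chain lives
  in the image of \<open>\<phi>\<close>, hence the preimages.\<close>

lemma gser_subnormal:
  fixes G :: "'a monoid" and \<phi> :: "'a \<Rightarrow> 'b::mgroup"
  assumes fn: "functorial \<gamma>" "F1 \<gamma>" "F2 \<gamma>" and G: "group G" "finite (carrier G)"
    and \<phi>: "\<phi> \<in> hom G (mgrp UNIV)" and U: "sn U (\<phi> ` carrier G)"
  defines "S \<equiv> {x \<in> carrier G. \<phi> x \<in> U}"
  shows "gser \<gamma> (G\<lparr>carrier := S\<rparr>) n \<subseteq> gser \<gamma> G n"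
    and "F5 \<gamma> \<Longrightarrow> gser \<gamma> G n \<inter> S \<subseteq> gser \<gamma> (G\<lparr>carrier := S\<rparr>) n"
proof -
  have P: "sg (\<phi> ` carrier G)" by (rule hom_image_sg[OF G(1) \<phi> group.subgroup_self[OF G(1)]])
  let ?V = "\<lambda>U. {x \<in> carrier G. \<phi> x \<in> U}"
  have "sg U \<and> gser \<gamma> (G\<lparr>carrier := ?V U\<rparr>) n \<subseteq> gser \<gamma> G n \<and>
      (F5 \<gamma> \<longrightarrow> gser \<gamma> G n \<inter> ?V U \<subseteq> gser \<gamma> (G\<lparr>carrier := ?V U\<rparr>) n)"
    using U
  proof (induction rule: converse_rtranclp_induct)
    case base
    have "?V (\<phi> ` carrier G) = carrier G" by auto
    then show ?case using P by simp
  next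
    case (step U U')
    let ?G' = "G\<lparr>carrier := ?V U'\<rparr>"
    have s': "subgroup (?V U') G" using hom_vimage_subgroup[OF G(1) \<phi>] step(3) by blast
    have G': "group ?G'" "finite (carrier ?G')"
      using subgroup.subgroup_is_group[OF s' G(1)] G(2) by auto
    have \<phi>': "\<phi> \<in> hom ?G' (mgrp UNIV)" using \<phi> by (auto simp: hom_def)
    have UP: "U' \<subseteq> \<phi> ` carrier G" using sn_subset[OF step(2)] .
    then have "\<phi> ` carrier ?G' = U'" by auto
    then have "{x \<in> carrier ?G'. \<phi> x \<in> U} \<lhd> ?G'"
      using hom_vimage_normal[OF G'(1) \<phi>'] step(1) by simp
    moreover have eq: "{x \<in> carrier ?G'. \<phi> x \<in> U} = ?V U" using nsg_subset[OF step(1)] by auto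
    ultimately have n: "?V U \<lhd> ?G'" by simp
    have e: "?G'\<lparr>carrier := ?V U\<rparr> = G\<lparr>carrier := ?V U\<rparr>" by simp
    have "?V U \<subseteq> ?V U'" using nsg_subset[OF step(1)] by auto
    then show ?case
      using gser_mono_normal[OF fn G' n, of n] gser_Int_normal[OF fn _ G' n, of n] step(3) nsg_sg[OF step(1)]
      unfolding e by blast
  qed
  then show "gser \<gamma> (G\<lparr>carrier := S\<rparr>) n \<subseteq> gser \<gamma> G n"
    and "F5 \<gamma> \<Longrightarrow> gser \<gamma> G n \<inter> S \<subseteq> gser \<gamma> (G\<lparr>carrier := S\<rparr>) n"
    unfolding S_def by auto
qed

section \<open>Assembly of the two bounds\<close>

lemma hom_image_set_mult:
  fixes \<phi> :: "'a \<Rightarrow> 'b::mgroup"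
  assumes G: "group G" "\<phi> \<in> hom G (mgrp UNIV)" and AB: "A \<subseteq> carrier G" "B \<subseteq> carrier G"
  shows "\<phi> ` (A <#>\<^bsub>G\<^esub> B) = \<phi> ` A \<bullet> \<phi> ` B"
proof (intro subset_antisym subsetI)
  fix p assume "p \<in> \<phi> ` (A <#>\<^bsub>G\<^esub> B)"
  then obtain a b where ab: "p = \<phi> (a \<otimes>\<^bsub>G\<^esub> b)" "a \<in> A" "b \<in> B" by (auto simp: set_mult_def)
  then have "a \<in> carrier G" "b \<in> carrier G" using AB by auto
  then have "p = \<phi> a * \<phi> b" using hom_mgrp(1)[OF G] ab(1) by simp
  then show "p \<in> \<phi> ` A \<bullet> \<phi> ` B" using ab by auto
next
  fix p assume "p \<in> \<phi> ` A \<bullet> \<phi> ` B"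
  then obtain a b where ab: "p = \<phi> a * \<phi> b" "a \<in> A" "b \<in> B" by blast
  then have "a \<in> carrier G" "b \<in> carrier G" using AB by auto
  then have "p = \<phi> (a \<otimes>\<^bsub>G\<^esub> b)" using hom_mgrp(1)[OF G] ab(1) by simp
  moreover have "a \<otimes>\<^bsub>G\<^esub> b \<in> A <#>\<^bsub>G\<^esub> B" using ab by (auto simp: set_mult_def)
  ultimately show "p \<in> \<phi> ` (A <#>\<^bsub>G\<^esub> B)" by blast
qed

lemma hom_image_mutperm_product:
  fixes \<phi> :: "'a \<Rightarrow> 'b::mgroup"
  assumes G: "group G" "finite (carrier G)" and \<phi>: "\<phi> \<in> hom G (mgrp UNIV)"
    and AB: "subgroup A G" "subgroup B G" "carrier G = A <#>\<^bsub>G\<^esub> B" and mut: "mutually_permutable G A B"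
  shows "mutperm_product (\<phi> ` carrier G) (\<phi> ` A) (\<phi> ` B)"
proof
  have sub: "A \<subseteq> carrier G" "B \<subseteq> carrier G" using AB subgroup.subset by auto
  show "sg (\<phi> ` carrier G)" "sg (\<phi> ` A)" "sg (\<phi> ` B)"
    using hom_image_sg[OF G(1) \<phi>] group.subgroup_self[OF G(1)] AB by auto
  show "finite (\<phi> ` carrier G)" using G by simp
  show "\<phi> ` carrier G = \<phi> ` A \<bullet> \<phi> ` B" using hom_image_set_mult[OF G(1) \<phi> sub] AB(3) by simp
  have *: "\<phi> ` C \<bullet> U = U \<bullet> \<phi> ` C"
    if CD: "C \<subseteq> carrier G" "subgroup D G" and perm: "\<And>V. subgroup V G \<Longrightarrow> V \<subseteq> D \<Longrightarrow> C <#>\<^bsub>G\<^esub> V = V <#>\<^bsub>G\<^esub> C"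
      and U: "sg U" "U \<subseteq> \<phi> ` D" for C D U
  proof -
    have DG: "D \<subseteq> carrier G" using CD(2) by (rule subgroup.subset)
    let ?V = "{x \<in> carrier G. \<phi> x \<in> U} \<inter> D"
    have V: "subgroup ?V G" by (rule group.subgroups_Inter_pair[OF G(1) hom_vimage_subgroup[OF G(1) \<phi> U(1)] CD(2)])
    have im: "\<phi> ` ?V = U" using U(2) DG by auto
    have VG: "?V \<subseteq> carrier G" by auto
    have "C <#>\<^bsub>G\<^esub> ?V = ?V <#>\<^bsub>G\<^esub> C" by (rule perm[OF V]) auto
    then have "\<phi> ` (C <#>\<^bsub>G\<^esub> ?V) = \<phi> ` (?V <#>\<^bsub>G\<^esub> C)" by (rule arg_cong)
    then show ?thesis
      unfolding hom_image_set_mult[OF G(1) \<phi> CD(1) VG] hom_image_set_mult[OF G(1) \<phi> VG CD(1)] im .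
  qed
  show "mutperm (\<phi> ` A) (\<phi> ` B)"
    unfolding mutperm_def
  proof (intro conjI allI impI)
    fix U assume "sg U \<and> U \<subseteq> \<phi> ` B"
    then show "\<phi> ` A \<bullet> U = U \<bullet> \<phi> ` A"
      by (intro *[OF sub(1) AB(2)]) (use mut in \<open>auto simp: mutually_permutable_def\<close>)
  next
    fix U assume "sg U \<and> U \<subseteq> \<phi> ` A"
    then show "\<phi> ` B \<bullet> U = U \<bullet> \<phi> ` B"
      by (intro *[OF sub(2) AB(1)]) (use mut in \<open>auto simp: mutually_permutable_def\<close>)
  qed
qed

lemma subgroup_embedding:
  assumes "subgroup A G" "\<phi> \<in> hom G (mgrp UNIV)" "inj_on \<phi> (carrier G)"
  shows "\<phi> \<in> hom (G\<lparr>carrier := A\<rparr>) (mgrp UNIV)" "inj_on \<phi> (carrier (G\<lparr>carrier := A\<rparr>))"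
proof -
  have "A \<subseteq> carrier G" using assms(1) by (rule subgroup.subset)
  then show "\<phi> \<in> hom (G\<lparr>carrier := A\<rparr>) (mgrp UNIV)" "inj_on \<phi> (carrier (G\<lparr>carrier := A\<rparr>))"
    using assms(2,3) by (auto simp: hom_def subset_iff intro: inj_on_subset)
qed

text \<open>The image of the residual is normal in that of \<open>A\<close> and lies in its derived
  subgroup, which is subnormal. So \<open>gser_subnormal\<close> compares the series of the residual
  with that of \<open>G\<close>.\<close>

lemma qn_residual_factor:
  fixes G :: "'a monoid" and \<phi> :: "'a \<Rightarrow> 'b::mgroup"
  assumes fn: "functorial \<gamma>" "F1 \<gamma>" "F2 \<gamma>" "F3 \<gamma>" and G: "group G" "finite (carrier G)"
    and \<phi>: "\<phi> \<in> hom G (mgrp UNIV)" "inj_on \<phi> (carrier G)" and A: "subgroup A G"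
    and mp: "mutperm_product (\<phi> ` carrier G) (\<phi> ` A) (\<phi> ` B)"
  defines "R \<equiv> qn_residual (G\<lparr>carrier := A\<rparr>)"
  shows "R \<subseteq> A" and "qnr (\<phi> ` A) (\<phi> ` R)" and "hgam \<gamma> (G\<lparr>carrier := R\<rparr>) \<le> n \<Longrightarrow> R \<subseteq> gser \<gamma> G n"
    and "F5 \<gamma> \<Longrightarrow> hgam \<gamma> (G\<lparr>carrier := R\<rparr>) \<le> hgam \<gamma> G"
proof -
  interpret P: mutperm_product "\<phi> ` carrier G" "\<phi> ` A" "\<phi> ` B" by (rule mp)
  let ?A = "G\<lparr>carrier := A\<rparr>"
  have AG: "A \<subseteq> carrier G" using A by (rule subgroup.subset)
  have gA: "group ?A" "finite (carrier ?A)"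
    using subgroup.subgroup_is_group[OF A G(1)] finite_subset[OF AG G(2)] by auto
  note res = qn_residual_image[OF gA subgroup_embedding[OF A \<phi>], folded R_def, simplified]
  show RA: "R \<subseteq> A" and "qnr (\<phi> ` A) (\<phi> ` R)" using res by auto
  have "nsg (\<phi> ` R) (der (\<phi> ` A))" by (rule nsg_mono[OF res(2,4) der_subset[OF P.A]])
  then have sn: "sn (\<phi> ` R) (\<phi> ` carrier G)"
    using der_factor_subnormal[OF P.G P.A P.B P.GAB P.mut] by (rule converse_rtranclp_into_rtranclp)
  have RG: "R \<subseteq> carrier G" using RA AG by simp
  have S: "{x \<in> carrier G. \<phi> x \<in> \<phi> ` R} = R"
    using inj_on_image_mem_iff[OF \<phi>(2) _ RG] RG by auto
  have sR: "subgroup R G"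
    using hom_vimage_subgroup[OF G(1) \<phi>(1) sn_sg[OF sn P.G(1)]] unfolding S .
  have gR: "group (G\<lparr>carrier := R\<rparr>)" "finite (carrier (G\<lparr>carrier := R\<rparr>))"
    using subgroup.subgroup_is_group[OF sR G(1)] finite_subset[OF RG G(2)] by auto
  note le = hgam_le_iff[OF fn(1,4) gR]
  note gs = gser_subnormal[OF fn(1-3) G \<phi>(1) sn, unfolded S]
  show "R \<subseteq> gser \<gamma> G n" if "hgam \<gamma> (G\<lparr>carrier := R\<rparr>) \<le> n"
    using gs(1)[of n] that unfolding le by simp
  show "hgam \<gamma> (G\<lparr>carrier := R\<rparr>) \<le> hgam \<gamma> G" if F5: "F5 \<gamma>"
  proof -
    have "gser \<gamma> G (hgam \<gamma> G) = carrier G" using hgam_le_iff[OF fn(1,4) G, of "hgam \<gamma> G"] by simp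
    then have "R \<subseteq> gser \<gamma> (G\<lparr>carrier := R\<rparr>) (hgam \<gamma> G)" using gs(2)[OF F5, of "hgam \<gamma> G"] RG by auto
    moreover have "gser \<gamma> (G\<lparr>carrier := R\<rparr>) (hgam \<gamma> G) \<subseteq> R" using gser_subset_carrier[OF fn(1) gR] by simp
    ultimately show ?thesis unfolding le by simp
  qed
qed

text \<open>\<open>\<phi>\<close> represents the quotient by the \<open>n\<close>-th term.
  Commutators there act as inner elements on all chief factors and fall into the next term; the
  quotient by that is abelian, and \<gamma> of an abelian group is the whole group.\<close>

lemma gser_product_carrier:
  fixes G :: "'a monoid" and \<phi> :: "'a \<Rightarrow> 'a set perm"
  assumes fn: "functorial \<gamma>" "F2 \<gamma>" "F3 \<gamma>" and G: "group G" "finite (carrier G)"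
    and \<phi>: "\<phi> \<in> hom G (mgrp UNIV)" "\<And>x. x \<in> carrier G \<Longrightarrow> \<phi> x = 1 \<longleftrightarrow> x \<in> gser \<gamma> G n"
    and mp: "mutperm_product (\<phi> ` carrier G) (\<phi> ` A) (\<phi> ` B)" and q: "qn (\<phi> ` A)" "qn (\<phi> ` B)"
  shows "gser \<gamma> G (Suc (Suc n)) = carrier G"
proof -
  interpret P: mutperm_product "\<phi> ` carrier G" "\<phi> ` A" "\<phi> ` B" by (rule mp)
  interpret I: internal_functorial "\<lambda>S::'a set perm set. gext \<gamma> (mgrp S)"
    by (rule gext_internal_functorial[OF fn])
  interpret group G by (rule G)
  have hom: "f \<in> hom G (mgrp (f ` carrier G))" if "f \<in> hom G (mgrp UNIV)" for f :: "'a \<Rightarrow> 'a set perm"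
    using that by (auto simp: hom_def)
  have via: "x \<in> gser \<gamma> G (Suc i) \<longleftrightarrow> f x \<in> gext \<gamma> (mgrp (f ` carrier G))"
    if f: "f \<in> hom G (mgrp UNIV)" "\<And>x. x \<in> carrier G \<Longrightarrow> f x = 1 \<longleftrightarrow> x \<in> gser \<gamma> G i" and x: "x \<in> carrier G"
    for f :: "'a \<Rightarrow> 'a set perm" and x i
    by (rule gser_via_hom[OF fn(1) G mgrp_group[OF hom_image_sg[OF G(1) f(1) subgroup_self]] hom[OF f(1)] _ _ x])
       (use f(2) in auto)
  have image_cmt: "f (x \<otimes>\<^bsub>G\<^esub> y \<otimes>\<^bsub>G\<^esub> inv\<^bsub>G\<^esub> x \<otimes>\<^bsub>G\<^esub> inv\<^bsub>G\<^esub> y) = cmt (f x) (f y)"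
    if "f \<in> hom G (mgrp UNIV)" "x \<in> carrier G" "y \<in> carrier G" for f :: "'a \<Rightarrow> 'a set perm" and x y
    using that by (simp add: hom_mgrp[OF G(1) that(1)] cmt_def)
  have comm: "x \<otimes>\<^bsub>G\<^esub> y \<otimes>\<^bsub>G\<^esub> inv\<^bsub>G\<^esub> x \<otimes>\<^bsub>G\<^esub> inv\<^bsub>G\<^esub> y \<in> gser \<gamma> G (Suc n)"
    if xy: "x \<in> carrier G" "y \<in> carrier G" for x y
  proof -
    have p: "\<phi> x \<in> \<phi> ` carrier G" "\<phi> y \<in> \<phi> ` carrier G" using xy by auto
    have "cmt (\<phi> x) (\<phi> y) \<in> gext \<gamma> (mgrp (\<phi> ` carrier G))"
    proof (rule I.inner_on_chief_mem[OF P.G])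
      show "cmt (\<phi> x) (\<phi> y) \<in> \<phi> ` carrier G" using p P.G(1) by (simp add: cmt_def)
      show "inner_on (cmt (\<phi> x) (\<phi> y)) H K" if "chief (\<phi> ` carrier G) H K" for H K
        by (rule P.cmt_inner_on_chief[OF q that p])
    qed
    then show ?thesis using via[OF \<phi>] image_cmt[OF \<phi>(1) xy] xy by simp
  qed
  obtain \<psi> :: "'a \<Rightarrow> 'a set perm" where \<psi>: "\<psi> \<in> hom G (mgrp UNIV)"
    "\<And>x. x \<in> carrier G \<Longrightarrow> \<psi> x = 1 \<longleftrightarrow> x \<in> gser \<gamma> G (Suc n)"
    using normal_quotient_embeds[OF G gser_normal[OF fn(1) G]] by metis
  have "gext \<gamma> (mgrp (\<psi> ` carrier G)) = \<psi> ` carrier G"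
  proof (rule I.abelian)
    show "sg (\<psi> ` carrier G)" by (rule hom_image_sg[OF G(1) \<psi>(1) subgroup_self])
    show "finite (\<psi> ` carrier G)" using G by simp
    fix p r assume "p \<in> \<psi> ` carrier G" "r \<in> \<psi> ` carrier G"
    then obtain x y where xy: "p = \<psi> x" "r = \<psi> y" "x \<in> carrier G" "y \<in> carrier G" by auto
    have "x \<otimes>\<^bsub>G\<^esub> y \<otimes>\<^bsub>G\<^esub> inv\<^bsub>G\<^esub> x \<otimes>\<^bsub>G\<^esub> inv\<^bsub>G\<^esub> y \<in> carrier G" using xy by simp
    then have "cmt p r = 1" using \<psi>(2) comm[OF xy(3,4)] image_cmt[OF \<psi>(1) xy(3,4)] xy(1,2) by metis
    then show "p * r = r * p" by (simp only: cmt_eq_1)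
  qed
  then have "x \<in> gser \<gamma> G (Suc (Suc n))" if "x \<in> carrier G" for x using via[OF \<psi> that] that by simp
  then show ?thesis using gser_subset_carrier[OF fn(1) G] by blast
qed

theorem theorem9:
  fixes \<gamma> :: "nat monoid \<Rightarrow> nat set" and G :: "'a monoid" and A B :: "'a set"
  assumes "functorial \<gamma>" and "F1 \<gamma>" and "F2 \<gamma>" and "F3 \<gamma>"
    and "group G" and "finite (carrier G)"
    and "subgroup A G" and "subgroup B G"
    and "carrier G = A <#>\<^bsub>G\<^esub> B"
    and "mutually_permutable G A B"
  shows "hgam \<gamma> G \<le>
           max (hgam \<gamma> (G\<lparr>carrier := qn_residual (G\<lparr>carrier := A\<rparr>)\<rparr>))
               (hgam \<gamma> (G\<lparr>carrier := qn_residual (G\<lparr>carrier := B\<rparr>)\<rparr>)) + 2 \<and>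
         (F5 \<gamma> \<longrightarrow>
           max (hgam \<gamma> (G\<lparr>carrier := qn_residual (G\<lparr>carrier := A\<rparr>)\<rparr>))
               (hgam \<gamma> (G\<lparr>carrier := qn_residual (G\<lparr>carrier := B\<rparr>)\<rparr>)) \<le> hgam \<gamma> G)"
proof -
  note fn = assms(1-4) and G = assms(5,6)
  \<comment> \<open>A faithful copy of \<open>G\<close>, in which subnormality of the residuals is
    obtained; \<open>\<psi>\<close> below has kernel \<open>gser \<gamma> G n\<close>.\<close>
  obtain \<phi> :: "'a \<Rightarrow> 'a perm" where \<phi>: "\<phi> \<in> hom G (mgrp UNIV)" "inj_on \<phi> (carrier G)"
    using finite_group_embeds[OF G] by blast
  have mp: "mutperm_product (\<phi> ` carrier G) (\<phi> ` A) (\<phi> ` B)"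
    by (rule hom_image_mutperm_product[OF G \<phi>(1) assms(7-10)])
  define RA RB where "RA = qn_residual (G\<lparr>carrier := A\<rparr>)" and "RB = qn_residual (G\<lparr>carrier := B\<rparr>)"
  note resA = qn_residual_factor[OF fn G \<phi> assms(7) mp, folded RA_def]
  note resB = qn_residual_factor[OF fn G \<phi> assms(8) mutperm_product.swap[OF mp], folded RB_def]
  \<comment> \<open>At this index the series of \<open>G\<close> has swallowed both
    residuals.\<close>
  define n where "n = max (hgam \<gamma> (G\<lparr>carrier := RA\<rparr>)) (hgam \<gamma> (G\<lparr>carrier := RB\<rparr>))"
  obtain \<psi> :: "'a \<Rightarrow> 'a set perm" where \<psi>: "\<psi> \<in> hom G (mgrp UNIV)"
    "\<And>x. x \<in> carrier G \<Longrightarrow> \<psi> x = 1 \<longleftrightarrow> x \<in> gser \<gamma> G n"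
    using normal_quotient_embeds[OF G gser_normal[OF fn(1) G]] by metis
  have q: "qn (\<psi> ` C)"
    if C: "subgroup C G" and R: "R \<subseteq> C" "qnr (\<phi> ` C) (\<phi> ` R)" "R \<subseteq> gser \<gamma> G n" for C R
  proof -
    have CG: "C \<subseteq> carrier G" using C by (rule subgroup.subset)
    \<comment> \<open>The map \<open>\<psi>\<close> read on the faithful copy. It kills the image of
      \<open>R\<close>, so quasinilpotency modulo \<open>R\<close> passes to the image of
      \<open>C\<close> under \<open>\<psi>\<close>.\<close>
    define \<chi> where "\<chi> p = \<psi> (inv_into (carrier G) \<phi> p)" for p
    have \<chi>\<phi>: "\<chi> (\<phi> x) = \<psi> x" if "x \<in> carrier G" for x using inv_into_f_f[OF \<phi>(2) that] by (simp add: \<chi>_def)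
    have \<chi>: "ghom \<chi> (\<phi> ` C)"
      unfolding \<chi>_def by (rule ghom_subset[OF ghom_inv_into[OF G \<phi> \<psi>(1)] image_mono[OF CG]])
    have "qn (\<chi> ` \<phi> ` C)"
    proof (rule qn_image_of_qnr[OF hom_image_sg[OF G(1) \<phi>(1) C] \<chi> _ R(2)])
      fix p assume "p \<in> \<phi> ` R"
      then obtain x where x: "p = \<phi> x" "x \<in> R" by blast
      then have "x \<in> carrier G" "x \<in> C" "x \<in> gser \<gamma> G n" using R CG by auto
      then show "p \<in> \<phi> ` C \<and> \<chi> p = 1" using x(1) \<chi>\<phi> \<psi>(2) by simp
    qed
    moreover have "\<chi> ` \<phi> ` C = \<psi> ` C" using \<chi>\<phi> CG by (force simp: image_image)
    ultimately show ?thesis by simp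
  qed
  have qA: "qn (\<psi> ` A)" by (rule q[OF assms(7) resA(1,2) resA(3)]) (simp add: n_def)
  have qB: "qn (\<psi> ` B)" by (rule q[OF assms(8) resB(1,2) resB(3)]) (simp add: n_def)
  have "gser \<gamma> G (Suc (Suc n)) = carrier G"
    by (rule gser_product_carrier[OF fn(1,3,4) G \<psi> hom_image_mutperm_product[OF G \<psi>(1) assms(7-10)] qA qB])
  then have "hgam \<gamma> G \<le> n + 2" using hgam_le_iff[OF fn(1,4) G] by simp
  then show ?thesis using resA(4) resB(4) unfolding n_def RA_def[symmetric] RB_def[symmetric] by simp
qed

end
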